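(* Let $A$ and $B$ be Artin $R$-algebras, and let $F:\mathscr{D}^b(A)\to\mathscr{D}^b(B)$ be a derived equivalence, normalized as in the context, with $Q$ the associated $A$-module. If $\mathrm{add}({}_AQ)=\mathrm{add}(\nu_AQ)$, then (1) $\mathrm{gl.dim}(A)\le\mathrm{gl.dim}(B)$; (2) $\mathrm{fin.dim}(A)\le\mathrm{fin.dim}(B)$; (3) $\mathrm{dom.dim}(A)\ge\mathrm{dom.dim}(B)$.
   Context: $R$ is a commutative Artin ring; modules are finitely generated left modules. $\nu_A=D\mathrm{Hom}_A(-,A)$ is the Nakayama functor on projective $A$-modules ($D$ the usual duality), and $\mathrm{add}(X)$ is the full subcategory of direct summands of finite direct sums of copies of $X$. A derived equivalence between $A$ and $B$ is an ($R$-linear) triangle equivalence $F:\mathscr{D}^b(A)\to\mathscr{D}^b(B)$ of bounded derived categories. A tilting complex over $A$ associated to $F$ is a bounded complex $T^\bullet$ of projective $A$-modules with $F(T^\bullet)\simeq B$. A complex is radical if all its differentials are radical maps (a map $f:X\to Y$ is radical if no composite $Z\to X\xrightarrow{f}Y\to Z$ with $Z\neq0$ is an isomorphism). Normalization (standing convention): up to composing $F$ with a power of the shift, the radical tilting complex $Q^\bullet$ over $A$ associated to $F$ has the form $0\to Q^{-n}\to\cdots\to Q^{-1}\to Q^0\to0$. Put $Q=\bigoplus_{i=1}^nQ^{-i}$ (degree $0$ excluded). $\mathrm{gl.dim}$ is the global dimension. $\mathrm{fin.dim}(A)$, the finitistic dimension, is the supremum of the projective dimensions of finitely generated $A$-modules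 of finite projective dimension. For an $A$-module $X$ with minimal injective resolution $0\to X\to I_0\to I_1\to\cdots$, $\mathrm{dom.dim}(X)=\sup\{m\mid I_i\text{ is projective for all }0\le i\le m-1\}$, and $\mathrm{dom.dim}(A)=\mathrm{dom.dim}({}_AA)$. *)

theory Defs
  imports "HOL-Algebra.Module" "HOL-Algebra.QuotRing" "HOL-Library.Extended_Nat"
begin

section \<open>Artin algebras\<close>

definition artinian_cring :: "('r, 'e) ring_scheme \<Rightarrow> bool" where
  "artinian_cring R \<longleftrightarrow> cring R \<and>
     (\<forall>I :: nat \<Rightarrow> 'r set. (\<forall>n. ideal (I n) R \<and> I (Suc n) \<subseteq> I n) \<longrightarrow>
        (\<exists>m. \<forall>n\<ge>m. I n = I m))"

text \<open>
  The locale \<^locale>\<open>Module.module\<close> requires a commutative ring of scalars. The following predicate is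
  the notion of a unital left module over an arbitrary ring; it uses the same record type.
  The fields \<^const>\<open>mult\<close> and \<^const>\<open>one\<close> of that record play no role for modules.
\<close>

definition left_module :: "('a, 'e) ring_scheme \<Rightarrow> ('a, 'm, 'f) module_scheme \<Rightarrow> bool" where
  "left_module A M \<longleftrightarrow> ring A \<and> abelian_group M \<and>
     (\<forall>a\<in>carrier A. \<forall>x\<in>carrier M. a \<odot>\<^bsub>M\<^esub> x \<in> carrier M) \<and>
     (\<forall>a\<in>carrier A. \<forall>b\<in>carrier A. \<forall>x\<in>carrier M.
        (a \<oplus>\<^bsub>A\<^esub> b) \<odot>\<^bsub>M\<^esub> x = a \<odot>\<^bsub>M\<^esub> x \<oplus>\<^bsub>M\<^esub> b \<odot>\<^bsub>M\<^esub> x) \<and>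
     (\<forall>a\<in>carrier A. \<forall>x\<in>carrier M. \<forall>y\<in>carrier M.
        a \<odot>\<^bsub>M\<^esub> (x \<oplus>\<^bsub>M\<^esub> y) = a \<odot>\<^bsub>M\<^esub> x \<oplus>\<^bsub>M\<^esub> a \<odot>\<^bsub>M\<^esub> y) \<and>
     (\<forall>a\<in>carrier A. \<forall>b\<in>carrier A. \<forall>x\<in>carrier M.
        (a \<otimes>\<^bsub>A\<^esub> b) \<odot>\<^bsub>M\<^esub> x = a \<odot>\<^bsub>M\<^esub> (b \<odot>\<^bsub>M\<^esub> x)) \<and>
     (\<forall>x\<in>carrier M. \<one>\<^bsub>A\<^esub> \<odot>\<^bsub>M\<^esub> x = x)"

definition fin_gen :: "('a, 'e) ring_scheme \<Rightarrow> ('a, 'm, 'f) module_scheme \<Rightarrow> bool" where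
  "fin_gen A M \<longleftrightarrow> (\<exists>S. finite S \<and> S \<subseteq> carrier M \<and>
     (\<forall>x\<in>carrier M. \<exists>c \<in> S \<rightarrow> carrier A. x = (\<Oplus>\<^bsub>M\<^esub>s\<in>S. c s \<odot>\<^bsub>M\<^esub> s)))"

definition artin_algebra :: "('r, 'e) ring_scheme \<Rightarrow> ('r, 'a, 'f) module_scheme \<Rightarrow> bool" where
  "artin_algebra R A \<longleftrightarrow> artinian_cring R \<and> ring A \<and> Module.module R A \<and> fin_gen R A \<and>
     (\<forall>r\<in>carrier R. \<forall>x\<in>carrier A. \<forall>y\<in>carrier A.
        (r \<odot>\<^bsub>A\<^esub> x) \<otimes>\<^bsub>A\<^esub> y = r \<odot>\<^bsub>A\<^esub> (x \<otimes>\<^bsub>A\<^esub> y) \<and> x \<otimes>\<^bsub>A\<^esub> (r \<odot>\<^bsub>A\<^esub> y) = r \<odot>\<^bsub>A\<^esub> (x \<otimes>\<^bsub>A\<^esub> y))"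


section \<open>Modules and homomorphisms\<close>

text \<open>
  Every finitely generated \<open>A\<close>-module is isomorphic to a quotient of some \<open>A\<^sup>n\<close>, that is, to a module
  whose elements are sets of functions \<open>nat \<Rightarrow> 'a\<close>. Hence the modules with carrier in the
  following type form a category equivalent to the category of all finitely generated
  \<open>A\<close>-modules. It is the object type of all categories below.
\<close>

type_synonym 'a univ = "(nat \<Rightarrow> 'a) set"

definition fgmod :: "('a, 'e) ring_scheme \<Rightarrow> ('a, 'a univ) module set" where
  "fgmod A = {M. left_module A M \<and> fin_gen A M}"

definition zero_module :: "('a, 'm, 'f) module_scheme \<Rightarrow> bool" where
  "zero_module M \<longleftrightarrow> carrier M = {\<zero>\<^bsub>M\<^esub>}"

text \<open>Homomorphisms are extensional, so that they are equal iff they agree on the carrier.\<close>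

definition lhom :: "('a, 'e) ring_scheme \<Rightarrow> ('a, 'm, 'f) module_scheme \<Rightarrow> ('a, 'n, 'g) module_scheme
    \<Rightarrow> ('m \<Rightarrow> 'n) set" where
  "lhom A M N = {f \<in> carrier M \<rightarrow>\<^sub>E carrier N.
     (\<forall>x\<in>carrier M. \<forall>y\<in>carrier M. f (x \<oplus>\<^bsub>M\<^esub> y) = f x \<oplus>\<^bsub>N\<^esub> f y) \<and>
     (\<forall>a\<in>carrier A. \<forall>x\<in>carrier M. f (a \<odot>\<^bsub>M\<^esub> x) = a \<odot>\<^bsub>N\<^esub> f x)}"

definition liso :: "('a, 'e) ring_scheme \<Rightarrow> ('a, 'm, 'f) module_scheme \<Rightarrow> ('a, 'n, 'g) module_scheme
    \<Rightarrow> bool" where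
  "liso A M N \<longleftrightarrow> (\<exists>f\<in>lhom A M N. bij_betw f (carrier M) (carrier N))"

definition submod :: "('a, 'e) ring_scheme \<Rightarrow> ('a, 'm, 'f) module_scheme \<Rightarrow> 'm set \<Rightarrow> bool" where
  "submod A M U \<longleftrightarrow> U \<subseteq> carrier M \<and> \<zero>\<^bsub>M\<^esub> \<in> U \<and> (\<forall>x\<in>U. \<forall>y\<in>U. x \<oplus>\<^bsub>M\<^esub> y \<in> U) \<and>
     (\<forall>a\<in>carrier A. \<forall>x\<in>U. a \<odot>\<^bsub>M\<^esub> x \<in> U)"

definition essential :: "('a, 'e) ring_scheme \<Rightarrow> ('a, 'm, 'f) module_scheme \<Rightarrow> 'm set \<Rightarrow> bool" where
  "essential A M U \<longleftrightarrow> submod A M U \<and>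
     (\<forall>V. submod A M V \<and> V \<noteq> {\<zero>\<^bsub>M\<^esub>} \<longrightarrow> U \<inter> V \<noteq> {\<zero>\<^bsub>M\<^esub>})"

definition regular :: "('a, 'e) ring_scheme \<Rightarrow> ('a, 'a) module" where
  "regular A = \<lparr>carrier = carrier A, mult = mult A, one = \<one>\<^bsub>A\<^esub>, zero = \<zero>\<^bsub>A\<^esub>, add = add A,
     smult = mult A\<rparr>"

definition biprod :: "('a, 'm) module \<Rightarrow> ('a, 'n) module \<Rightarrow> ('a, 'm \<times> 'n) module" where
  "biprod M N = \<lparr>carrier = carrier M \<times> carrier N, mult = undefined, one = undefined,
     zero = (\<zero>\<^bsub>M\<^esub>, \<zero>\<^bsub>N\<^esub>),
     add = (\<lambda>(x, y) (x', y'). (x \<oplus>\<^bsub>M\<^esub> x', y \<oplus>\<^bsub>N\<^esub> y')),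
     smult = (\<lambda>a (x, y). (a \<odot>\<^bsub>M\<^esub> x, a \<odot>\<^bsub>N\<^esub> y))\<rparr>"

text \<open>Direct sum of a family of modules, used for finite index sets only.\<close>

definition dsum :: "'i set \<Rightarrow> ('i \<Rightarrow> ('a, 'm) module) \<Rightarrow> ('a, 'i \<Rightarrow> 'm) module" where
  "dsum I M = \<lparr>carrier = (\<Pi>\<^sub>E i\<in>I. carrier (M i)), mult = undefined, one = undefined,
     zero = (\<lambda>i\<in>I. \<zero>\<^bsub>M i\<^esub>),
     add = (\<lambda>x y. \<lambda>i\<in>I. x i \<oplus>\<^bsub>M i\<^esub> y i),
     smult = (\<lambda>a x. \<lambda>i\<in>I. a \<odot>\<^bsub>M i\<^esub> x i)\<rparr>"

text \<open>The objects of the full subcategory \<open>add X\<close>.\<close>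

definition addcat :: "('a, 'e) ring_scheme \<Rightarrow> ('a, 'x) module \<Rightarrow> ('a, 'a univ) module set" where
  "addcat A X = {M \<in> fgmod A. \<exists>N\<in>fgmod A. \<exists>n::nat. liso A (biprod M N) (dsum {..<n} (\<lambda>_. X))}"

definition projective :: "('a, 'e) ring_scheme \<Rightarrow> ('a, 'm) module \<Rightarrow> bool" where
  "projective A P \<longleftrightarrow> left_module A P \<and>
     (\<forall>X\<in>fgmod A. \<forall>Y\<in>fgmod A. \<forall>g\<in>lhom A X Y. \<forall>f\<in>lhom A P Y. g ` carrier X = carrier Y \<longrightarrow>
        (\<exists>h\<in>lhom A P X. \<forall>p\<in>carrier P. g (h p) = f p))"

definition injective :: "('a, 'e) ring_scheme \<Rightarrow> ('a, 'm) module \<Rightarrow> bool" where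
  "injective A I \<longleftrightarrow> left_module A I \<and>
     (\<forall>X\<in>fgmod A. \<forall>Y\<in>fgmod A. \<forall>g\<in>lhom A X Y. \<forall>f\<in>lhom A X I. inj_on g (carrier X) \<longrightarrow>
        (\<exists>h\<in>lhom A Y I. \<forall>x\<in>carrier X. h (g x) = f x))"

definition injective_envelope ::
    "('a, 'e) ring_scheme \<Rightarrow> ('a, 'm) module \<Rightarrow> ('a, 'a univ) module \<Rightarrow> bool" where
  "injective_envelope A M I \<longleftrightarrow> I \<in> fgmod A \<and> injective A I \<and>
     (\<exists>e\<in>lhom A M I. inj_on e (carrier M) \<and> essential A I (e ` carrier M))"

definition radical_map :: "('a, 'e) ring_scheme \<Rightarrow> ('a, 'a univ) module \<Rightarrow> ('a, 'a univ) module \<Rightarrow>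
    ('a univ \<Rightarrow> 'a univ) \<Rightarrow> bool" where
  "radical_map A X Y f \<longleftrightarrow> f \<in> lhom A X Y \<and>
     \<not> (\<exists>Z\<in>fgmod A. \<not> zero_module Z \<and>
          (\<exists>g\<in>lhom A Z X. \<exists>h\<in>lhom A Y Z. bij_betw (\<lambda>z. h (f (g z))) (carrier Z) (carrier Z)))"


section \<open>Homological dimensions\<close>

definition proj_resolution :: "('a, 'e) ring_scheme \<Rightarrow> ('a, 'a univ) module \<Rightarrow> nat \<Rightarrow> bool" where
  "proj_resolution A M n \<longleftrightarrow> (\<exists>P d e.
     (\<forall>i::nat. P i \<in> fgmod A \<and> projective A (P i) \<and> d i \<in> lhom A (P (Suc i)) (P i)) \<and>
     (\<forall>i>n. zero_module (P i)) \<and>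
     e \<in> lhom A (P 0) M \<and> e ` carrier (P 0) = carrier M \<and>
     {x \<in> carrier (P 0). e x = \<zero>\<^bsub>M\<^esub>} = d 0 ` carrier (P 1) \<and>
     (\<forall>i. {x \<in> carrier (P (Suc i)). d i x = \<zero>\<^bsub>P i\<^esub>} = d (Suc i) ` carrier (P (Suc (Suc i)))))"

definition proj_dim :: "('a, 'e) ring_scheme \<Rightarrow> ('a, 'a univ) module \<Rightarrow> enat" where
  "proj_dim A M = Inf {enat n | n. proj_resolution A M n}"

definition gl_dim :: "('a, 'e) ring_scheme \<Rightarrow> enat" where
  "gl_dim A = Sup {proj_dim A M | M. M \<in> fgmod A}"

definition fin_dim :: "('a, 'e) ring_scheme \<Rightarrow> enat" where
  "fin_dim A = Sup {proj_dim A M | M. M \<in> fgmod A \<and> proj_dim A M < \<infinity>}"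

definition min_inj_resolution :: "('a, 'e) ring_scheme \<Rightarrow> ('a, 'x) module \<Rightarrow>
    (nat \<Rightarrow> ('a, 'a univ) module) \<Rightarrow> bool" where
  "min_inj_resolution A X I \<longleftrightarrow> (\<exists>e d.
     (\<forall>i::nat. I i \<in> fgmod A \<and> injective A (I i) \<and> d i \<in> lhom A (I i) (I (Suc i))) \<and>
     e \<in> lhom A X (I 0) \<and> inj_on e (carrier X) \<and>
     {x \<in> carrier (I 0). d 0 x = \<zero>\<^bsub>I 1\<^esub>} = e ` carrier X \<and>
     (\<forall>i. {x \<in> carrier (I (Suc i)). d (Suc i) x = \<zero>\<^bsub>I (Suc (Suc i))\<^esub>} = d i ` carrier (I i)) \<and>
     essential A (I 0) (e ` carrier X) \<and>
     (\<forall>i. essential A (I (Suc i)) (d i ` carrier (I i))))"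

text \<open>
  Minimal injective resolutions are unique up to isomorphism, so the existential quantifier over
  them is harmless.
\<close>

definition dom_dim_module :: "('a, 'e) ring_scheme \<Rightarrow> ('a, 'x) module \<Rightarrow> enat" where
  "dom_dim_module A X = Sup {enat m | m. \<exists>I. min_inj_resolution A X I \<and> (\<forall>i<m. projective A (I i))}"

definition dom_dim :: "('a, 'e) ring_scheme \<Rightarrow> enat" where
  "dom_dim A = dom_dim_module A (regular A)"


section \<open>Duality and the Nakayama functor\<close>

definition jacobson :: "('r, 'e) ring_scheme \<Rightarrow> 'r set" where
  "jacobson R = carrier R \<inter> \<Inter>{I. maximalideal I R}"

definition top_module :: "('r, 'e) ring_scheme \<Rightarrow> ('r, 'r set) module" where
  "top_module R = (let J = jacobson R; K = R Quot J in
     \<lparr>carrier = carrier K, mult = mult K, one = \<one>\<^bsub>K\<^esub>, zero = \<zero>\<^bsub>K\<^esub>, add = add K,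
      smult = (\<lambda>r x. (J +>\<^bsub>R\<^esub> r) \<otimes>\<^bsub>K\<^esub> x)\<rparr>)"

text \<open>
  Right \<open>A\<close>-modules are represented by the same record type, where \<open>a \<odot>\<^bsub>M\<^esub> x\<close> stands for \<open>x a\<close>.
  The next definition is the right \<open>A\<close>-module \<open>Hom\<^sub>A(P, A)\<close>, with \<open>(f a) p = (f p) a\<close>.
\<close>

definition hom_ring :: "('a, 'e) ring_scheme \<Rightarrow> ('a, 'm) module \<Rightarrow> ('a, 'm \<Rightarrow> 'a) module" where
  "hom_ring A P = \<lparr>carrier = lhom A P (regular A), mult = undefined, one = undefined,
     zero = (\<lambda>p\<in>carrier P. \<zero>\<^bsub>A\<^esub>),
     add = (\<lambda>f g. \<lambda>p\<in>carrier P. f p \<oplus>\<^bsub>A\<^esub> g p),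
     smult = (\<lambda>a f. \<lambda>p\<in>carrier P. f p \<otimes>\<^bsub>A\<^esub> a)\<rparr>"

definition restrict_scalars :: "('r, 'a, 'f) module_scheme \<Rightarrow> ('a, 'm) module \<Rightarrow> ('r, 'm) module" where
  "restrict_scalars A M = \<lparr>carrier = carrier M, mult = mult M, one = \<one>\<^bsub>M\<^esub>, zero = \<zero>\<^bsub>M\<^esub>,
     add = add M, smult = (\<lambda>r x. (r \<odot>\<^bsub>A\<^esub> \<one>\<^bsub>A\<^esub>) \<odot>\<^bsub>M\<^esub> x)\<rparr>"

text \<open>
  The left \<open>A\<close>-module \<open>D M = Hom\<^sub>R(M, J)\<close> of a right \<open>A\<close>-module \<open>M\<close>, with \<open>(a f) m = f (m a)\<close>. For the
  usual duality, \<open>J\<close> is an injective envelope of \<open>R / rad R\<close>.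
\<close>

definition dual :: "('r, 'e) ring_scheme \<Rightarrow> ('r, 'j) module \<Rightarrow> ('r, 'a, 'f) module_scheme \<Rightarrow>
    ('a, 'm) module \<Rightarrow> ('a, 'm \<Rightarrow> 'j) module" where
  "dual R J A M = \<lparr>carrier = lhom R (restrict_scalars A M) J, mult = undefined, one = undefined,
     zero = (\<lambda>m\<in>carrier M. \<zero>\<^bsub>J\<^esub>),
     add = (\<lambda>f g. \<lambda>m\<in>carrier M. f m \<oplus>\<^bsub>J\<^esub> g m),
     smult = (\<lambda>a f. \<lambda>m\<in>carrier M. f (a \<odot>\<^bsub>M\<^esub> m))\<rparr>"

definition nakayama :: "('r, 'e) ring_scheme \<Rightarrow> ('r, 'j) module \<Rightarrow> ('r, 'a, 'f) module_scheme \<Rightarrow>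
    ('a, 'm) module \<Rightarrow> ('a, ('m \<Rightarrow> 'a) \<Rightarrow> 'j) module" where
  "nakayama R J A P = dual R J A (hom_ring A P)"


section \<open>Complexes\<close>

record ('a, 'm) cplx =
  obj :: "int \<Rightarrow> ('a, 'm) module"
  dif :: "int \<Rightarrow> 'm \<Rightarrow> 'm"

type_synonym ('m, 'n) gmap = "int \<Rightarrow> 'm \<Rightarrow> 'n"

definition is_complex :: "('a, 'e) ring_scheme \<Rightarrow> ('a, 'm) cplx \<Rightarrow> bool" where
  "is_complex A X \<longleftrightarrow> (\<forall>i. left_module A (obj X i) \<and> dif X i \<in> lhom A (obj X i) (obj X (i + 1)) \<and>
     (\<forall>x\<in>carrier (obj X i). dif X (i + 1) (dif X i x) = \<zero>\<^bsub>obj X (i + 2)\<^esub>))"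

definition bounded_cplx :: "('a, 'm) cplx \<Rightarrow> bool" where
  "bounded_cplx X \<longleftrightarrow> (\<exists>m. \<forall>i. \<bar>i\<bar> > m \<longrightarrow> zero_module (obj X i))"

definition bcomplexes :: "('a, 'e) ring_scheme \<Rightarrow> ('a, 'a univ) cplx set" where
  "bcomplexes A = {X. is_complex A X \<and> bounded_cplx X \<and> (\<forall>i. obj X i \<in> fgmod A)}"

definition cmaps :: "('a, 'e) ring_scheme \<Rightarrow> ('a, 'm) cplx \<Rightarrow> ('a, 'n) cplx \<Rightarrow> ('m, 'n) gmap set" where
  "cmaps A X Y = {f. \<forall>i. f i \<in> lhom A (obj X i) (obj Y i) \<and>
     (\<forall>x\<in>carrier (obj X i). f (i + 1) (dif X i x) = dif Y i (f i x))}"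

definition cid :: "('a, 'm) cplx \<Rightarrow> ('m, 'm) gmap" where
  "cid X = (\<lambda>i. \<lambda>x\<in>carrier (obj X i). x)"

definition ccomp :: "('a, 'm) cplx \<Rightarrow> ('n, 'k) gmap \<Rightarrow> ('m, 'n) gmap \<Rightarrow> ('m, 'k) gmap" where
  "ccomp X g f = (\<lambda>i. compose (carrier (obj X i)) (g i) (f i))"

definition homotopic :: "('a, 'e) ring_scheme \<Rightarrow> ('a, 'm) cplx \<Rightarrow> ('a, 'n) cplx \<Rightarrow>
    ('m, 'n) gmap \<Rightarrow> ('m, 'n) gmap \<Rightarrow> bool" where
  "homotopic A X Y f g \<longleftrightarrow> (\<exists>h. \<forall>i. h i \<in> lhom A (obj X i) (obj Y (i - 1)) \<and>
     (\<forall>x\<in>carrier (obj X i).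
        f i x \<ominus>\<^bsub>obj Y i\<^esub> g i x = dif Y (i - 1) (h i x) \<oplus>\<^bsub>obj Y i\<^esub> h (i + 1) (dif X i x)))"

definition cycles :: "('a, 'm) cplx \<Rightarrow> int \<Rightarrow> 'm set" where
  "cycles X i = {x \<in> carrier (obj X i). dif X i x = \<zero>\<^bsub>obj X (i + 1)\<^esub>}"

definition boundaries :: "('a, 'm) cplx \<Rightarrow> int \<Rightarrow> 'm set" where
  "boundaries X i = dif X (i - 1) ` carrier (obj X (i - 1))"

definition cohomology :: "('a, 'm) cplx \<Rightarrow> int \<Rightarrow> 'm set set" where
  "cohomology X i = {boundaries X i +>\<^bsub>obj X i\<^esub> z | z. z \<in> cycles X i}"

definition cohomology_map :: "('a, 'n) cplx \<Rightarrow> ('m, 'n) gmap \<Rightarrow> int \<Rightarrow> 'm set \<Rightarrow> 'n set" where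
  "cohomology_map Y f i C = (\<Union>z\<in>C. boundaries Y i +>\<^bsub>obj Y i\<^esub> f i z)"

definition quasi_iso :: "('a, 'e) ring_scheme \<Rightarrow> ('a, 'm) cplx \<Rightarrow> ('a, 'n) cplx \<Rightarrow> ('m, 'n) gmap \<Rightarrow> bool"
  where
  "quasi_iso A X Y f \<longleftrightarrow> f \<in> cmaps A X Y \<and>
     (\<forall>i. bij_betw (cohomology_map Y f i) (cohomology X i) (cohomology Y i))"

definition shift :: "('a, 'm) cplx \<Rightarrow> ('a, 'm) cplx" where
  "shift X = \<lparr>obj = (\<lambda>i. obj X (i + 1)),
     dif = (\<lambda>i. \<lambda>x\<in>carrier (obj X (i + 1)). \<ominus>\<^bsub>obj X (i + 2)\<^esub> dif X (i + 1) x)\<rparr>"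

definition cone :: "('a, 'm) cplx \<Rightarrow> ('a, 'n) cplx \<Rightarrow> ('m, 'n) gmap \<Rightarrow> ('a, 'm \<times> 'n) cplx" where
  "cone X Y f = \<lparr>obj = (\<lambda>i. biprod (obj X (i + 1)) (obj Y i)),
     dif = (\<lambda>i. restrict
       (\<lambda>(x, y). (\<ominus>\<^bsub>obj X (i + 2)\<^esub> dif X (i + 1) x, f (i + 1) x \<oplus>\<^bsub>obj Y (i + 1)\<^esub> dif Y i y))
       (carrier (obj X (i + 1)) \<times> carrier (obj Y i)))\<rparr>"


section \<open>Categories and functors\<close>

text \<open>
  Hom-sets of different pairs of objects need not be disjoint, hence composition and the action of
  functors on morphisms take the objects as arguments.
\<close>

record ('o, 'h) cat =
  Ob :: "'o set"
  Hom :: "'o \<Rightarrow> 'o \<Rightarrow> 'h set"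
  Id :: "'o \<Rightarrow> 'h"
  Comp :: "'o \<Rightarrow> 'o \<Rightarrow> 'o \<Rightarrow> 'h \<Rightarrow> 'h \<Rightarrow> 'h"  \<comment> \<open>\<open>Comp C X Y Z g f\<close> is \<open>g \<circ> f\<close> for \<open>f : X \<rightarrow> Y\<close>, \<open>g : Y \<rightarrow> Z\<close>\<close>

record ('o, 'h, 'p, 'k) funct =
  fob :: "'o \<Rightarrow> 'p"
  fmap :: "'o \<Rightarrow> 'o \<Rightarrow> 'h \<Rightarrow> 'k"

definition is_functor :: "('o, 'h) cat \<Rightarrow> ('p, 'k) cat \<Rightarrow> ('o, 'h, 'p, 'k) funct \<Rightarrow> bool" where
  "is_functor C D F \<longleftrightarrow>
     (\<forall>X\<in>Ob C. fob F X \<in> Ob D \<and> fmap F X X (Id C X) = Id D (fob F X)) \<and>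
     (\<forall>X\<in>Ob C. \<forall>Y\<in>Ob C. \<forall>f\<in>Hom C X Y. fmap F X Y f \<in> Hom D (fob F X) (fob F Y)) \<and>
     (\<forall>X\<in>Ob C. \<forall>Y\<in>Ob C. \<forall>Z\<in>Ob C. \<forall>f\<in>Hom C X Y. \<forall>g\<in>Hom C Y Z.
        fmap F X Z (Comp C X Y Z g f) =
        Comp D (fob F X) (fob F Y) (fob F Z) (fmap F Y Z g) (fmap F X Y f))"

definition fid :: "('o, 'h, 'o, 'h) funct" where
  "fid = \<lparr>fob = (\<lambda>X. X), fmap = (\<lambda>X Y f. f)\<rparr>"

definition fcomp :: "('p, 'k, 'q, 'l) funct \<Rightarrow> ('o, 'h, 'p, 'k) funct \<Rightarrow> ('o, 'h, 'q, 'l) funct" where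
  "fcomp G F = \<lparr>fob = (\<lambda>X. fob G (fob F X)),
     fmap = (\<lambda>X Y f. fmap G (fob F X) (fob F Y) (fmap F X Y f))\<rparr>"

definition iso_mor :: "('o, 'h) cat \<Rightarrow> 'o \<Rightarrow> 'o \<Rightarrow> 'h \<Rightarrow> bool" where
  "iso_mor C X Y f \<longleftrightarrow> f \<in> Hom C X Y \<and>
     (\<exists>g\<in>Hom C Y X. Comp C X Y X g f = Id C X \<and> Comp C Y X Y f g = Id C Y)"

definition nat_iso :: "('o, 'h) cat \<Rightarrow> ('p, 'k) cat \<Rightarrow> ('o, 'h, 'p, 'k) funct \<Rightarrow>
    ('o, 'h, 'p, 'k) funct \<Rightarrow> ('o \<Rightarrow> 'k) \<Rightarrow> bool" where
  "nat_iso C D F G t \<longleftrightarrow>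
     (\<forall>X\<in>Ob C. iso_mor D (fob F X) (fob G X) (t X)) \<and>
     (\<forall>X\<in>Ob C. \<forall>Y\<in>Ob C. \<forall>f\<in>Hom C X Y.
        Comp D (fob F X) (fob F Y) (fob G Y) (t Y) (fmap F X Y f) =
        Comp D (fob F X) (fob G X) (fob G Y) (fmap G X Y f) (t X))"

definition cat_equivalence :: "('o, 'h) cat \<Rightarrow> ('p, 'k) cat \<Rightarrow> ('o, 'h, 'p, 'k) funct \<Rightarrow> bool" where
  "cat_equivalence C D F \<longleftrightarrow> is_functor C D F \<and>
     (\<exists>G s t. is_functor D C G \<and> nat_iso C C (fcomp G F) fid s \<and> nat_iso D D (fcomp F G) fid t)"


section \<open>The bounded derived category\<close>

text \<open>
  The derived category is the localization of the homotopy category of bounded complexes at the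
  quasi-isomorphisms. Its morphisms \<open>X \<rightarrow> Y\<close> are equivalence classes of roofs \<open>(Z, s, f)\<close> with
  \<open>s : Z \<rightarrow> X\<close> a quasi-isomorphism and \<open>f : Z \<rightarrow> Y\<close> a chain map. Chain maps are
  not replaced by homotopy classes; instead, homotopies enter the equivalence of roofs.
\<close>

type_synonym 'a ucplx = "('a, 'a univ) cplx"
type_synonym 'a umap = "('a univ, 'a univ) gmap"
type_synonym 'a roof = "'a ucplx \<times> 'a umap \<times> 'a umap"

definition roofs :: "('a, 'e) ring_scheme \<Rightarrow> 'a ucplx \<Rightarrow> 'a ucplx \<Rightarrow> 'a roof set" where
  "roofs A X Y = {(Z, s, f). Z \<in> bcomplexes A \<and> quasi_iso A Z X s \<and> f \<in> cmaps A Z Y}"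

definition roof_eq :: "('a, 'e) ring_scheme \<Rightarrow> 'a ucplx \<Rightarrow> 'a ucplx \<Rightarrow> 'a roof \<Rightarrow> 'a roof \<Rightarrow> bool" where
  "roof_eq A X Y = (\<lambda>(Z, s, f) (Z', s', f').
     \<exists>W\<in>bcomplexes A. \<exists>u\<in>cmaps A W Z. \<exists>u'\<in>cmaps A W Z'.
       quasi_iso A W X (ccomp W s u) \<and>
       homotopic A W X (ccomp W s u) (ccomp W s' u') \<and>
       homotopic A W Y (ccomp W f u) (ccomp W f' u'))"

definition roof_class :: "('a, 'e) ring_scheme \<Rightarrow> 'a ucplx \<Rightarrow> 'a ucplx \<Rightarrow> 'a roof \<Rightarrow> 'a roof set" where
  "roof_class A X Y r = {r' \<in> roofs A X Y. roof_eq A X Y r r'}"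

definition dhom :: "('a, 'e) ring_scheme \<Rightarrow> 'a ucplx \<Rightarrow> 'a ucplx \<Rightarrow> 'a roof set set" where
  "dhom A X Y = roof_class A X Y ` roofs A X Y"

definition dmap :: "('a, 'e) ring_scheme \<Rightarrow> 'a ucplx \<Rightarrow> 'a ucplx \<Rightarrow> 'a umap \<Rightarrow> 'a roof set" where
  "dmap A X Y f = roof_class A X Y (X, cid X, f)"

text \<open>
  The operations on morphisms are given as the union of the classes of all results on
  representatives; all these results are equivalent. Roofs \<open>X \<leftarrow> U \<rightarrow> Y\<close> and \<open>Y \<leftarrow> V \<rightarrow> Z\<close> are
  composed by completing \<open>U \<rightarrow> Y \<leftarrow> V\<close> to a square commuting up to homotopy.
\<close>

definition dcomp :: "('a, 'e) ring_scheme \<Rightarrow> 'a ucplx \<Rightarrow> 'a ucplx \<Rightarrow> 'a ucplx \<Rightarrow>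
    'a roof set \<Rightarrow> 'a roof set \<Rightarrow> 'a roof set" where
  "dcomp A X Y Z \<beta> \<alpha> = \<Union>{roof_class A X Z (W, ccomp W s u, ccomp W g v) | U s f V t g W u v.
     (U, s, f) \<in> \<alpha> \<and> (V, t, g) \<in> \<beta> \<and> W \<in> bcomplexes A \<and>
     quasi_iso A W U u \<and> v \<in> cmaps A W V \<and> homotopic A W Y (ccomp W f u) (ccomp W t v)}"

definition Db :: "('a, 'e) ring_scheme \<Rightarrow> ('a ucplx, 'a roof set) cat" where
  "Db A = \<lparr>Ob = bcomplexes A, Hom = dhom A, Id = (\<lambda>X. dmap A X X (cid X)), Comp = dcomp A\<rparr>"

definition dadd :: "('a, 'e) ring_scheme \<Rightarrow> 'a ucplx \<Rightarrow> 'a ucplx \<Rightarrow>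
    'a roof set \<Rightarrow> 'a roof set \<Rightarrow> 'a roof set" where
  "dadd A X Y \<alpha> \<beta> = \<Union>{roof_class A X Y
       (Z, s, \<lambda>i. \<lambda>z\<in>carrier (obj Z i). f i z \<oplus>\<^bsub>obj Y i\<^esub> g i z) | Z s f g.
     (Z, s, f) \<in> \<alpha> \<and> (Z, s, g) \<in> \<beta>}"

definition dscale :: "('r, 'a, 'f) module_scheme \<Rightarrow> 'a ucplx \<Rightarrow> 'a ucplx \<Rightarrow>
    'r \<Rightarrow> 'a roof set \<Rightarrow> 'a roof set" where
  "dscale A X Y r \<alpha> = \<Union>{roof_class A X Y
       (Z, s, \<lambda>i. \<lambda>z\<in>carrier (obj Z i). (r \<odot>\<^bsub>A\<^esub> \<one>\<^bsub>A\<^esub>) \<odot>\<^bsub>obj Y i\<^esub> f i z) | Z s f.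
     (Z, s, f) \<in> \<alpha>}"

definition dshift :: "('a, 'e) ring_scheme \<Rightarrow> ('a ucplx, 'a roof set, 'a ucplx, 'a roof set) funct" where
  "dshift A = \<lparr>fob = shift, fmap = (\<lambda>X Y \<alpha>.
     \<Union>{roof_class A (shift X) (shift Y) (shift Z, \<lambda>i. s (i + 1), \<lambda>i. f (i + 1)) | Z s f.
        (Z, s, f) \<in> \<alpha>})\<rparr>"

text \<open>
  Distinguished triangles \<open>X \<rightarrow> Y \<rightarrow> Z \<rightarrow> X[1]\<close> are those isomorphic in the derived category to
  \<open>X' \<rightarrow> Y' \<rightarrow> cone f \<rightarrow> X'[1]\<close> for a chain map \<open>f : X' \<rightarrow> Y'\<close>. Since \<^term>\<open>cone X' Y' f\<close> has
  another carrier type, it is replaced by an isomorphic complex \<open>K\<close>.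
\<close>

definition distinguished :: "('a, 'e) ring_scheme \<Rightarrow> 'a ucplx \<Rightarrow> 'a ucplx \<Rightarrow> 'a ucplx \<Rightarrow>
    'a roof set \<Rightarrow> 'a roof set \<Rightarrow> 'a roof set \<Rightarrow> bool" where
  "distinguished A X Y Z u v w \<longleftrightarrow>
     X \<in> bcomplexes A \<and> Y \<in> bcomplexes A \<and> Z \<in> bcomplexes A \<and>
     u \<in> dhom A X Y \<and> v \<in> dhom A Y Z \<and> w \<in> dhom A Z (shift X) \<and>
     (\<exists>X'\<in>bcomplexes A. \<exists>Y'\<in>bcomplexes A. \<exists>K\<in>bcomplexes A. \<exists>f\<in>cmaps A X' Y'.
      \<exists>k\<in>cmaps A K (cone X' Y' f). \<exists>g\<in>cmaps A Y' K. \<exists>h\<in>cmaps A K (shift X'). \<exists>a b c.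
        (\<forall>i. bij_betw (k i) (carrier (obj K i)) (carrier (obj (cone X' Y' f) i))) \<and>
        (\<forall>i. \<forall>y\<in>carrier (obj Y' i). k i (g i y) = (\<zero>\<^bsub>obj X' (i + 1)\<^esub>, y)) \<and>
        (\<forall>i. \<forall>z\<in>carrier (obj K i). h i z = fst (k i z)) \<and>
        iso_mor (Db A) X X' a \<and> iso_mor (Db A) Y Y' b \<and> iso_mor (Db A) Z K c \<and>
        dcomp A X Y Y' b u = dcomp A X X' Y' (dmap A X' Y' f) a \<and>
        dcomp A Y Z K c v = dcomp A Y Y' K (dmap A Y' K g) b \<and>
        dcomp A Z (shift X) (shift X') (fmap (dshift A) X X' a) w =
          dcomp A Z K (shift X') (dmap A K (shift X') h) c)"

type_synonym ('a, 'b) dfunct = "('a ucplx, 'a roof set, 'b ucplx, 'b roof set) funct"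

definition triangle_functor ::
    "('a, 'e) ring_scheme \<Rightarrow> ('b, 'f) ring_scheme \<Rightarrow> ('a, 'b) dfunct \<Rightarrow> bool" where
  "triangle_functor A B F \<longleftrightarrow> is_functor (Db A) (Db B) F \<and>
     (\<forall>X\<in>bcomplexes A. \<forall>Y\<in>bcomplexes A. \<forall>\<alpha>\<in>dhom A X Y. \<forall>\<beta>\<in>dhom A X Y.
        fmap F X Y (dadd A X Y \<alpha> \<beta>) =
        dadd B (fob F X) (fob F Y) (fmap F X Y \<alpha>) (fmap F X Y \<beta>)) \<and>
     (\<exists>\<eta>. nat_iso (Db A) (Db B) (fcomp F (dshift A)) (fcomp (dshift B) F) \<eta> \<and>
        (\<forall>X Y Z u v w. distinguished A X Y Z u v w \<longrightarrow>
           distinguished B (fob F X) (fob F Y) (fob F Z) (fmap F X Y u) (fmap F Y Z v)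
             (dcomp B (fob F Z) (fob F (shift X)) (shift (fob F X)) (\<eta> X) (fmap F Z (shift X) w))))"

definition derived_equivalence :: "('r, 'e) ring_scheme \<Rightarrow> ('r, 'a, 'f) module_scheme \<Rightarrow>
    ('r, 'b, 'g) module_scheme \<Rightarrow> ('a, 'b) dfunct \<Rightarrow> bool" where
  "derived_equivalence R A B F \<longleftrightarrow> triangle_functor A B F \<and> cat_equivalence (Db A) (Db B) F \<and>
     (\<forall>X\<in>bcomplexes A. \<forall>Y\<in>bcomplexes A. \<forall>\<alpha>\<in>dhom A X Y. \<forall>r\<in>carrier R.
        fmap F X Y (dscale A X Y r \<alpha>) = dscale B (fob F X) (fob F Y) r (fmap F X Y \<alpha>))"


section \<open>Tilting complexes associated to a derived equivalence\<close>

text \<open>\<open>S\<close> is, up to isomorphism, the regular module \<open>B\<close> regarded as a complex in degree \<open>0\<close>.\<close>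

definition regular_stalk :: "('b, 'f) ring_scheme \<Rightarrow> 'b ucplx \<Rightarrow> bool" where
  "regular_stalk B S \<longleftrightarrow> S \<in> bcomplexes B \<and> liso B (obj S 0) (regular B) \<and>
     (\<forall>i. i \<noteq> 0 \<longrightarrow> zero_module (obj S i))"

definition associated_tilting ::
    "('a, 'e) ring_scheme \<Rightarrow> ('b, 'f) ring_scheme \<Rightarrow> ('a, 'b) dfunct \<Rightarrow> 'a ucplx \<Rightarrow> bool" where
  "associated_tilting A B F T \<longleftrightarrow> T \<in> bcomplexes A \<and> (\<forall>i. projective A (obj T i)) \<and>
     (\<exists>S \<phi>. regular_stalk B S \<and> iso_mor (Db B) (fob F T) S \<phi>)"

definition radical_complex :: "('a, 'e) ring_scheme \<Rightarrow> 'a ucplx \<Rightarrow> bool" where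
  "radical_complex A X \<longleftrightarrow> (\<forall>i. radical_map A (obj X i) (obj X (i + 1)) (dif X i))"

end

(* Since add(Q) = add(nu Q), every term T^i with i < 0 is projective-injective.
For gl.dim and fin.dim, proj.dim X <= p means Hom(X, N[p+1]) = 0 for all modules N. Truncating a projective
resolution of F(X) gives a B-module M with Hom(M, N[p+1]) = Hom(F(X), N[p+1]). An induction on syzygies of X, in
which one divides by the image of a projective-injective module, brings the vanishing back from B to A.
For dom.dim, let Y be an A-module without nonzero maps to projective-injective modules. If the terms of the minimal
injective resolution of B up to degree i are projective, then Hom(Y[-i], T) = 0; since Y does not see the T^j with
j < 0, this gives Ext^i(Y, A) = 0. So no nonzero submodule Y of the i-th cosyzygy of A is of this kind, the cosyzygy
embeds into a projective-injective module, and its injective envelope is projective. *)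

theory Submission imports Defs
begin

text \<open>Both halves rest on \<open>H^j(F X) = Hom(T, X[j])\<close>: the cohomology of an image
  is read off from maps out of the terms of \<open>T\<close>, which occupy the degrees from
  \<open>- n\<close> to \<open>0\<close>. A module may thus be spread by \<open>F\<close> over
  \<open>n + 1\<close> degrees; for the projective dimension this loss is recovered by a descending
  induction that starts \<open>n\<close> degrees away from the wanted one. Vanishing of Hom is
  expressed by \<open>hz\<close>, a hom set with at most one element, which every equivalence
  respects. Morphisms of the derived category are computed from projective resolutions. These are
  unbounded below, while roofs consist of bounded complexes, so truncations mediate. The delicate
  point of the dominant dimension is a projective-injective \<open>B\<close>-module
  \<open>W = F V\<close>. The complex \<open>V\<close> is a retract of a power of \<open>T\<close>
  only up to homotopy, and the idempotent cannot be split term by term. Its degree \<open>0\<close>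
  part is instead extended to an injective module \<open>H\<close> that contains the degree
  \<open>0\<close> term, and Fitting's lemma extracts from \<open>H\<close> a projective-injective
  summand through which the relevant maps have to pass.\<close>

abbreviation (input) "lmod == left_module"
abbreviation (input) "cpx == is_complex"
abbreviation (input) "hty == homotopic"
abbreviation (input) "qis == quasi_iso"
abbreviation (input) "bcx == bcomplexes"
abbreviation (input) "zm == zero_module"
abbreviation (input) "cr == carrier"
abbreviation (input) miff (infixr "<->" 25) where "P <-> Q == P = Q"
abbreviation (input) mzero ("0[_]") where "0[M] == zero M"
abbreviation (input) mone ("1[_]") where "1[M] == one M"
abbreviation (input) mplus ("_ +[_] _" [65, 0, 66] 65) where "x +[M] y == add M x y"
abbreviation (input) mneg ("-[_] _" [0, 81] 80) where "-[M] x == a_inv M x"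
abbreviation (input) mdiff ("_ -[_] _" [65, 0, 66] 65) where "x -[M] y == a_minus M x y"
abbreviation (input) mact ("_ *[_] _" [70, 0, 71] 70) where "a *[M] x == smult M a x"
abbreviation (input) mtimes ("_ **[_] _" [70, 0, 71] 70) where "a **[M] x == mult M a x"
abbreviation (input) mmem (infix "IN" 50) where "x IN M == x : carrier M"
abbreviation (input) cob ("_$_" [1000, 1000] 1000) where "X$i == obj X i"
\<comment> \<open>\<open>_lam\<close> is the syntax constant behind the bounded abstraction of
  FuncSet. So this is an ASCII notation for \<open>restrict\<close>: \<open>%x:S. f x\<close> is
  \<open>undefined\<close> off \<open>S\<close>, as the extensional \<open>lhom\<close>
  demands.\<close>
syntax "_lam" :: "pttrn => 'a set => ('a => 'b) => ('a => 'b)" ("(3%_:_./ _)" [0, 0, 3] 3)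

section \<open>Left modules over an arbitrary ring\<close>

locale base_ring =
 fixes A :: "('a, 'e) ring_scheme"
 assumes ring_A: "ring A"
begin

sublocale A: ring A by (rule ring_A)

lemma lm_ag: "lmod A M ==> abelian_group M" by (simp add: left_module_def)

lemmas lm_am = abelian_group.axioms(1)[OF lm_ag]

lemma lm_smult_closed: "lmod A M ==> a IN A ==> x IN M ==> a *[M] x IN M"
 by (simp add: left_module_def)

lemmas lcl [simp] = abelian_monoid.zero_closed[OF lm_am] abelian_monoid.a_closed[OF lm_am] abelian_group.a_inv_closed[OF lm_ag]
 abelian_group.minus_closed[OF lm_ag] lm_smult_closed

lemma lsm:
 assumes "lmod A M"
 shows "a IN A ==> x IN M ==> y IN M ==>
   a *[M] (x +[M] y) = a *[M] x +[M] a *[M] y"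
  and "a IN A ==> b IN A ==> x IN M ==>
   (a +[A] b) *[M] x = a *[M] x +[M] b *[M] x"
  and "a IN A ==> b IN A ==> x IN M ==>
   (a **[A] b) *[M] x = a *[M] (b *[M] x)"
  and "x IN M ==> 1[A] *[M] x = x" using assms unfolding left_module_def by blast+

lemma lm_smult_zero [simp]:
 assumes "lmod A M"
 shows "x IN M ==> 0[A] *[M] x = 0[M]"
  and "a IN A ==> a *[M] 0[M] = 0[M]"
proof -
 interpret M: abelian_group M using assms by (rule lm_ag)
 show "0[A] *[M] x = 0[M]" if x: "x IN M" using lsm(2)[OF assms A.zero_closed A.zero_closed x] x assms by (metis A.l_zero A.zero_closed lcl(5) M.add.l_cancel_one')
 show "a *[M] 0[M] = 0[M]" if a: "a IN A" using lsm(1)[OF assms a M.zero_closed M.zero_closed] a assms by (metis M.l_zero M.zero_closed lcl(5) M.add.l_cancel_one')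
qed

lemma lm_smult_neg:
 assumes "lmod A M" "a IN A" "x IN M"
 shows "a *[M] (-[M] x) = -[M] (a *[M] x)" "(-[A] a) *[M] x = -[M] (a *[M] x)"
proof -
 interpret M: abelian_group M using assms(1) by (rule lm_ag)
 show "a *[M] (-[M] x) = -[M] (a *[M] x)" using lsm(1)[OF assms(1,2), of "-[M] x" x] assms by (metis M.a_inv_closed M.l_neg M.minus_equality lcl(5) lm_smult_zero(2))
 show "(-[A] a) *[M] x = -[M] (a *[M] x)" using lsm(2)[OF assms(1), of "-[A] a" a x] assms by (metis A.a_inv_closed A.l_neg M.minus_equality lcl(5) lm_smult_zero(1))
qed

lemmas lgr = abelian_monoid.a_assoc[OF lm_am] abelian_monoid.a_comm[OF lm_am] abelian_monoid.a_lcomm[OF lm_am]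
 abelian_group.minus_eq[OF lm_ag] abelian_group.minus_add[OF lm_ag] abelian_group.r_neg2[OF lm_ag] abelian_group.r_neg1[OF lm_ag]

lemmas lm_neg [simp] = abelian_monoid.l_zero[OF lm_am] abelian_monoid.r_zero[OF lm_am] abelian_group.r_neg[OF lm_ag] abelian_group.l_neg[OF lm_ag]

lemma lm_neg_unique:
 assumes "lmod A M" "x IN M" "y IN M" "x +[M] y = 0[M]"
 shows "y = -[M] x"
proof -
 interpret M: abelian_group M using assms(1) by (rule lm_ag)
 show ?thesis using assms by (metis M.minus_equality M.a_comm)
qed

lemma lm_diff [simp]:
 assumes "lmod A M"
 shows "-[M] 0[M] = 0[M]" "x IN M ==> -[M] (-[M] x) = x" "x IN M ==> x -[M] x = 0[M]" "x IN M ==> x -[M] 0[M] = x"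
 using assms lm_neg_unique[OF assms, of "0[M]" "0[M]"] lm_neg_unique[OF assms, of "-[M] x" x] by (simp_all add: lgr(4))

lemmas lm_simps = lm_neg lm_diff

text \<open>Rewriting with associativity and commutativity does not always make a summand and its
  negative neighbours. These rules cancel them across up to three other summands, so that
  \<open>simp\<close> with \<open>lm_ac\<close> can normalise such sums.\<close>

lemma lm_cancel:
 assumes "lmod A M"
 shows "x IN M ==> y IN M ==> x +[M] (y +[M] -[M] x) = y"
  and "x IN M ==> y IN M ==> z IN M ==> x +[M] (y +[M] (-[M] x +[M] z)) = y +[M] z"
  and "x IN M ==> y IN M ==> w IN M ==> x +[M] (y +[M] (w +[M] -[M] x)) = y +[M] w"
  and "x IN M ==> y IN M ==> w IN M ==> z IN M ==> x +[M] (y +[M] (w +[M] (-[M] x +[M] z))) = y +[M] (w +[M] z)"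
  and "x IN M ==> y IN M ==> w IN M ==> v IN M ==> x +[M] (y +[M] (w +[M] (v +[M] -[M] x))) = y +[M] (w +[M] v)"
  and "x IN M ==> y IN M ==> w IN M ==> v IN M ==> z IN M ==> x +[M] (y +[M] (w +[M] (v +[M] (-[M] x +[M] z)))) = y +[M] (w +[M] (v +[M] z))"
  and "x IN M ==> y IN M ==> -[M] x +[M] (y +[M] x) = y"
  and "x IN M ==> y IN M ==> z IN M ==> -[M] x +[M] (y +[M] (x +[M] z)) = y +[M] z"
  and "x IN M ==> y IN M ==> w IN M ==> -[M] x +[M] (y +[M] (w +[M] x)) = y +[M] w"
  and "x IN M ==> y IN M ==> w IN M ==> z IN M ==> -[M] x +[M] (y +[M] (w +[M] (x +[M] z))) = y +[M] (w +[M] z)"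
  and "x IN M ==> y IN M ==> w IN M ==> v IN M ==> -[M] x +[M] (y +[M] (w +[M] (v +[M] x))) = y +[M] (w +[M] v)"
  and "x IN M ==> y IN M ==> w IN M ==> v IN M ==> z IN M ==> -[M] x +[M] (y +[M] (w +[M] (v +[M] (x +[M] z)))) = y +[M] (w +[M] (v +[M] z))"
 by (simp_all add: assms lgr(3)[OF assms, of _ "-[M] x"] lgr(3)[OF assms, of _ x] lgr(6,7) lgr(2)[OF assms, of _ x] lgr(2)[OF assms, of _ "-[M] x"])

lemmas lm_ac = lgr lm_cancel

lemma lm_add_cancel:
 assumes "lmod A M" "x IN M" "y IN M" "z IN M"
 shows "x +[M] y = x +[M] z <-> y = z"
proof -
 interpret M: abelian_group M using assms(1) by (rule lm_ag)
 show ?thesis using assms by simp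
qed

lemma lm_minus_eq_zero:
 assumes "lmod A M" "x IN M" "y IN M"
 shows "x -[M] y = 0[M] <-> x = y"
proof -
 interpret M: abelian_group M using assms(1) by (rule lm_ag)
 show ?thesis using assms by (metis M.a_inv_closed M.minus_equality M.minus_minus M.r_neg M.minus_eq)
qed

lemma left_moduleI:
 assumes "!!x y. x IN M ==> y IN M ==> x +[M] y IN M" "0[M] IN M"
  "!!x y z. x IN M ==> y IN M ==> z IN M ==> (x +[M] y) +[M] z = x +[M] (y +[M] z)"
  "!!x y. x IN M ==> y IN M ==> x +[M] y = y +[M] x"
  "!!x. x IN M ==> 0[M] +[M] x = x"
  "!!x. x IN M ==> EX y:cr M. y +[M] x = 0[M]"
  "!!a x. a IN A ==> x IN M ==> a *[M] x IN M"
  "!!a b x. a IN A ==> b IN A ==> x IN M ==>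
   (a +[A] b) *[M] x = a *[M] x +[M] b *[M] x"
  "!!a x y. a IN A ==> x IN M ==> y IN M ==>
   a *[M] (x +[M] y) = a *[M] x +[M] a *[M] y"
  "!!a b x. a IN A ==> b IN A ==> x IN M ==>
   (a **[A] b) *[M] x = a *[M] (b *[M] x)"
  "!!x. x IN M ==> 1[A] *[M] x = x"
 shows "lmod A M"
proof -
 have "abelian_group M" by (rule abelian_groupI) (use assms in auto)
 thus ?thesis unfolding left_module_def using assms ring_A by auto
qed

subsection \<open>Homomorphisms\<close>

lemma hcl: "f : lhom A M N ==> x IN M ==> f x IN N" unfolding lhom_def by auto

lemma hadd: "f : lhom A M N ==> x IN M ==> y IN M ==> f (x +[M] y) = f x +[N] f y" unfolding lhom_def by auto

lemma hsm: "f : lhom A M N ==> a IN A ==> x IN M ==> f (a *[M] x) = a *[N] f x" unfolding lhom_def by auto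

lemma hzero:
 assumes "f : lhom A M N" "lmod A M" "lmod A N"
 shows "f 0[M] = 0[N]"
proof -
 have "f (0[A] *[M] 0[M]) = 0[A] *[N] f 0[M]" using assms hsm by force
 thus ?thesis using assms hcl by (metis A.zero_closed lcl(1) lm_smult_zero(1))
qed

lemma lhom_neg:
 assumes "f : lhom A M N" "lmod A M" "lmod A N" "x IN M"
 shows "f (-[M] x) = -[N] f x" using assms hadd[OF assms(1), of x "-[M] x"] hzero[OF assms(1-3)] hcl[OF assms(1)] by (intro lm_neg_unique[OF assms(3)]) auto

lemma hminus:
 assumes "f : lhom A M N" "lmod A M" "lmod A N" "x IN M" "y IN M"
 shows "f (x -[M] y) = f x -[N] f y" using assms by (simp add: lgr(4) hadd lhom_neg)

lemmas lhom_rules = hcl hadd hzero lhom_neg hminus hsm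

lemma lhom_extensional: "f : lhom A M N ==> f : extensional (cr M)" unfolding lhom_def by (auto simp: PiE_def)

lemma lhom_eqI:
 "f : lhom A M N ==> g : lhom A M N' ==> (!!x. x IN M ==> f x = g x) ==> f = g" by (meson extensionalityI lhom_extensional)

lemma hresI:
 assumes "lmod A M" "!!x. x IN M ==> f x IN N"
  "!!x y. x IN M ==> y IN M ==> f (x +[M] y) = f x +[N] f y"
  "!!a x. a IN A ==> x IN M ==> f (a *[M] x) = a *[N] f x"
 shows "(%x:cr M. f x) : lhom A M N" using assms unfolding lhom_def by auto

lemma lhom_id: "lmod A M ==> (%x:cr M. x) : lhom A M M" by (rule hresI) auto

lemma hcomp:
 assumes "lmod A M" "f : lhom A M N" "g : lhom A N L"
 shows "(%x:cr M. g (f x)) : lhom A M L" using assms by (intro hresI) (auto simp: hcl hadd hsm)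

lemma hzmap:
 assumes "lmod A M" "lmod A N"
 shows "(%x:cr M. 0[N]) : lhom A M N" using assms by (intro hresI) auto

lemma lhom_plus:
 assumes "lmod A M" "lmod A N" "f : lhom A M N" "g : lhom A M N"
 shows "(%x:cr M. f x +[N] g x) : lhom A M N" using assms by (intro hresI) (auto simp: lhom_rules lgr lsm)

lemma lhom_uminus:
 assumes "lmod A M" "lmod A N" "f : lhom A M N"
 shows "(%x:cr M. -[N] f x) : lhom A M N" using assms by (intro hresI) (auto simp: lhom_rules lgr lm_smult_neg)

lemma lhom_diff:
 assumes "lmod A M" "lmod A N" "f : lhom A M N" "g : lhom A M N"
 shows "(%x:cr M. f x -[N] g x) : lhom A M N" using assms by (intro hresI) (auto simp: lhom_rules lgr lm_smult_neg lsm)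

text \<open>A surjection is the cokernel of its kernel. \<open>k\<close> evaluates \<open>f\<close>
  at a chosen preimage; two preimages differ by an element of the kernel of \<open>g\<close>, which
  \<open>f\<close> kills, so linearity can be read off from arbitrary preimages.\<close>

lemma lhom_factor:
 assumes "lmod A P" "lmod A L" "lmod A N"
  and "f : lhom A P N" "g : lhom A P L" "g ` cr P = cr L"
  and ker: "!!x. x IN P ==> g x = 0[L] ==> f x = 0[N]"
 obtains k where "k : lhom A L N" "!!x. x IN P ==> k (g x) = f x"
proof -
 have wd: "f x = f y" if "x IN P" "y IN P" "g x = g y" for x y
 proof -
  have "f (x -[P] y) = 0[N]" using that assms by (intro ker) (auto simp: hminus hcl)
  thus ?thesis using that assms by (auto simp: hminus hcl lm_minus_eq_zero)
 qed
 define k where "k = (%y:cr L. f (inv_into (cr P) g y))"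
 have k: "k (g x) = f x" if "x IN P" for x
 proof -
  have gx: "g x : g ` cr P" using that by auto
  show ?thesis unfolding k_def using wd[of "inv_into (cr P) g (g x)" x] that inv_into_into[OF gx] f_inv_into_f[OF gx] assms by (auto simp: hcl)
 qed
 have rep: "EX x':cr P. x = g x'" if "x IN L" for x using that assms(6) by force
 have "k : lhom A L N" unfolding lhom_def
 proof (intro CollectI conjI ballI)
  have "k x IN N" if "x IN L" for x using rep[OF that] k hcl[OF assms(4)] by metis
  thus "k : cr L \<rightarrow>\<^sub>E cr N" by (auto simp: k_def)
  show "k (x +[L] y) = k x +[N] k y" if "x IN L" "y IN L" for x y using rep[OF that(1)] rep[OF that(2)] k hadd[OF assms(4)] hadd[OF assms(5)] lcl(2)[OF assms(1)] by metis
  show "k (a *[L] x) = a *[N] k x" if "a IN A" "x IN L" for a x using rep[OF that(2)] that k hsm[OF assms(4)] hsm[OF assms(5)] lcl(5)[OF assms(1)] by metis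
 qed
 thus ?thesis using k that by blast
qed

lemma lhom_inverse:
 assumes "lmod A M" "lmod A N" "f : lhom A M N" "bij_betw f (cr M) (cr N)"
 obtains g where "g : lhom A N M" "!!x. x IN M ==> g (f x) = x" "!!y. y IN N ==> f (g y) = y"
proof -
 have im: "f ` cr M = cr N" and inj: "inj_on f (cr M)" using assms(4) by (auto simp: bij_betw_def)
 have "x = 0[M]" if "x IN M" "f x = 0[N]" for x using that inj hzero[OF assms(3,1,2)] assms by (metis inj_onD lcl(1))
 then obtain g where g: "g : lhom A N M" "!!x. x IN M ==> g (f x) = (%x:cr M. x) x"
  using lhom_factor[OF assms(1,2,1) lhom_id[OF assms(1)] assms(3) im] by (smt (verit, best) restrict_apply)
 hence "f (g y) = y" if "y IN N" for y using that im by force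
 thus ?thesis using g that by auto
qed

lemma lhom_inj_iff:
 assumes "lmod A M" "lmod A N" "f : lhom A M N"
 shows "inj_on f (cr M) <-> (ALL x:cr M. f x = 0[N] --> x = 0[M])"
proof
 assume "inj_on f (cr M)"
 thus "ALL x:cr M. f x = 0[N] --> x = 0[M]" using hzero[OF assms(3,1,2)] assms(1) by (metis inj_onD lcl(1))
next
 assume r: "ALL x:cr M. f x = 0[N] --> x = 0[M]"
 show "inj_on f (cr M)"
 proof
  fix x y assume xy: "x IN M" "y IN M" "f x = f y"
  hence "f (x -[M] y) = 0[N]" using assms by (simp add: hminus hcl)
  thus "x=y" using r xy assms by (metis lcl(4) lm_minus_eq_zero)
 qed
qed

subsection \<open>Submodules\<close>

definition sub :: "('a, 'm) module => 'm set => ('a, 'm) module" where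
 "sub M U = M\<lparr>carrier := U\<rparr>"

lemma sub_simps [simp]:
 "cr (sub M U) = U" "0[sub M U] = 0[M]" "x +[sub M U] y = x +[M] y" "a *[sub M U] x = a *[M] x" by (simp_all add: sub_def)

lemma smD:
 assumes "submod A M U"
 shows "U<=cr M" "0[M] : U" "x : U ==> y : U ==> x +[M] y : U"
  "a IN A ==> x : U ==> a *[M] x : U" "x : U ==> x IN M" using assms unfolding submod_def by auto

lemma submod_neg:
 assumes "lmod A M" "submod A M U" "x : U"
 shows "-[M] x : U"
proof -
 have "(-[A] 1[A]) *[M] x : U" using assms by (auto simp: smD)
 thus ?thesis using assms by (simp add: lm_smult_neg lsm smD)
qed

lemma submod_minus:
 assumes "lmod A M" "submod A M U" "x : U" "y : U"
 shows "x -[M] y : U" using assms by (simp add: lgr smD submod_neg)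

lemma lm_sub [simp]:
 assumes "lmod A M" "submod A M U"
 shows "lmod A (sub M U)"
proof (rule left_moduleI)
 show "EX y:cr (sub M U). y +[sub M U] x = 0[sub M U]" if "x IN sub M U" for x
  using that submod_neg[OF assms, of x] smD[OF assms(2)] assms(1) by (auto intro!: bexI[of _ "-[M] x"])
qed (use assms smD[OF assms(2)] in "auto simp: lgr lsm")

lemma submod_carrier [simp]: "lmod A M ==> submod A M (cr M)" by (simp add: submod_def)

lemma submod_zero [simp]: "lmod A M ==> submod A M {0[M]}" by (simp add: submod_def)

lemma submod_Int: "submod A M U ==> submod A M V ==> submod A M (U \<inter> V)" by (auto simp: submod_def)

lemma submod_image:
 assumes "lmod A M" "lmod A N" "f : lhom A M N" "submod A M U"
 shows "submod A N (f ` U)" unfolding submod_def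
proof (intro conjI ballI)
 show "f ` U<=cr N" using assms smD(1)[OF assms(4)] by (auto simp: hcl)
 show "0[N] : f ` U" using assms by (metis imageI hzero smD(2))
 show "x +[N] y : f ` U" if "x : f ` U" "y : f ` U" for x y using that smD[OF assms(4)] by (auto simp: image_iff) (metis assms(3) hadd)
 show "a *[N] x : f ` U" if "a IN A" "x : f ` U" for a x using that smD[OF assms(4)] by (auto simp: image_iff) (metis assms(3) hsm)
qed

lemma sm_range:
 "lmod A M ==> lmod A N ==> f : lhom A M N ==> submod A N (f ` cr M)" by (rule submod_image) auto

lemma submod_vimage:
 assumes "lmod A M" "lmod A N" "f : lhom A M N" "submod A N U"
 shows "submod A M {x:cr M. f x : U}" using assms by (auto simp: submod_def lhom_rules)

lemma submod_kernel:
 assumes "lmod A M" "lmod A N" "f : lhom A M N"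
 shows "submod A M {x:cr M. f x = 0[N]}" using submod_vimage[OF assms submod_zero[OF assms(2)]] by auto

lemma lhom_sub:
 assumes "f : lhom A M N" "submod A M U"
 shows "(%x:U. f x) : lhom A (sub M U) N" using assms smD[OF assms(2)] unfolding lhom_def by auto

lemma lhom_incl: "lmod A M ==> submod A M U ==> (%x:U. x) : lhom A (sub M U) M" using smD[of M U] unfolding lhom_def by auto

lemma lhom_cosub:
 assumes "f : lhom A M N" "f ` cr M<=U"
 shows "f : lhom A M (sub N U)" using assms unfolding lhom_def by auto

lemma lhom_unsub:
 assumes "f : lhom A M (sub N U)" "submod A N U"
 shows "f : lhom A M N" using assms smD[OF assms(2)] unfolding lhom_def by auto

end

context base_ring
begin

subsection \<open>Sums, direct sums and free modules\<close>

lemma finsum_closed':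
 assumes "lmod A M" "!!i. i : I ==> g i IN M"
 shows "finsum M g I IN M" by (rule abelian_monoid.finsum_closed[OF lm_am[OF assms(1)]]) (use assms in auto)

lemma finsum_insert':
 assumes "lmod A M" "finite I" "i ~: I" "!!j. j : insert i I ==> g j IN M"
 shows "finsum M g (insert i I) = g i +[M] finsum M g I" by (rule abelian_monoid.finsum_insert[OF lm_am[OF assms(1)]]) (use assms in auto)

lemma finsum_empty' [simp]: "lmod A M ==> finsum M g {} = 0[M]" by (rule abelian_monoid.finsum_empty[OF lm_am])

lemma finsum_cong':
 assumes "lmod A M" "!!i. i : I ==> f i = g i" "!!i. i : I ==> g i IN M"
 shows "finsum M f I = finsum M g I" by (rule abelian_monoid.finsum_cong'[OF lm_am[OF assms(1)]]) (use assms in auto)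

lemma finsum_submod:
 assumes "lmod A M" "submod A M U" "finite I" "!!i. i : I ==> g i : U"
 shows "finsum M g I : U" using assms(3,4)
proof (induction I)
 case (insert i I)
 thus ?case using assms smD[OF assms(2)] by (subst finsum_insert') auto
qed (use assms smD in auto)

lemma lhom_finsum:
 assumes "lmod A M" "lmod A N" "f : lhom A M N" "finite I" "!!i. i : I ==> g i IN M"
 shows "f (finsum M g I) = finsum N (%i. f (g i)) I" using assms(4,5)
proof (induction I)
 case (insert i I)
 have g: "g i IN M" "finsum M g I IN M" "!!j. j : insert i I ==> f (g j) IN N" using insert.prems assms(1) hcl[OF assms(3)] by (auto intro: finsum_closed')
 have "finsum M g (insert i I) = g i +[M] finsum M g I"
  and "finsum N (%i. f (g i)) (insert i I) = f (g i) +[N] finsum N (%i. f (g i)) I" using insert g(3) assms(1,2) by (intro finsum_insert'; auto)+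
 thus ?case using insert g by (simp add: hadd[OF assms(3)])
qed (use assms hzero in auto)

lemma finsum_smult:
 assumes "lmod A M" "finite I" "!!i. i : I ==> g i IN M" "a IN A"
 shows "a *[M] finsum M g I = finsum M (%i. a *[M] g i) I" using assms(2,3)
proof (induction I)
 case (insert i I)
 have g: "g i IN M" "finsum M g I IN M" "!!j. j : insert i I ==> a *[M] g j IN M" using insert.prems assms(1,4) by (auto intro: finsum_closed')
 have "finsum M g (insert i I) = g i +[M] finsum M g I"
  and "finsum M (%i. a *[M] g i) (insert i I) = a *[M] g i +[M] finsum M (%i. a *[M] g i) I" using insert g(3) assms(1) by (intro finsum_insert'; auto)+
 thus ?case using insert g assms by (simp add: lsm)
qed (use assms in auto)

lemma finsum_add':
 assumes "lmod A M" "!!i. i : I ==> f i IN M" "!!i. i : I ==> g i IN M"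
 shows "finsum M (%i. f i +[M] g i) I = finsum M f I +[M] finsum M g I" by (rule abelian_monoid.finsum_addf[OF lm_am[OF assms(1)]]) (use assms in auto)

lemma lhom_sum:
 assumes "lmod A M" "lmod A N" "finite I" "!!i. i : I ==> f i : lhom A M N"
 shows "(%x:cr M. finsum N (%i. f i x) I) : lhom A M N"
proof (rule hresI)
 have c: "f i x IN N" if "i : I" "x IN M" for i x by (rule hcl[OF assms(4)]) (use that in auto)
 show "finsum N (%i. f i (x +[M] y)) I = finsum N (%i. f i x) I +[N] finsum N (%i. f i y) I"
  if "x IN M" "y IN M" for x y using that c assms(2) by (subst finsum_add'[symmetric]) (auto intro!: finsum_cong' hadd[OF assms(4)])
 show "finsum N (%i. f i (a *[M] x)) I = a *[N] finsum N (%i. f i x) I"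
  if "a IN A" "x IN M" for a x using that c assms(2,3) by (subst finsum_smult) (auto intro!: finsum_cong' hsm[OF assms(4)])
 show "finsum N (%i. f i x) I IN N" if "x IN M" for x using that c assms by (intro finsum_closed') auto
qed (rule assms)

lemma finsum_delta:
 assumes "lmod A M" "finite I" "i : I" "x IN M"
 shows "finsum M (%j. if j=i then x else 0[M]) I = x" using abelian_monoid.finsum_singleton[OF lm_am[OF assms(1)] assms(3,2), of "%_. x"] assms(4)
 by (simp add: eq_commute)

lemma regular_simps [simp]:
 "cr (regular A) = cr A" "0[regular A] = 0[A]" "x +[regular A] y = x +[A] y"
 "a *[regular A] x = a **[A] x" by (simp_all add: regular_def)

lemma lm_regular [simp]: "lmod A (regular A)" by (rule left_moduleI) (auto simp: A.a_ac A.m_assoc A.l_distr A.r_distr intro: A.l_neg A.a_inv_closed)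

lemma dsum_simps [simp]:
 "cr (dsum I M) = (\<Pi>\<^sub>E i\<in>I. cr (M i))" "0[dsum I M] = (%i:I. 0[M i])"
 "x +[dsum I M] y = (%i:I. x i +[M i] y i)" "a *[dsum I M] x = (%i:I. a *[M i] x i)" by (simp_all add: dsum_def)

lemma lm_dsum [simp]:
 assumes "!!i. i : I ==> lmod A (M i)"
 shows "lmod A (dsum I M)"
proof (rule left_moduleI)
 fix x assume x: "x IN dsum I M"
 show "EX y:cr (dsum I M). y +[dsum I M] x = 0[dsum I M]" using x assms by (intro bexI[of _ "%i:I. -[M i] x i"]) (auto intro!: restrict_ext simp: PiE_def Pi_def)
qed (use assms in "auto intro!: extensionalityI[of _ I] restrict_ext simp: PiE_def Pi_def lgr lsm")

lemma lhom_dproj: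
 assumes "!!i. i : I ==> lmod A (M i)" "i : I"
 shows "(%x:cr (dsum I M). x i) : lhom A (dsum I M) (M i)" by (rule hresI) (use assms in auto)

lemma lhom_dpair:
 assumes "lmod A N" "!!i. i : I ==> f i : lhom A N (M i)"
 shows "(%x:cr N. %i:I. f i x) : lhom A N (dsum I M)"
proof (rule hresI)
 show "(%i:I. f i x) IN dsum I M" if "x IN N" for x using that hcl[OF assms(2)] by auto
 show "(%i:I. f i (x +[N] y)) = (%i:I. f i x) +[dsum I M] (%i:I. f i y)"
  if "x IN N" "y IN N" for x y using that by (auto simp: hadd[OF assms(2)] intro!: restrict_ext)
 show "(%i:I. f i (a *[N] x)) = a *[dsum I M] (%i:I. f i x)"
  if "a IN A" "x IN N" for a x using that by (auto simp: hsm[OF assms(2)] intro!: restrict_ext)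
qed (rule assms)

definition dinj :: "'i set => ('i => ('a, 'm) module) => 'i => 'm => 'i => 'm" where
 "dinj I M i = (%y:cr (M i). %j:I. if j=i then y else 0[M j])"

lemma lhom_dinj:
 assumes "!!i. i : I ==> lmod A (M i)" "i : I"
 shows "dinj I M i : lhom A (M i) (dsum I M)" unfolding dinj_def by (rule hresI) (use assms in "auto intro!: restrict_ext")

lemma dsum_decomp:
 assumes "!!i. i : I ==> lmod A (M i)" "finite I" "x IN dsum I M"
 shows "x = finsum (dsum I M) (%i. dinj I M i (x i)) I"
proof -
 have xi: "x i IN M i" if "i : I" for i using assms(3) that by auto
 have L: "lmod A (dsum I M)" using assms(1) by auto
 have D: "dinj I M i (x i) IN dsum I M" if "i : I" for i by (rule hcl[OF lhom_dinj]) (use assms(1) that xi in auto)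
 have C: "finsum (dsum I M) (%i. dinj I M i (x i)) I IN dsum I M" by (rule finsum_closed'[OF L D])
 have "finsum (dsum I M) (%i. dinj I M i (x i)) I j = x j" if j: "j : I" for j
 proof -
  have "(%x:cr (dsum I M). x j) (finsum (dsum I M) (%i. dinj I M i (x i)) I) =
   finsum (M j) (%i. (%x:cr (dsum I M). x j) (dinj I M i (x i))) I" by (rule lhom_finsum[OF L assms(1)[OF j] lhom_dproj[OF assms(1) j] assms(2) D])
  also have "... = finsum (M j) (%i. if i=j then x j else 0[M j]) I"
  proof (rule finsum_cong'[OF assms(1)[OF j]])
   fix i assume i: "i : I"
   show "(%x:cr (dsum I M). x j) (dinj I M i (x i)) = (if i=j then x j else 0[M j])" using D[OF i] xi[OF i] j by (simp add: dinj_def)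
   show "(if i=j then x j else 0[M j]) IN M j" using xi j assms(1) by auto
  qed
  also have "... = x j" by (rule finsum_delta[OF assms(1)[OF j] assms(2) j xi[OF j]])
  finally show ?thesis using C by simp
 qed
 thus ?thesis using assms(3) C by (intro extensionalityI[of _ I]) (auto simp: PiE_def)
qed

text \<open>The elements are functions of type \<open>nat => 'a\<close>, so a set of elements of
  \<open>free k\<close> is a value of \<open>'a univ\<close>. This is what brings quotients of free
  modules into the prescribed carrier type.\<close>

definition free :: "nat => ('a, nat => 'a) module" where
 "free k = dsum {..<k} (%_. regular A)"

lemma lm_free [simp]: "lmod A (free k)" by (simp add: free_def)

lemma free_simps:
 "c IN free k ==> j<k ==> c j IN A"
 "j<k ==> (c +[free k] d) j = c j +[A] d j"
 "j<k ==> (a *[free k] c) j = a **[A] c j" by (auto simp: free_def)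

definition basis :: "nat => nat => nat => 'a" where
 "basis k j = (%i:{..<k}. if i=j then 1[A] else 0[A])"

lemma basis_closed [simp]: "basis k j IN free k" by (auto simp: basis_def free_def)

definition lin :: "nat => (nat => 'm) => ('a, 'm) module => (nat => 'a) => 'm" where
 "lin k w M = (%c:cr (free k). finsum M (%j. c j *[M] w j) {..<k})"

lemma lin_hom:
 assumes "lmod A M" "!!j. j<k ==> w j IN M"
 shows "lin k w M : lhom A (free k) M"
proof -
 have "(%c:cr (free k). finsum M (%j. (%c:cr (free k). c j *[M] w j) c) {..<k}) : lhom A (free k) M"
 proof (rule lhom_sum)
  show "(%c:cr (free k). c j *[M] w j) : lhom A (free k) M" if "j : {..<k}" for j by (rule hresI) (use assms that in "simp_all add: free_simps lsm")
 qed (use assms in auto)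
 moreover have "(%c:cr (free k). finsum M (%j. (%c:cr (free k). c j *[M] w j) c) {..<k}) = lin k w M" unfolding lin_def by (intro restrict_ext) auto
 ultimately show ?thesis by simp
qed

lemma lin_basis:
 assumes "lmod A M" "!!j. j<k ==> w j IN M" "i<k"
 shows "lin k w M (basis k i) = w i"
proof -
 have "lin k w M (basis k i) = finsum M (%j. basis k i j *[M] w j) {..<k}" by (simp add: lin_def)
 also have "... = finsum M (%j. if j=i then w i else 0[M]) {..<k}" by (rule finsum_cong') (use assms in "auto simp: basis_def lsm")
 also have "... = w i" using assms by (intro finsum_delta) auto
 finally show ?thesis .
qed

lemma free_decomp:
 assumes "c IN free k"
 shows "c = finsum (free k) (%j. c j *[free k] basis k j) {..<k}"
proof -
 have e: "dinj {..<k} (%_. regular A) j (c j) = c j *[free k] basis k j" if "j : {..<k}" for j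
 proof -
  have "c j IN A" using free_simps(1)[OF assms, of j] that by simp
  thus ?thesis unfolding dinj_def free_def basis_def dsum_simps by (intro ext) simp
 qed
 have "c = finsum (dsum {..<k} (%_. regular A)) (%j. dinj {..<k} (%_. regular A) j (c j)) {..<k}" by (rule dsum_decomp) (use assms in "auto simp: free_def")
 also have "... = finsum (free k) (%j. c j *[free k] basis k j) {..<k}" unfolding free_def[symmetric]
 proof (rule finsum_cong'[OF lm_free e])
  show "c j *[free k] basis k j IN free k" if "j : {..<k}" for j by (rule lcl(5)[OF lm_free free_simps(1)[OF assms] basis_closed]) (use that in simp)
 qed
 finally show ?thesis .
qed

lemma free_hom_formula:
 assumes "lmod A M" "f : lhom A (free k) M" "c IN free k"
 shows "f c = finsum M (%j. c j *[M] f (basis k j)) {..<k}"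
proof -
 have cj: "c j IN A" if "j<k" for j using assms(3) that by (auto simp: free_def)
 have "f c = f (finsum (free k) (%j. c j *[free k] basis k j) {..<k})" by (rule arg_cong[OF free_decomp[OF assms(3)]])
 also have "... = finsum M (%j. f (c j *[free k] basis k j)) {..<k}" by (rule lhom_finsum[OF lm_free assms(1,2)]) (use cj in auto)
 also have "... = finsum M (%j. c j *[M] f (basis k j)) {..<k}" by (rule finsum_cong') (use assms cj in "auto simp: hsm[OF assms(2)] hcl[OF assms(2)]")
 finally show ?thesis .
qed

lemma free_hom_eq:
 assumes "lmod A M" "f : lhom A (free k) M" "g : lhom A (free k) M"
  "!!j. j<k ==> f (basis k j) = g (basis k j)" "c IN free k"
 shows "f c = g c"
proof -
 have cj: "c j IN A" if "j<k" for j using assms(5) that by (auto simp: free_def)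
 have "finsum M (%j. c j *[M] f (basis k j)) {..<k} = finsum M (%j. c j *[M] g (basis k j)) {..<k}" by (rule finsum_cong') (use assms cj in "auto simp: hcl[OF assms(3)]")
 thus ?thesis using free_hom_formula[OF assms(1,2,5)] free_hom_formula[OF assms(1,3,5)] by simp
qed

subsection \<open>Finitely generated modules\<close>

text \<open>Generation without coefficients: no proper submodule contains \<open>S\<close>. In this
  form it is transported along homomorphisms by taking preimages of submodules.\<close>

definition generates :: "('a, 'm) module => 'm set => bool" where
 "generates M S <-> S<=cr M & (ALL U. submod A M U & S<=U --> U = cr M)"

lemma fin_gen_generates:
 assumes "lmod A M" "fin_gen A M"
 obtains S where "finite S" "generates M S"
proof -
 obtain S where S: "finite S" "S<=cr M"
  "!!x. x IN M ==> EX c:S \<rightarrow> cr A. x = (\<Oplus>\<^bsub>M\<^esub>s\<in>S. c s *[M] s)" using assms(2) unfolding fin_gen_def by blast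
 have "U = cr M" if U: "submod A M U" "S<=U" for U
 proof
  show "cr M<=U"
  proof
   fix x assume "x IN M"
   then obtain c where c: "c : S \<rightarrow> cr A" "x = (\<Oplus>\<^bsub>M\<^esub>s\<in>S. c s *[M] s)" using S(3) by blast
   have "(\<Oplus>\<^bsub>M\<^esub>s\<in>S. c s *[M] s) : U" by (rule finsum_submod[OF assms(1) U(1) S(1)]) (use c U smD(4)[OF U(1)] in auto)
   thus "x : U" using c by simp
  qed
 qed (use smD[OF U(1)] in auto)
 thus ?thesis using that S(1,2) by (auto simp: generates_def)
qed

text \<open>The image of \<open>lin k w M\<close> is a submodule that contains the images
  \<open>w j\<close> of the basis vectors, hence it is all of \<open>M\<close>.\<close>

lemma generates_lin:
 assumes "lmod A M" "finite S" "generates M S"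
 obtains k w where "S = w ` {..<k}" "inj_on w {..<k}" "lin k w M : lhom A (free k) M" "lin k w M ` cr (free k) = cr M"
proof -
 obtain k :: nat and w where w: "S = w ` {..<k}" "inj_on w {..<k}" using finite_imp_nat_seg_image_inj_on[OF assms(2)] unfolding lessThan_def by blast
 have wj: "w j IN M" if "j<k" for j using w assms(3) that by (auto simp: generates_def)
 have l: "lin k w M : lhom A (free k) M" by (rule lin_hom[OF assms(1) wj])
 have "w j : lin k w M ` cr (free k)" if "j<k" for j by (rule image_eqI[where x="basis k j"]) (use lin_basis[OF assms(1) wj that] in auto)
 hence "S<=lin k w M ` cr (free k)" unfolding w by blast
 hence "lin k w M ` cr (free k) = cr M" using assms(3) sm_range[OF lm_free assms(1) l] unfolding generates_def by blast
 thus ?thesis using that w l by blast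
qed

lemma generates_fin_gen:
 assumes "lmod A M" "finite S" "generates M S"
 shows "fin_gen A M" unfolding fin_gen_def
proof (intro exI[of _ S] conjI ballI)
 show S: "S<=cr M" using assms(3) by (simp add: generates_def)
 obtain k w where w: "S = w ` {..<k}" "inj_on w {..<k}" "lin k w M ` cr (free k) = cr M" by (rule generates_lin[OF assms])
 fix x assume "x IN M"
 then obtain c where c: "c IN free k" "x = lin k w M c" using w(3) by blast
 let ?c = "%s. c (inv_into {..<k} w s)"
 have cA: "c j IN A" if "j<k" for j using free_simps(1)[OF c(1) that] .
 have wj: "w j IN M" if "j<k" for j using S w(1) that by auto
 have cs: "?c : S \<rightarrow> cr A" using cA inv_into_into[of _ w "{..<k}"] unfolding w(1) by auto
 have "finsum M (%s. ?c s *[M] s) S = finsum M (%j. ?c (w j) *[M] w j) {..<k}" unfolding w(1)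
  by (rule abelian_monoid.finsum_reindex[OF lm_am[OF assms(1)] _ w(2)]) (use cA wj w(2) assms(1) in auto)
 also have "... = finsum M (%j. c j *[M] w j) {..<k}" by (rule finsum_cong'[OF assms(1)]) (use cA wj w(2) assms(1) in auto)
 finally show "EX c:S \<rightarrow> cr A. x = (\<Oplus>\<^bsub>M\<^esub>s\<in>S. c s *[M] s)" using c cs unfolding lin_def by (intro bexI[of _ ?c]) auto
qed (rule assms(2))

lemma fin_gen_cover:
 fixes M :: "('a, 'm) module"
 assumes "lmod A M" "fin_gen A M"
 obtains k f where "f : lhom A (free k) M" "f ` cr (free k) = cr M"
 by (rule fin_gen_generates[OF assms]) (rule generates_lin[OF assms(1)], auto intro: that)

lemma generates_image:
 assumes "lmod A M" "lmod A N" "f : lhom A M N" "f ` cr M = cr N" "generates M S"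
 shows "generates N (f ` S)"
proof -
 have S: "S<=cr M" "!!U. submod A M U ==> S<=U ==> U = cr M" using assms(5) unfolding generates_def by auto
 have "U = cr N" if U: "submod A N U" "f ` S<=U" for U
 proof -
  have "{x:cr M. f x : U} = cr M" by (rule S(2)[OF submod_vimage[OF assms(1-3) U(1)]]) (use S(1) U(2) in auto)
  hence "f ` cr M<=U" by auto
  thus ?thesis using assms(4) smD(1)[OF U(1)] by simp
 qed
 thus ?thesis using image_mono[OF S(1), of f] assms(4) unfolding generates_def by auto
qed

lemma fin_gen_image:
 fixes M :: "('a, 'm) module" and N :: "('a, 'n) module"
 assumes "lmod A M" "lmod A N" "f : lhom A M N" "f ` cr M = cr N" "fin_gen A M"
 shows "fin_gen A N"
proof -
 obtain S where S: "finite S" "generates M S" by (rule fin_gen_generates[OF assms(1,5)])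
 show ?thesis by (rule generates_fin_gen[OF assms(2) _ generates_image[OF assms(1-4) S(2)]]) (use S in simp)
qed

lemma fin_gen_range:
 fixes M :: "('a, 'm) module" and N :: "('a, 'n) module"
 assumes "lmod A M" "lmod A N" "f : lhom A M N" "fin_gen A M"
 shows "fin_gen A (sub N (f ` cr M))" by (rule fin_gen_image[of M _ f]) (use assms sm_range[OF assms(1-3)] in "auto intro: lhom_cosub")

lemma fin_gen_dsum:
 assumes "!!i. i : I ==> lmod A (M i)" "!!i. i : I ==> fin_gen A (M i)" "finite I"
 shows "fin_gen A (dsum I M)"
proof -
 have "EX S. finite S & generates (M i) S" if i: "i : I" for i
 proof -
  obtain S where "finite S" "generates (M i) S" by (rule fin_gen_generates[OF assms(1)[OF i] assms(2)[OF i]])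
  thus ?thesis by blast
 qed
 hence "ALL i:I. EX S. finite S & generates (M i) S" by blast
 from bchoice[OF this] obtain S where S: "!!i. i : I ==> finite (S i)" "!!i. i : I ==> generates (M i) (S i)" by blast
 have L: "lmod A (dsum I M)" using assms by auto
 have d: "dinj I M i : lhom A (M i) (dsum I M)" if "i : I" for i by (rule lhom_dinj[OF assms(1) that])
 have "generates (dsum I M) (\<Union>i\<in>I. dinj I M i ` S i)" unfolding generates_def
 proof (intro conjI allI impI)
  have "dinj I M i s IN dsum I M" if "i : I" "s : S i" for i s using hcl[OF d[OF that(1)]] S(2)[OF that(1)] that(2) unfolding generates_def by blast
  thus "(\<Union>i\<in>I. dinj I M i ` S i)<=cr (dsum I M)" by blast
  fix U assume U: "submod A (dsum I M) U & (\<Union>i\<in>I. dinj I M i ` S i)<=U"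
  have *: "dinj I M i x : U" if i: "i : I" and x: "x IN M i" for i x
  proof -
   have "S i <= {x:cr (M i). dinj I M i x : U}" using U S(2)[OF i] i unfolding generates_def by blast
   moreover have "submod A (M i) {x:cr (M i). dinj I M i x : U}" using submod_vimage[OF assms(1)[OF i] L d[OF i]] U by blast
   ultimately have "{x:cr (M i). dinj I M i x : U} = cr (M i)" using S(2)[OF i] unfolding generates_def by blast
   thus ?thesis using x by blast
  qed
  have "finsum (dsum I M) (%i. dinj I M i (x i)) I : U" if "x IN dsum I M" for x by (rule finsum_submod[OF L _ assms(3)]) (use U * that in auto)
  hence "x : U" if "x IN dsum I M" for x using that dsum_decomp[OF assms(1,3) that] by metis
  thus "U = cr (dsum I M)" using smD(1)[of "dsum I M" U] U by blast
 qed
 thus ?thesis by (rule generates_fin_gen[OF L, rotated]) (use S(1) assms(3) in auto)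
qed

lemma fin_gen_regular: "fin_gen A (regular A)"
proof -
 have "generates (regular A) {1[A]}" unfolding generates_def
 proof (intro conjI allI impI)
  fix U assume U: "submod A (regular A) U & {1[A]} <= U"
  have "a **[A] 1[A] : U" if "a IN A" for a using U smD(4)[of "regular A" U a "1[A]"] that by auto
  thus "U = cr (regular A)" using U smD(1)[of "regular A" U] by auto
 qed simp
 thus ?thesis by (rule generates_fin_gen[OF lm_regular, rotated]) auto
qed

lemma fin_gen_free: "fin_gen A (free k)" unfolding free_def by (rule fin_gen_dsum) (auto intro: fin_gen_regular)

lemma biprod_simps [simp]:
 "cr (biprod M N) = cr M \<times> cr N" "0[biprod M N] = (0[M], 0[N])"
 "(x, y) +[biprod M N] (x', y') = (x +[M] x', y +[N] y')"
 "a *[biprod M N] (x, y) = (a *[M] x, a *[N] y)" by (simp_all add: biprod_def)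

lemma lm_biprod [simp]:
 assumes "lmod A M" "lmod A N"
 shows "lmod A (biprod M N)"
proof (rule left_moduleI)
 fix x assume "x IN biprod M N"
 thus "EX y:cr (biprod M N). y +[biprod M N] x = 0[biprod M N]" using assms by (intro bexI[of _ "(-[M] fst x, -[N] snd x)"]) (cases x; simp)+
qed (use assms in "auto simp: lgr lsm")

lemma lhom_fst: "lmod A M ==> lmod A N ==> restrict fst (cr (biprod M N)) : lhom A (biprod M N) M" by (rule hresI) auto

lemma lhom_snd: "lmod A M ==> lmod A N ==> restrict snd (cr (biprod M N)) : lhom A (biprod M N) N" by (rule hresI) auto

lemma lhom_inl: "lmod A M ==> lmod A N ==> (%x:cr M. (x, 0[N])) : lhom A M (biprod M N)" by (rule hresI) auto

lemma lhom_inr: "lmod A M ==> lmod A N ==> (%y:cr N. (0[M], y)) : lhom A N (biprod M N)" by (rule hresI) auto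

lemma lhom_copair:
 assumes "lmod A M" "lmod A N" "lmod A L" "f : lhom A M L" "g : lhom A N L"
 shows "(%z:cr (biprod M N). f (fst z) +[L] g (snd z)) : lhom A (biprod M N) L" using assms by (intro hresI) (auto simp: lhom_rules lgr lsm)

lemma lhom_pair:
 assumes "lmod A L" "f : lhom A L M" "g : lhom A L N"
 shows "(%z:cr L. (f z, g z)) : lhom A L (biprod M N)" using assms by (intro hresI) (auto simp: lhom_rules)

lemma fin_gen_biprod:
 assumes "lmod A M" "lmod A N" "fin_gen A M" "fin_gen A N"
 shows "fin_gen A (biprod M N)"
proof -
 obtain S where S: "finite S" "generates M S" by (rule fin_gen_generates[OF assms(1,3)])
 obtain S' where S': "finite S'" "generates N S'" by (rule fin_gen_generates[OF assms(2,4)])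
 let ?i = "%x:cr M. (x, 0[N])" and ?j = "%y:cr N. (0[M], y)"
 have "generates (biprod M N) (?i ` S \<union> ?j ` S')" unfolding generates_def
 proof (intro conjI allI impI)
  show "?i ` S \<union> ?j ` S'<=cr (biprod M N)" using S S' assms unfolding generates_def by auto
  fix U assume U: "submod A (biprod M N) U & ?i ` S \<union> ?j ` S'<=U"
  have 1: "(x, 0[N]) : U" if "x IN M" for x
  proof -
   have "x : {x:cr M. ?i x : U}" using U S(2) submod_vimage[OF assms(1) lm_biprod[OF assms(1,2)] lhom_inl[OF assms(1,2)], of U] that unfolding generates_def by blast
   thus ?thesis using that by auto
  qed
  have 2: "(0[M], y) : U" if "y IN N" for y
  proof -
   have "y : {x:cr N. ?j x : U}" using U S'(2) submod_vimage[OF assms(2) lm_biprod[OF assms(1,2)] lhom_inr[OF assms(1,2)], of U] that unfolding generates_def by blast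
   thus ?thesis using that by auto
  qed
  have "(x, y) : U" if "x IN M" "y IN N" for x y using smD(3)[of "biprod M N" U "(x, 0[N])" "(0[M], y)"] U 1[OF that(1)] 2[OF that(2)] that assms by simp
  thus "U = cr (biprod M N)" using smD(1)[of "biprod M N" U] U by auto
 qed
 thus ?thesis by (rule generates_fin_gen[OF lm_biprod[OF assms(1,2)], rotated]) (use S(1) S'(1) in auto)
qed

end

lemma surjE: "f ` S = T ==> y : T ==> (!!x. x : S ==> f x = y ==> thesis) ==> thesis" by blast

context base_ring
begin

lemma fgD: "M : fgmod A ==> lmod A M" "M : fgmod A ==> fin_gen A M" by (auto simp: fgmod_def)

lemma fgmodI: "lmod A M ==> fin_gen A M ==> M : fgmod A" by (auto simp: fgmod_def)

definition zmod :: "('a, 'a univ) module" where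
 "zmod = \<lparr>carrier = {{}}, mult = (%_ _. {}), one = {}, zero = {}, add = (%_ _. {}), smult = (%_ _. {})\<rparr>"

lemma zmod_simps [simp]:
 "cr zmod = {{}}" "0[zmod] = {}" "x +[zmod] y = {}" "a *[zmod] x = {}" by (simp_all add: zmod_def)

lemma lm_zmod [simp]: "lmod A zmod" by (rule left_moduleI) auto

lemma zero_module_zmod [simp]: "zm zmod" by (simp add: zero_module_def)

lemma zmod_fgmod [simp]: "zmod : fgmod A"
proof -
 have "generates zmod {}" unfolding generates_def submod_def by auto
 hence "fin_gen A zmod" by (rule generates_fin_gen[OF lm_zmod finite.emptyI])
 thus ?thesis by (rule fgmodI[OF lm_zmod])
qed

lemma zmD: "zm M ==> x IN M ==> x = 0[M]" by (auto simp: zero_module_def)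

subsection \<open>Quotients and copies with a prescribed carrier type\<close>

text \<open>Transport of structure along \<open>j\<close>. It is well defined as soon as the fibres
  of \<open>j\<close> are the cosets of a submodule, so the same construction serves for quotients
  and for copies in another type.\<close>

definition push :: "('m => 'z) => ('a, 'm) module => ('a, 'z) module" where
 "push j M = \<lparr>carrier = j ` cr M, mult = undefined, one = undefined, zero = j 0[M],
   add = (%u v. j (inv_into (cr M) j u +[M] inv_into (cr M) j v)),
   smult = (%a u. j (a *[M] inv_into (cr M) j u))\<rparr>"

lemma push_props:
 fixes M :: "('a, 'm) module" and j :: "'m => 'z"
 assumes M: "lmod A M" and U: "submod A M U"
  and j: "!!x y. x IN M ==> y IN M ==> j x = j y <-> x -[M] y : U"
 shows "lmod A (push j M)" "(%x:cr M. j x) : lhom A M (push j M)"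
  "{x:cr M. j x = 0[push j M]} = U"
proof -
 let ?i = "inv_into (cr M) j"
 have i: "?i (j x) IN M" "j (?i (j x)) = j x" if "x IN M" for x using that by (auto intro: inv_into_into f_inv_into_f)
 have cong: "j (x +[M] y) = j (x' +[M] y')"
  if "j x = j x'" "j y = j y'" "x IN M" "y IN M" "x' IN M" "y' IN M" for x y x' y'
 proof -
  have "x -[M] x' : U" "y -[M] y' : U" using that j by auto
  hence "(x -[M] x') +[M] (y -[M] y') : U" using smD(3)[OF U] by blast
  moreover have "(x -[M] x') +[M] (y -[M] y') = (x +[M] y) -[M] (x' +[M] y')" using that M by (simp add: lgr)
  ultimately show ?thesis using j[of "x +[M] y" "x' +[M] y'"] that M by simp
 qed
 have scong: "j (a *[M] x) = j (a *[M] x')"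
  if "j x = j x'" "x IN M" "x' IN M" "a IN A" for a x x'
 proof -
  have "a *[M] (x -[M] x') : U" using that j smD(4)[OF U] by auto
  moreover have "a *[M] (x -[M] x') = (a *[M] x) -[M] (a *[M] x')" using that M by (simp add: lgr lsm lm_smult_neg)
  ultimately show ?thesis using j[of "a *[M] x" "a *[M] x'"] that M by simp
 qed
 have c: "cr (push j M) = j ` cr M" and z: "0[push j M] = j 0[M]" by (simp_all add: push_def)
 have add: "j x +[push j M] j y = j (x +[M] y)" if "x IN M" "y IN M" for x y
  using cong[of "?i (j x)" x "?i (j y)" y] i[OF that(1)] i[OF that(2)] that by (simp add: push_def)
 have sm: "a *[push j M] j x = j (a *[M] x)" if "x IN M" "a IN A" for a x using scong[of "?i (j x)" x a] i[OF that(1)] that by (simp add: push_def)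
 show "lmod A (push j M)"
 proof (rule left_moduleI, unfold c)
  show "EX y:j ` cr M. y +[push j M] x = 0[push j M]" if "x : j ` cr M" for x
  proof -
   from that obtain x' where x': "x' IN M" "x = j x'" by blast
   show ?thesis by (rule bexI[of _ "j (-[M] x')"]) (use x' M add[of "-[M] x'" x'] z in auto)
  qed
 qed (use M add sm z in "auto simp: lgr lsm")
 show "(%x:cr M. j x) : lhom A M (push j M)" by (rule hresI) (use M add sm c in auto)
 show "{x:cr M. j x = 0[push j M]} = U" using j[of _ "0[M]"] M smD(1)[OF U] unfolding z by auto
qed

lemma ex_quotient:
 fixes M :: "('a, 'm) module"
 assumes M: "lmod A M" "fin_gen A M" and U: "submod A M U"
 obtains M' q where "M' : fgmod A" "q : lhom A M M'" "q ` cr M = cr M'"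
  "{x:cr M. q x = 0[M']} = U"
proof -
 obtain k f where f: "f : lhom A (free k) M" "f ` cr (free k) = cr M" by (rule fin_gen_cover[OF M])
 \<comment> \<open>\<open>x\<close> is encoded by the preimage in \<open>free k\<close> of the coset
   of \<open>x\<close> modulo \<open>U\<close>. This is a value of \<open>'a univ\<close> whatever
   the type of \<open>x\<close> is.\<close>
 define j where "j x = {c:cr (free k). f c -[M] x : U}" for x
 have j: "j x = j y <-> x -[M] y : U" if xy: "x IN M" "y IN M" for x y
 proof
  assume e: "j x = j y"
  obtain c where c: "c IN free k" "f c = x" by (rule surjE[OF f(2) xy(1)])
  hence "c : j x" using xy M smD(2)[OF U] by (simp add: j_def)
  hence "c : j y" using e by simp
  hence "f c -[M] y : U" by (simp add: j_def)
  thus "x -[M] y : U" using c by simp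
 next
  assume u: "x -[M] y : U"
  have "f c -[M] x : U <-> f c -[M] y : U" if c: "c IN free k" for c
  proof -
   have fc: "f c IN M" using hcl[OF f(1) c] .
   have "f c -[M] y = (f c -[M] x) +[M] (x -[M] y)" "f c -[M] x = (f c -[M] y) -[M] (x -[M] y)" using fc xy M by (simp_all add: lm_ac)
   thus ?thesis using smD(3)[OF U _ u, of "f c -[M] x"] submod_minus[OF M(1) U _ u, of "f c -[M] y"] by auto
  qed
  thus "j x = j y" by (auto simp: j_def)
 qed
 note p = push_props[OF M(1) U j]
 let ?q = "%x:cr M. j x"
 have im: "?q ` cr M = cr (push j M)" by (auto simp: push_def)
 have "fin_gen A (push j M)" by (rule fin_gen_image[OF M(1) p(1,2) im M(2)])
 thus ?thesis using p by (intro that[of "push j M" ?q] fgmodI im) auto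
qed

text \<open>Division by the zero submodule moves a finitely generated module of any carrier type
  into \<open>fgmod A\<close>, over which \<open>projective\<close>, \<open>injective\<close> and
  \<open>addcat\<close> quantify.\<close>

lemma ex_copy:
 fixes M :: "('a, 'm) module"
 assumes M: "lmod A M" "fin_gen A M"
 obtains M' f g where "M' : fgmod A" "f : lhom A M M'" "g : lhom A M' M"
  "!!x. x IN M ==> g (f x) = x" "!!y. y IN M' ==> f (g y) = y"
proof -
 obtain M' q where q: "M' : fgmod A" "q : lhom A M M'" "q ` cr M = cr M'"
  "{x:cr M. q x = 0[M']} = {0[M]}" by (rule ex_quotient[OF M submod_zero[OF M(1)]])
 have M': "lmod A M'" using q by (simp add: fgD)
 have "inj_on q (cr M)" using lhom_inj_iff[OF M(1) M' q(2)] q(4) by blast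
 hence b: "bij_betw q (cr M) (cr M')" using q(3) by (simp add: bij_betw_def)
 show ?thesis by (rule lhom_inverse[OF M(1) M' q(2) b]) (rule that[OF q(1,2)])
qed

subsection \<open>Finitely generated projective modules\<close>

text \<open>Retracts of free modules lift against modules of every carrier type, whereas
  \<open>projective\<close> tests modules in \<open>fgmod A\<close> only. The two notions agree on
  \<open>fgmod A\<close> by \<open>fgproj_projective\<close> and
  \<open>projective_fgproj\<close>.\<close>

definition fgproj :: "('a, 'm) module => bool" where
 "fgproj P <-> lmod A P &
   (EX k. EX i:lhom A P (free k). EX r:lhom A (free k) P. ALL x:cr P. r (i x) = x)"

lemma fgproj_lm [simp]: "fgproj P ==> lmod A P" by (simp add: fgproj_def)

lemma fgproj_fin_gen:
 fixes P :: "('a, 'm) module"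
 assumes "fgproj P"
 shows "fin_gen A P"
proof -
 obtain k i r where r: "i : lhom A P (free k)" "r : lhom A (free k) P" "ALL x:cr P. r (i x) = x" using assms unfolding fgproj_def by blast
 have "r ` cr (free k) = cr P"
 proof
  show "r ` cr (free k)<=cr P" using hcl[OF r(2)] by blast
  show "cr P<=r ` cr (free k)"
  proof
   fix x assume x: "x IN P"
   show "x : r ` cr (free k)" by (rule image_eqI[where x="i x"]) (use r x hcl[OF r(1) x] in auto)
  qed
 qed
 thus ?thesis using fin_gen_image[OF lm_free _ r(2) _ fin_gen_free] assms by simp
qed

lemma fgproj_retract:
 assumes "fgproj P" "lmod A N" "i : lhom A N P" "r : lhom A P N" "!!x. x IN N ==> r (i x) = x"
 shows "fgproj N"
proof -
 obtain k i' r' where r: "i' : lhom A P (free k)" "r' : lhom A (free k) P" "ALL x:cr P. r' (i' x) = x" using assms unfolding fgproj_def by blast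
 have c: "i x IN P" if "x IN N" for x using hcl[OF assms(3) that] .
 have "(%x:cr (free k). r (r' x)) ((%x:cr N. i' (i x)) x) = x" if x: "x IN N" for x using x c[OF x] r(3) assms(5)[OF x] hcl[OF r(1) c[OF x]] by simp
 thus ?thesis unfolding fgproj_def using assms(2) hcomp[OF assms(2,3) r(1)] hcomp[OF lm_free r(2) assms(4)] by blast
qed

lemma free_lift:
 fixes X :: "('a, 'x) module" and Y :: "('a, 'y) module"
 assumes "lmod A X" "lmod A Y" "g : lhom A X Y" "f : lhom A (free k) Y"
  "f ` cr (free k)<=g ` cr X"
 obtains h where "h : lhom A (free k) X" "!!c. c IN free k ==> g (h c) = f c"
proof -
 have "ALL j:{..<k}. EX w. w IN X & g w = f (basis k j)"
 proof
  fix j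
  have "f (basis k j) : g ` cr X" using assms(5) basis_closed by blast
  thus "EX w. w IN X & g w = f (basis k j)" by force
 qed
 from bchoice[OF this] obtain w where w: "!!j. j<k ==> w j IN X" "!!j. j<k ==> g (w j) = f (basis k j)" by auto
 have h: "lin k w X : lhom A (free k) X" by (rule lin_hom[OF assms(1) w(1)])
 have gh: "(%c:cr (free k). g (lin k w X c)) : lhom A (free k) Y" by (rule hcomp[OF lm_free h assms(3)])
 have "(%c:cr (free k). g (lin k w X c)) c = f c" if "c IN free k" for c by (rule free_hom_eq[OF assms(2) gh assms(4) _ that]) (use w lin_basis[OF assms(1) w(1)] in simp)
 thus ?thesis using that[OF h] by simp
qed

text \<open>Containment of the images is enough; \<open>g\<close> need not be onto \<open>Y\<close>.
  Most later uses lift into the image of a differential or of an embedding.\<close>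

lemma fgproj_lift:
 fixes X :: "('a, 'x) module" and Y :: "('a, 'y) module"
 assumes P: "fgproj P" and "lmod A X" "lmod A Y" "g : lhom A X Y" "f : lhom A P Y"
  "f ` cr P<=g ` cr X"
 obtains h where "h : lhom A P X" "!!x. x IN P ==> g (h x) = f x"
proof -
 obtain k i r where r: "i : lhom A P (free k)" "r : lhom A (free k) P" "ALL x:cr P. r (i x) = x" using P unfolding fgproj_def by blast
 have fr: "(%c:cr (free k). f (r c)) : lhom A (free k) Y" by (rule hcomp[OF lm_free r(2) assms(5)])
 have "(%c:cr (free k). f (r c)) ` cr (free k)<=g ` cr X" using assms(6) hcl[OF r(2)] by auto
 then obtain h where h: "h : lhom A (free k) X" "!!c. c IN free k ==> g (h c) = (%c:cr (free k). f (r c)) c" using free_lift[OF assms(2-4) fr] by blast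
 have "g (h (i x)) = f x" if "x IN P" for x using h(2)[OF hcl[OF r(1) that]] hcl[OF r(1) that] r(3) that by simp
 thus ?thesis using that[of "%x:cr P. h (i x)"] hcomp[OF fgproj_lm[OF P] r(1) h(1)] by simp
qed

lemma fgproj_free: "fgproj (free k)" unfolding fgproj_def using lhom_id[OF lm_free] by (auto intro!: exI[of _ k] bexI[OF _ lhom_id[OF lm_free]])

lemma fgproj_iso:
 assumes "fgproj P" "lmod A N" "i : lhom A N P" "r : lhom A P N" "!!x. x IN N ==> r (i x) = x"
 shows "fgproj N" using fgproj_retract[OF assms] .

lemma fgproj_projective: "fgproj P ==> projective A P" unfolding projective_def
proof (intro conjI ballI impI)
 fix X Y g f
 assume P: "fgproj P" and a: "X : fgmod A" "Y : fgmod A" "g : lhom A X Y" "f : lhom A P Y" "g ` cr X = cr Y"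
 have "f ` cr P<=g ` cr X" using a hcl[OF a(4)] by auto
 then obtain h where "h : lhom A P X" "!!x. x IN P ==> g (h x) = f x" using fgproj_lift[OF P fgD(1)[OF a(1)] fgD(1)[OF a(2)] a(3,4)] by blast
 thus "EX h:lhom A P X. ALL p:cr P. g (h p) = f p" by blast
qed simp

text \<open>The free cover is replaced by its copy \<open>F\<close> in \<open>fgmod A\<close>,
  because \<open>projective\<close> permits lifting there only; the lifted identity then splits the
  cover.\<close>

lemma projective_fgproj:
 assumes "projective A P" "P : fgmod A"
 shows "fgproj P"
proof -
 have P: "lmod A P" "fin_gen A P" using assms(2) by (auto simp: fgD)
 obtain k f where f: "f : lhom A (free k) P" "f ` cr (free k) = cr P" by (rule fin_gen_cover[OF P])
 obtain F a b where F: "F : fgmod A" "a : lhom A (free k) F" "b : lhom A F (free k)"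
  "!!x. x IN free k ==> b (a x) = x" "!!y. y IN F ==> a (b y) = y" using ex_copy[OF lm_free fin_gen_free] by blast
 have F': "lmod A F" using F by (simp add: fgD)
 let ?g = "%y:cr F. f (b y)"
 have g: "?g : lhom A F P" by (rule hcomp[OF F' F(3) f(1)])
 have "?g ` cr F = cr P"
 proof
  show "?g ` cr F<=cr P" using hcl[OF g] by (rule image_subsetI)
  show "cr P<=?g ` cr F"
  proof
   fix x assume x: "x IN P"
   obtain c where "c IN free k" "f c = x" by (rule surjE[OF f(2) x])
   thus "x : ?g ` cr F" using F hcl[OF F(2)] by (intro image_eqI[where x="a c"]) auto
  qed
 qed
 then obtain h where h: "h : lhom A P F" "ALL p:cr P. ?g (h p) = (%x:cr P. x) p" using assms F(1) g lhom_id[OF P(1)] unfolding projective_def by blast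
 show ?thesis
 proof (rule fgproj_retract[OF fgproj_free P(1) hcomp[OF P(1) h(1) F(3)] f(1)])
  show "f ((%x:cr P. b (h x)) x) = x" if "x IN P" for x using bspec[OF h(2) that] that hcl[OF h(1) that] by simp
 qed
qed

text \<open>A free cover exists by finite generation, and a section of it is all that
  \<open>fgproj\<close> asks for. For sums the section is assembled from lifts of the inclusions of
  the summands.\<close>

lemma fgprojI:
 fixes P :: "('a, 'm) module"
 assumes P: "lmod A P" "fin_gen A P"
  and lift: "!!k f. f : lhom A (free k) P ==> f ` cr (free k) = cr P ==>
   EX s:lhom A P (free k). ALL x:cr P. f (s x) = x"
 shows "fgproj P"
proof -
 obtain k f where f: "f : lhom A (free k) P" "f ` cr (free k) = cr P" by (rule fin_gen_cover[OF P])
 then obtain s where "s : lhom A P (free k)" "ALL x:cr P. f (s x) = x" using lift by blast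
 thus ?thesis using P f unfolding fgproj_def by blast
qed

lemma fgproj_dsum:
 fixes M :: "'i => ('a, 'm) module"
 assumes M: "!!i. i : I ==> fgproj (M i)" and I: "finite I"
 shows "fgproj (dsum I M)"
proof (rule fgprojI)
 let ?L = "dsum I M"
 have lm: "lmod A (M i)" if "i : I" for i using M[OF that] by simp
 show L: "lmod A ?L" using lm by simp
 show "fin_gen A ?L" by (rule fin_gen_dsum[OF lm fgproj_fin_gen[OF M] I])
 fix k f assume f: "f : lhom A (free k) ?L" "f ` cr (free k) = cr ?L"
 have d: "dinj I M i : lhom A (M i) ?L" if "i : I" for i by (rule lhom_dinj[OF lm that])
 have "EX s. s : lhom A (M i) (free k) & (ALL x:cr (M i). f (s x) = dinj I M i x)" if i: "i : I" for i
 proof -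
  have "dinj I M i ` cr (M i)<=f ` cr (free k)" using hcl[OF d[OF i]] f(2) by blast
  thus ?thesis using fgproj_lift[OF M[OF i] lm_free L f(1) d[OF i]] by metis
 qed
 hence "ALL i:I. EX s. s : lhom A (M i) (free k) & (ALL x:cr (M i). f (s x) = dinj I M i x)" by blast
 from bchoice[OF this] obtain s where s: "!!i. i : I ==> s i : lhom A (M i) (free k)"
  "!!i x. i : I ==> x IN M i ==> f (s i x) = dinj I M i x" by blast
 define t where "t = (%i. %x:cr ?L. s i ((%x:cr ?L. x i) x))"
 have t: "t i : lhom A ?L (free k)" if "i : I" for i unfolding t_def by (rule hcomp[OF L lhom_dproj[OF lm that] s(1)[OF that]])
 have tx: "t i x = s i (x i)" if "x IN dsum I M" for i x using that by (simp add: t_def)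
 let ?s = "%x:cr ?L. finsum (free k) (%i. t i x) I"
 have S: "?s : lhom A ?L (free k)" by (rule lhom_sum[OF L lm_free I t])
 have "f (?s x) = x" if x: "x IN dsum I M" for x
 proof -
  have xi: "x i IN M i" if "i : I" for i using x that by auto
  have "f (?s x) = f (finsum (free k) (%i. t i x) I)" using x by simp
  also have "... = finsum ?L (%i. f (t i x)) I" by (rule lhom_finsum[OF lm_free L f(1) I]) (rule hcl[OF t x])
  also have "... = finsum ?L (%i. dinj I M i (x i)) I" by (rule finsum_cong'[OF L]) (use tx[OF x] s(2) xi hcl[OF d xi] in auto)
  also have "... = x" by (rule dsum_decomp[OF lm I x, symmetric])
  finally show ?thesis .
 qed
 thus "EX s:lhom A ?L (free k). ALL x:cr ?L. f (s x) = x" using S by blast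
qed

lemma fgproj_biprod:
 fixes M :: "('a, 'm) module" and N :: "('a, 'n) module"
 assumes "fgproj M" "fgproj N"
 shows "fgproj (biprod M N)"
proof (rule fgprojI)
 let ?L = "biprod M N"
 have lm: "lmod A M" "lmod A N" using assms by auto
 show L: "lmod A ?L" using lm by simp
 show "fin_gen A ?L" using lm assms by (intro fin_gen_biprod fgproj_fin_gen)
 fix k f assume f: "f : lhom A (free k) ?L" "f ` cr (free k) = cr ?L"
 have i: "(%x:cr M. (x, 0[N])) : lhom A M ?L" "(%y:cr N. (0[M], y)) : lhom A N ?L" using lm by (auto intro: lhom_inl lhom_inr)
 have "(%x:cr M. (x, 0[N])) ` cr M<=f ` cr (free k)"
  "(%y:cr N. (0[M], y)) ` cr N<=f ` cr (free k)" using f(2) lm by auto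
 then obtain s t where s: "s : lhom A M (free k)" "!!x. x IN M ==> f (s x) = (%x:cr M. (x, 0[N])) x"
  and t: "t : lhom A N (free k)" "!!x. x IN N ==> f (t x) = (%y:cr N. (0[M], y)) x"
  using fgproj_lift[OF assms(1) lm_free L f(1) i(1)] fgproj_lift[OF assms(2) lm_free L f(1) i(2)] by metis
 let ?s = "%z:cr ?L. s (fst z) +[free k] t (snd z)"
 have "?s : lhom A ?L (free k)" by (rule lhom_copair[OF lm lm_free s(1) t(1)])
 moreover have "f (?s z) = z" if z: "z IN biprod M N" for z
 proof -
  obtain x y where xy: "z = (x, y)" "x IN M" "y IN N" using z by auto
  have "f (?s z) = f (s x) +[biprod M N] f (t y)" using xy hadd[OF f(1) hcl[OF s(1)] hcl[OF t(1)]] by simp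
  also have "... = z" using xy s(2) t(2) lm by simp
  finally show ?thesis .
 qed
 ultimately show "EX s:lhom A ?L (free k). ALL x:cr ?L. f (s x) = x" by blast
qed

lemma fgproj_regular: "fgproj (regular A)"
proof (rule fgproj_retract[OF fgproj_free[of 1] lm_regular])
 show "(%x:cr (regular A). %i:{..<1}. x) : lhom A (regular A) (free 1)" by (rule hresI) (auto simp: free_def intro!: restrict_ext)
 show "(%x:cr (free 1). x 0) : lhom A (free 1) (regular A)" by (rule hresI) (auto simp: free_simps)
qed (auto simp: free_def)

lemma fgproj_zero: "lmod A M ==> zm M ==> fgproj M" using hzmap[of M "free 0"] hzmap[of "free 0" M] unfolding fgproj_def zero_module_def
 by (intro conjI exI[of _ 0] bexI[of _ "%x:cr M. 0[free 0]"] bexI[of _ "%x:cr (free 0). 0[M]"]) auto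

text \<open>The dual basis lemma: \<open>phi j\<close> are the coordinates of an embedding into a
  free module, \<open>q j\<close> the images of the basis vectors under its retraction.\<close>

lemma fgproj_dual_basis:
 assumes "fgproj P"
 obtains k phi q where "!!j. j<k ==> phi j : lhom A P (regular A)" "!!j. j<(k::nat) ==> q j IN P"
  "!!x. x IN P ==> x = finsum P (%j. phi j x *[P] q j) {..<k}"
proof -
 have P: "lmod A P" using assms by simp
 obtain k i r where r: "i : lhom A P (free k)" "r : lhom A (free k) P" "ALL x:cr P. r (i x) = x" using assms unfolding fgproj_def by blast
 define phi where "phi = (%j. %x:cr P. i x j)"
 show ?thesis
 proof
  show "phi j : lhom A P (regular A)" if j: "j<k" for j unfolding phi_def
   by (rule hresI[OF P]) (use r(1) j in "simp_all add: hadd[OF r(1)] hsm[OF r(1)] free_simps free_simps(1)[OF hcl[OF r(1)]]")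
  show "r (basis k j) IN P" if "j<k" for j using hcl[OF r(2) basis_closed] .
  fix x assume x: "x IN P"
  have "r (i x) = finsum P (%j. i x j *[P] r (basis k j)) {..<k}" by (rule free_hom_formula[OF P r(2) hcl[OF r(1) x]])
  thus "x = finsum P (%j. phi j x *[P] r (basis k j)) {..<k}" using r(3) x by (simp add: phi_def)
 qed
qed

lemma ex_fgproj_cover:
 fixes M :: "('a, 'm) module"
 assumes "lmod A M" "fin_gen A M"
 obtains P f where "P : fgmod A" "fgproj P" "f : lhom A P M" "f ` cr P = cr M"
proof -
 obtain k f where f: "f : lhom A (free k) M" "f ` cr (free k) = cr M" by (rule fin_gen_cover[OF assms])
 obtain F a b where F: "F : fgmod A" "a : lhom A (free k) F" "b : lhom A F (free k)"
  "!!x. x IN free k ==> b (a x) = x" "!!y. y IN F ==> a (b y) = y" using ex_copy[OF lm_free fin_gen_free] by blast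
 have F': "lmod A F" using F by (simp add: fgD)
 have g: "(%y:cr F. f (b y)) : lhom A F M" by (rule hcomp[OF F' F(3) f(1)])
 have "cr M<=(%y:cr F. f (b y)) ` cr F"
 proof
  fix x assume x: "x IN M"
  obtain c where "c IN free k" "f c = x" by (rule surjE[OF f(2) x])
  thus "x : (%y:cr F. f (b y)) ` cr F" using F hcl[OF F(2)] by (intro image_eqI[where x="a c"]) auto
 qed
 hence "(%y:cr F. f (b y)) ` cr F = cr M" using image_subsetI[OF hcl[OF g]] by (intro equalityI)
 moreover have "fgproj F" by (rule fgproj_retract[OF fgproj_free F' F(3,2)]) (rule F(5))
 ultimately show ?thesis by (intro that[OF F(1) _ g])
qed

subsection \<open>Injective modules\<close>

lemma injective_lm: "injective A I ==> lmod A I" by (simp add: injective_def)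

text \<open>\<open>injective\<close> tests embeddings inside \<open>fgmod A\<close>; passing to
  copies of \<open>X\<close> and \<open>Y\<close> there frees the extension property from carrier
  types.\<close>

lemma injective_extend:
 fixes X :: "('a, 'x) module" and Y :: "('a, 'y) module"
 assumes I: "injective A I" and X: "lmod A X" "fin_gen A X" and Y: "lmod A Y" "fin_gen A Y"
  and g: "g : lhom A X Y" "inj_on g (cr X)" and f: "f : lhom A X I"
 obtains h where "h : lhom A Y I" "!!x. x IN X ==> h (g x) = f x"
proof -
 obtain X' a b where X': "X' : fgmod A" "a : lhom A X X'" "b : lhom A X' X"
  "!!x. x IN X ==> b (a x) = x" "!!y. y IN X' ==> a (b y) = y" using ex_copy[OF X] by blast
 obtain Y' c d where Y': "Y' : fgmod A" "c : lhom A Y Y'" "d : lhom A Y' Y"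
  "!!x. x IN Y ==> d (c x) = x" "!!y. y IN Y' ==> c (d y) = y" using ex_copy[OF Y] by blast
 have lm: "lmod A X'" "lmod A Y'" using X' Y' by (auto simp: fgD)
 have bg: "(%x:cr X'. g (b x)) : lhom A X' Y" by (rule hcomp[OF lm(1) X'(3) g(1)])
 let ?g = "%x:cr X'. c ((%x:cr X'. g (b x)) x)"
 have g': "?g : lhom A X' Y'" by (rule hcomp[OF lm(1) bg Y'(2)])
 have inj: "inj_on ?g (cr X')"
 proof
  fix x y assume xy: "x IN X'" "y IN X'" "?g x = ?g y"
  have bb: "b x IN X" "b y IN X" using xy hcl[OF X'(3)] by auto
  have "c (g (b x)) = c (g (b y))" using xy by simp
  hence "g (b x) = g (b y)" using Y'(4) hcl[OF g(1)] bb by metis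
  hence "b x = b y" using g(2) bb by (auto dest: inj_onD)
  thus "x=y" using X'(5) xy by metis
 qed
 let ?f = "%x:cr X'. f (b x)"
 have f': "?f : lhom A X' I" by (rule hcomp[OF lm(1) X'(3) f])
 from I g' f' inj X'(1) Y'(1) obtain h where h: "h : lhom A Y' I" "ALL x:cr X'. h (?g x) = ?f x" unfolding injective_def by blast
 show ?thesis
 proof
  show "(%y:cr Y. h (c y)) : lhom A Y I" by (rule hcomp[OF Y(1) Y'(2) h(1)])
  fix x assume x: "x IN X"
  have ax: "a x IN X'" using hcl[OF X'(2) x] .
  show "(%y:cr Y. h (c y)) (g x) = f x" using h(2)[rule_format, OF ax] ax X'(4)[OF x] hcl[OF g(1) x] by simp
 qed
qed

lemma injective_retract:
 assumes I: "injective A I" and "lmod A N" "i : lhom A N I" "r : lhom A I N"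
  "!!x. x IN N ==> r (i x) = x"
 shows "injective A N" unfolding injective_def
proof (intro conjI ballI impI)
 fix X Y g f
 assume a: "X : fgmod A" "Y : fgmod A" "g : lhom A X Y" "f : lhom A X N" "inj_on g (cr X)"
 have lm: "lmod A X" "lmod A Y" using a by (auto simp: fgD)
 have "(%x:cr X. i (f x)) : lhom A X I" by (rule hcomp[OF lm(1) a(4) assms(3)])
 then obtain h where h: "h : lhom A Y I" "ALL x:cr X. h (g x) = (%x:cr X. i (f x)) x" using I a unfolding injective_def by blast
 have "(%y:cr Y. r (h y)) (g x) = f x" if "x IN X" for x using h(2) that assms(5)[OF hcl[OF a(4) that]] hcl[OF a(3) that] by simp
 thus "EX h:lhom A Y N. ALL x:cr X. h (g x) = f x" using hcomp[OF lm(2) h(1) assms(4)] by blast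
qed (rule assms)

lemma injective_dsum:
 fixes M :: "'i => ('a, 'm) module"
 assumes M: "!!i. i : I ==> injective A (M i)"
 shows "injective A (dsum I M)" unfolding injective_def
proof (intro conjI ballI impI)
 have lm: "lmod A (M i)" if "i : I" for i using M[OF that] by (rule injective_lm)
 show L: "lmod A (dsum I M)" using lm by simp
 fix X Y g f
 assume a: "X : fgmod A" "Y : fgmod A" "g : lhom A X Y" "f : lhom A X (dsum I M)" "inj_on g (cr X)"
 have lXY: "lmod A X" "lmod A Y" using a by (auto simp: fgD)
 have "EX h. h : lhom A Y (M i) & (ALL x:cr X. h (g x) = f x i)" if i: "i : I" for i
 proof -
  have fi: "(%x:cr X. (%x:cr (dsum I M). x i) (f x)) : lhom A X (M i)" by (rule hcomp[OF lXY(1) a(4) lhom_dproj[OF lm i]])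
  then obtain h where h: "h : lhom A Y (M i)" "ALL x:cr X. h (g x) = (%x:cr X. (%x:cr (dsum I M). x i) (f x)) x" using M[OF i] a unfolding injective_def by blast
  have "h (g x) = f x i" if "x IN X" for x using h(2) that hcl[OF a(4) that] by simp
  thus ?thesis using h(1) by blast
 qed
 hence "ALL i:I. EX h. h : lhom A Y (M i) & (ALL x:cr X. h (g x) = f x i)" by blast
 from bchoice[OF this] obtain h where h: "!!i. i : I ==> h i : lhom A Y (M i)"
  "!!i x. i : I ==> x IN X ==> h i (g x) = f x i" by blast
 let ?h = "%y:cr Y. %i:I. h i y"
 have "?h (g x) = f x" if x: "x IN X" for x
 proof -
  have "f x : extensional I" using hcl[OF a(4) x] by (auto simp: PiE_def)
  thus ?thesis using hcl[OF a(3) x] h(2)[OF _ x] by (auto intro!: extensionalityI[of _ I])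
 qed
 thus "EX h:lhom A Y (dsum I M). ALL x:cr X. h (g x) = f x" by (intro bexI[of _ ?h] ballI lhom_dpair[OF lXY(2) h(1)])
qed

lemma injective_biprod:
 fixes M :: "('a, 'm) module" and N :: "('a, 'n) module"
 assumes M: "injective A M" "injective A N"
 shows "injective A (biprod M N)" unfolding injective_def
proof (intro conjI ballI impI)
 let ?L = "biprod M N"
 have lm: "lmod A M" "lmod A N" using M by (auto intro: injective_lm)
 show L: "lmod A ?L" using lm by simp
 fix X Y g f
 assume a: "X : fgmod A" "Y : fgmod A" "g : lhom A X Y" "f : lhom A X ?L" "inj_on g (cr X)"
 have lXY: "lmod A X" "lmod A Y" using a by (auto simp: fgD)
 have 1: "(%x:cr X. restrict fst (cr ?L) (f x)) : lhom A X M" by (rule hcomp[OF lXY(1) a(4) lhom_fst[OF lm]])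
 have 2: "(%x:cr X. restrict snd (cr ?L) (f x)) : lhom A X N" by (rule hcomp[OF lXY(1) a(4) lhom_snd[OF lm]])
 obtain h where h: "h : lhom A Y M" "ALL x:cr X. h (g x) = (%x:cr X. restrict fst (cr ?L) (f x)) x" using M(1) a 1 unfolding injective_def by blast
 obtain k where k: "k : lhom A Y N" "ALL x:cr X. k (g x) = (%x:cr X. restrict snd (cr ?L) (f x)) x" using M(2) a 2 unfolding injective_def by blast
 have "(%y:cr Y. (h y, k y)) (g x) = f x" if "x IN X" for x using h(2) k(2) that hcl[OF a(4) that] hcl[OF a(3) that] by auto
 thus "EX h:lhom A Y ?L. ALL x:cr X. h (g x) = f x" using lhom_pair[OF lXY(2) h(1) k(1)] by blast
qed

end

section \<open>Chain conditions\<close>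

text \<open>Both chain conditions at once; for submodules this is finite length. Treating them
  together lets \<open>chains_stop_pair\<close> serve for ascending and descending chains with one
  proof.\<close>

definition chains_stop :: "('s set => bool) => bool" where
 "chains_stop Q <-> (ALL U :: nat => 's set. (ALL n. Q (U n)) &
   ((ALL n. U (Suc n)<=U n) | (ALL n. U n<=U (Suc n))) --> (EX m. ALL n>=m. U n = U m))"

lemma descending_min:
 assumes dcc: "!!U :: nat => 's set. (!!n. Q (U n)) ==> (!!n. U (Suc n)<=U n) ==> EX m. ALL n>=m. U n = U m"
  and "X : \<C>" "!!X. X : \<C> ==> Q X"
 obtains Y where "Y : \<C>" "!!Z. Z : \<C> ==> Z<=Y ==> Z = Y"
proof (rule ccontr)
 assume "~ thesis"
 hence step: "!!Y. Y : \<C> ==> EX Z. Z : \<C> & Z \<subset> Y" using that by blast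
 have "EX f. ALL n. f n : \<C> & f (Suc n) \<subset> f n" using dependent_nat_choice[of "%_ Y. Y : \<C>" "%_ Y Z. Z \<subset> Y"] step assms(2) by blast
 then obtain f where f: "!!n. f n : \<C>" "!!n. f (Suc n) \<subset> f n" by blast
 have "EX m. ALL n>=m. f n = f m" by (rule dcc) (use f assms(3) in auto)
 then obtain m where "ALL n>=m. f n = f m" ..
 hence "f (Suc m) = f m" by (elim allE[of _ "Suc m"]) simp
 thus False using f(2)[of m] by simp
qed

lemma ascending_max:
 assumes acc: "!!U :: nat => 's set. (!!n. Q (U n)) ==> (!!n. U n<=U (Suc n)) ==> EX m. ALL n>=m. U n = U m"
  and C: "X : \<C>" "!!X. X : \<C> ==> Q X"
 obtains Y where "Y : \<C>" "!!Z. Z : \<C> ==> Y<=Z ==> Z = Y"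
proof -
 obtain Y where Y: "Y : uminus ` \<C>" "!!Z. Z : uminus ` \<C> ==> Z<=Y ==> Z = Y"
 proof (rule descending_min[of "%X. Q (- X)" "- X" "uminus ` \<C>"])
  show "EX m. ALL n>=m. U n = U m" if "!!n. Q (- U n)" "!!n. U (Suc n)<=U n" for U using acc[of "%n. - U n"] that by auto
 qed (use C in auto)
 then obtain W where W: "W : \<C>" "Y = - W" by blast
 show ?thesis
 proof (rule that[OF W(1)])
  show "Z = W" if "Z : \<C>" "W<=Z" for Z using Y(2)[OF imageI[OF that(1)]] that W(2) by simp
 qed
qed

text \<open>The pattern of a submodule and its quotient: if both traces of a chain stop and
  comparable members with equal traces are equal, then the chain itself stops.\<close>

lemma chains_stop_pair:
 assumes Q: "chains_stop Q1" "chains_stop Q2" and f: "!!X. Q X ==> Q1 (f X)" "!!X. Q X ==> Q2 (g X)"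
   "!!X Y. X<=Y ==> f X<=f Y" "!!X Y. X<=Y ==> g X<=g Y"
  and e: "!!X Y. Q X ==> Q Y ==> X<=Y ==> f X = f Y ==> g X = g Y ==> X = Y"
 shows "chains_stop Q" unfolding chains_stop_def
proof (intro allI impI)
 fix U :: "nat => _" assume U: "(ALL n. Q (U n)) & ((ALL n. U (Suc n)<=U n) | (ALL n. U n<=U (Suc n)))"
 obtain m1 where m1: "!!n. n>=m1 ==> f (U n) = f (U m1)" using Q(1)[unfolded chains_stop_def, rule_format, of "%n. f (U n)"] U f(1,3) by meson
 obtain m2 where m2: "!!n. n>=m2 ==> g (U n) = g (U m2)" using Q(2)[unfolded chains_stop_def, rule_format, of "%n. g (U n)"] U f(2,4) by meson
 let ?m = "max m1 m2"
 have "U n = U ?m" if n: "n>=?m" for n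
 proof -
  have 1: "f (U n) = f (U ?m)" "g (U n) = g (U ?m)" using m1[of n] m1[of ?m] m2[of n] m2[of ?m] n by auto
  have "U n<=U ?m | U ?m<=U n" using U lift_Suc_antimono_le[of U ?m n] lift_Suc_mono_le[of U ?m n] n by blast
  thus ?thesis using e[of "U n" "U ?m"] e[of "U ?m" "U n"] U 1 by auto
 qed
 thus "EX m. ALL n>=m. U n = U m" by blast
qed

lemma chains_stop_min:
 assumes "chains_stop Q" "X : \<C>" "!!X. X : \<C> ==> Q X"
 obtains Y where "Y : \<C>" "!!Z. Z : \<C> ==> Z<=Y ==> Z = Y" by (rule descending_min[of Q X \<C>]) (use assms in "auto simp: chains_stop_def")

lemma chains_stop_max:
 assumes "chains_stop Q" "X : \<C>" "!!X. X : \<C> ==> Q X"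
 obtains Y where "Y : \<C>" "!!Z. Z : \<C> ==> Y<=Z ==> Z = Y" by (rule ascending_max[of Q X \<C>]) (use assms in "auto simp: chains_stop_def")

text \<open>Take a maximal finitely generated submodule \<open>W\<close> of \<open>U\<close>. For
  \<open>x\<close> in \<open>U\<close> the submodule \<open>W + A x\<close> is again finitely
  generated, so \<open>x\<close> lies in \<open>W\<close>.\<close>

lemma (in base_ring) fin_gen_sub_stop:
 fixes M :: "('a, 'm) module"
 assumes M: "lmod A M" and stop: "chains_stop (submod A M)" and U: "submod A M U"
 shows "fin_gen A (sub M U)"
proof -
 let ?C = "{W. submod A M W & W<=U & fin_gen A (sub M W)}"
 have "generates (sub M {0[M]}) {}" unfolding generates_def submod_def by auto
 hence "fin_gen A (sub M {0[M]})" by (intro generates_fin_gen[OF lm_sub[OF M submod_zero[OF M]] finite.emptyI])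
 hence "{0[M]} : ?C" using M smD(2)[OF U] by simp
 then obtain W where W: "W : ?C" "!!Z. Z : ?C ==> W<=Z ==> Z = W" by (rule chains_stop_max[OF stop]) auto
 hence Ws: "submod A M W" "W<=U" "fin_gen A (sub M W)" by auto
 have "x : W" if x: "x : U" for x
 proof -
  have xc: "x IN M" using smD(5)[OF U x] .
  let ?f = "%z:cr (biprod (sub M W) (regular A)). (%w:W. w) (fst z) +[M] (%a:cr (regular A). a *[M] x) (snd z)"
  have r: "(%a:cr (regular A). a *[M] x) : lhom A (regular A) M" by (rule hresI) (use xc M in "auto simp: lsm")
  have L: "lmod A (sub M W)" using M Ws by simp
  have f: "?f : lhom A (biprod (sub M W) (regular A)) M" by (rule lhom_copair[OF L lm_regular M lhom_incl[OF M Ws(1)] r])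
  let ?Z = "?f ` cr (biprod (sub M W) (regular A))"
  have LB: "lmod A (biprod (sub M W) (regular A))" using L by simp
  have "fin_gen A (biprod (sub M W) (regular A))" by (rule fin_gen_biprod[OF L lm_regular Ws(3) fin_gen_regular])
  hence fg: "fin_gen A (sub M ?Z)" by (rule fin_gen_range[OF LB M f])
  have Z: "submod A M ?Z" by (rule sm_range[OF LB M f])
  have zw: "w +[M] a *[M] x : ?Z" if "w : W" "a IN A" for w a by (rule image_eqI[where x="(w, a)"]) (use that in auto)
  have "?Z<=U"
  proof (rule image_subsetI)
   fix z assume "z IN biprod (sub M W) (regular A)"
   thus "?f z : U" using Ws(2) smD(3)[OF U] smD(4)[OF U _ x] by (cases z) auto
  qed
  moreover have "W<=?Z"
  proof
   fix w assume w: "w : W"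
   thus "w : ?Z" using zw[OF w A.zero_closed] xc M smD(5)[OF Ws(1) w] by simp
  qed
  ultimately have "?Z = W" using W(2)[of ?Z] Z fg by blast
  moreover have "x : ?Z" using zw[OF smD(2)[OF Ws(1)] A.one_closed] xc M by (simp add: lsm)
  ultimately show ?thesis by blast
 qed
 hence "W = U" using Ws(2) by blast
 thus ?thesis using Ws(3) by simp
qed

subsection \<open>Artinian commutative rings are Noetherian\<close>

locale artin_ring =
 fixes R :: "('r, 'e) ring_scheme"
 assumes artinian: "artinian_cring R"
begin

sublocale cring R using artinian by (simp add: artinian_cring_def)

sublocale base_ring R by unfold_locales

lemma ideals_min:
 assumes "X : \<C>" "!!X. X : \<C> ==> ideal X R"
 obtains Y where "Y : \<C>" "!!Z. Z : \<C> ==> Z<=Y ==> Z = Y"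
 by (rule descending_min[of "%I. ideal I R" X \<C>]) (use assms artinian in "auto simp: artinian_cring_def")

text \<open>Finite generation of \<open>K\<close> modulo \<open>I\<close>, said with ideals of
  \<open>R\<close> only in order to avoid quotient rings.\<close>

definition fg_over :: "'r set => 'r set => bool" where
 "fg_over I K <-> (EX S. finite S & S<=K & (ALL L. ideal L R & I<=L & S<=L --> K<=L))"

lemma fg_overI:
 "finite S ==> S<=K ==> (!!L. ideal L R ==> I<=L ==> S<=L ==> K<=L) ==> fg_over I K" unfolding fg_over_def by (intro exI[of _ S]) auto

lemma fg_overE:
 assumes "fg_over I K"
 obtains S where "finite S" "S<=K" "!!L. ideal L R ==> I<=L ==> S<=L ==> K<=L" using assms unfolding fg_over_def by auto

lemma ideal_plus:
 assumes "ideal I R" "ideal K R"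
 shows "ideal {x +[R] y | x y. x : I & y : K} R"
proof -
 have "{x +[R] y | x y. x : I & y : K} = I <+>\<^bsub>R\<^esub> K" by (auto simp: set_add_defs)
 thus ?thesis using add_ideals[OF assms] by simp
qed

lemma idealD:
 assumes "ideal I R"
 shows "I<=cr R" "0[R] : I" "x : I ==> x IN R" "x : I ==> y : I ==> x +[R] y : I"
  "x : I ==> y : I ==> x -[R] y : I" "a IN R ==> x : I ==> a **[R] x : I"
proof -
 interpret I: ideal I R by fact
 show "I<=cr R" "0[R] : I" "x : I ==> x IN R" "x : I ==> y : I ==> x +[R] y : I"
  "x : I ==> y : I ==> x -[R] y : I" "a IN R ==> x : I ==> a **[R] x : I" by (auto simp: I.I_l_closed a_minus_def)
qed

lemma ideal_Collect:
 assumes "!!x. x : I ==> x IN R" "0[R] : I" "!!x y. x : I ==> y : I ==> x +[R] y : I"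
  "!!a x. a IN R ==> x : I ==> a **[R] x : I"
 shows "ideal I R"
proof (rule idealI)
 have "-[R] x : I" if "x : I" for x using assms(4)[of "-[R] 1[R]" x] assms(1)[OF that] that by (simp add: l_minus)
 thus "subgroup I (add_monoid R)" using assms by (intro subgroup.intro) (auto simp flip: a_inv_def)
 show "a **[R] x : I" if "a : I" "x IN R" for a x using assms(4)[OF that(2,1)] assms(1)[OF that(1)] that by (simp add: m_comm)
qed (use assms in "auto intro: ring_axioms")

text \<open>With \<open>I / I'\<close> simple, generators of \<open>K + I\<close> over
  \<open>I\<close> are lifted to \<open>K\<close>. They generate \<open>K\<close> up to
  \<open>K \<inter> I\<close>, and this is either \<open>I'\<close> or, with one more generator
  \<open>y\<close>, covered by simplicity.\<close>

lemma fg_over_simple_step: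
 assumes I: "ideal I R" "!!K. ideal K R ==> I<=K ==> fg_over I K"
  and I': "ideal I' R" "I' \<subset> I" "!!W. ideal W R ==> I'<=W ==> W<=I ==> W = I' | W = I"
  and K: "ideal K R" "I'<=K"
 shows "fg_over I' K"
proof -
 let ?s = "%L. {x +[R] y | x y. x : L & y : I}"
 have sub: "L<=?s L" if "ideal L R" for L
 proof
  fix x assume "x : L"
  moreover have "x = x +[R] 0[R]" using idealD(3)[OF that \<open>x : L\<close>] by simp
  ultimately show "x : ?s L" using idealD(2)[OF I(1)] by blast
 qed
 have subI: "I<=?s L" if "ideal L R" for L
 proof
  fix x assume "x : I"
  moreover have "x = 0[R] +[R] x" using idealD(3)[OF I(1) \<open>x : I\<close>] by simp
  ultimately show "x : ?s L" using idealD(2)[OF that] by blast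
 qed
 have "fg_over I (?s K)" by (rule I(2)[OF ideal_plus[OF K(1) I(1)] subI[OF K(1)]])
 then obtain S where S: "finite S" "S<=?s K" "!!L. ideal L R ==> I<=L ==> S<=L ==> ?s K<=L" by (rule fg_overE) blast
 have "ALL s:S. EX k. k : K & (EX i:I. s = k +[R] i)" using S(2) by blast
 from bchoice[OF this] obtain k where k: "!!s. s : S ==> k s : K" "!!s. s : S ==> EX i:I. s = k s +[R] i" by blast
 have KI: "K \<inter> I = I' | K \<inter> I = I" by (rule I'(3)[OF i_intersect[OF K(1) I(1)]]) (use K(2) I'(2) in auto)
 obtain y where y: "y : I" "y ~: I'" using I'(2) by blast
 define S' where "S' = k ` S \<union> (if K \<inter> I = I then {y} else {})"
 have "finite S'" "S'<=K" using S(1) k(1) y KI by (auto simp: S'_def)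
 moreover have "K<=L" if L: "ideal L R" "I'<=L" "S'<=L" for L
 proof
  fix z assume z: "z : K"
  have L0: "ideal (L \<inter> K) R" by (rule i_intersect[OF L(1) K(1)])
  have "S<=?s (L \<inter> K)"
  proof
   fix s assume s: "s : S"
   then obtain i where "i : I" "s = k s +[R] i" using k(2) by blast
   moreover have "k s : L \<inter> K" using s L(3) k(1) by (auto simp: S'_def)
   ultimately show "s : ?s (L \<inter> K)" by blast
  qed
  hence "?s K<=?s (L \<inter> K)" by (intro S(3) ideal_plus L0 I(1) subI)
  hence "z : ?s (L \<inter> K)" using z sub[OF K(1)] by blast
  then obtain l i where li: "l : L" "l : K" "i : I" "z = l +[R] i" by blast
  have "l IN R" "i IN R" using li idealD(3)[OF K(1)] idealD(3)[OF I(1)] by auto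
  hence "i = z -[R] l" unfolding li(4) by algebra
  hence iK: "i : K" using idealD(5)[OF K(1) z li(2)] by simp
  \<comment> \<open>If \<open>K \<inter> I\<close> is \<open>I'\<close>, then \<open>i\<close> lies
    in \<open>I'\<close> and so in \<open>L\<close>. Otherwise \<open>y\<close> witnesses that
    \<open>L \<inter> I\<close> is larger than \<open>I'\<close>, hence equal to
    \<open>I\<close>.\<close>
  have "i : L"
  proof (cases "K \<inter> I = I")
   case False
   thus ?thesis using KI iK li(3) L(2) by blast
  next
   case True
   hence "y : L" using L(3) by (auto simp: S'_def)
   hence "L \<inter> I~=I'" using y by blast
   hence "L \<inter> I = I" using I'(3)[OF i_intersect[OF L(1) I(1)]] L(2) I'(2) by blast
   thus ?thesis using li(3) by blast
  qed
  thus "z : L" using li idealD(4)[OF L(1)] by blast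
 qed
 ultimately show ?thesis by (rule fg_overI)
qed

lemma ideal_Union_chain:
 assumes "\<C> ~= {}" "!!I. I : \<C> ==> ideal I R" "!!I K. I : \<C> ==> K : \<C> ==> I<=K | K<=I"
 shows "ideal (\<Union>\<C>) R"
proof (rule ideal_Collect)
 show "x +[R] y : \<Union>\<C>" if xy: "x : \<Union>\<C>" "y : \<Union>\<C>" for x y
 proof -
  obtain I K where IK: "I : \<C>" "K : \<C>" "x : I" "y : K" using xy by blast
  hence "EX L:\<C>. x : L & y : L" using assms(3)[OF IK(1,2)] by blast
  thus ?thesis using idealD(4)[OF assms(2)] by blast
 qed
 show "x IN R" if "x : \<Union>\<C>" for x using that idealD(3)[OF assms(2)] by blast
 show "0[R] : \<Union>\<C>" using assms(1) idealD(2)[OF assms(2)] by blast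
 show "a **[R] x : \<Union>\<C>" if "a IN R" "x : \<Union>\<C>" for a x using that idealD(6)[OF assms(2)] by blast
qed

lemma ideal_maximal_avoiding:
 assumes "ideal I R" "y ~: I" "I<=M"
 obtains U where "ideal U R" "I<=U" "U<=M" "y ~: U"
  "!!W. ideal W R ==> U<=W ==> W<=M ==> y ~: W ==> W = U"
proof -
 let ?A = "{W. ideal W R & I<=W & W<=M & y ~: W}"
 have "EX U:?A. ALL X:?A. U<=X --> X = U"
 proof (rule subset_Zorn_nonempty)
  show "?A ~= {}" using assms by blast
  fix \<C> assume C: "\<C> ~= {}" "subset.chain ?A \<C>"
  hence "ideal (\<Union>\<C>) R" by (intro ideal_Union_chain) (auto simp: subset_chain_def)
  thus "\<Union>\<C> : ?A" using C unfolding subset_chain_def by blast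
 qed
 then obtain U where U: "U : ?A" "ALL X:?A. U<=X --> X = U" ..
 show ?thesis
 proof (rule that[of U])
  show "W = U" if "ideal W R" "U<=W" "W<=M" "y ~: W" for W
  proof -
   have "W : ?A" using that U(1) by auto
   thus ?thesis using U(2) that(2) by (elim ballE impE) auto
  qed
 qed (use U(1) in auto)
qed

text \<open>
 A minimal ideal \<open>I\<close> with Noetherian quotient vanishes: otherwise take a minimal ideal \<open>R x\<close> that \<open>I\<close> does
 not annihilate. Then \<open>I / (I \<inter> ann x)\<close> is a vector space over a residue field, and the
 preimage of a hyperplane would be a smaller ideal with Noetherian quotient.
\<close>

lemma fg_over_zero:
 assumes "ideal K R"
 shows "fg_over {0[R]} K"
proof -
 let ?P = "%I. ideal I R & (ALL K. ideal K R & I<=K --> fg_over I K)"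
 have "fg_over (cr R) K" if "ideal K R" for K by (rule fg_overI[of "{}"]) (use idealD(1)[OF that] in auto)
 hence P0: "cr R : Collect ?P" using oneideal by auto
 obtain I where "I : Collect ?P" and min': "!!J. J : Collect ?P ==> J<=I ==> J = I" by (rule ideals_min[OF P0]) auto
 hence idI: "ideal I R" and I: "!!K. ideal K R ==> I<=K ==> fg_over I K" by auto
 have min: "J = I" if "ideal J R" "!!K. ideal K R ==> J<=K ==> fg_over J K" "J<=I" for J by (rule min') (use that in auto)
 note Ic = idealD(3)[OF idI]
 have "I = {0[R]}"
 proof (rule ccontr)
  assume "I ~= {0[R]}"
  then obtain i1 where i1: "i1 : I" "i1~=0[R]" using idealD(2)[OF idI] by blast
  let ?C = "{K. ideal K R & (EX i:I. EX k:K. i **[R] k~=0[R])}"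
  have "i1 **[R] 1[R]~=0[R]" using i1 Ic by simp
  hence C0: "cr R : ?C" using i1(1) oneideal one_closed by blast
  obtain K where K: "K : ?C" "!!Z. Z : ?C ==> Z<=K ==> Z = K" by (rule ideals_min[OF C0]) auto
  then obtain i0 x where x: "x : K" "i0 : I" "i0 **[R] x~=0[R]" by blast
  have idK: "ideal K R" using K(1) by blast
  have xc: "x IN R" using x idealD(3)[OF idK] by blast
  \<comment> \<open>By minimality of \<open>K\<close>, a multiple of \<open>x\<close> that is not
    annihilated by \<open>I\<close> generates \<open>K\<close> again. So \<open>r\<close> can be
    undone on \<open>x\<close>: this is where the residue field comes from.\<close>
  have inv: "EX b:cr R. x = b **[R] (r **[R] x)"
   if r: "r IN R" and i: "i : I" "i **[R] (r **[R] x)~=0[R]" for r i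
  proof -
   have rx: "r **[R] x IN R" using r xc by simp
   have "PIdl\<^bsub>R\<^esub> (r **[R] x) = K"
   proof (rule K(2))
    show "PIdl\<^bsub>R\<^esub> (r **[R] x) : ?C" using cgenideal_ideal[OF rx] cgenideal_self[OF rx] i by blast
    show "PIdl\<^bsub>R\<^esub> (r **[R] x)<=K" by (rule cgenideal_minimal[OF idK idealD(6)[OF idK r x(1)]])
   qed
   thus ?thesis using x(1) unfolding cgenideal_def by blast
  qed
  define I0 where "I0 = {i:I. i **[R] x = 0[R]}"
  have I0: "ideal I0 R" unfolding I0_def by (rule ideal_Collect) (use idealD[OF idI] xc Ic in "auto simp: l_distr m_assoc")
  have I0I: "I0<=I" "i0 ~: I0" using x by (auto simp: I0_def)
  obtain U where U: "ideal U R" "I0<=U" "U<=I" "i0 ~: U"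
   "!!W. ideal W R ==> U<=W ==> W<=I ==> i0 ~: W ==> W = U" using ideal_maximal_avoiding[OF I0 I0I(2,1)] by blast
  \<comment> \<open>\<open>U\<close> is maximal among the ideals between \<open>I0\<close> and
    \<open>I\<close> without \<open>i0\<close>. An ideal above \<open>U\<close> that does contain
    \<open>i0\<close> is shown to contain every \<open>z\<close> in \<open>I\<close>, so nothing
    lies strictly in between.\<close>
  have simple: "W = U | W = I" if W: "ideal W R" "U<=W" "W<=I" for W
  proof (cases "i0 : W")
   case True
   have "z : W" if z: "z : I" for z
   proof (cases "z : U")
    case True
    thus ?thesis using W by blast
   next
    case False
    have zc: "z IN R" using Ic z by blast
    let ?V = "{u +[R] v | u v. u : U & v : PIdl\<^bsub>R\<^esub> z}"
    have V: "ideal ?V R" by (rule ideal_plus[OF U(1) cgenideal_ideal[OF zc]])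
    have UV: "U<=?V"
    proof
     fix u assume u: "u : U"
     moreover have "u = u +[R] 0[R]" using idealD(3)[OF U(1) u] by simp
     ultimately show "u : ?V" using idealD(2)[OF cgenideal_ideal[OF zc]] by blast
    qed
    have "z = 0[R] +[R] z" using zc by simp
    hence "z : ?V" using cgenideal_self[OF zc] idealD(2)[OF U(1)] by blast
    hence "?V~=U" using False by blast
    moreover have "?V<=I" using U(3) cgenideal_minimal[OF idI z] idealD(4)[OF idI] by blast
    ultimately have "i0 : ?V" using U(5)[OF V UV] by blast
    then obtain u r where u: "u : U" "r IN R" "i0 = u +[R] r **[R] z" unfolding cgenideal_def by blast
    have uc: "u IN R" using idealD(3)[OF U(1) u(1)] .
    have "EX i:I. i **[R] (r **[R] x)~=0[R]"
    proof (rule ccontr)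
     assume "~ (EX i:I. i **[R] (r **[R] x)~=0[R])"
     hence "z **[R] (r **[R] x) = 0[R]" using z by blast
     hence "r **[R] z : I0" using idealD(6)[OF idI u(2) z] zc u(2) xc by (simp add: I0_def m_ac)
     thus False using u U(2,4) idealD(4)[OF U(1)] by blast
    qed
    then obtain b where b: "b IN R" "x = b **[R] (r **[R] x)" using inv[OF u(2)] by blast
    \<comment> \<open>\<open>?c\<close> annihilates \<open>x\<close>, so \<open>?c z\<close> lies in
      \<open>I0\<close>. The remaining part \<open>b r z\<close> of \<open>z\<close> equals
      \<open>b (i0 - u)\<close>, which lies in \<open>W\<close>.\<close>
    let ?c = "1[R] -[R] b **[R] r"
    have c: "?c IN R" using b u by simp
    have "?c **[R] x = x -[R] b **[R] (r **[R] x)" using b(1) u(2) xc by algebra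
    hence "?c **[R] x = 0[R]" using b(2) xc by (simp add: a_minus_def r_neg)
    hence "?c **[R] z **[R] x = 0[R]" using c zc xc by (metis m_assoc m_comm r_null)
    hence "?c **[R] z : I0" using idealD(6)[OF idI c z] by (simp add: I0_def)
    hence 1: "?c **[R] z : W" using U(2) W(2) by blast
    have "u : W" using u W by blast
    hence 2: "b **[R] (i0 -[R] u) : W" using idealD(6)[OF W(1) b(1) idealD(5)[OF W(1) True]] by blast
    have "b **[R] (i0 -[R] u) = b **[R] (r **[R] z)" unfolding u(3) using b(1) u(2) uc zc by algebra
    moreover have "z = ?c **[R] z +[R] b **[R] (r **[R] z)" using b(1) u(2) zc by algebra
    ultimately show "z : W" using 1 2 idealD(4)[OF W(1)] by metis
   qed
   thus ?thesis using W by blast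
  qed (use U(5) W in blast)
  have psub: "U \<subset> I" using U(3,4) x(2) by blast
  have "fg_over U K" if "ideal K R" "U<=K" for K by (rule fg_over_simple_step[OF idI I U(1) psub simple that])
  hence "U = I" by (rule min[OF U(1) _ U(3)])
  thus False using psub by blast
 qed
 thus ?thesis using I[OF assms] idealD(2)[OF assms] by simp
qed

text \<open>Only ascending chains need an argument: their union is an ideal, finitely generated by
  \<open>fg_over_zero\<close>, and finitely many generators already occur at one stage.\<close>

lemma ideals_stop: "chains_stop (%I. ideal I R)" unfolding chains_stop_def
proof (intro allI impI)
 fix U :: "nat => 'r set"
 assume U: "(ALL n. ideal (U n) R) & ((ALL n. U (Suc n)<=U n) | (ALL n. U n<=U (Suc n)))"
 show "EX m. ALL n>=m. U n = U m"
 proof (cases "ALL n. U (Suc n)<=U n")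
  case True
  thus ?thesis using artinian U unfolding artinian_cring_def by blast
 next
  case False
  hence up: "!!n. U n<=U (Suc n)" using U by blast
  hence mono: "U i<=U j" if "i<=j" for i j using that by (rule lift_Suc_mono_le)
  have id: "ideal (\<Union>(range U)) R" by (rule ideal_Union_chain) (use U mono nat_le_linear in "auto, blast+")
  obtain S where S: "finite S" "S <= \<Union>(range U)" "!!L. ideal L R ==> {0[R]} <= L ==> S<=L ==> \<Union>(range U)<=L"
   by (rule fg_overE[OF fg_over_zero[OF id]]) blast
  have "EX m. S<=U m" using S(1,2)
  proof (induction S)
   case (insert s S)
   then obtain m k where "S<=U m" "s : U k" by blast
   hence "insert s S<=U (max m k)" using mono[of m "max m k"] mono[of k "max m k"] by auto
   thus ?case by blast
  qed auto
  then obtain m where m: "S<=U m" by blast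
  have "\<Union>(range U)<=U m" by (rule S(3)) (use U m idealD(2) in auto)
  hence "U n = U m" if "n>=m" for n using mono[OF that] by blast
  thus ?thesis by blast
 qed
qed

subsection \<open>Finitely generated modules\<close>

text \<open>Induction along the submodules \<open>V k\<close> generated by the first
  \<open>k\<close> generators. A submodule \<open>U\<close> of \<open>V (Suc k)\<close> is
  controlled by \<open>U \<inter> V k\<close> and by the ideal \<open>?I U\<close> of its
  coefficients at the generator \<open>w k\<close>.\<close>

lemma submods_stop:
 fixes M :: "('r, 'm) module"
 assumes M: "lmod R M" "fin_gen R M"
 shows "chains_stop (submod R M)"
proof -
 obtain S where S: "finite S" "generates M S" by (rule fin_gen_generates[OF M])
 obtain l w where w: "S = w ` {..<l}" "lin l w M ` cr (free l) = cr M" by (rule generates_lin[OF M(1) S]) blast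
 define V where "V k = lin k w M ` cr (free k)" for k
 have "chains_stop (%U. submod R M U & U<=V k)" if "k<=l" for k using that
 proof (induction k)
  case 0
  have "V 0 <= {0[M]}" using M unfolding V_def lin_def by auto
  hence "U = {0[M]}" if "submod R M U & U<=V 0" for U using that smD(2)[of M U] by blast
  thus ?case unfolding chains_stop_def by metis
 next
  case (Suc k)
  let ?V = "V k" and ?s = "w k"
  have wc: "w j IN M" if "j<l" for j using w(1) S(2) that unfolding generates_def by auto
  have sc: "?s IN M" using wc Suc.prems by simp
  have V: "submod R M ?V" unfolding V_def by (rule sm_range[OF lm_free M(1) lin_hom[OF M(1) wc]]) (use Suc.prems in simp)
  let ?I = "%U. {r:cr R. EX v:?V. r *[M] ?s +[M] v : U}"
  have I: "ideal (?I U) R" if U: "submod R M U" for U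
  proof (rule ideal_Collect)
   show "x IN R" if "x : ?I U" for x using that by simp
   have "0[R] *[M] ?s +[M] 0[M] : U" using sc M smD(2)[OF U] by simp
   thus "0[R] : ?I U" using smD(2)[OF V] by blast
   show "x +[R] y : ?I U" if xy: "x : ?I U" "y : ?I U" for x y
   proof -
    obtain v w where vw: "v : ?V" "x *[M] ?s +[M] v : U" "w : ?V" "y *[M] ?s +[M] w : U" "x IN R" "y IN R" using xy by blast
    have "(x *[M] ?s +[M] v) +[M] (y *[M] ?s +[M] w) = (x +[R] y) *[M] ?s +[M] (v +[M] w)" using vw smD(5)[OF V] sc M by (simp add: lm_ac lsm)
    hence "(x +[R] y) *[M] ?s +[M] (v +[M] w) : U" using smD(3)[OF U vw(2,4)] by simp
    thus ?thesis using smD(3)[OF V vw(1,3)] vw by blast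
   qed
   show "a **[R] x : ?I U" if ax: "a IN R" "x : ?I U" for a x
   proof -
    obtain v where vw: "v : ?V" "x *[M] ?s +[M] v : U" "x IN R" using ax by blast
    have "a *[M] (x *[M] ?s +[M] v) = (a **[R] x) *[M] ?s +[M] a *[M] v" using vw smD(5)[OF V] sc M ax by (simp add: lm_ac lsm)
    hence "(a **[R] x) *[M] ?s +[M] a *[M] v : U" using smD(4)[OF U ax(1) vw(2)] by simp
    thus ?thesis using smD(4)[OF V ax(1) vw(1)] vw ax(1) by blast
   qed
  qed
  have VS: "EX r:cr R. EX v:?V. x = r *[M] ?s +[M] v" if x: "x : V (Suc k)" for x
  proof -
   obtain c where c: "c IN free (Suc k)" "x = lin (Suc k) w M c" using x unfolding V_def by blast
   have cR: "c j IN R" if "j<Suc k" for j using free_simps(1)[OF c(1) that] .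
   let ?c = "%j:{..<k}. c j"
   have cw: "c j *[M] w j IN M" if "j = k | j<k" for j by (rule lcl(5)[OF M(1) cR wc]) (use that Suc.prems in auto)
   have d: "?c IN free k" using cR unfolding free_def by auto
   have "x = c k *[M] ?s +[M] finsum M (%j. c j *[M] w j) {..<k}"
    using c finsum_insert'[OF M(1), of "{..<k}" k "%j. c j *[M] w j"] cw by (simp add: lin_def lessThan_Suc)
   also have "finsum M (%j. c j *[M] w j) {..<k} = lin k w M ?c" using d cR wc Suc.prems M by (simp add: lin_def cong: finsum_cong') (intro finsum_cong'; simp)
   finally show ?thesis using d cR[of k] unfolding V_def by blast
  qed
  have key: "X = Y" if X: "submod R M X" and Y: "submod R M Y" "Y<=V (Suc k)" and XY: "X<=Y" "X \<inter> ?V = Y \<inter> ?V" "?I X = ?I Y" for X Y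
  proof -
   have "y : X" if y: "y : Y" for y
   proof -
    obtain r v where rv: "r IN R" "v : ?V" "y = r *[M] ?s +[M] v" using VS y Y(2) by blast
    hence "r : ?I Y" using y by blast
    hence "r : ?I X" using XY(3) by blast
    then obtain w where w: "w : ?V" "r *[M] ?s +[M] w : X" by blast
    have c: "v IN M" "w IN M" using smD(5)[OF V] rv w by auto
    have e: "y -[M] (r *[M] ?s +[M] w) = v -[M] w" using rv c sc M by (simp add: lm_ac)
    have "v -[M] w : Y" using submod_minus[OF M(1) Y(1) y subsetD[OF XY(1) w(2)]] unfolding e .
    moreover have "v -[M] w : ?V" by (rule submod_minus[OF M(1) V rv(2) w(1)])
    ultimately have "v -[M] w : X" using XY(2) by blast
    hence "(r *[M] ?s +[M] w) +[M] (v -[M] w) : X" using smD(3)[OF X w(2)] by blast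
    moreover have "(r *[M] ?s +[M] w) +[M] (v -[M] w) = y" using rv c sc M by (simp add: lm_ac)
    ultimately show ?thesis by simp
   qed
   thus ?thesis using XY(1) by blast
  qed
  have IH: "chains_stop (%U. submod R M U & U<=?V)" using Suc by simp
  show ?case by (rule chains_stop_pair[OF IH ideals_stop, of _ "%U. U \<inter> ?V" ?I])
   (use submod_Int[OF _ V] I key in auto)
 qed
 from this[of l] have *: "chains_stop (%U. submod R M U & U<=cr M)" unfolding V_def w(2) by simp
 have "submod R M U & U<=cr M <-> submod R M U" for U using smD(1)[of M U] by blast
 thus ?thesis using * by simp
qed

end

section \<open>Artin algebras\<close>

locale artin_alg =
 fixes R :: "('r, 'e) ring_scheme" and A :: "('r, 'a) module"
 assumes artin_algebra: "artin_algebra R A"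
begin

sublocale R: artin_ring R using artin_algebra by unfold_locales (simp add: artin_algebra_def)

sublocale base_ring A using artin_algebra by (intro base_ring.intro) (simp add: artin_algebra_def)

sublocale alg: Module.module R A using artin_algebra by (simp add: artin_algebra_def)

lemma alg_assoc:
 assumes "r IN R" "x IN A" "y IN A"
 shows "(r *[A] x) **[A] y = r *[A] (x **[A] y)" "x **[A] (r *[A] y) = r *[A] (x **[A] y)" using artin_algebra assms by (auto simp: artin_algebra_def)

lemma lm_R_A [simp]: "lmod R A" by (rule R.left_moduleI)
  (auto simp: alg.smult_l_distr alg.smult_r_distr alg.smult_assoc1 A.a_ac intro: A.l_neg A.a_inv_closed)

lemma restrict_simps [simp]:
 "cr (restrict_scalars A M) = cr M" "0[restrict_scalars A M] = 0[M]"
 "x +[restrict_scalars A M] y = x +[M] y" "r *[restrict_scalars A M] x = (r *[A] 1[A]) *[M] x" by (simp_all add: restrict_scalars_def)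

lemma unit_closed [simp]: "r IN R ==> r *[A] 1[A] IN A" by simp

lemma lm_restrict [simp]:
 assumes M: "lmod A M"
 shows "lmod R (restrict_scalars A M)"
proof (rule R.left_moduleI)
 fix a b x assume "a IN R" "b IN R" "x IN restrict_scalars A M"
 moreover have "(a **[R] b) *[A] 1[A] = (a *[A] 1[A]) **[A] (b *[A] 1[A])" using calculation by (simp add: alg_assoc(1) alg.smult_assoc1)
 ultimately show "(a **[R] b) *[restrict_scalars A M] x = a *[restrict_scalars A M] (b *[restrict_scalars A M] x)" using M by (simp add: lsm)
next
 fix x assume "x IN restrict_scalars A M"
 thus "EX y:cr (restrict_scalars A M). y +[restrict_scalars A M] x = 0[restrict_scalars A M]" using M by (intro bexI[of _ "-[M] x"]) auto
qed (use M in "auto simp: lgr lsm alg.smult_l_distr")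

text \<open>The products of generators of \<open>A\<close> over \<open>R\<close> with generators of
  \<open>M\<close> over \<open>A\<close> generate \<open>M\<close> over \<open>R\<close>.\<close>

lemma fin_gen_restrict:
 fixes M :: "('a, 'm) module"
 assumes M: "lmod A M" "fin_gen A M"
 shows "fin_gen R (restrict_scalars A M)"
proof -
 have "fin_gen R A" using artin_algebra by (simp add: artin_algebra_def)
 then obtain S where S: "finite S" "R.generates A S" using R.fin_gen_generates[OF lm_R_A] by blast
 obtain T where T: "finite T" "generates M T" by (rule fin_gen_generates[OF M])
 let ?N = "restrict_scalars A M"
 have Sc: "S<=cr A" "T<=cr M" using S T by (auto simp: R.generates_def generates_def)
 have "R.generates ?N ((%(a, x). a *[M] x) ` (S \<times> T))" unfolding R.generates_def
 proof (intro conjI allI impI)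
  show "(%(a, x). a *[M] x) ` (S \<times> T)<=cr ?N" using Sc lcl(5)[OF M(1)] by (auto simp: subset_iff)
  fix U assume U': "submod R ?N U & (%(a, x). a *[M] x) ` (S \<times> T)<=U"
  hence U: "submod R ?N U" by blast
  note Ud = R.smD[OF U, simplified]
  have aT: "a *[M] t : U" if t: "t : T" and a: "a IN A" for a t
  proof -
   have tc: "t IN M" using t Sc by blast
   have "submod R A {a:cr A. a *[M] t : U}" unfolding submod_def
   proof (intro conjI ballI)
    show "r *[A] x : {a:cr A. a *[M] t : U}" if rx: "r IN R" "x : {a:cr A. a *[M] t : U}" for r x
    proof -
     have "(r *[A] x) *[M] t = ((r *[A] 1[A]) **[A] x) *[M] t" using rx by (simp add: alg_assoc)
     also have "... = (r *[A] 1[A]) *[M] (x *[M] t)" using rx tc M by (simp add: lsm)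
     finally show ?thesis using rx Ud(4)[of r "x *[M] t"] by simp
    qed
   qed (use tc M Ud in "auto simp: lsm")
   moreover have "S <= {a:cr A. a *[M] t : U}" using U' t Sc by auto
   ultimately have "{a:cr A. a *[M] t : U} = cr A" using S(2) unfolding R.generates_def by blast
   thus ?thesis using a by blast
  qed
  \<comment> \<open>\<open>U\<close> is an \<open>R\<close>-submodule only. The set considered here
    is the largest \<open>A\<close>-submodule inside \<open>U\<close>; it contains \<open>T\<close>
    and is therefore everything.\<close>
  have "submod A M {x:cr M. ALL a:cr A. a *[M] x : U}"
  proof (unfold submod_def, intro conjI ballI)
   show "x +[M] y : {x:cr M. ALL a:cr A. a *[M] x : U}"
    if "x : {x:cr M. ALL a:cr A. a *[M] x : U}" "y : {x:cr M. ALL a:cr A. a *[M] x : U}" for x y using that M Ud(3) by (simp add: lsm)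
   show "b *[M] x : {x:cr M. ALL a:cr A. a *[M] x : U}"
    if "b IN A" "x : {x:cr M. ALL a:cr A. a *[M] x : U}" for b x using that M by (simp flip: lsm(3)[OF M(1)])
  qed (use M Ud(2) in auto)
  moreover have "T <= {x:cr M. ALL a:cr A. a *[M] x : U}" using aT Sc by blast
  ultimately have "{x:cr M. ALL a:cr A. a *[M] x : U} = cr M" using T(2) unfolding generates_def by blast
  hence "x : U" if "x IN M" for x using that lsm(4)[OF M(1) that] A.one_closed by (metis (mono_tags, lifting) mem_Collect_eq)
  thus "U = cr ?N" using Ud(1) by auto
 qed
 thus ?thesis using R.generates_fin_gen[OF lm_restrict[OF M(1)]] S(1) T(1) by (meson finite_SigmaI finite_imageI)
qed

lemma submods_stop:
 fixes M :: "('a, 'm) module"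
 assumes M: "lmod A M" "fin_gen A M"
 shows "chains_stop (submod A M)"
proof -
 have "submod R (restrict_scalars A M) U" if "submod A M U" for U using that unfolding submod_def by auto
 thus ?thesis using R.submods_stop[OF lm_restrict[OF M(1)] fin_gen_restrict[OF M]] unfolding chains_stop_def by blast
qed

lemma fin_gen_sub:
 fixes M :: "('a, 'm) module"
 assumes M: "lmod A M" "fin_gen A M" and U: "submod A M U"
 shows "fin_gen A (sub M U)" by (rule fin_gen_sub_stop[OF M(1) submods_stop[OF M] U])

lemma fgmod_sub: "M : fgmod A ==> submod A M U ==> sub M U : fgmod A" using fin_gen_sub[of M U] by (auto simp: fgmod_def)

end

text \<open>Dependent choice along a ray of integers, with invariant \<open>Q\<close> and a relation
  \<open>S\<close> between neighbours. Nothing is said about \<open>f\<close> off the ray, so each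
  application continues by zero where it needs all degrees.\<close>

lemma int_up:
 assumes "Q b x" "!!i x. (b::int)<=i ==> Q i x ==> EX y. Q (i+1) y & S i x y"
 obtains f where "!!i. b<=i ==> Q i (f i) & S i (f i) (f (i+1))"
proof -
 have "EX g. ALL k. Q (b+int k) (g k) & S (b+int k) (g k) (g (Suc k))" by (rule dependent_nat_choice) (use assms(1) assms(2)[of "b + int _"] in "auto simp: ac_simps")
 then obtain g where g: "!!k. Q (b+int k) (g k) & S (b+int k) (g k) (g (Suc k))" by blast
 have "Q i (g (nat (i-b))) & S i (g (nat (i-b))) (g (nat (i+1-b)))" if "b<=i" for i using g[of "nat (i-b)"] that by (simp add: Suc_nat_eq_nat_zadd1 algebra_simps)
 thus ?thesis by (rule that)
qed

lemma int_down:
 assumes "Q c x" "!!i x. i<(c::int) ==> Q (i+1) x ==> EX y. Q i y & S i y x"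
 obtains f where "!!i. i<=c ==> Q i (f i)" "!!i. i<c ==> S i (f i) (f (i+1))"
proof -
 obtain f where f: "!!i. - c<=i ==> Q (- i) (f i) & S (- i-1) (f (i+1)) (f i)"
  by (rule int_up[of "%i. Q (- i)" "- c" x "%i x y. S (- i-1) y x"]) (use assms(1) assms(2)[of "- _ - 1"] in auto)
 show ?thesis
 proof (rule that[of "%i. f (- i)"])
  show "Q i (f (- i))" if "i<=c" for i using f[of "- i"] that by simp
  show "S i (f (- i)) (f (- (i+1)))" if "i<c" for i using f[of "- i-1"] that by simp
 qed
qed

abbreviation (input) "zmp X Y == %i. %x:cr X$i. 0[Y$i]"
abbreviation (input) "conc X Y j u == %i. if i=j then u else (%x:cr X$i. 0[Y$i])"
abbreviation (input) "hm X Y h i x == dif Y (i-1) (h i x) +[Y$i] h (i+1) (dif X i x)"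
text \<open>\<open>kz\<close> says that \<open>u\<close> is a cocycle of \<open>Hom(X, M)\<close> in
  degree \<open>j\<close>, and \<open>fac\<close> that it is a coboundary. So \<open>kz\<close>
  implying \<open>fac\<close> is the vanishing of a cohomology group of \<open>Hom(X, M)\<close>. As
  \<open>kz\<close> is a meta-level proposition, it occurs as \<open>PROP kz\<close>.\<close>

abbreviation (input) "fac A X j M u == EX h:lhom A X$(j+1) M. ALL x:cr X$j. u x = h (dif X j x)"
abbreviation (input) "kz X j M u == (!!x. x IN X$(j-1) ==> u (dif X (j-1) x) = 0[M])"
abbreviation (input) "kd X i == {x:cr X$i. dif X i x = 0[X$(i+1)]}"

context base_ring
begin

section \<open>Complexes and homotopies\<close>

lemma xlm [simp]: "cpx A X ==> lmod A X$i" by (simp add: is_complex_def)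

lemma dhm: "cpx A X ==> dif X i : lhom A X$i X$(i+1)" by (simp add: is_complex_def)

lemma dhm': "cpx A X ==> dif X (i-1) : lhom A X$(i-1) X$i" using dhm[of X "i-1"] by simp

lemma dcl [simp]:
 assumes "cpx A X"
 shows "x IN X$i ==> dif X i x IN X$(i+1)"
  and "x IN X$(i-1) ==> dif X (i-1) x IN X$i" using hcl[OF dhm[OF assms]] hcl[OF dhm'[OF assms]] by auto

lemma dif_dif [simp]:
 assumes "cpx A X"
 shows "x IN X$i ==> dif X (i+1) (dif X i x) = 0[X$(i+2)]"
  and "x IN X$(i-1) ==> dif X i (dif X (i-1) x) = 0[X$(i+1)]"
proof -
 show *: "x IN X$i ==> dif X (i+1) (dif X i x) = 0[X$(i+2)]" for i x using assms by (simp add: is_complex_def)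
 show "x IN X$(i-1) ==> dif X i (dif X (i-1) x) = 0[X$(i+1)]" using *[of x "i-1"] by (simp add: add.commute)
qed

lemma dif_rules [simp]:
 assumes "cpx A X"
 shows "x IN X$i ==> y IN X$i ==> dif X i (x +[X$i] y) = dif X i x +[X$(i+1)] dif X i y"
  and "dif X i 0[X$i] = 0[X$(i+1)]"
  and "x IN X$i ==> dif X i (-[X$i] x) = -[X$(i+1)] dif X i x"
  and "a IN A ==> x IN X$i ==> dif X i (a *[X$i] x) = a *[X$(i+1)] dif X i x"
 using assms hadd[OF dhm[OF assms, of i]] hzero[OF dhm[OF assms, of i]] lhom_neg[OF dhm[OF assms, of i]]
  hsm[OF dhm[OF assms, of i]] by auto

lemma cmh: "f : cmaps A X Y ==> f i : lhom A X$i Y$i" by (simp add: cmaps_def)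

lemma cmr:
 assumes f: "f : cmaps A X Y" and X: "cpx A X" "cpx A Y"
 shows "x IN X$i ==> f i x IN Y$i"
  and "x IN X$i ==> f (i+1) (dif X i x) = dif Y i (f i x)"
  and "x IN X$(i-1) ==> f i (dif X (i-1) x) = dif Y (i-1) (f (i-1) x)"
  and "x IN X$i ==> y IN X$i ==> f i (x +[X$i] y) = f i x +[Y$i] f i y"
  and "f i 0[X$i] = 0[Y$i]"
  and "x IN X$i ==> f i (-[X$i] x) = -[Y$i] f i x"
  and "a IN A ==> x IN X$i ==> f i (a *[X$i] x) = a *[Y$i] f i x"
proof -
 note h = cmh[OF f, of i]
 have c: "x IN X$i ==> f (i+1) (dif X i x) = dif Y i (f i x)" for i x using f by (simp add: cmaps_def)
 show "x IN X$i ==> f i x IN Y$i" by (rule hcl[OF h])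
 show "x IN X$i ==> f (i+1) (dif X i x) = dif Y i (f i x)" by (rule c)
 show "x IN X$(i-1) ==> f i (dif X (i-1) x) = dif Y (i-1) (f (i-1) x)" using c[of x "i-1"] by simp
 show "x IN X$i ==> y IN X$i ==> f i (x +[X$i] y) = f i x +[Y$i] f i y" by (rule hadd[OF h])
 show "f i 0[X$i] = 0[Y$i]" using hzero[OF h] X by simp
 show "x IN X$i ==> f i (-[X$i] x) = -[Y$i] f i x" using lhom_neg[OF h] X by simp
 show "a IN A ==> x IN X$i ==> f i (a *[X$i] x) = a *[Y$i] f i x" by (rule hsm[OF h])
qed

lemma cmapsI:
 assumes "!!i. f i : lhom A X$i Y$i"
  "!!i x. x IN X$i ==> f (i+1) (dif X i x) = dif Y i (f i x)"
 shows "f : cmaps A X Y" using assms by (simp add: cmaps_def)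

lemma cmaps_eqI:
 assumes "f : cmaps A X Y" "g : cmaps A X Y'" "!!i x. x IN X$i ==> f i x = g i x"
 shows "f=g"
proof
 fix i show "f i = g i" by (rule lhom_eqI[OF cmh[OF assms(1)] cmh[OF assms(2)] assms(3)])
qed

definition hfam :: "('a, 'm) cplx => ('a, 'n) cplx => ('m, 'n) gmap => bool" where
 "hfam X Y h <-> (ALL i. h i : lhom A X$i Y$(i-1))"

lemma hfamD:
 assumes "hfam X Y h"
 shows "h i : lhom A X$i Y$(i-1)" "h (i+1) : lhom A X$(i+1) Y$i"
proof -
 show *: "h i : lhom A X$i Y$(i-1)" for i using assms by (simp add: hfam_def)
 show "h (i+1) : lhom A X$(i+1) Y$i" using *[of "i+1"] by simp
qed

lemma hfr:
 assumes h: "hfam X Y h" and X: "cpx A X" "cpx A Y"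
 shows "x IN X$i ==> h i x IN Y$(i-1)"
  and "x IN X$(i+1) ==> h (i+1) x IN Y$i"
  and "x IN X$i ==> y IN X$i ==> h i (x +[X$i] y) = h i x +[Y$(i-1)] h i y"
  and "h i 0[X$i] = 0[Y$(i-1)]"
  and "h (i+1) 0[X$(i+1)] = 0[Y$i]"
  and "x IN X$i ==> h i (-[X$i] x) = -[Y$(i-1)] h i x" using hcl[OF hfamD(1)[OF h]] hcl[OF hfamD(2)[OF h]] hadd[OF hfamD(1)[OF h]] hzero[OF hfamD(1)[OF h]]
  hzero[OF hfamD(2)[OF h]] lhom_neg[OF hfamD(1)[OF h]] X by auto

definition hdif :: "('a, 'm) cplx => ('a, 'n) cplx => ('m, 'n) gmap => ('m, 'n) gmap" where
 "hdif X Y h = (%i. %x:cr X$i. hm X Y h i x)"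

lemma homotopicI:
 assumes "cpx A X" "cpx A Y" "f : cmaps A X Y" "g : cmaps A X Y" "hfam X Y h"
  and eq: "!!i x. x IN X$i ==> f i x = g i x +[Y$i] hm X Y h i x"
 shows "hty A X Y f g" unfolding homotopic_def
proof (intro exI[of _ h] allI conjI ballI)
 fix i show "h i : lhom A X$i Y$(i-1)" by (rule hfamD[OF assms(5)])
 fix x assume x: "x IN X$i"
 note r = hfr[OF assms(5,1,2)] cmr[OF assms(3,1,2)] cmr[OF assms(4,1,2)]
 show "f i x -[Y$i] g i x = hm X Y h i x" unfolding eq[OF x] using assms(1,2) x r(1,2,8,15)
  by (simp add: lm_ac r(1,2) cmr(1)[OF assms(4,1,2)])
qed

lemma homotopicE:
 assumes "cpx A X" "cpx A Y" "f : cmaps A X Y" "g : cmaps A X Y" "hty A X Y f g"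
 obtains h where "hfam X Y h"
  "!!i x. x IN X$i ==> f i x = g i x +[Y$i] hm X Y h i x"
proof -
 obtain h where h: "!!i. h i : lhom A X$i Y$(i-1)"
  "!!i x. x IN X$i ==> f i x -[Y$i] g i x = hm X Y h i x" using assms(5) unfolding homotopic_def by auto
 have hf: "hfam X Y h" using h(1) by (simp add: hfam_def)
 show ?thesis
 proof (rule that[OF hf])
  fix i x assume x: "x IN X$i"
  show "f i x = g i x +[Y$i] hm X Y h i x"
   unfolding h(2)[OF x, symmetric] using assms(1,2) x cmr(1)[OF assms(3,1,2) x] cmr(1)[OF assms(4,1,2) x] by (simp add: lm_ac)
 qed
qed

lemma hfam_zero: "cpx A X ==> cpx A Y ==> hfam X Y (%i. %x:cr X$i. 0[Y$(i-1)])" unfolding hfam_def by (auto intro: hzmap)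

lemma hfam_neg:
 "cpx A X ==> cpx A Y ==> hfam X Y h ==> hfam X Y (%i. %x:cr X$i. -[Y$(i-1)] h i x)" unfolding hfam_def by (auto intro: lhom_uminus)

lemma hfam_add:
 "cpx A X ==> cpx A Y ==> hfam X Y h ==> hfam X Y k ==>
  hfam X Y (%i. %x:cr X$i. h i x +[Y$(i-1)] k i x)" unfolding hfam_def by (auto intro: lhom_plus)

lemma hty_refl:
 assumes "cpx A X" "cpx A Y" "f : cmaps A X Y"
 shows "hty A X Y f f" by (rule homotopicI[OF assms assms(3) hfam_zero[OF assms(1,2)]])
  (use assms cmr(1)[OF assms(3,1,2)] in simp)

lemma hty_sym:
 assumes "cpx A X" "cpx A Y" "f : cmaps A X Y" "g : cmaps A X Y" "hty A X Y f g"
 shows "hty A X Y g f"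
proof -
 obtain h where h: "hfam X Y h" "!!i x. x IN X$i ==>
   f i x = g i x +[Y$i] hm X Y h i x" by (rule homotopicE[OF assms]) blast
 note r = hfr[OF h(1) assms(1,2)]
 show ?thesis
 proof (rule homotopicI[OF assms(1,2,4,3) hfam_neg[OF assms(1,2) h(1)]])
  fix i x assume x: "x IN X$i"
  have dh: "dif Y (i-1) (-[Y$(i-1)] h i x) = -[Y$i] dif Y (i-1) (h i x)" using lhom_neg[OF dhm'[OF assms(2)]] assms(2) r(1)[OF x] by simp
  show "g i x = f i x +[Y$i] (dif Y (i-1) ((%x:cr X$i. -[Y$(i-1)] h i x) x)
    +[Y$i] (%x:cr X$(i+1). -[Y$(i+1-1)] h (i+1) x) (dif X i x))" using x assms(1,2) r(1)[OF x] r(2) cmr(1)[OF assms(3,1,2) x] cmr(1)[OF assms(4,1,2) x]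
   by (simp add: h(2)[OF x] dh lm_ac)
 qed
qed

lemma hty_trans:
 assumes "cpx A X" "cpx A Y" "f : cmaps A X Y" "g : cmaps A X Y" "k : cmaps A X Y"
  "hty A X Y f g" "hty A X Y g k"
 shows "hty A X Y f k"
proof -
 obtain h where h: "hfam X Y h" "!!i x. x IN X$i ==>
   f i x = g i x +[Y$i] hm X Y h i x" by (rule homotopicE[OF assms(1-4,6)]) blast
 obtain h' where h': "hfam X Y h'" "!!i x. x IN X$i ==>
   g i x = k i x +[Y$i] hm X Y h' i x" by (rule homotopicE[OF assms(1,2,4,5,7)]) blast
 note r = hfr[OF h(1) assms(1,2)] and r' = hfr[OF h'(1) assms(1,2)]
 show ?thesis
 proof (rule homotopicI[OF assms(1,2,3,5) hfam_add[OF assms(1,2) h(1) h'(1)]])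
  fix i x assume x: "x IN X$i"
  have dh: "dif Y (i-1) (h i x +[Y$(i-1)] h' i x) = dif Y (i-1) (h i x) +[Y$i] dif Y (i-1) (h' i x)" using hadd[OF dhm'[OF assms(2)]] r(1)[OF x] r'(1)[OF x] by simp
  show "f i x = k i x +[Y$i] (dif Y (i-1) ((%x:cr X$i. h i x +[Y$(i-1)] h' i x) x)
    +[Y$i] (%x:cr X$(i+1). h (i+1) x +[Y$(i+1-1)] h' (i+1) x) (dif X i x))" using x assms(1,2) r(1)[OF x] r(2) r'(1)[OF x] r'(2) cmr(1)[OF assms(5,1,2) x]
   by (simp add: h(2)[OF x] h'(2)[OF x] dh lm_ac)
 qed
qed

lemma ccm:
 assumes "cpx A X" "cpx A Y" "cpx A Z" "f : cmaps A X Y" "g : cmaps A Y Z"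
 shows "ccomp X g f : cmaps A X Z"
proof (rule cmapsI)
 fix i show "ccomp X g f i : lhom A X$i Z$i" unfolding ccomp_def compose_def by (rule hcomp[OF xlm[OF assms(1)] cmh[OF assms(4)] cmh[OF assms(5)]])
 fix x assume "x IN X$i"
 thus "ccomp X g f (i+1) (dif X i x) = dif Z i (ccomp X g f i x)" using assms(1) cmr(1,2)[OF assms(4,1,2)] cmr(1,2)[OF assms(5,2,3)] by (simp add: ccomp_def compose_def)
qed

lemma ccomp_apply [simp]: "x IN X$i ==> ccomp X g f i x = g i (f i x)" by (simp add: ccomp_def compose_def)

lemma cid_cmaps: "cpx A X ==> cid X : cmaps A X X" by (rule cmapsI) (auto simp: cid_def intro: lhom_id)

lemma cid_apply [simp]: "x IN X$i ==> cid X i x = x" by (simp add: cid_def)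

lemma ccomp_as:
 assumes "cpx A W" "cpx A X" "cpx A Y" "cpx A Z"
  "f : cmaps A W X" "g : cmaps A X Y" "h : cmaps A Y Z"
 shows "ccomp W h (ccomp W g f) = ccomp W (ccomp X h g) f" by (rule cmaps_eqI[OF ccm[OF assms(1,3,4) ccm[OF assms(1,2,3,5,6)] assms(7)]
   ccm[OF assms(1,2,4,5) ccm[OF assms(2-4,6,7)]]])
  (use cmr(1)[OF assms(5,1,2)] in simp)

lemma ccomp_cid:
 assumes "cpx A X" "cpx A Y" "f : cmaps A X Y"
 shows "ccomp X f (cid X) = f" "ccomp X (cid Y) f = f" by (rule cmaps_eqI[OF ccm[OF assms(1,1,2) cid_cmaps[OF assms(1)] assms(3)] assms(3)], simp)
  (rule cmaps_eqI[OF ccm[OF assms(1,2,2,3) cid_cmaps[OF assms(2)]] assms(3)], use cmr(1)[OF assms(3,1,2)] in simp)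

lemma hty_comp:
 assumes "cpx A X" "cpx A Y" "cpx A Z" "f : cmaps A X Y" "f' : cmaps A X Y" "g : cmaps A Y Z"
  "hty A X Y f f'"
 shows "hty A X Z (ccomp X g f) (ccomp X g f')"
proof -
 obtain h where h: "hfam X Y h" "!!i x. x IN X$i ==>
   f i x = f' i x +[Y$i] hm X Y h i x" by (rule homotopicE[OF assms(1,2,4,5,7)]) blast
 note r = hfr[OF h(1) assms(1,2)] and rg = cmr[OF assms(6,2,3)]
 have hf: "hfam X Z (%i. %x:cr X$i. g (i-1) (h i x))" unfolding hfam_def using hcomp[OF xlm[OF assms(1)] hfamD(1)[OF h(1)] cmh[OF assms(6)]] by blast
 show ?thesis
 proof (rule homotopicI[OF assms(1,3) ccm[OF assms(1-3,4,6)] ccm[OF assms(1-3,5,6)] hf])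
  fix i x assume x: "x IN X$i"
  show "ccomp X g f i x = ccomp X g f' i x +[Z$i] (dif Z (i-1) ((%x:cr X$i. g (i-1) (h i x)) x)
   +[Z$i] (%x:cr X$(i+1). g (i+1-1) (h (i+1) x)) (dif X i x))" using x assms(1-3) r(1)[OF x] r(2) cmr(1)[OF assms(5,1,2) x] rg by (simp add: h(2)[OF x])
 qed
qed

lemma hty_comp2:
 assumes "cpx A W" "cpx A X" "cpx A Y" "k : cmaps A W X" "f : cmaps A X Y" "f' : cmaps A X Y"
  "hty A X Y f f'"
 shows "hty A W Y (ccomp W f k) (ccomp W f' k)"
proof -
 obtain h where h: "hfam X Y h" "!!i x. x IN X$i ==>
   f i x = f' i x +[Y$i] hm X Y h i x" by (rule homotopicE[OF assms(2,3,5,6,7)]) blast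
 note rk = cmr[OF assms(4,1,2)]
 have hf: "hfam W Y (%i. %x:cr W$i. h i (k i x))" unfolding hfam_def using hcomp[OF xlm[OF assms(1)] cmh[OF assms(4)] hfamD(1)[OF h(1)]] by blast
 show ?thesis
 proof (rule homotopicI[OF assms(1,3) ccm[OF assms(1-3,4,5)] ccm[OF assms(1-3,4,6)] hf])
  fix i x assume x: "x IN W$i"
  show "ccomp W f k i x = ccomp W f' k i x +[Y$i] (dif Y (i-1) ((%x:cr W$i. h i (k i x)) x)
   +[Y$i] (%x:cr W$(i+1). h (i+1) (k (i+1) x)) (dif W i x))" using x assms(1-3) rk(1)[OF x] by (simp add: h(2)[OF rk(1)[OF x]] rk(2))
 qed
qed

definition cadd :: "('a, 'm) cplx => ('a, 'n) cplx => ('m, 'n) gmap => ('m, 'n) gmap => ('m, 'n) gmap" where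
 "cadd X Y f g = (%i. %x:cr X$i. f i x +[Y$i] g i x)"

lemma cadd_apply [simp]: "x IN X$i ==> cadd X Y f g i x = f i x +[Y$i] g i x" by (simp add: cadd_def)

lemma cadd_cmaps:
 assumes "cpx A X" "cpx A Y" "f : cmaps A X Y" "g : cmaps A X Y"
 shows "cadd X Y f g : cmaps A X Y"
proof (rule cmapsI)
 fix i show "cadd X Y f g i : lhom A X$i Y$i" unfolding cadd_def by (rule lhom_plus[OF xlm[OF assms(1)] xlm[OF assms(2)] cmh[OF assms(3)] cmh[OF assms(4)]])
 fix x assume "x IN X$i"
 thus "cadd X Y f g (i+1) (dif X i x) = dif Y i (cadd X Y f g i x)" using assms(1,2) cmr(1,2)[OF assms(3,1,2)] cmr(1,2)[OF assms(4,1,2)] by simp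
qed

lemma hty_cadd:
 assumes "cpx A X" "cpx A Y" "f : cmaps A X Y" "f' : cmaps A X Y" "g : cmaps A X Y" "g' : cmaps A X Y"
  "hty A X Y f f'" "hty A X Y g g'"
 shows "hty A X Y (cadd X Y f g) (cadd X Y f' g')"
proof -
 obtain h where h: "hfam X Y h" "!!i x. x IN X$i ==>
   f i x = f' i x +[Y$i] hm X Y h i x" by (rule homotopicE[OF assms(1,2,3,4,7)]) blast
 obtain k where k: "hfam X Y k" "!!i x. x IN X$i ==>
   g i x = g' i x +[Y$i] hm X Y k i x" by (rule homotopicE[OF assms(1,2,5,6,8)]) blast
 note r = hfr[OF h(1) assms(1,2)] and r' = hfr[OF k(1) assms(1,2)]
 show ?thesis
 proof (rule homotopicI[OF assms(1,2) cadd_cmaps[OF assms(1,2,3,5)] cadd_cmaps[OF assms(1,2,4,6)] hfam_add[OF assms(1,2) h(1) k(1)]])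
  fix i x assume x: "x IN X$i"
  have dh: "dif Y (i-1) (h i x +[Y$(i-1)] k i x) = dif Y (i-1) (h i x) +[Y$i] dif Y (i-1) (k i x)" using hadd[OF dhm'[OF assms(2)]] r(1)[OF x] r'(1)[OF x] by simp
  show "cadd X Y f g i x = cadd X Y f' g' i x +[Y$i] (dif Y (i-1) ((%x:cr X$i. h i x +[Y$(i-1)] k i x) x)
    +[Y$i] (%x:cr X$(i+1). h (i+1) x +[Y$(i+1-1)] k (i+1) x) (dif X i x))"
   using x assms(1,2) r(1)[OF x] r(2) r'(1)[OF x] r'(2) cmr(1)[OF assms(4,1,2) x] cmr(1)[OF assms(6,1,2) x] by (simp add: h(2)[OF x] k(2)[OF x] dh lm_ac)
 qed
qed

subsection \<open>Criteria for homotopy\<close>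

text \<open>A null-homotopy is built upwards from the lower bound of \<open>N\<close>, using that
  cocycles with values in \<open>N j\<close> are coboundaries for \<open>j <= c\<close>. The target
  is a family of modules with its own differential, so that it can be applied to a shifted complex
  with changed signs.\<close>

lemma ascending_null:
 fixes R :: "('a, 'm) cplx" and N :: "int => ('a, 'n) module"
 assumes R: "cpx A R" and N: "!!i. lmod A (N i)" "!!i. d i : lhom A (N i) (N (i+1))" "!!i x. x IN N i ==> d (i+1) (d i x) = 0[N (i+1+1)]"
  and low: "!!i. i<b ==> zm (N i)" and u: "!!i. u i : lhom A R$i (N i)" "!!i x. i<c ==> x IN R$i ==> u (i+1) (dif R i x) = d i (u i x)"
  and ext: "!!j f. j<=c ==> f : lhom A R$j (N j) ==> PROP kz R j (N j) f ==>
   fac A R j (N j) f"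
 obtains h where "!!i. h i : lhom A R$i (N (i-1))" "!!i x. i<=c ==> x IN R$i ==> u i x = d (i-1) (h i x) +[N i] h (i+1) (dif R i x)"
proof -
 note lR = xlm[OF R]
 have d1: "d (i-1) : lhom A (N (i-1)) (N i)" for i using N(2)[of "i-1"] by simp
 have dd: "d i (d (i-1) x) = 0[N (i+1)]" if "x IN N (i-1)" for i x using N(3)[OF that] by simp
 have z: "(%x:cr R$i. 0[N (i-1)]) : lhom A R$i (N (i-1))" for i by (rule hzmap[OF lR N(1)])
 \<comment> \<open>The invariant says that \<open>u - d h\<close> kills boundaries, which makes it a
   cocycle; \<open>ext\<close> factors it through the differential, and the factor is the next
   \<open>h\<close>.\<close>
 let ?Q = "%i h. h : lhom A R$i (N (i-1)) & (i<=c --> (ALL x:cr R$(i-1). u i (dif R (i-1) x) = d (i-1) (h (dif R (i-1) x))))"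
 let ?S = "%i h h'. i<=c --> (ALL x:cr R$i. u i x = d (i-1) (h x) +[N i] h' (dif R i x))"
 obtain h where h: "!!i. b<=i ==> ?Q i (h i) & ?S i (h i) (h (i+1))"
 proof (rule int_up[of ?Q b "%x:cr R$b. 0[N (b-1)]" ?S])
  have "u b (dif R (b-1) x) = 0[N b]" if "b<=c" "x IN R$(b-1)" for x using u(2)[of "b-1" x] that zmD[OF low hcl[OF u(1) that(2)]] hzero[OF d1 N(1,1)] by simp
  thus "?Q b (%x:cr R$b. 0[N (b-1)])" using z R hzero[OF d1 N(1,1)] by simp
 next
  fix i h assume Q: "?Q i h"
  show "EX h'. ?Q (i+1) h' & ?S i h h'"
  proof (cases "i<=c")
   case False thus ?thesis using z[of "i+1"] by (intro exI[of _ "%x:cr R$(i+1). 0[N (i+1-1)]"]) simp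
  next
   case i: True
   have h: "h : lhom A R$i (N (i-1))" and e: "!!x. x IN R$(i-1) ==> u i (dif R (i-1) x) = d (i-1) (h (dif R (i-1) x))" using Q i by auto
   note dh = hcomp[OF lR h d1]
   have uc: "u i x IN N i" "d (i-1) (h x) IN N i" if "x IN R$i" for x using hcl[OF u(1) that] hcl[OF d1 hcl[OF h that]] .
   let ?f = "%x:cr R$i. u i x -[N i] (%x:cr R$i. d (i-1) (h x)) x"
   have f: "?f : lhom A R$i (N i)" by (rule lhom_diff[OF lR N(1) u(1) dh])
   have "?f (dif R (i-1) x) = 0[N i]" if "x IN R$(i-1)" for x using e[OF that] dcl(2)[OF R that] uc(2)[OF dcl(2)[OF R that]] N(1) by simp
   from ext[OF i f this] obtain g where g: "g : lhom A R$(i+1) (N i)" "!!x. x IN R$i ==> ?f x = g (dif R i x)" by blast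
   have S: "u i x = d (i-1) (h x) +[N i] g (dif R i x)" if "x IN R$i" for x unfolding g(2)[OF that, symmetric] using that uc[OF that] N(1) by (simp add: lm_ac)
   have "u (i+1) (dif R i x) = d i (g (dif R i x))" if "i<c" "x IN R$i" for x
    using u(2)[OF that] S[OF that(2)] hadd[OF N(2) uc(2)[OF that(2)] hcl[OF g(1) dcl(1)[OF R that(2)]]]
     dd[OF hcl[OF h that(2)]] hcl[OF N(2) hcl[OF g(1) dcl(1)[OF R that(2)]]] N(1) by simp
   thus ?thesis using g(1) S by (intro exI[of _ g]) simp
  qed
 qed blast
 let ?H = "%i. if i<b then (%x:cr R$i. 0[N (i-1)]) else h i"
 have H: "?H i : lhom A R$i (N (i-1))" for i using z h[of i] by simp
 show ?thesis
 proof (rule that[OF H])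
  fix i x assume i: "i<=c" and x: "x IN R$i"
  show "u i x = d (i-1) (?H i x) +[N i] ?H (i+1) (dif R i x)"
  proof (cases "i<b")
   case False thus ?thesis using h[of i] i x by simp
  next
   case True
   have "?H (i+1) (dif R i x) IN N i" using hcl[OF H dcl(1)[OF R x]] by (simp only: add_diff_cancel_right')
   thus ?thesis using zmD[OF low[OF True]] hcl[OF u(1) x] lcl(2)[OF N(1) hcl[OF d1 hcl[OF H x]]] by metis
  qed
 qed
qed

section \<open>Quasi-isomorphisms\<close>

definition acyc :: "('a, 'm) cplx => int => bool" where
 "acyc X i <-> (ALL x:cr X$i. dif X i x = 0[X$(i+1)] -->
   (EX y:cr X$(i-1). dif X (i-1) y = x))"

lemma acycE:
 assumes "acyc X i" "x IN X$i" "dif X i x = 0[X$(i+1)]"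
 obtains y where "y IN X$(i-1)" "dif X (i-1) y = x" using assms unfolding acyc_def by blast

lemma acyc_zero: "cpx A X ==> zm X$i ==> acyc X i" unfolding acyc_def
proof (intro ballI impI)
 fix x assume a: "cpx A X" "zm X$i" "x IN X$i"
 have "dif X (i-1) 0[X$(i-1)] = x" using dif_rules(2)[OF a(1), of "i-1"] zmD[OF a(2,3)] by simp
 thus "EX y:cr X$(i-1). dif X (i-1) y = x" by (rule bexI[where x="0[X$(i-1)]"]) (use a(1) in simp)
qed

lemma coset_mem:
 assumes "lmod A M" "submod A M B" "z IN M"
 shows "y : B +>\<^bsub>M\<^esub> z <-> y IN M & y -[M] z : B"
proof
 assume "y : B +>\<^bsub>M\<^esub> z"
 then obtain b where b: "b : B" "y = b +[M] z" by (auto simp: a_r_coset_def')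
 thus "y IN M & y -[M] z : B" using assms smD(5)[OF assms(2) b(1)] by (simp add: lm_ac)
next
 assume y: "y IN M & y -[M] z : B"
 hence "y = (y -[M] z) +[M] z" using assms by (simp add: lm_ac)
 thus "y : B +>\<^bsub>M\<^esub> z" using y unfolding a_r_coset_def' by blast
qed

lemma coset_eq:
 assumes "lmod A M" "submod A M B" "z IN M" "z' IN M"
 shows "B +>\<^bsub>M\<^esub> z = B +>\<^bsub>M\<^esub> z' <-> z -[M] z' : B"
proof
 assume "B +>\<^bsub>M\<^esub> z = B +>\<^bsub>M\<^esub> z'"
 moreover have "z : B +>\<^bsub>M\<^esub> z" using coset_mem[OF assms(1-3)] assms smD(2)[OF assms(2)] by simp
 ultimately show "z -[M] z' : B" using coset_mem[OF assms(1,2,4)] by simp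
next
 assume d: "z -[M] z' : B"
 have "y -[M] z : B <-> y -[M] z' : B" if y: "y IN M" for y
 proof -
  have 1: "y -[M] z' = (y -[M] z) +[M] (z -[M] z')" "y -[M] z = (y -[M] z') -[M] (z -[M] z')" using y assms by (simp_all add: lm_ac)
  show ?thesis
  proof
   assume "y -[M] z : B"
   thus "y -[M] z' : B" unfolding 1(1) by (rule smD(3)[OF assms(2) _ d])
  next
   assume "y -[M] z' : B"
   thus "y -[M] z : B" unfolding 1(2) by (rule submod_minus[OF assms(1,2) _ d])
  qed
 qed
 thus "B +>\<^bsub>M\<^esub> z = B +>\<^bsub>M\<^esub> z'" using coset_mem[OF assms(1-3)] coset_mem[OF assms(1,2,4)] by blast
qed

lemma submod_boundaries: "cpx A X ==> submod A X$i (boundaries X i)" unfolding boundaries_def by (rule sm_range[OF _ _ dhm']) auto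

lemma cohomology_map_coset:
 assumes X: "cpx A X" and Y: "cpx A Y" and f: "f : cmaps A X Y" and z: "z IN X$i"
 shows "cohomology_map Y f i (boundaries X i +>\<^bsub>X$i\<^esub> z) = boundaries Y i +>\<^bsub>Y$i\<^esub> f i z"
proof -
 note rf = cmr[OF f X Y]
 have "boundaries Y i +>\<^bsub>Y$i\<^esub> f i w = boundaries Y i +>\<^bsub>Y$i\<^esub> f i z"
  if w: "w : boundaries X i +>\<^bsub>X$i\<^esub> z" for w
 proof -
  have w': "w IN X$i" "w -[X$i] z : boundaries X i" using w coset_mem[OF xlm[OF X] submod_boundaries[OF X] z] by auto
  then obtain v where v: "v IN X$(i-1)" "w -[X$i] z = dif X (i-1) v" by (auto simp: boundaries_def)
  have "f i w -[Y$i] f i z = f i (w -[X$i] z)" using hminus[OF cmh[OF f]] X Y w' z by simp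
  also have "... = dif Y (i-1) (f (i-1) v)" using v rf by simp
  also have "... : boundaries Y i" using rf(1)[OF v(1)] by (auto simp: boundaries_def)
  finally show ?thesis using coset_eq[OF xlm[OF Y] submod_boundaries[OF Y]] rf(1) w' z by blast
 qed
 moreover have "z : boundaries X i +>\<^bsub>X$i\<^esub> z" using coset_mem[OF xlm[OF X] submod_boundaries[OF X] z] z X smD(2)[OF submod_boundaries[OF X]] by simp
 ultimately show ?thesis unfolding cohomology_map_def by blast
qed

text \<open>Replaces cosets by elements: injectivity on cohomology means that a cycle with bounding
  image bounds, surjectivity that every cycle is an image up to a boundary. From here on
  quasi-isomorphisms are handled in this form.\<close>

lemma qis_iff:
 assumes X: "cpx A X" and Y: "cpx A Y"
 shows "qis A X Y f <-> f : cmaps A X Y &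
  (ALL i. (ALL x:cr X$i. ALL w:cr Y$(i-1). dif X i x = 0[X$(i+1)] & f i x = dif Y (i-1) w -->
      (EX v:cr X$(i-1). dif X (i-1) v = x)) &
     (ALL y:cr Y$i. dif Y i y = 0[Y$(i+1)] -->
      (EX x:cr X$i. EX w:cr Y$(i-1). dif X i x = 0[X$(i+1)] & y = f i x +[Y$i] dif Y (i-1) w)))"
  (is "_ <-> _ & (ALL i. ?I i & ?S i)")
proof (cases "f : cmaps A X Y")
 case f: True
 note rf = cmr[OF f X Y]
 let ?c = "%i z. boundaries X i +>\<^bsub>X$i\<^esub> z" and ?d = "%i z. boundaries Y i +>\<^bsub>Y$i\<^esub> z"
 have cyc: "z IN X$i" "f i z : cycles Y i" "f i z IN Y$i" if "z : cycles X i" for z i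
  using that rf(1)[of z i] rf(2)[of z i, symmetric] rf(5)[of "i+1"] by (auto simp: cycles_def)
 have cycY: "z IN Y$i" if "z : cycles Y i" for z i using that by (auto simp: cycles_def)
 have ceq: "?c i z = ?c i z' <-> z -[X$i] z' : boundaries X i" if "z : cycles X i" "z' : cycles X i" for i z z'
  using coset_eq[OF xlm[OF X] submod_boundaries[OF X]] cyc(1) that by blast
 have deq: "?d i z = ?d i z' <-> z -[Y$i] z' : boundaries Y i" if "z : cycles Y i" "z' : cycles Y i" for i z z'
  using coset_eq[OF xlm[OF Y] submod_boundaries[OF Y]] cycY that by blast
 have zc: "0[X$i] : cycles X i" for i using X by (simp add: cycles_def)
 have mc: "z -[X$i] z' : cycles X i" if "z : cycles X i" "z' : cycles X i" for i z z' using that X by (simp add: cycles_def lgr)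
 have H: "cohomology X i = ?c i ` cycles X i" "cohomology Y i = ?d i ` cycles Y i" for i by (auto simp: cohomology_def)
 have inj: "inj_on (cohomology_map Y f i) (cohomology X i) <-> ?I i" for i
 proof
  assume inj: "inj_on (cohomology_map Y f i) (cohomology X i)"
  show "?I i"
  proof (intro ballI impI)
   fix x w assume x: "x IN X$i" and w: "w IN Y$(i-1)"
    and e: "dif X i x = 0[X$(i+1)] & f i x = dif Y (i-1) w"
   have xc: "x : cycles X i" using x e by (simp add: cycles_def)
   have "f i x -[Y$i] f i 0[X$i] : boundaries Y i" using e w Y rf(5) by (auto simp: boundaries_def)
   hence "?d i (f i x) = ?d i (f i 0[X$i])" using deq cyc(2) xc zc by blast
   hence "cohomology_map Y f i (?c i x) = cohomology_map Y f i (?c i 0[X$i])" using cohomology_map_coset[OF X Y f] cyc(1)[OF xc] cyc(1)[OF zc] by simp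
   hence "?c i x = ?c i 0[X$i]" by (rule inj_onD[OF inj]) (use H xc zc in auto)
   hence "x : boundaries X i" using ceq[OF xc zc] x X by simp
   thus "EX v:cr X$(i-1). dif X (i-1) v = x" by (auto simp: boundaries_def)
  qed
 next
  assume I: "?I i"
  show "inj_on (cohomology_map Y f i) (cohomology X i)"
  proof (rule inj_onI)
   fix C C' assume "C : cohomology X i" "C' : cohomology X i" and e: "cohomology_map Y f i C = cohomology_map Y f i C'"
   then obtain z z' where z: "z : cycles X i" "z' : cycles X i" "C = ?c i z" "C' = ?c i z'" unfolding H by blast
   hence "?d i (f i z) = ?d i (f i z')" using e cohomology_map_coset[OF X Y f] cyc(1) by simp
   hence "f i z -[Y$i] f i z' : boundaries Y i" using deq cyc(2) z by blast
   hence "f i (z -[X$i] z') : boundaries Y i" using hminus[OF cmh[OF f]] X Y cyc(1) z by simp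
   then obtain w where "w IN Y$(i-1)" "f i (z -[X$i] z') = dif Y (i-1) w" by (auto simp: boundaries_def)
   hence "EX v:cr X$(i-1). dif X (i-1) v = z -[X$i] z'" using I mc[OF z(1,2)] by (auto simp: cycles_def)
   hence "z -[X$i] z' : boundaries X i" by (force simp: boundaries_def)
   thus "C = C'" using z ceq by blast
  qed
 qed
 have img: "cohomology_map Y f i ` cohomology X i = (%z. ?d i (f i z)) ` cycles X i" for i
  unfolding H image_image using cohomology_map_coset[OF X Y f] cyc(1) by (intro image_cong) auto
 have surj: "cohomology_map Y f i ` cohomology X i = cohomology Y i <-> ?S i" for i
 proof
  assume e: "cohomology_map Y f i ` cohomology X i = cohomology Y i"
  show "?S i"
  proof (intro ballI impI)
   fix y assume "y IN Y$i" "dif Y i y = 0[Y$(i+1)]"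
   hence y: "y : cycles Y i" by (simp add: cycles_def)
   have "?d i y : cohomology Y i" unfolding H(2) using y by (rule imageI)
   hence "?d i y : (%z. ?d i (f i z)) ` cycles X i" unfolding e[symmetric] img .
   then obtain z where z: "?d i y = ?d i (f i z)" "z : cycles X i" by (rule imageE)
   note z = z(2,1)
   hence "y -[Y$i] f i z : boundaries Y i" using deq y cyc(2) by blast
   then obtain w where w: "w IN Y$(i-1)" "y -[Y$i] f i z = dif Y (i-1) w" by (auto simp: boundaries_def)
   have "y = f i z +[Y$i] (y -[Y$i] f i z)" using cycY[OF y] cyc(3)[OF z(1)] Y by (simp add: lm_ac)
   thus "EX x:cr X$i. EX w:cr Y$(i-1). dif X i x = 0[X$(i+1)] & y = f i x +[Y$i] dif Y (i-1) w" using z(1) w by (auto simp: cycles_def)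
  qed
 next
  assume S: "?S i"
  have "?d i y : (%z. ?d i (f i z)) ` cycles X i" if y: "y : cycles Y i" for y
  proof -
   obtain x w where xw: "x IN X$i" "w IN Y$(i-1)" "dif X i x = 0[X$(i+1)]" "y = f i x +[Y$i] dif Y (i-1) w" using S y by (auto simp: cycles_def)
   hence x: "x : cycles X i" by (simp add: cycles_def)
   have "y -[Y$i] f i x = dif Y (i-1) w" unfolding xw(4) using xw(1,2) rf(1) Y by (simp add: lm_ac)
   hence "y -[Y$i] f i x : boundaries Y i" using xw(2) by (auto simp: boundaries_def)
   hence "?d i y = ?d i (f i x)" using deq y cyc(2)[OF x] by blast
   thus ?thesis using x by blast
  qed
  hence 1: "?d i ` cycles Y i<=(%z. ?d i (f i z)) ` cycles X i" by (intro image_subsetI)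
  have 2: "(%z. ?d i (f i z)) ` cycles X i<=?d i ` cycles Y i" by (rule image_subsetI) (rule imageI, rule cyc(2))
  show "cohomology_map Y f i ` cohomology X i = cohomology Y i" unfolding img unfolding H by (rule equalityI[OF 2 1])
 qed
 show ?thesis using f inj surj by (simp add: quasi_iso_def bij_betw_def)
qed (simp add: quasi_iso_def)

lemma qis_cmaps: "qis A X Y f ==> f : cmaps A X Y" by (simp add: quasi_iso_def)

lemma quasi_isoD1:
 assumes "cpx A X" "cpx A Y" "qis A X Y f"
  "x IN X$i" "w IN Y$(i-1)" "dif X i x = 0[X$(i+1)]" "f i x = dif Y (i-1) w"
 obtains v where "v IN X$(i-1)" "dif X (i-1) v = x" using assms(3-7) qis_iff[OF assms(1,2)] by blast

lemma quasi_isoD2: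
 assumes "cpx A X" "cpx A Y" "qis A X Y f"
  "y IN Y$i" "dif Y i y = 0[Y$(i+1)]"
 obtains x w where "x IN X$i" "w IN Y$(i-1)" "dif X i x = 0[X$(i+1)]"
  "y = f i x +[Y$i] dif Y (i-1) w" using assms(3-5) qis_iff[OF assms(1,2)] by blast

lemma quasi_isoI:
 assumes "cpx A X" "cpx A Y" "f : cmaps A X Y"
  "!!i x w. x IN X$i ==> w IN Y$(i-1) ==> dif X i x = 0[X$(i+1)] ==>
   f i x = dif Y (i-1) w ==> EX v:cr X$(i-1). dif X (i-1) v = x"
  "!!i y. y IN Y$i ==> dif Y i y = 0[Y$(i+1)] ==>
   EX x:cr X$i. EX w:cr Y$(i-1). dif X i x = 0[X$(i+1)] & y = f i x +[Y$i] dif Y (i-1) w"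
 shows "qis A X Y f" unfolding qis_iff[OF assms(1,2)] using assms(3-5) by blast

lemma qis_id: "cpx A X ==> qis A X X (cid X)"
proof (rule quasi_isoI)
 assume X: "cpx A X"
 thus "cpx A X" "cpx A X" "cid X : cmaps A X X" by (auto intro: cid_cmaps)
 show "EX v:cr X$(i-1). dif X (i-1) v = x"
  if "x IN X$i" "w IN X$(i-1)" "cid X i x = dif X (i-1) w" for i x w using that by auto
 show "EX x:cr X$i. EX w:cr X$(i-1). dif X i x = 0[X$(i+1)] & y = cid X i x +[X$i] dif X (i-1) w"
  if "y IN X$i" "dif X i y = 0[X$(i+1)]" for i y by (rule bexI[where x=y], rule bexI[where x="0[X$(i-1)]"])
   (use that X hzero[OF dhm'[OF X], of i] in auto)
qed

lemma qis_acyc: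
 assumes X: "cpx A X" and Y: "cpx A Y" and f: "qis A X Y f"
 shows "acyc X i <-> acyc Y i"
proof
 note rf = cmr[OF qis_cmaps[OF f] X Y]
 assume a: "acyc X i"
 show "acyc Y i" unfolding acyc_def
 proof (intro ballI impI)
  fix y assume y: "y IN Y$i" "dif Y i y = 0[Y$(i+1)]"
  obtain x w where xw: "x IN X$i" "w IN Y$(i-1)" "dif X i x = 0[X$(i+1)]"
   "y = f i x +[Y$i] dif Y (i-1) w" by (rule quasi_isoD2[OF X Y f y])
  obtain v where v: "v IN X$(i-1)" "dif X (i-1) v = x" by (rule acycE[OF a xw(1,3)])
  have "y = dif Y (i-1) (f (i-1) v +[Y$(i-1)] w)" using xw v rf hadd[OF dhm'[OF Y], of "f (i-1) v" i w] by auto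
  thus "EX y':cr Y$(i-1). dif Y (i-1) y' = y" using v xw rf(1) Y by (intro bexI[of _ "f (i-1) v +[Y$(i-1)] w"]) auto
 qed
next
 note rf = cmr[OF qis_cmaps[OF f] X Y]
 assume a: "acyc Y i"
 show "acyc X i" unfolding acyc_def
 proof (intro ballI impI)
  fix x assume x: "x IN X$i" "dif X i x = 0[X$(i+1)]"
  have "dif Y i (f i x) = 0[Y$(i+1)]" using rf(2)[OF x(1)] x(2) rf(5) by simp
  then obtain w where w: "w IN Y$(i-1)" "dif Y (i-1) w = f i x" by (rule acycE[OF a rf(1)[OF x(1)]])
  obtain v where "v IN X$(i-1)" "dif X (i-1) v = x" by (rule quasi_isoD1[OF X Y f x(1) w(1) x(2) w(2)[symmetric]])
  thus "EX v:cr X$(i-1). dif X (i-1) v = x" by blast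
 qed
qed

lemma qis_comp:
 assumes X: "cpx A X" and Y: "cpx A Y" and Z: "cpx A Z"
  and f: "qis A X Y f" and g: "qis A Y Z g"
 shows "qis A X Z (ccomp X g f)"
proof (rule quasi_isoI[OF X Z ccm[OF X Y Z qis_cmaps[OF f] qis_cmaps[OF g]]])
 note rf = cmr[OF qis_cmaps[OF f] X Y] and rg = cmr[OF qis_cmaps[OF g] Y Z]
 fix i x w assume x: "x IN X$i" "w IN Z$(i-1)" "dif X i x = 0[X$(i+1)]" "ccomp X g f i x = dif Z (i-1) w"
 have "dif Y i (f i x) = 0[Y$(i+1)]" using rf(2)[OF x(1)] x(3) rf(5) by simp
 then obtain v where v: "v IN Y$(i-1)" "dif Y (i-1) v = f i x" using quasi_isoD1[OF Y Z g rf(1)[OF x(1)] x(2)] x(1,4) by auto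
 thus "EX v:cr X$(i-1). dif X (i-1) v = x" using quasi_isoD1[OF X Y f x(1) v(1) x(3)] by metis
next
 note rf = cmr[OF qis_cmaps[OF f] X Y] and rg = cmr[OF qis_cmaps[OF g] Y Z]
 fix i z assume z: "z IN Z$i" "dif Z i z = 0[Z$(i+1)]"
 obtain y w where y: "y IN Y$i" "w IN Z$(i-1)" "dif Y i y = 0[Y$(i+1)]"
  "z = g i y +[Z$i] dif Z (i-1) w" by (rule quasi_isoD2[OF Y Z g z])
 obtain x v where x: "x IN X$i" "v IN Y$(i-1)" "dif X i x = 0[X$(i+1)]"
  "y = f i x +[Y$i] dif Y (i-1) v" by (rule quasi_isoD2[OF X Y f y(1,3)])
 have "z = ccomp X g f i x +[Z$i] dif Z (i-1) (g (i-1) v +[Z$(i-1)] w)" using x y rf rg X Y Z hadd[OF dhm'[OF Z], of "g (i-1) v" i w] by (simp add: lgr)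
 thus "EX x:cr X$i. EX w:cr Z$(i-1). dif X i x = 0[X$(i+1)] & z = ccomp X g f i x +[Z$i] dif Z (i-1) w"
  using x(1,2,3) y(2) rg(1) Z by (intro bexI[of _ x] bexI[of _ "g (i-1) v +[Z$(i-1)] w"]) auto
qed

subsection \<open>Shifts and lifting along quasi-isomorphisms\<close>

lemma ips: "i+1 + 1 = i + (2::int)" "i+2 + 1 = i + (3::int)" "i+1 + 2 = i + (3::int)" "1+i = i + (1::int)" by auto

lemma shift_simps [simp]:
 "(shift X)$i = X$(i+1)"
 "x IN X$(i+1) ==> dif (shift X) i x = -[X$(i+2)] dif X (i+1) x" by (simp_all add: shift_def)

lemma shift_complex:
 assumes X: "cpx A X"
 shows "cpx A (shift X)" unfolding is_complex_def
proof (intro allI conjI ballI)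
 let ?L = "shift X"
 fix i
 have d: "dif X (i+1) : lhom A X$(i+1) X$(i+2)" for i using dhm[OF X, of "i+1"] by (simp add: ips)
 show "lmod A ?L$i" using X by simp
 show "dif ?L i : lhom A ?L$i ?L$(i+1)" using lhom_uminus[OF xlm[OF X] xlm[OF X] d] by (simp add: shift_def ips)
 fix x assume x: "x IN ?L$i"
 have dd: "dif X (i+2) (dif X (i+1) x) = 0[X$(i+3)]" using dif_dif(1)[OF X, of x "i+1"] x by (simp add: ips)
 have dc: "dif X (i+1) x IN X$(i+2)" using hcl[OF d] x by simp
 have "dif ?L (i+1) (dif ?L i x) = -[X$(i+3)] dif X (i+2) (-[X$(i+2)] dif X (i+1) x)"
  using x shift_simps(2)[of "-[X$(i+2)] dif X (i+1) x" X "i+1"] dc X by (simp add: ips)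
 also have "... = 0[X$(i+3)]" using dif_rules(3)[OF X dc] dd X by (simp add: ips)
 finally show "dif ?L (i+1) (dif ?L i x) = 0[?L$(i+2)]" by (simp add: ips)
qed

lemma shift_cycles:
 assumes X: "cpx A X"
 shows "cycles (shift X) i = cycles X (i+1)" "boundaries (shift X) i = boundaries X (i+1)"
proof -
 have n: "-[X$i] y = 0[X$i] <-> y = 0[X$i]" if "y IN X$i" for y i using that X by (metis xlm lm_simps(5,6))
 have dc: "dif X (i+1) x IN X$(i+2)" if "x IN X$(i+1)" for x using dcl(1)[OF X that] by (simp add: ips)
 show "cycles (shift X) i = cycles X (i+1)" unfolding cycles_def using n[OF dc] by (auto simp: ips lm_simps(5)[OF xlm[OF X]])
 have d: "dif (shift X) (i-1) y = dif X i (-[X$i] y)" "dif X i y = dif (shift X) (i-1) (-[X$i] y)"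
  if "y IN X$i" for y using that shift_simps(2)[of y X "i-1"] shift_simps(2)[of "-[X$i] y" X "i-1"] X by (auto simp: ips)
 have "boundaries (shift X) i<=boundaries X (i+1)" unfolding boundaries_def by (rule image_subsetI) (use d(1) X in "simp add: imageI del: dif_rules")
 moreover have "boundaries X (i+1)<=boundaries (shift X) i" unfolding boundaries_def
 proof (rule image_subsetI)
  fix x assume "x IN X$(i+1-1)"
  thus "dif X (i+1-1) x : dif (shift X) (i-1) ` cr (shift X)$(i-1)" using d(2)[of x] X by (intro image_eqI[of _ _ "-[X$i] x"]) (simp_all del: shift_simps(2))
 qed
 ultimately show "boundaries (shift X) i = boundaries X (i+1)" by (rule equalityI)
qed

lemma shift_acyc:
 fixes X :: "('a, 'm) cplx"
 assumes "cpx A X"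
 shows "acyc (shift X) i <-> acyc X (i+1)"
proof -
 have "acyc Z i <-> cycles Z i<=boundaries Z i" for Z :: "('a, 'm) cplx" and i by (auto simp: acyc_def cycles_def boundaries_def)
 thus ?thesis by (simp add: shift_cycles[OF assms])
qed

definition bproj :: "int => ('a, 'm) cplx => bool" where
 "bproj c P <-> cpx A P & (ALL i. fgproj P$i) & (ALL i>c. zm P$i)"

lemma bprojD:
 "bproj c P ==> cpx A P" "bproj c P ==> fgproj P$i" "bproj c P ==> i>c ==> zm P$i" by (auto simp: bproj_def)

text \<open>The common recursion behind homotopies and lifts out of a bounded above complex of
  projectives: the equation is solved from the top degree downwards. \<open>step\<close> asks for
  solvability element by element, and projectivity turns it into a homomorphism. The last premise of
  \<open>step\<close> serves degrees in which \<open>P\<close> vanishes.\<close>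

lemma descending_lift:
 fixes P :: "('a, 'p) cplx" and N :: "int => ('a, 'n) module" and L :: "int => ('a, 'l) module"
 assumes P: "bproj c P" and lm: "!!i. lmod A (N i)" "!!i. lmod A (L i)"
  and d: "!!i. d i : lhom A (N i) (L i)" and t: "!!i. t i : lhom A P$i (L i)" and r: "!!i. r i : lhom A (N (i+1)) (L i)"
  and step: "!!i x y. x IN P$i ==> y IN N (i+1) ==> d (i+1) y = t (i+1) (dif P i x) ==> (x = 0[P$i] ==> y = 0[N (i+1)]) ==>
   EX z:cr (N i). d i z = t i x +[L i] r i y"
 obtains a where "!!i. a i : lhom A P$i (N i)" "!!i x. x IN P$i ==> d i (a i x) = t i x +[L i] r i (a (i+1) (dif P i x))"
proof -
 note PC = bprojD(1)[OF P] and zP = bprojD(3)[OF P]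
 note lP = xlm[OF PC]
 let ?z = "%i. %x:cr P$i. 0[N i]"
 have z: "?z i : lhom A P$i (N i)" for i by (rule hzmap[OF lP lm(1)])
 have h0: "d i 0[N i] = 0[L i]" "t i 0[P$i] = 0[L i]" "r i 0[N (i+1)] = 0[L i]" for i using hzero[OF d lm] hzero[OF t lP lm(2)] hzero[OF r lm] .
 let ?Q = "%i a. a : lhom A P$i (N i) & (ALL x:cr P$(i-1). d i (a (dif P (i-1) x)) = t i (dif P (i-1) x))"
 let ?S = "%i a a'. ALL x:cr P$i. d i (a x) = t i x +[L i] r i (a' (dif P i x))"
 obtain a where a: "!!i. i<=c+1 ==> ?Q i (a i)" "!!i. i<c+1 ==> ?S i (a i) (a (i+1))"
 proof (rule int_down[of ?Q "c+1" "?z (c+1)" ?S])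
  have "dif P (c+1-1) x = 0[P$(c+1)]" if "x IN P$(c+1-1)" for x using zmD[OF zP dcl(2)[OF PC that]] by simp
  thus "?Q (c+1) (?z (c+1))" using z[of "c+1"] h0 lP by simp
 next
  fix i a' assume Q: "?Q (i+1) a'"
  hence a': "a' : lhom A P$(i+1) (N (i+1))" "!!x. x IN P$i ==> d (i+1) (a' (dif P i x)) = t (i+1) (dif P i x)" by auto
  note ad = hcomp[OF lP dhm[OF PC] a'(1)]
  have dc: "dif P i x IN P$(i+1)" if "x IN P$i" for x by (rule dcl(1)[OF PC that])
  let ?u = "%x:cr P$i. t i x +[L i] (%x:cr P$i. r i ((%x:cr P$i. a' (dif P i x)) x)) x"
  have u: "?u : lhom A P$i (L i)" by (rule lhom_plus[OF lP lm(2) t hcomp[OF lP ad r]])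
  have "?u ` cr P$i<=d i ` cr (N i)"
  proof (rule image_subsetI)
   fix x assume x: "x IN P$i"
   have "EX z:cr (N i). d i z = t i x +[L i] r i (a' (dif P i x))" by (rule step[OF x hcl[OF a'(1) dc[OF x]] a'(2)[OF x]]) (use PC hzero[OF a'(1) lP lm(1)] in simp)
   then obtain z where "z IN N i" "d i z = ?u x" using x by auto
   thus "?u x : d i ` cr (N i)" by (metis imageI)
  qed
  then obtain a where a: "a : lhom A P$i (N i)" "!!x. x IN P$i ==> d i (a x) = ?u x" by (rule fgproj_lift[OF bprojD(2)[OF P] lm d u]) blast
  have "d i (a (dif P (i-1) x)) = t i (dif P (i-1) x)" if x: "x IN P$(i-1)" for x
   using a(2)[OF dcl(2)[OF PC x]] dcl(2)[OF PC x] dif_dif(2)[OF PC x] hzero[OF a'(1) lP lm(1)] h0(3) hcl[OF t dcl(2)[OF PC x]] lm(2) by simp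
  thus "EX a. ?Q i a & ?S i a a'" using a by (intro exI[of _ a]) simp
 qed blast
 let ?a = "%i. if i<=c+1 then a i else ?z i"
 have A: "?a i : lhom A P$i (N i)" for i using a(1)[of i] z by simp
 show ?thesis
 proof (rule that[OF A])
  fix i x assume x: "x IN P$i"
  show "d i (?a i x) = t i x +[L i] r i (?a (i+1) (dif P i x))"
  proof (cases "i<=c")
   case True thus ?thesis using a(2)[of i] x by simp
  next
   case False
   hence "x = 0[P$i]" using zmD[OF zP x] by simp
   thus ?thesis using hzero[OF A lP lm(1), of i] hzero[OF A lP lm(1), of "i+1"] h0 PC lm by simp
  qed
 qed
qed

text \<open>Morphisms vanish when in each degree either the projective source is zero or the target
  has no cohomology. Nearly all vanishing of Hom below is reduced to this disjointness of
  degrees.\<close>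

lemma hty_proj:
 assumes P: "bproj c P" and W: "cpx A W" and f: "f : cmaps A P W" and g: "g : cmaps A P W"
  and ac: "!!i. zm P$i | acyc W i"
 shows "hty A P W f g"
proof -
 note PC = bprojD(1)[OF P]
 note rf = cmr[OF f PC W] and rg = cmr[OF g PC W] and lW = xlm[OF W]
 have t: "(%x:cr P$i. f i x -[W$i] g i x) : lhom A P$i W$i" for i by (rule lhom_diff[OF xlm[OF PC] lW cmh[OF f] cmh[OF g]])
 have r: "(%y:cr W$(i+1-1). -[W$i] y) : lhom A W$(i+1-1) W$i" for i using lhom_uminus[OF lW lW lhom_id[OF lW]] by (simp cong: restrict_cong)
 obtain a where a: "!!i. a i : lhom A P$i W$(i-1)"
   "!!i x. x IN P$i ==> dif W (i-1) (a i x) = (%x:cr P$i. f i x -[W$i] g i x) x +[W$i] (%y:cr W$(i+1-1). -[W$i] y) (a (i+1) (dif P i x))"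
 proof (rule descending_lift[OF P lW lW dhm'[OF W] t r])
  fix i x y assume x: "x IN P$i" and y: "y IN W$(i+1-1)" "dif W (i+1-1) y = (%x:cr P$(i+1). f (i+1) x -[W$(i+1)] g (i+1) x) (dif P i x)"
   and z: "x = 0[P$i] ==> y = 0[W$(i+1-1)]"
  let ?w = "f i x -[W$i] g i x +[W$i] -[W$i] y"
  have w: "?w IN W$i" using rf(1)[OF x] rg(1)[OF x] y(1) W by simp
  have dw: "dif W i ?w = 0[W$(i+1)]" using rf(1,2)[OF x] rg(1,2)[OF x] y x PC W hminus[OF dhm[OF W] lW lW rf(1)[OF x] rg(1)[OF x]] by simp
  have "EX z:cr W$(i-1). dif W (i-1) z = ?w"
  proof (cases "acyc W i")
   case True show ?thesis by (rule acycE[OF True w dw]) blast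
  next
   case False
   hence "x = 0[P$i]" using ac[of i] zmD[OF _ x] by blast
   thus ?thesis using z rf(5) rg(5) dif_rules(2)[OF W, of "i-1"] W by (intro bexI[of _ "0[W$(i-1)]"]) auto
  qed
  thus "EX z:cr W$(i-1). dif W (i-1) z = (%x:cr P$i. f i x -[W$i] g i x) x +[W$i] (%y:cr W$(i+1-1). -[W$i] y) y" using x y(1) by simp
 qed blast
 show ?thesis
 proof (rule homotopicI[OF PC W f g, of a])
  show "hfam P W a" using a(1) unfolding hfam_def by blast
  fix i x assume x: "x IN P$i"
  have c: "a (i+1) (dif P i x) IN W$i" using hcl[OF a(1) dcl(1)[OF PC x]] by simp
  show "f i x = g i x +[W$i] hm P W a i x" using a(2)[OF x] x c rf(1)[OF x] rg(1)[OF x] W by (simp add: lm_ac)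
 qed
qed

text \<open>Acyclicity of the mapping cone of \<open>s\<close>, spelled out for elements:
  \<open>(v, x)\<close> is a cone cycle up to signs, and the pair that is found bounds it.\<close>

lemma qis_step:
 assumes V: "cpx A V" and X: "cpx A X" and s: "qis A V X s" and v: "v IN V$(i+1)" "dif V (i+1) v = 0[V$(i+1+1)]"
  and x: "x IN X$i" "s (i+1) v = dif X i x"
 shows "EX z:cr (biprod V$i X$(i-1)). dif V i (fst z) = v & s i (fst z) +[X$i] dif X (i-1) (snd z) = x"
proof -
 note rs = cmr[OF qis_cmaps[OF s] V X]
 obtain w where w: "w IN V$i" "dif V i w = v" using quasi_isoD1[OF V X s v(1) _ v(2), of x] x by auto
 have "dif X i (x -[X$i] s i w) = 0[X$(i+1)]" using hminus[OF dhm[OF X] xlm[OF X] xlm[OF X] x(1) rs(1)[OF w(1)]] rs(2)[OF w(1)] w x X dcl(1)[OF X rs(1)[OF w(1)]] by simp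
 then obtain u y where u: "u IN V$i" "y IN X$(i-1)" "dif V i u = 0[V$(i+1)]" "x -[X$i] s i w = s i u +[X$i] dif X (i-1) y"
  using quasi_isoD2[OF V X s, of "x -[X$i] s i w" i] x(1) rs(1)[OF w(1)] X by (metis xlm lcl(4))
 have "s i (w +[V$i] u) +[X$i] dif X (i-1) y = s i w +[X$i] (x -[X$i] s i w)" unfolding u(4) using rs(1,4) w u dcl(2)[OF X u(2)] X by (simp add: lm_ac)
 also have "... = x" using rs(1)[OF w(1)] x X by (simp add: lm_ac)
 finally show ?thesis using u w v V by (intro bexI[of _ "(w +[V$i] u, y)"]) auto
qed

lemma lhom_fst_snd:
 assumes "lmod A P" "lmod A M" "lmod A N" "f : lhom A P (biprod M N)"
 shows "(%x:cr P. fst (f x)) : lhom A P M" "(%x:cr P. snd (f x)) : lhom A P N"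
proof -
 have "f x : cr M \<times> cr N" if "x IN P" for x using hcl[OF assms(4) that] by simp
 thus "(%x:cr P. fst (f x)) : lhom A P M" "(%x:cr P. snd (f x)) : lhom A P N"
  using hadd[OF assms(4)] hsm[OF assms(4)] assms(1-3) by (auto intro!: hresI simp: mem_Times_iff split_beta biprod_def)
qed

lemma qis_hom:
 assumes V: "cpx A V" and X: "cpx A X" and s: "s : cmaps A V X"
 shows "(%z:cr (biprod V$j X$(j-1)). (dif V j (fst z), s j (fst z) +[X$j] dif X (j-1) (snd z))) : lhom A (biprod V$j X$(j-1)) (biprod V$(j+1) X$j)"
 by (rule hresI) (use V X cmr[OF s V X] hsm[OF dhm'[OF X]] hadd[OF dhm'[OF X]] in "auto simp: lsm lm_ac")

text \<open>The recursion runs in the mapping cone of \<open>s\<close>: the first component of the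
  solution is the lift, the second the homotopy that compares it with \<open>g\<close>.\<close>

lemma lift_exists:
 assumes P: "bproj c P" and V: "cpx A V" and X: "cpx A X" and s: "qis A V X s" and g: "g : cmaps A P X"
 obtains g' where "g' : cmaps A P V" "hty A P X (ccomp P s g') g"
proof -
 note PC = bprojD(1)[OF P] and sc = qis_cmaps[OF s]
 note rg = cmr[OF g PC X] and rs = cmr[OF sc V X] and lP = xlm[OF PC] and lV = xlm[OF V] and lX = xlm[OF X]
 let ?N = "%i. biprod V$i X$(i-1)" and ?L = "%i. biprod V$(i+1) X$i"
 let ?d = "%i. %z:cr (?N i). (dif V i (fst z), s i (fst z) +[X$i] dif X (i-1) (snd z))"
 let ?t = "%i. %x:cr P$i. (0[V$(i+1)], g i x)" and ?r = "%i. %z:cr (?N (i+1)). (fst z, -[X$i] snd z)"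
 have t: "?t i : lhom A P$i (?L i)" for i by (rule hresI) (use PC V X rg in auto)
 have r: "?r i : lhom A (?N (i+1)) (?L i)" for i by (rule hresI) (use V X in "auto simp: lm_smult_neg lm_ac")
 obtain a where a: "!!i. a i : lhom A P$i (?N i)" "!!i x. x IN P$i ==> ?d i (a i x) = ?t i x +[?L i] ?r i (a (i+1) (dif P i x))"
 proof (rule descending_lift[OF P _ _ qis_hom[OF V X sc] t r])
  fix i x y assume x: "x IN P$i" and y: "y IN ?N (i+1)" "?d (i+1) y = ?t (i+1) (dif P i x)"
  obtain v w where vw: "y = (v, w)" "v IN V$(i+1)" "w IN X$i" using y(1) by auto
  have e: "dif V (i+1) v = 0[V$(i+1+1)]" "s (i+1) v +[X$(i+1)] dif X i w = g (i+1) (dif P i x)" using y vw x PC by auto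
  have "dif X i (g i x +[X$i] -[X$i] w) = s (i+1) v +[X$(i+1)] dif X i w +[X$(i+1)] -[X$(i+1)] dif X i w" unfolding e(2) using rg(1,2)[OF x] vw X by simp
  also have "... = s (i+1) v" using rs(1)[OF vw(2)] dcl(1)[OF X vw(3)] X by (simp add: lm_ac)
  finally have "s (i+1) v = dif X i (g i x +[X$i] -[X$i] w)" ..
  from qis_step[OF V X s vw(2) e(1) _ this] show "EX z:cr (?N i). ?d i z = ?t i x +[?L i] ?r i y" using x vw rg(1)[OF x] V X by (auto simp: Bex_def)
 qed (use V X in auto)
 let ?a = "%i. %x:cr P$i. fst (a i x)" and ?b = "%i. %x:cr P$i. snd (a i x)"
 have ac: "a i x IN ?N i" if "x IN P$i" for i x by (rule hcl[OF a(1) that])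
 have al: "?a i : lhom A P$i V$i" and bl: "?b i : lhom A P$i X$(i-1)" for i using lhom_fst_snd[OF lP lV lX a(1)] by auto
 have e: "dif V i (?a i x) = ?a (i+1) (dif P i x)" "g i x = s i (?a i x) +[X$i] (dif X (i-1) (?b i x) +[X$i] ?b (i+1) (dif P i x))" if x: "x IN P$i" for i x
 proof -
  have dx: "dif P i x IN P$(i+1)" using x PC by simp
  obtain v w v' w' where vw: "a i x = (v, w)" "v IN V$i" "w IN X$(i-1)" "a (i+1) (dif P i x) = (v', w')" "v' IN V$(i+1)" "w' IN X$i" using ac[OF x] ac[OF dx] by auto
  have "dif V i v = v'" "s i v +[X$i] dif X (i-1) w = g i x +[X$i] -[X$i] w'" using a(2)[OF x] x vw V by auto
  moreover from this have "g i x = (s i v +[X$i] dif X (i-1) w) +[X$i] w'" using rg(1)[OF x] vw X by (simp add: lm_ac)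
  ultimately show "dif V i (?a i x) = ?a (i+1) (dif P i x)" "g i x = s i (?a i x) +[X$i] (dif X (i-1) (?b i x) +[X$i] ?b (i+1) (dif P i x))"
   using vw x dx rs(1) dcl(2)[OF X vw(3)] X by (simp_all add: lgr(1))
 qed
 have am: "?a : cmaps A P V" by (rule cmapsI[OF al]) (use e(1) in simp)
 have "hty A P X g (ccomp P s ?a)" by (rule homotopicI[OF PC X g ccm[OF PC V X am sc], of ?b]) (use bl e(2) in "auto simp: hfam_def")
 thus ?thesis by (intro that[OF am] hty_sym[OF PC X g ccm[OF PC V X am sc]])
qed

text \<open>The cone recursion again, one degree lower: the first component is the homotopy from
  \<open>f\<close> to \<open>g\<close>, while the second corrects the given homotopy
  \<open>k\<close> so that the next step stays solvable.\<close>

lemma lift_unique: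
 assumes P: "bproj c P" and V: "cpx A V" and X: "cpx A X" and s: "qis A V X s"
  and f: "f : cmaps A P V" and g: "g : cmaps A P V" and fg: "hty A P X (ccomp P s f) (ccomp P s g)"
 shows "hty A P V f g"
proof -
 note PC = bprojD(1)[OF P] and sc = qis_cmaps[OF s]
 note rf = cmr[OF f PC V] and rg = cmr[OF g PC V] and rs = cmr[OF sc V X] and lP = xlm[OF PC] and lV = xlm[OF V] and lX = xlm[OF X]
 obtain k where k: "hfam P X k" "!!i x. x IN P$i ==>
   ccomp P s f i x = ccomp P s g i x +[X$i] hm P X k i x"
  by (rule homotopicE[OF PC X ccm[OF PC V X f sc] ccm[OF PC V X g sc] fg]) blast
 note rk = hfr[OF k(1) PC X]
 let ?N = "%i. biprod V$(i-1) X$(i-1-1)" and ?L = "%i. biprod V$(i-1+1) X$(i-1)"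
 let ?d = "%i. %z:cr (?N i). (dif V (i-1) (fst z), s (i-1) (fst z) +[X$(i-1)] dif X (i-1-1) (snd z))"
 let ?t = "%i. %x:cr P$i. (f i x -[V$i] g i x, k i x)" and ?r = "%i. %z:cr (?N (i+1)). (-[V$i] fst z, snd z)"
 have "(%x:cr P$i. ((%x:cr P$i. f i x -[V$i] g i x) x, k i x)) : lhom A P$i (?L i)" for i
  using lhom_pair[OF lP lhom_diff[OF lP lV cmh[OF f] cmh[OF g]] hfamD(1)[OF k(1)]] by simp
 hence t: "?t i : lhom A P$i (?L i)" for i by (simp cong: restrict_cong)
 have r: "?r i : lhom A (?N (i+1)) (?L i)" for i by (rule hresI) (use V X in "auto simp: lm_smult_neg lm_ac")
 obtain a where a: "!!i. a i : lhom A P$i (?N i)" "!!i x. x IN P$i ==> ?d i (a i x) = ?t i x +[?L i] ?r i (a (i+1) (dif P i x))"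
 proof (rule descending_lift[OF P _ _ qis_hom[OF V X sc] t r])
  fix i x y assume x: "x IN P$i" and y: "y IN ?N (i+1)" "?d (i+1) y = ?t (i+1) (dif P i x)"
  have dx: "dif P i x IN P$(i+1)" using x PC by simp
  obtain v w where vw: "y = (v, w)" "v IN V$i" "w IN X$(i-1)" using y(1) by auto
  have e: "dif V i v = f (i+1) (dif P i x) -[V$(i+1)] g (i+1) (dif P i x)" "s i v +[X$i] dif X (i-1) w = k (i+1) (dif P i x)" using y vw dx by auto
  let ?v = "f i x -[V$i] g i x +[V$i] -[V$i] v" and ?x = "k i x +[X$(i-1)] w"
  have v: "?v IN V$i" and xx: "?x IN X$(i-1)" using rf(1)[OF x] rg(1)[OF x] rk(1)[OF x] vw V X by auto
  have 1: "dif V i ?v = 0[V$(i+1)]" using e(1) hminus[OF dhm[OF V] lV lV rf(1)[OF x] rg(1)[OF x]] rf(1,2)[OF x] rg(1,2)[OF x] vw V by simp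
  have sf: "s i (f i x) = s i (g i x) +[X$i] (dif X (i-1) (k i x) +[X$i] (s i v +[X$i] dif X (i-1) w))" using k(2)[OF x] x e(2) by simp
  have "s i ?v = s i (f i x) -[X$i] s i (g i x) +[X$i] -[X$i] s i v"
   using rf(1)[OF x] rg(1)[OF x] vw rs(4,6) hminus[OF cmh[OF sc] lV lX rf(1)[OF x] rg(1)[OF x]] V by simp
  also have "... = dif X (i-1) ?x"
   unfolding sf using rs(1)[OF rg(1)[OF x]] rs(1)[OF vw(2)] dcl(2)[OF X rk(1)[OF x]] dcl(2)[OF X vw(3)] rk(1)[OF x] vw(3) hadd[OF dhm'[OF X] rk(1)[OF x] vw(3)] X by (simp add: lm_ac)
  finally have 2: "s i ?v = dif X (i-1) ?x" .
  show "EX z:cr (?N i). ?d i z = ?t i x +[?L i] ?r i y" using qis_step[OF V X s, of ?v "i-1" ?x] v xx 1 2 x vw by (auto simp: Bex_def)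
 qed (use V X in auto)
 let ?a = "%i. %x:cr P$i. fst (a i x)"
 have ac: "a i x IN ?N i" if "x IN P$i" for i x by (rule hcl[OF a(1) that])
 have al: "?a i : lhom A P$i V$(i-1)" for i using lhom_fst_snd(1)[OF lP lV lX a(1)] .
 show ?thesis
 proof (rule homotopicI[OF PC V f g, of ?a])
  show "hfam P V ?a" using al unfolding hfam_def by blast
  fix i x assume x: "x IN P$i"
  have dx: "dif P i x IN P$(i+1)" using x PC by simp
  obtain v w v' w' where vw: "a i x = (v, w)" "v IN V$(i-1)" "a (i+1) (dif P i x) = (v', w')" "v' IN V$i" "w IN X$(i-1-1)" "w' IN X$(i-1)"
   using ac[OF x] ac[OF dx] by auto
  have "dif V (i-1) v = f i x -[V$i] g i x +[V$i] -[V$i] v'" using a(2)[OF x] x vw by auto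
  thus "f i x = g i x +[V$i] (dif V (i-1) (?a i x) +[V$i] ?a (i+1) (dif P i x))" using x dx vw rf(1)[OF x] rg(1)[OF x] V by (simp add: lm_ac)
 qed
qed

subsection \<open>Stalk complexes\<close>

definition stalk :: "('a, 'a univ) module => int => 'a ucplx" where
 "stalk M j = \<lparr>obj = (%i. if i=j then M else zmod),
   dif = (%i. %x:cr (if i=j then M else zmod). 0[if i+1 = j then M else zmod])\<rparr>"

lemma stalk_obj [simp]: "(stalk M j)$j = M" "i~=j ==> (stalk M j)$i = zmod" by (auto simp: stalk_def)

lemma stalk_dif: "x IN (stalk M j)$i ==> dif (stalk M j) i x = 0[(stalk M j)$(i+1)]" by (simp add: stalk_def)

lemma stalk_lm: "lmod A M ==> lmod A (stalk M j)$i" by (simp add: stalk_def)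

lemma stalk_complex:
 assumes M: "lmod A M"
 shows "cpx A (stalk M j)" unfolding is_complex_def
proof (intro allI conjI ballI)
 let ?L = "stalk M j"
 fix i
 show "lmod A ?L$i" by (rule stalk_lm[OF M])
 have "dif ?L i = (%x:cr ?L$i. 0[?L$(i+1)])" by (simp add: stalk_def)
 thus "dif ?L i : lhom A ?L$i ?L$(i+1)" using hzmap[OF stalk_lm[OF M] stalk_lm[OF M]] by simp
 fix x assume x: "x IN ?L$i"
 have "0[?L$(i+1)] IN ?L$(i+1)" using stalk_lm[OF M] by simp
 thus "dif ?L (i+1) (dif ?L i x) = 0[?L$(i+2)]" using stalk_dif[OF x] stalk_dif[of _ M j "i+1"] by (simp add: ips)
qed

lemma bcD:
 "X : bcx A ==> cpx A X" "X : bcx A ==> X$i : fgmod A" by (auto simp: bcomplexes_def)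

lemma bcomplexes_bounds:
 assumes "X : bcx A"
 obtains m where "m>=0" "!!i. i>m ==> zm X$i" "!!i. i < - m ==> zm X$i"
proof -
 obtain m where m: "!!i. \<bar>i\<bar> > m ==> zm X$i" using assms by (auto simp: bcomplexes_def bounded_cplx_def)
 show ?thesis by (rule that[of "max 0 m"]) (auto intro!: m)
qed

lemma bcomplexesI:
 assumes "cpx A X" "!!i. X$i : fgmod A" "!!i. i>c ==> zm X$i" "!!i. i<b ==> zm X$i"
 shows "X : bcx A"
proof -
 have "ALL i. \<bar>i\<bar> > max \<bar>c\<bar> \<bar>b\<bar> --> zm X$i"
 proof (intro allI impI)
  fix i :: int assume "\<bar>i\<bar> > max \<bar>c\<bar> \<bar>b\<bar>"
  hence "i>c | i<b" by auto
  thus "zm X$i" using assms by blast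
 qed
 thus ?thesis using assms(1,2) unfolding bcomplexes_def bounded_cplx_def by blast
qed

lemma stalk_bc:
 assumes "M : fgmod A"
 shows "stalk M j : bcx A"
proof (rule bcomplexesI[OF stalk_complex, of _ _ j j])
 show "(stalk M j)$i : fgmod A" for i using assms by (cases "i=j") auto
qed (use assms fgD in auto)

lemma shift_bcomplexes:
 assumes "X : bcx A"
 shows "shift X : bcx A"
proof -
 obtain m where "m>=0" "!!i. i>m ==> zm X$i" "!!i. i < - m ==> zm X$i" using bcomplexes_bounds[OF assms] by blast
 thus ?thesis by (intro bcomplexesI[of "shift X" "m-1" "- m-1"] shift_complex bcD[OF assms])
   (use assms bcD in auto)
qed

text \<open>An equation of records and not merely an isomorphism: all differentials of a stalk
  complex vanish, so the sign introduced by \<open>shift\<close> leaves no trace.\<close>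

lemma shift_stalk:
 assumes M: "lmod A M"
 shows "shift (stalk M j) = stalk M (j-1)"
proof -
 let ?L = "stalk M (j-1)"
 have o: "(shift (stalk M j))$i = ?L$i" for i by (auto simp: stalk_def shift_def)
 have "dif (shift (stalk M j)) i = dif ?L i" for i
 proof
  fix x
  note S = stalk_complex[OF M]
  show "dif (shift (stalk M j)) i x = dif ?L i x"
  proof (cases "x IN (stalk M j)$(i+1)")
   case True
   hence "dif (shift (stalk M j)) i x = 0[(stalk M j)$(i+2)]" using stalk_dif[OF True] stalk_lm[OF M] by (simp add: ips)
   moreover have "dif ?L i x = 0[?L$(i+1)]" using stalk_dif[of x M "j-1" i] True o[of i] by simp
   moreover have "?L$(i+1) = (stalk M j)$(i+2)" using o[of "i+1"] by (simp add: ips)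
   ultimately show ?thesis by simp
  next
   case False
   have "dif ?L i : extensional (cr ?L$i)" by (rule lhom_extensional[OF dhm[OF S]])
   thus ?thesis using False o[of i] by (simp add: shift_def extensional_def)
  qed
 qed
 hence "dif (shift (stalk M j)) = dif ?L" by blast
 moreover have "obj (shift (stalk M j)) = obj ?L" using o by blast
 ultimately show ?thesis by (simp add: cplx.equality)
qed

lemma stalk_map_hom:
 assumes P: "cpx A P" and M: "lmod A M" and f: "f : cmaps A P (stalk M j)"
 shows "f j : lhom A P$j M" "x IN P$(j-1) ==> f j (dif P (j-1) x) = 0[M]"
proof -
 note S = stalk_complex[OF M, of j]
 show "f j : lhom A P$j M" using cmh[OF f, of j] by simp
 assume x: "x IN P$(j-1)"
 show "f j (dif P (j-1) x) = 0[M]" unfolding cmr(3)[OF f P S x] stalk_dif[OF cmr(1)[OF f P S x]] by simp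
qed

lemma stalk_homotopicI:
 assumes P: "cpx A P" and M: "lmod A M" and f: "f : cmaps A P (stalk M j)" and g: "g : cmaps A P (stalk M j)"
  and h: "h : lhom A P$(j+1) M" "!!x. x IN P$j ==> f j x = g j x +[M] h (dif P j x)"
 shows "hty A P (stalk M j) f g"
proof -
 let ?L = "stalk M j"
 note S = stalk_complex[OF M, of j]
 let ?h = "%i. if i = j+1 then h else (%x:cr P$i. 0[?L$(i-1)])"
 have hf: "hfam P ?L ?h" unfolding hfam_def
 proof
  fix i
  show "?h i : lhom A P$i ?L$(i-1)" using h(1) hzmap[OF xlm[OF P] stalk_lm[OF M], of j "i-1" i] by (cases "i = j+1") auto
 qed
 note rh = hfr[OF hf P S]
 show ?thesis
 proof (rule homotopicI[OF P S f g hf])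
  fix i x assume x: "x IN P$i"
  show "f i x = g i x +[?L$i] (dif ?L (i-1) (?h i x) +[?L$i] ?h (i+1) (dif P i x))"
  proof (cases "i=j")
   case True
   have "dif ?L (j-1) (?h j x) = 0[M]" using stalk_dif[of "?h j x" M j "j-1"] rh(1)[OF x] True by simp
   moreover have "h (dif P j x) IN M" using hcl[OF h(1)] x P True by simp
   ultimately show ?thesis using h(2)[of x] x True M by simp
  next
   case False
   have c: "f i x : {{}}" "g i x : {{}}" using cmr(1)[OF f P S x] cmr(1)[OF g P S x] False by auto
   thus ?thesis using False by simp
  qed
 qed
qed

lemma stalk_homotopicE:
 assumes P: "cpx A P" and M: "lmod A M" and f: "f : cmaps A P (stalk M j)" and g: "g : cmaps A P (stalk M j)"
  and fg: "hty A P (stalk M j) f g"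
 obtains h where "h : lhom A P$(j+1) M" "!!x. x IN P$j ==> f j x = g j x +[M] h (dif P j x)"
proof -
 note S = stalk_complex[OF M, of j]
 obtain h where h: "hfam P (stalk M j) h" "!!i x. x IN P$i ==>
   f i x = g i x +[(stalk M j)$i] (hm P (stalk M j) h i x)" by (rule homotopicE[OF P S f g fg]) blast
 have hl: "h (j+1) : lhom A P$(j+1) M" using hfamD(2)[OF h(1), of j] by simp
 show ?thesis
 proof (rule that[OF hl])
  fix x assume x: "x IN P$j"
  have "dif (stalk M j) (j-1) (h j x) = 0[M]" using stalk_dif[of "h j x" M j "j-1"] hfr(1)[OF h(1) P S x] by simp
  moreover have "h (j+1) (dif P j x) IN M" using hcl[OF hl] x P by simp
  ultimately show "f j x = g j x +[M] h (j+1) (dif P j x)" using h(2)[OF x] M by simp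
 qed
qed

subsection \<open>Truncation\<close>

text \<open>A good truncation that avoids quotients. The usual term in degree \<open>b\<close> is
  the cokernel of the incoming differential; if \<open>P\<close> is acyclic at \<open>b\<close> and
  \<open>b+1\<close>, the differential identifies it with the cycles in degree \<open>b+1\<close>,
  which are used here.\<close>

definition trunc :: "'a ucplx => int => 'a ucplx" where
 "trunc P b = \<lparr>obj = (%i. if i>b then P$i else if i=b then sub P$(b+1) {x:cr P$(b+1). dif P (b+1) x = 0[P$(b+2)]} else zmod),
   dif = (%i. if i>b then dif P i else if i=b then (%x:{x:cr P$(b+1). dif P (b+1) x = 0[P$(b+2)]}. x)
    else (%x:{{}}. if i+1 = b then 0[P$(b+1)] else {}))\<rparr>"

definition tau :: "'a ucplx => int => 'a umap" where
 "tau P b = (%i. %x:cr P$i. if i>b then x else if i=b then dif P b x else {})"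

lemma trunc_simps [simp]:
 "i>b ==> (trunc P b)$i = P$i" "i>b ==> dif (trunc P b) i = dif P i" "i<b ==> (trunc P b)$i = zmod" by (auto simp: trunc_def)

lemma trunc_b:
 "(trunc P b)$b = sub P$(b+1) {x:cr P$(b+1). dif P (b+1) x = 0[P$(b+2)]}"
 "dif (trunc P b) b = (%x:{x:cr P$(b+1). dif P (b+1) x = 0[P$(b+2)]}. x)" by (auto simp: trunc_def)

lemma trunc_cyc: "cpx A P ==> submod A P$(b+1) {x:cr P$(b+1). dif P (b+1) x = 0[P$(b+2)]}" using submod_kernel[OF _ _ dhm, of P "b+1"] by (simp add: ips)

lemma trunc_complex:
 assumes P: "cpx A P"
 shows "cpx A (trunc P b)" unfolding is_complex_def
proof (intro allI conjI ballI)
 let ?L = "trunc P b"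
 let ?Z = "{x:cr P$(b+1). dif P (b+1) x = 0[P$(b+2)]}"
 have lmZ: "lmod A (sub P$(b+1) ?Z)" using trunc_cyc[OF P] P by simp
 fix i
 consider "i>b" | "i=b" | "i+1 = b" | "i+1<b" by linarith
 note c = this
 show "lmod A ?L$i" using c by cases (use P lmZ in "auto simp: trunc_def")
 have z: "(%x:{{}}. 0[N]) : lhom A zmod N" if "lmod A N" for N :: "('a, 'a univ) module" using hzmap[OF lm_zmod that] by simp
 show "dif ?L i : lhom A ?L$i ?L$(i+1)" using c
 proof cases
  case 1 thus ?thesis using P dhm by simp
 next
  case 2 thus ?thesis using lhom_incl[OF xlm[OF P] trunc_cyc[OF P]] by (simp add: trunc_b)
 next
  case 3
  hence "dif ?L i = (%x:{{}}. 0[sub P$(b+1) ?Z])" "?L$(i+1) = sub P$(b+1) ?Z" by (auto simp: trunc_def)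
  thus ?thesis using z[OF lmZ] 3 by simp
 next
  case 4
  hence "dif ?L i = (%x:{{}}. 0[zmod])" by (auto simp: trunc_def)
  thus ?thesis using z[OF lm_zmod] 4 by simp
 qed
 fix x assume x: "x IN ?L$i"
 show "dif ?L (i+1) (dif ?L i x) = 0[?L$(i+2)]" using c
 proof cases
  case 1 thus ?thesis using P x by simp
 next
  case 2 thus ?thesis using x by (simp add: trunc_b)
 next
  case 3
  have "0[P$(b+1)] : ?Z" using smD(2)[OF trunc_cyc[OF P]] .
  moreover have "dif ?L i x = 0[P$(b+1)]" "i+1 = b" "i+2 = b+1" using 3 x by (auto simp: trunc_def)
  ultimately show ?thesis using trunc_b[of P b] by (simp only: ) (simp add: trunc_simps)
 next
  case 4
  hence "dif ?L i x = {}" using x by (auto simp: trunc_def)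
  moreover have "dif ?L (i+1) {} = 0[?L$(i+2)]" using 4 by (auto simp: trunc_def)
  ultimately show ?thesis by simp
 qed
qed

lemma tau_cmaps:
 assumes P: "cpx A P"
 shows "tau P b : cmaps A P (trunc P b)"
proof (rule cmapsI)
 let ?Z = "{x:cr P$(b+1). dif P (b+1) x = 0[P$(b+2)]}"
 fix i
 show "tau P b i : lhom A P$i (trunc P b)$i"
 proof (cases i b rule: linorder_cases)
  case greater
  hence "tau P b i = (%x:cr P$i. x)" by (simp add: tau_def)
  thus ?thesis using greater lhom_id[OF xlm[OF P]] by simp
 next
  case equal
  have "dif P b : extensional (cr P$b)" by (rule lhom_extensional[OF dhm[OF P]])
  hence "tau P b b = dif P b" by (auto simp: tau_def intro!: extensionalityI[of _ "cr P$b"])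
  moreover have "dif P b ` cr P$b<=?Z" using P by auto
  ultimately show ?thesis using equal lhom_cosub[OF dhm[OF P]] by (simp add: trunc_b)
 next
  case less
  hence "tau P b i = (%x:cr P$i. 0[zmod])" by (simp add: tau_def)
  thus ?thesis using less hzmap[OF xlm[OF P] lm_zmod] by simp
 qed
 fix x assume x: "x IN P$i"
 consider "i>b" | "i=b" | "i+1 = b" | "i+1<b" by linarith
 thus "tau P b (i+1) (dif P i x) = dif (trunc P b) i (tau P b i x)"
 proof cases
  case 1 thus ?thesis using x P by (simp add: tau_def)
 next
  case 2 thus ?thesis using x P by (simp add: tau_def trunc_b)
 next
  case 3
  hence "dif P b (dif P i x) = 0[P$(b+1)]" using dif_dif(1)[OF P x] by (simp add: ips flip: 3)
  moreover have "dif P i x IN P$b" using dcl(1)[OF P x] 3 by simp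
  ultimately show ?thesis using x 3 P by (auto simp: tau_def trunc_def)
 next
  case 4 thus ?thesis using x P by (auto simp: tau_def trunc_def)
 qed
qed

lemma tau_quasi_iso:
 assumes P: "cpx A P" and ac: "!!i. i<=b+1 ==> acyc P i"
 shows "qis A P (trunc P b) (tau P b)"
proof (rule quasi_isoI[OF P trunc_complex[OF P] tau_cmaps[OF P]])
 let ?L = "trunc P b"
 note T = trunc_complex[OF P, of b]
 fix i x w assume x: "x IN P$i" "w IN ?L$(i-1)" "dif P i x = 0[P$(i+1)]"
  "tau P b i x = dif ?L (i-1) w"
 show "EX v:cr P$(i-1). dif P (i-1) v = x"
 proof (cases "i<=b+1")
  case True
  thus ?thesis using acycE[OF ac[OF True] x(1,3)] by metis
 next
  case False
  hence "w IN P$(i-1)" "dif ?L (i-1) w = dif P (i-1) w" using x(2) by auto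
  thus ?thesis using x False by (auto simp: tau_def)
 qed
next
 let ?L = "trunc P b"
 note T = trunc_complex[OF P, of b]
 fix i y assume y: "y IN ?L$i" "dif ?L i y = 0[?L$(i+1)]"
 show "EX x:cr P$i. EX w:cr ?L$(i-1). dif P i x = 0[P$(i+1)] &
   y = tau P b i x +[?L$i] dif ?L (i-1) w"
 proof (cases "i>b")
  case True
  thus ?thesis using y P T hzero[OF dhm'[OF T], of i] by (intro bexI[of _ y] bexI[of _ "0[?L$(i-1)]"]) (auto simp: tau_def)
 next
  case False
  have "y = 0[?L$i]"
  proof (cases "i=b")
   case True
   thus ?thesis using y by (simp add: trunc_b)
  next
   case False
   thus ?thesis using y \<open>~ i > b\<close> by simp
  qed
  thus ?thesis using P T hzero[OF dhm'[OF T], of i] cmr(5)[OF tau_cmaps[OF P] P T] by (intro bexI[of _ "0[P$i]"] bexI[of _ "0[?L$(i-1)]"]) auto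
 qed
qed

text \<open>A chain map from \<open>P\<close> to a complex that vanishes up to degree
  \<open>b\<close> descends to the truncation. By \<open>tmap_tau\<close> it is recovered exactly,
  not just up to homotopy.\<close>

definition tmap :: "'a ucplx => int => ('a, 'n) cplx => ('a univ, 'n) gmap => ('a univ, 'n) gmap" where
 "tmap P b Y f = (%i. if i>b then f i else (%x:cr (trunc P b)$i. 0[Y$i]))"

lemma tmap_cmaps:
 assumes P: "cpx A P" and Y: "cpx A Y" and f: "f : cmaps A P Y"
  and ac: "acyc P (b+1)" and z: "!!i. i<=b ==> zm Y$i"
 shows "tmap P b Y f : cmaps A (trunc P b) Y"
proof (rule cmapsI)
 note T = trunc_complex[OF P, of b] and rf = cmr[OF f P Y]
 fix i
 show "tmap P b Y f i : lhom A (trunc P b)$i Y$i" using cmh[OF f] T Y by (auto simp: tmap_def intro: hzmap)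
 fix x assume x: "x IN (trunc P b)$i"
 consider "i>b" | "i=b" | "i<b" by linarith
 thus "tmap P b Y f (i+1) (dif (trunc P b) i x) = dif Y i (tmap P b Y f i x)"
 proof cases
  case 1 thus ?thesis using x rf by (simp add: tmap_def)
 next
  case 2
  hence x': "x IN P$(b+1)" "dif P (b+1) x = 0[P$(b+1+1)]" using x by (auto simp: trunc_b ips)
  obtain v where v: "v IN P$b" "dif P b v = x" using acycE[OF ac x'] by auto
  have "f (b+1) x = dif Y b (f b v)" using rf(2)[OF v(1)] v(2) by simp
  also have "f b v = 0[Y$b]" by (rule zmD[OF z rf(1)[OF v(1)]]) simp
  finally show ?thesis using 2 x Y by (simp add: tmap_def trunc_b)
 next
  case 3
  have "dif (trunc P b) i x IN (trunc P b)$(i+1)" using x T by simp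
  thus ?thesis using 3 x Y by (simp add: tmap_def)
 qed
qed

lemma tmap_tau:
 assumes P: "cpx A P" and Y: "cpx A Y" and f: "f : cmaps A P Y"
  and ac: "acyc P (b+1)" and z: "!!i. i<=b ==> zm Y$i"
 shows "ccomp P (tmap P b Y f) (tau P b) = f"
proof (rule cmaps_eqI[OF ccm[OF P trunc_complex[OF P] Y tau_cmaps[OF P] tmap_cmaps[OF assms]] f])
 fix i x assume x: "x IN P$i"
 show "ccomp P (tmap P b Y f) (tau P b) i x = f i x"
 proof (cases "i>b")
  case True thus ?thesis using x by (simp add: tmap_def tau_def)
 next
  case False
  have "tau P b i x IN (trunc P b)$i" by (rule hcl[OF cmh[OF tau_cmaps[OF P]] x])
  moreover have "f i x = 0[Y$i]" by (rule zmD[OF z hcl[OF cmh[OF f] x]]) (use False in simp)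
  ultimately show ?thesis using x False by (simp add: tmap_def)
 qed
qed

lemma trunc_homotopic:
 assumes P: "cpx A P" and Y: "cpx A Y" and f: "f : cmaps A (trunc P b) Y" and g: "g : cmaps A (trunc P b) Y"
  and z: "!!i. i<=b ==> zm Y$i"
  and h: "hty A P Y (ccomp P f (tau P b)) (ccomp P g (tau P b))"
 shows "hty A (trunc P b) Y f g"
proof -
 note T = trunc_complex[OF P, of b] and t = tau_cmaps[OF P, of b]
 obtain k where k: "hfam P Y k" "!!i x. x IN P$i ==>
   ccomp P f (tau P b) i x = ccomp P g (tau P b) i x +[Y$i] hm P Y k i x"
  by (rule homotopicE[OF P Y ccm[OF P T Y t f] ccm[OF P T Y t g] h]) blast
 let ?h = "%i. if i>b then k i else (%x:cr (trunc P b)$i. 0[Y$(i-1)])"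
 have hf: "hfam (trunc P b) Y ?h" unfolding hfam_def using hfamD(1)[OF k(1)] T Y by (auto intro: hzmap)
 note rh = hfr[OF hf T Y]
 show ?thesis
 proof (rule homotopicI[OF T Y f g hf])
  fix i x assume x: "x IN (trunc P b)$i"
  show "f i x = g i x +[Y$i] (dif Y (i-1) (?h i x) +[Y$i] ?h (i+1) (dif (trunc P b) i x))"
  proof (cases "i>b")
   case True
   thus ?thesis using k(2)[of x i] x by (simp add: tau_def)
  next
   case False
   have zz: "y = 0[Y$i]" if "y IN Y$i" for y by (rule zmD[OF z that]) (use False in simp)
   have "g i x +[Y$i] (dif Y (i-1) (?h i x) +[Y$i] ?h (i+1) (dif (trunc P b) i x)) IN Y$i"
    using cmr(1)[OF g T Y x] rh(1)[OF x] rh(2)[of "dif (trunc P b) i x" i] x T Y by (intro lcl(2)[OF xlm[OF Y]]) auto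
   thus ?thesis using zz cmr(1)[OF f T Y x] by metis
  qed
 qed
qed

end

context artin_alg
begin

lemma trunc_bcomplexes:
 assumes P: "cpx A P" "!!i. P$i : fgmod A" "!!i. i>c ==> zm P$i"
 shows "trunc P b : bcx A"
proof (rule bcomplexesI[of _ "max b c" b])
 show "cpx A (trunc P b)" by (rule trunc_complex[OF P(1)])
 show "(trunc P b)$i : fgmod A" for i
 proof (cases i b rule: linorder_cases)
  case equal
  thus ?thesis using fgmod_sub[OF P(2) trunc_cyc[OF P(1)]] by (simp add: trunc_b)
 qed (use P in auto)
qed (use P in auto)

subsection \<open>Projective resolutions of complexes\<close>

text \<open>The pairs \<open>(z, x)\<close> on the left of the equivalence form a submodule of
  \<open>biprod M X\<close>, the cycles of a mapping cone. A projective cover of it, split into two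
  components, continues the resolution with an exact cone.\<close>

lemma resolution_step:
 assumes M: "M : fgmod A" and N: "lmod A N" and d: "d : lhom A M N" and Y: "lmod A Y" and p: "p : lhom A M Y"
  and X: "X : fgmod A" and e: "e : lhom A X Y"
 obtains M' d' p' where "M' : fgmod A" "fgproj M'" "d' : lhom A M' M" "p' : lhom A M' X"
  "!!z x. z IN M ==> x IN X ==> (d z = 0[N] & p z = e x) <-> (EX m:cr M'. d' m = z & p' m = x)"
proof -
 note lM = fgD(1)[OF M] and lX = fgD(1)[OF X]
 let ?B = "biprod M X"
 let ?L = "{q:cr ?B. d (fst q) = 0[N] & p (fst q) = e (snd q)}"
 have lB: "lmod A ?B" using lM lX by simp
 have L: "submod A ?B ?L" unfolding submod_def using lhom_rules[OF d] lhom_rules[OF p] lhom_rules[OF e] hzero[OF d lM N] hzero[OF p lM Y] hzero[OF e lX Y] lM lX N by auto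
 have fg: "fin_gen A (sub ?B ?L)" by (rule fin_gen_sub[OF lB fin_gen_biprod[OF lM lX fgD(2)[OF M] fgD(2)[OF X]] L])
 obtain M' q where q: "M' : fgmod A" "fgproj M'" "q : lhom A M' (sub ?B ?L)" "q ` cr M' = cr (sub ?B ?L)" by (rule ex_fgproj_cover[OF lm_sub[OF lB L] fg])
 have q': "q : lhom A M' ?B" by (rule lhom_unsub[OF q(3) L])
 note lM' = fgD(1)[OF q(1)]
 show ?thesis
 proof (rule that[OF q(1,2) hcomp[OF lM' q' lhom_fst[OF lM lX]] hcomp[OF lM' q' lhom_snd[OF lM lX]]])
  fix z x assume zx: "z IN M" "x IN X"
  have qc: "q m IN ?B" if "m IN M'" for m using hcl[OF q' that] .
  have "(EX m:cr M'. (%x:cr M'. restrict fst (cr ?B) (q x)) m = z & (%x:cr M'. restrict snd (cr ?B) (q x)) m = x)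
    <-> (EX m:cr M'. q m = (z, x))" using qc by (intro bex_cong) (auto simp: prod_eq_iff)
  also have "... <-> (z, x) : ?L" using q(4) unfolding sub_simps(1) by (metis (mono_tags, lifting) image_iff)
  also have "... <-> d z = 0[N] & p z = e x" using zx by auto
  finally show "(d z = 0[N] & p z = e x) <-> (EX m:cr M'. (%x:cr M'. restrict fst (cr ?B) (q x)) m = z & (%x:cr M'. restrict snd (cr ?B) (q x)) m = x)" by blast
 qed
qed

definition projres :: "int => 'a ucplx => 'a ucplx => 'a umap => bool" where
 "projres c X P pr <-> bproj c P & (ALL i. P$i : fgmod A) & qis A P X pr"

text \<open>Built downwards from degree \<open>c\<close>: keeping the cone of \<open>pr\<close>
  exact at every stage is what makes \<open>pr\<close> a quasi-isomorphism. Acyclicity of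
  \<open>X\<close> above \<open>c\<close> allows the resolution to start there.\<close>

lemma ex_projres:
 assumes X: "X : bcx A" and ac: "!!i. i>c ==> acyc X i"
 obtains P pr where "projres c X P pr"
proof -
 note XC = bcD(1)[OF X] and Xf = bcD(2)[OF X]
 \<comment> \<open>A state consists of the current term, the next higher term, the differential
   between them and the map to \<open>X\<close>. \<open>z\<close> is the zero state; pinning it down
   in degree \<open>c+1\<close> lets the recursion be glued to zero above.\<close>
 define z :: "int => ('a, 'a univ) module \<times> ('a, 'a univ) module \<times> ('a univ => 'a univ) \<times> ('a univ => 'a univ)" where "z i = (zmod, zmod, %x:{{}}. {}, %x:{{}}. 0[X$i])" for i
 let ?I = "%i (M, N, d, p). M : fgmod A & fgproj M & lmod A N & d : lhom A M N & p : lhom A M X$i & (i = c+1 --> (M, N, d, p) = z i)"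
 let ?S = "%i (M', N', d', p') (M, N, d, p). N' = M &
  (ALL z:cr M. ALL x:cr X$i. (d z = 0[N] & p z = dif X i x) <-> (EX m:cr M'. d' m = z & p' m = x))"
 have hz: "(%x:{{}}. 0[X$i]) : lhom A zmod X$i" "(%x:{{}}. {}) : lhom A zmod zmod" for i
  using hzmap[OF lm_zmod xlm[OF XC]] hzmap[OF lm_zmod lm_zmod] by auto
 have fz: "fgproj zmod" by (rule fgproj_zero) auto
 obtain s where s: "!!i. i<=c+1 ==> ?I i (s i)" "!!i. i<c+1 ==> ?S i (s i) (s (i+1))"
 proof (rule int_down[of ?I "c+1" "z (c+1)" ?S])
  show "?I (c+1) (z (c+1))" using hz fz by (simp add: z_def)
  fix i s assume i: "i<c+1" and I: "?I (i+1) s"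
  obtain M N d p where s: "s = (M, N, d, p)" by (cases s)
  have II: "M : fgmod A" "lmod A N" "d : lhom A M N" "p : lhom A M X$(i+1)" using I s by auto
  obtain M' d' p' where n: "M' : fgmod A" "fgproj M'" "d' : lhom A M' M" "p' : lhom A M' X$i"
   "!!z x. z IN M ==> x IN X$i ==> (d z = 0[N] & p z = dif X i x) <-> (EX m:cr M'. d' m = z & p' m = x)"
   by (rule resolution_step[OF II(1,2,3) xlm[OF XC] II(4) Xf dhm[OF XC]]) blast
  have "?I i (M', M, d', p') & ?S i (M', M, d', p') s" using n II(1) i s fgD(1) by auto
  thus "EX s'. ?I i s' & ?S i s' s" by (rule exI[where x="(M', M, d', p')"])
 qed blast
 define M where "M i = (if i<=c then fst (s i) else zmod)" for i
 define d where "d i = (if i<=c then fst (snd (snd (s i))) else (%x:{{}}. {}))" for i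
 define p where "p i = (if i<=c then snd (snd (snd (s i))) else (%x:{{}}. 0[X$i]))" for i
 have hi: "M i = zmod" "d i = (%x:{{}}. {})" "p i = (%x:{{}}. 0[X$i])" if "i>c" for i using that by (simp_all add: M_def d_def p_def)
 have sc: "s (c+1) = z (c+1)" using s(1)[of "c+1"] by (auto split: prod.splits)
 have sM: "s i = (M i, M (i+1), d i, p i)" if i: "i<=c" for i
 proof -
  have "fst (s (i+1)) = M (i+1)" using i sc by (cases "i=c") (auto simp: M_def z_def)
  moreover have "fst (snd (s i)) = fst (s (i+1))" using s(2)[of i] i by (auto split: prod.splits)
  ultimately show ?thesis using i by (simp add: M_def d_def p_def prod_eq_iff)
 qed
 have sM1: "s (i+1) = (M (i+1), M (i+1+1), d (i+1), p (i+1))" if "i<=c" for i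
  using that sM[of "i+1"] sc hi[of "c+1"] hi[of "c+1+1"] by (cases "i=c") (auto simp: z_def)
 have M: "M i : fgmod A" "fgproj (M i)" for i using s(1)[of i] sM[of i] fz zmod_fgmod hi by (cases "i<=c"; simp)+
 have dh: "d i : lhom A (M i) (M (i+1))" for i using s(1)[of i] sM[of i] hz hi[of i] hi[of "i+1"] by (cases "i<=c") auto
 have ph: "p i : lhom A (M i) X$i" for i using s(1)[of i] sM[of i] hz hi[of i] by (cases "i<=c") auto
 have st: "(d (i+1) z = 0[M (i+1+1)] & p (i+1) z = dif X i x) <-> (EX m:cr (M i). d i m = z & p i m = x)"
  if "i<=c" "z IN M (i+1)" "x IN X$i" for i z x using s(2)[of i] that sM sM1 by simp
 note lM = fgproj_lm[OF M(2)]
 define P :: "'a ucplx" where "P = \<lparr>obj = M, dif = d\<rparr>"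
 have oP: "obj P = M" "dif P = d" by (simp_all add: P_def)
 have dp: "d (i+1) (d i x) = 0[M (i+1+1)]" "p (i+1) (d i x) = dif X i (p i x)" if x: "x IN M i" for i x
 proof -
  have "d (i+1) (d i x) = 0[M (i+1+1)] & p (i+1) (d i x) = dif X i (p i x)"
  proof (cases "i<=c")
   case True
   show ?thesis using st[OF True hcl[OF dh x] hcl[OF ph x]] x by blast
  next
   case False
   thus ?thesis using x hi[of i] hi[of "i+1"] hi[of "i+1+1"] dif_rules(2)[OF XC] by simp
  qed
  thus "d (i+1) (d i x) = 0[M (i+1+1)]" "p (i+1) (d i x) = dif X i (p i x)" by auto
 qed
 have PC: "cpx A P" unfolding is_complex_def oP using lM dh dp(1) by (simp add: ips)
 have pc: "p : cmaps A P X" by (rule cmapsI) (use ph dp(2) in "auto simp: oP")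
 have "qis A P X p"
 proof (rule quasi_isoI[OF PC XC pc])
  fix i x w assume x: "x IN P$i" "w IN X$(i-1)" "dif P i x = 0[P$(i+1)]" "p i x = dif X (i-1) w"
  show "EX v:cr P$(i-1). dif P (i-1) v = x"
  proof (cases "i-1<=c")
   case True
   show ?thesis using st[OF True, of x w] x unfolding oP by auto
  next
   case False
   hence "x = 0[P$i]" using x(1) hi(1)[of i] by (simp add: oP)
   thus ?thesis using hzero[OF dhm'[OF PC, of i]] PC by (intro bexI[of _ "0[P$(i-1)]"]) auto
  qed
 next
  fix i y assume y: "y IN X$i" "dif X i y = 0[X$(i+1)]"
  show "EX x:cr P$i. EX w:cr X$(i-1). dif P i x = 0[P$(i+1)] & y = p i x +[X$i] dif X (i-1) w"
  proof (cases "i<=c")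
   case True
   have "d (i+1) 0[M (i+1)] = 0[M (i+1+1)]" "p (i+1) 0[M (i+1)] = dif X i y" using hzero[OF dh lM lM] hzero[OF ph lM xlm[OF XC]] y(2) by auto
   then obtain m where m: "m IN M i" "d i m = 0[M (i+1)]" "p i m = y" using st[OF True _ y(1), of "0[M (i+1)]"] lcl(1)[OF lM] by blast
   thus ?thesis using y(1) XC hzero[OF dhm'[OF XC, of i]] by (intro bexI[of _ m] bexI[of _ "0[X$(i-1)]"]) (auto simp: oP)
  next
   case False
   obtain w where "w IN X$(i-1)" "dif X (i-1) w = y" using acycE[OF ac y] False by auto
   thus ?thesis using cmr(5)[OF pc PC XC] PC XC y(1) by (intro bexI[of _ "0[P$i]"] bexI[of _ w]) auto
  qed
 qed
 moreover have "bproj c P" using PC M(2) hi(1) by (auto simp: bproj_def oP(1))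
 ultimately show ?thesis using that M(1) unfolding projres_def oP(1)[symmetric] by blast
qed

end

section \<open>Stability of quasi-isomorphisms under homotopy and cancellation\<close>

context base_ring
begin

lemma qis_homotopic:
 assumes X: "cpx A X" and Y: "cpx A Y" and f: "qis A X Y f" and g: "g : cmaps A X Y" and fg: "hty A X Y f g"
 shows "qis A X Y g"
proof -
 note fc = qis_cmaps[OF f]
 note rg = cmr[OF g X Y]
 obtain h where h: "hfam X Y h" "!!i x. x IN X$i ==>
   f i x = g i x +[Y$i] hm X Y h i x" by (rule homotopicE[OF X Y fc g fg]) blast
 note rh = hfr[OF h(1) X Y]
 have e: "f i x = g i x +[Y$i] dif Y (i-1) (h i x)" if "x IN X$i" "dif X i x = 0[X$(i+1)]" for i x using h(2)[OF that(1)] that rh(5) rh(1)[OF that(1)] Y by simp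
 have da: "dif Y (i-1) (v +[Y$(i-1)] w) = dif Y (i-1) v +[Y$i] dif Y (i-1) w"
  if "v IN Y$(i-1)" "w IN Y$(i-1)" for i v w by (rule hadd[OF dhm'[OF Y] that])
 show ?thesis
 proof (rule quasi_isoI[OF X Y g])
  fix i x w assume x: "x IN X$i" "w IN Y$(i-1)" "dif X i x = 0[X$(i+1)]" "g i x = dif Y (i-1) w"
  have "f i x = dif Y (i-1) (w +[Y$(i-1)] h i x)" using e[OF x(1,3)] x(4) da[OF x(2) rh(1)[OF x(1)]] by simp
  moreover have "w +[Y$(i-1)] h i x IN Y$(i-1)" using x(2) rh(1)[OF x(1)] Y by simp
  ultimately show "EX v:cr X$(i-1). dif X (i-1) v = x" using quasi_isoD1[OF X Y f x(1) _ x(3)] by metis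
 next
  fix i y assume y: "y IN Y$i" "dif Y i y = 0[Y$(i+1)]"
  obtain x w where x: "x IN X$i" "w IN Y$(i-1)" "dif X i x = 0[X$(i+1)]"
   "y = f i x +[Y$i] dif Y (i-1) w" by (rule quasi_isoD2[OF X Y f y])
  have "y = g i x +[Y$i] dif Y (i-1) (h i x +[Y$(i-1)] w)"
   unfolding x(4) e[OF x(1,3)] da[OF rh(1)[OF x(1)] x(2)] using x(2) rh(1)[OF x(1)] rg(1)[OF x(1)] Y by (simp add: lgr)
  thus "EX x:cr X$i. EX w:cr Y$(i-1). dif X i x = 0[X$(i+1)] & y = g i x +[Y$i] dif Y (i-1) w"
   using x(1,2,3) rh(1)[OF x(1)] Y by (intro bexI[of _ x] bexI[of _ "h i x +[Y$(i-1)] w"]) auto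
 qed
qed

lemma qis_cancel:
 assumes P: "cpx A P" and W: "cpx A W" and X: "cpx A X"
  and t: "qis A P W t" and f: "f : cmaps A W X" and ft: "qis A P X (ccomp P f t)"
 shows "qis A W X f"
proof -
 note rt = cmr[OF qis_cmaps[OF t] P W] and rf = cmr[OF f W X]
 have da: "dif Y (i-1) (v +[Y$(i-1)] w) = dif Y (i-1) v +[Y$i] dif Y (i-1) w"
  if "cpx A Y" "v IN Y$(i-1)" "w IN Y$(i-1)" for i v w and Y :: "('a, 'x) cplx" by (rule hadd[OF dhm'[OF that(1)] that(2,3)])
 show ?thesis
 proof (rule quasi_isoI[OF W X f])
  fix i w x assume a: "w IN W$i" "x IN X$(i-1)" "dif W i w = 0[W$(i+1)]" "f i w = dif X (i-1) x"
  obtain p w' where p: "p IN P$i" "w' IN W$(i-1)" "dif P i p = 0[P$(i+1)]"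
   "w = t i p +[W$i] dif W (i-1) w'" by (rule quasi_isoD2[OF P W t a(1,3)])
  have x': "x -[X$(i-1)] f (i-1) w' IN X$(i-1)" using a(2) rf(1)[OF p(2)] X by simp
  have "f i w = f i (t i p) +[X$i] dif X (i-1) (f (i-1) w')" unfolding p(4) using p(1,2) rt(1) rf W by simp
  hence "ccomp P f t i p = dif X (i-1) x -[X$i] dif X (i-1) (f (i-1) w')" unfolding a(4) using p(1,2) rt(1) rf(1) X by (simp add: lm_ac)
  also have "... = dif X (i-1) (x -[X$(i-1)] f (i-1) w')" using hminus[OF dhm'[OF X]] a(2) rf(1)[OF p(2)] X by simp
  finally obtain v where v: "v IN P$(i-1)" "dif P (i-1) v = p" using quasi_isoD1[OF P X ft p(1) x' p(3)] by blast
  have "w = dif W (i-1) (t (i-1) v +[W$(i-1)] w')" unfolding p(4) using v rt(1,3) p(2) da[OF W] by auto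
  thus "EX v:cr W$(i-1). dif W (i-1) v = w" using rt(1)[OF v(1)] p(2) W by (intro bexI[of _ "t (i-1) v +[W$(i-1)] w'"]) auto
 next
  fix i y assume y: "y IN X$i" "dif X i y = 0[X$(i+1)]"
  obtain p x where p: "p IN P$i" "x IN X$(i-1)" "dif P i p = 0[P$(i+1)]"
   "y = ccomp P f t i p +[X$i] dif X (i-1) x" by (rule quasi_isoD2[OF P X ft y])
  have "dif W i (t i p) = 0[W$(i+1)]" using rt(2)[OF p(1)] p(3) rt(5) by simp
  thus "EX x:cr W$i. EX w:cr X$(i-1). dif W i x = 0[W$(i+1)] & y = f i x +[X$i] dif X (i-1) w" using p rt(1) by (intro bexI[of _ "t i p"] bexI[of _ x]) auto
 qed
qed

end

context artin_alg
begin

section \<open>Morphisms in the derived category via projective resolutions\<close>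

text \<open>The morphism represented by a chain map \<open>f\<close> out of the resolution
  \<open>pr\<close> from \<open>P\<close> to \<open>X\<close>: all roofs that become
  \<open>f\<close> up to homotopy when their left leg is lifted to \<open>P\<close>. It turns hom
  sets of the derived category into homotopy classes of maps from \<open>P\<close> to
  \<open>Y\<close>.\<close>

definition cls :: "'a ucplx => 'a ucplx => 'a ucplx => 'a umap => 'a umap => 'a roof set" where
 "cls X Y P pr f = {r:roofs A X Y. EX p:cmaps A P (fst r). hty A P X (ccomp P (fst (snd r)) p) pr &
   hty A P Y (ccomp P (snd (snd r)) p) f}"

lemma cls_mem:
 "(Z, s, g) : cls X Y P pr f <-> (Z, s, g) : roofs A X Y &
  (EX p:cmaps A P Z. hty A P X (ccomp P s p) pr & hty A P Y (ccomp P g p) f)" by (simp add: cls_def)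

lemma roofsD:
 assumes "(Z, s, g) : roofs A X Y"
 shows "Z : bcx A" "cpx A Z" "qis A Z X s" "s : cmaps A Z X" "g : cmaps A Z Y" using assms bcD(1) qis_cmaps by (auto simp: roofs_def)

lemma prD:
 assumes "projres c X P pr"
 shows "bproj c P" "cpx A P" "P$i : fgmod A" "qis A P X pr" "pr : cmaps A P X" "fgproj P$i" using assms bprojD qis_cmaps by (auto simp: projres_def)

text \<open>The degree \<open>b+1\<close> is included because \<open>trunc P b\<close> is built from
  the cycles there, so the resolution has to be acyclic in that degree too.\<close>

definition low :: "int => ('x, 'm) cplx => bool" where
 "low b X <-> (ALL i<=b+1. zm X$i)"

lemma lowD: "low b X ==> i<=b+1 ==> zm X$i" by (simp add: low_def)

lemma ex_low: "X : bcx A ==> EX b0. ALL b<=b0. low b X"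
proof -
 assume "X : bcx A"
 then obtain m where "!!i. i < - m ==> zm X$i" by (rule bcomplexes_bounds) blast
 hence "ALL b<=- m-2. low b X" by (auto simp: low_def)
 thus ?thesis by blast
qed

lemma ex_low2: "X : bcx A ==> Y : bcx A ==> Z : bcx A ==> Z' : bcx A ==> EX b. low b X & low b Y & low b Z & low b Z'"
proof -
 assume "X : bcx A" "Y : bcx A" "Z : bcx A" "Z' : bcx A"
 then obtain b1 b2 b3 b4 where "ALL b<=b1. low b X" "ALL b<=b2. low b Y" "ALL b<=b3. low b Z" "ALL b<=b4. low b Z'" using ex_low by metis
 thus ?thesis by (intro exI[of _ "min (min b1 b2) (min b3 b4)"]) auto
qed

context
 fixes c :: int and X P :: "'a ucplx" and pr :: "'a umap"
 assumes X: "X : bcx A" and res: "projres c X P pr"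
begin

lemma XC: "cpx A X" and PC: "cpx A P" and pr: "pr : cmaps A P X" and bP: "bproj c P" using bcD[OF X] prD[OF res] by auto

lemma res_low_acyc: "low b X ==> i<=b+1 ==> acyc P i" using qis_acyc[OF PC XC prD(4)[OF res]] acyc_zero[OF XC lowD] by blast

lemma roof_lift:
 assumes "(Z, s, g) : roofs A X Y"
 obtains p where "p : cmaps A P Z" "hty A P X (ccomp P s p) pr" using lift_exists[OF bP roofsD(2)[OF assms] XC roofsD(3)[OF assms] pr] .

lemma qlift_unique:
 assumes Z: "cpx A Z" "qis A Z X s" and p: "p : cmaps A P Z" "hty A P X (ccomp P s p) pr"
  and q: "q : cmaps A P Z" "hty A P X (ccomp P s q) pr"
 shows "hty A P Z p q"
proof -
 note s = qis_cmaps[OF Z(2)]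
 note c = ccm[OF PC Z(1) XC p(1) s] ccm[OF PC Z(1) XC q(1) s]
 show ?thesis by (rule lift_unique[OF bP Z(1) XC Z(2) p(1) q(1)])
   (rule hty_trans[OF PC XC c(1) pr c(2) p(2) hty_sym[OF PC XC c(2) pr q(2)]])
qed

lemma lift_homotopic:
 assumes Z: "cpx A Z" "qis A Z X s" and p: "p : cmaps A P Z" "hty A P X (ccomp P s p) pr"
  and q: "q : cmaps A P Z" "hty A P X (ccomp P s q) pr" and Y: "cpx A Y" and g: "g : cmaps A Z Y"
 shows "hty A P Y (ccomp P g p) (ccomp P g q)" by (rule hty_comp[OF PC Z(1) Y p(1) q(1) g qlift_unique[OF assms(1-6)]])

lemma trunc_quasi_iso:
 assumes b: "low b X" and u: "u : cmaps A (trunc P b) X" and h: "hty A P X (ccomp P u (tau P b)) pr"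
 shows "qis A (trunc P b) X u"
proof -
 note T = trunc_complex[OF PC, of b]
 have t: "qis A P (trunc P b) (tau P b)" by (rule tau_quasi_iso[OF PC]) (rule res_low_acyc[OF b])
 note c = ccm[OF PC T XC tau_cmaps[OF PC] u]
 have "qis A P X (ccomp P u (tau P b))" by (rule qis_homotopic[OF PC XC prD(4)[OF res] c hty_sym[OF PC XC c pr h]])
 thus ?thesis by (rule qis_cancel[OF PC T XC t u])
qed

lemma trunc_bc: "trunc P b : bcx A" by (rule trunc_bcomplexes[OF PC prD(3)[OF res] bprojD(3)[OF bP]])

lemma tmap_props:
 assumes b: "low b X" "low b Z" and Z: "cpx A Z" and f: "f : cmaps A P Z"
 shows "tmap P b Z f : cmaps A (trunc P b) Z" "ccomp P (tmap P b Z f) (tau P b) = f"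
proof -
 have a: "acyc P (b+1)" by (rule res_low_acyc[OF b(1)]) simp
 have z: "!!i. i<=b ==> zm Z$i" using lowD[OF b(2)] by simp
 show "tmap P b Z f : cmaps A (trunc P b) Z" by (rule tmap_cmaps[OF PC Z f a z])
 show "ccomp P (tmap P b Z f) (tau P b) = f" by (rule tmap_tau[OF PC Z f a z])
qed

lemma ccomp_tmap:
 assumes b: "low b X" "low b Z" and Z: "cpx A Z" and f: "f : cmaps A P Z" and Y: "cpx A Y" and g: "g : cmaps A Z Y"
 shows "ccomp P (ccomp (trunc P b) g (tmap P b Z f)) (tau P b) = ccomp P g f"
 using ccomp_as[OF PC trunc_complex[OF PC] Z Y tau_cmaps[OF PC] tmap_props(1)[OF b Z f] g] tmap_props(2)[OF b Z f] by simp

lemma trunc_homotopic':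
 assumes b: "low b Y" and Y: "cpx A Y" and f: "f : cmaps A (trunc P b) Y" "g : cmaps A (trunc P b) Y"
  and h: "hty A P Y (ccomp P f (tau P b)) (ccomp P g (tau P b))"
 shows "hty A (trunc P b) Y f g" by (rule trunc_homotopic[OF PC Y f _ h]) (use lowD[OF b] in simp)

text \<open>From a common roof \<open>W\<close> the map \<open>pr\<close> lifts to \<open>W\<close>,
  which compares the two sides on \<open>P\<close>. Conversely a comparison on \<open>P\<close>
  descends to a sufficiently low truncation of \<open>P\<close>, which is bounded and serves as
  \<open>W\<close>.\<close>

lemma roof_eq_iff:
 assumes Y: "Y : bcx A" and r: "(Z, s, g) : roofs A X Y" and r': "(Z', s', g') : roofs A X Y"
  and p: "p : cmaps A P Z" "hty A P X (ccomp P s p) pr"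
 shows "roof_eq A X Y (Z, s, g) (Z', s', g') <->
  (EX p':cmaps A P Z'. hty A P X (ccomp P s' p') pr & hty A P Y (ccomp P g' p') (ccomp P g p))"
proof
 note YC = bcD(1)[OF Y] and Z = roofsD[OF r] and Z' = roofsD[OF r']
 assume "roof_eq A X Y (Z, s, g) (Z', s', g')"
 then obtain W u u' where W: "W : bcx A" and u: "u : cmaps A W Z" and u': "u' : cmaps A W Z'"
  and q: "qis A W X (ccomp W s u)" and h1: "hty A W X (ccomp W s u) (ccomp W s' u')"
  and h2: "hty A W Y (ccomp W g u) (ccomp W g' u')" unfolding roof_eq_def by auto
 note WC = bcD(1)[OF W]
 note c1 = ccm[OF WC Z(2) XC u Z(4)] and c2 = ccm[OF WC Z'(2) XC u' Z'(4)]
  and c3 = ccm[OF WC Z(2) YC u Z(5)] and c4 = ccm[OF WC Z'(2) YC u' Z'(5)]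
 obtain w where w: "w : cmaps A P W" "hty A P X (ccomp P (ccomp W s u) w) pr" by (rule lift_exists[OF bP WC XC q pr])
 note uw = ccm[OF PC WC Z(2) w(1) u] and uw' = ccm[OF PC WC Z'(2) w(1) u']
 have a: "ccomp P s (ccomp P u w) = ccomp P (ccomp W s u) w" by (rule ccomp_as[OF PC WC Z(2) XC w(1) u Z(4)])
 have a': "ccomp P s' (ccomp P u' w) = ccomp P (ccomp W s' u') w" by (rule ccomp_as[OF PC WC Z'(2) XC w(1) u' Z'(4)])
 have b: "ccomp P g (ccomp P u w) = ccomp P (ccomp W g u) w" by (rule ccomp_as[OF PC WC Z(2) YC w(1) u Z(5)])
 have b': "ccomp P g' (ccomp P u' w) = ccomp P (ccomp W g' u') w" by (rule ccomp_as[OF PC WC Z'(2) YC w(1) u' Z'(5)])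
 have 1: "hty A P X (ccomp P s' (ccomp P u' w)) pr"
 proof (rule hty_trans[OF PC XC _ _ pr _ w(2)])
  show "hty A P X (ccomp P s' (ccomp P u' w)) (ccomp P (ccomp W s u) w)" unfolding a' by (rule hty_comp2[OF PC WC XC w(1) c2 c1 hty_sym[OF WC XC c1 c2 h1]])
 qed (rule ccm[OF PC Z'(2) XC uw' Z'(4)], rule ccm[OF PC WC XC w(1) c1])
 have "hty A P Y (ccomp P g' (ccomp P u' w)) (ccomp P g (ccomp P u w))" unfolding b b' by (rule hty_comp2[OF PC WC YC w(1) c4 c3 hty_sym[OF WC YC c3 c4 h2]])
 moreover have "hty A P Y (ccomp P g (ccomp P u w)) (ccomp P g p)" by (rule lift_homotopic[OF Z(2,3) uw _ p YC Z(5)]) (simp add: a w(2))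
 ultimately have "hty A P Y (ccomp P g' (ccomp P u' w)) (ccomp P g p)"
  by (rule hty_trans[OF PC YC ccm[OF PC Z'(2) YC uw' Z'(5)] ccm[OF PC Z(2) YC uw Z(5)] ccm[OF PC Z(2) YC p(1) Z(5)]])
 thus "EX p':cmaps A P Z'. hty A P X (ccomp P s' p') pr & hty A P Y (ccomp P g' p') (ccomp P g p)" using uw' 1 by blast
next
 note YC = bcD(1)[OF Y] and Z = roofsD[OF r] and Z' = roofsD[OF r']
 assume "EX p':cmaps A P Z'. hty A P X (ccomp P s' p') pr & hty A P Y (ccomp P g' p') (ccomp P g p)"
 then obtain p' where p': "p' : cmaps A P Z'" "hty A P X (ccomp P s' p') pr" "hty A P Y (ccomp P g' p') (ccomp P g p)" by blast
 obtain b where b: "low b X" "low b Y" "low b Z" "low b Z'" using ex_low2[OF X Y Z(1) Z'(1)] by blast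
 let ?W = "trunc P b" and ?u = "tmap P b Z p" and ?u' = "tmap P b Z' p'"
 note WC = trunc_complex[OF PC, of b]
 note u = tmap_props(1)[OF b(1,3) Z(2) p(1)] and u' = tmap_props(1)[OF b(1,4) Z'(2) p'(1)]
 note c1 = ccm[OF WC Z(2) XC u Z(4)] and c2 = ccm[OF WC Z'(2) XC u' Z'(4)]
  and c3 = ccm[OF WC Z(2) YC u Z(5)] and c4 = ccm[OF WC Z'(2) YC u' Z'(5)]
 note e1 = ccomp_tmap[OF b(1,3) Z(2) p(1) XC Z(4)] and e2 = ccomp_tmap[OF b(1,4) Z'(2) p'(1) XC Z'(4)]
  and e3 = ccomp_tmap[OF b(1,3) Z(2) p(1) YC Z(5)] and e4 = ccomp_tmap[OF b(1,4) Z'(2) p'(1) YC Z'(5)]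
 have q: "qis A ?W X (ccomp ?W s ?u)" by (rule trunc_quasi_iso[OF b(1) c1]) (simp add: e1 p(2))
 have h1: "hty A ?W X (ccomp ?W s ?u) (ccomp ?W s' ?u')" by (rule trunc_homotopic'[OF b(1) XC c1 c2], unfold e1 e2)
   (rule hty_trans[OF PC XC ccm[OF PC Z(2) XC p(1) Z(4)] pr ccm[OF PC Z'(2) XC p'(1) Z'(4)] p(2)
    hty_sym[OF PC XC ccm[OF PC Z'(2) XC p'(1) Z'(4)] pr p'(2)]])
 have h2: "hty A ?W Y (ccomp ?W g ?u) (ccomp ?W g' ?u')" by (rule trunc_homotopic'[OF b(2) YC c3 c4], unfold e3 e4)
   (rule hty_sym[OF PC YC ccm[OF PC Z'(2) YC p'(1) Z'(5)] ccm[OF PC Z(2) YC p(1) Z(5)] p'(3)])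
 show "roof_eq A X Y (Z, s, g) (Z', s', g')" unfolding roof_eq_def using trunc_bc u u' q h1 h2 by auto
qed

lemma roof_class_cls:
 assumes Y: "Y : bcx A" and r: "(Z, s, g) : roofs A X Y"
  and p: "p : cmaps A P Z" "hty A P X (ccomp P s p) pr"
 shows "roof_class A X Y (Z, s, g) = cls X Y P pr (ccomp P g p)"
proof -
 have "r' : roof_class A X Y (Z, s, g) <-> r' : cls X Y P pr (ccomp P g p)" for r'
 proof (cases r')
  case (fields Z' s' g')
  thus ?thesis using roof_eq_iff[OF Y r _ p, of Z' s' g'] unfolding roof_class_def fields cls_mem by auto
 qed
 thus ?thesis by blast
qed

text \<open>Every chain map out of \<open>P\<close> comes from a roof with bounded apex. For fixed
  \<open>b\<close> all these roofs share apex and left leg, so two of them can be added.\<close>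

lemma std_roof:
 assumes Y: "Y : bcx A" and f: "f : cmaps A P Y" and b: "low b X" "low b Y"
 shows "(trunc P b, tmap P b X pr, tmap P b Y f) : roofs A X Y"
  "(trunc P b, tmap P b X pr, tmap P b Y f) : cls X Y P pr f"
proof -
 note YC = bcD(1)[OF Y]
 note t1 = tmap_props[OF b(1,1) XC pr] and t2 = tmap_props[OF b YC f]
 have "qis A (trunc P b) X (tmap P b X pr)" by (rule trunc_quasi_iso[OF b(1) t1(1)]) (simp add: t1(2) hty_refl[OF PC XC pr])
 thus r: "(trunc P b, tmap P b X pr, tmap P b Y f) : roofs A X Y" using trunc_bc t2(1) by (simp add: roofs_def)
 show "(trunc P b, tmap P b X pr, tmap P b Y f) : cls X Y P pr f"
  unfolding cls_mem using r tau_cmaps[OF PC] hty_refl[OF PC XC pr] hty_refl[OF PC YC f] t1(2) t2(2) by metis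
qed

lemma cls_dhom:
 assumes Y: "Y : bcx A" and f: "f : cmaps A P Y"
 shows "cls X Y P pr f : dhom A X Y"
proof -
 note YC = bcD(1)[OF Y]
 obtain b where b: "low b X" "low b Y" using ex_low2[OF X Y X X] by blast
 note t1 = tmap_props[OF b(1,1) XC pr] and t2 = tmap_props[OF b YC f]
 have "roof_class A X Y (trunc P b, tmap P b X pr, tmap P b Y f) = cls X Y P pr (ccomp P (tmap P b Y f) (tau P b))"
  by (rule roof_class_cls[OF Y std_roof(1)[OF Y f b] tau_cmaps[OF PC]]) (simp add: t1(2) hty_refl[OF PC XC pr])
 thus ?thesis unfolding t2(2) dhom_def using std_roof(1)[OF Y f b] by blast
qed

lemma dhom_cls:
 assumes Y: "Y : bcx A" and al: "al : dhom A X Y"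
 obtains f where "f : cmaps A P Y" "al = cls X Y P pr f"
proof -
 obtain r where r: "al = roof_class A X Y r" "r : roofs A X Y" using al unfolding dhom_def by (rule imageE)
 obtain Z s g where zs: "r = (Z, s, g)" by (cases r)
 note r' = r(2)[unfolded zs]
 obtain p where p: "p : cmaps A P Z" "hty A P X (ccomp P s p) pr" by (rule roof_lift[OF r'])
 show ?thesis by (rule that[OF ccm[OF PC roofsD(2)[OF r'] bcD(1)[OF Y] p(1) roofsD(5)[OF r']]])
   (use r(1) zs roof_class_cls[OF Y r' p] in simp)
qed

lemma cls_eq_iff:
 assumes Y: "Y : bcx A" and f: "f : cmaps A P Y" and g: "g : cmaps A P Y"
 shows "cls X Y P pr f = cls X Y P pr g <-> hty A P Y f g"
proof
 note YC = bcD(1)[OF Y]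
 assume e: "cls X Y P pr f = cls X Y P pr g"
 obtain b where b: "low b X" "low b Y" using ex_low2[OF X Y X X] by blast
 note t1 = tmap_props[OF b(1,1) XC pr] and t2 = tmap_props[OF b YC f]
 let ?W = "trunc P b" and ?s = "tmap P b X pr" and ?f = "tmap P b Y f"
 have "(?W, ?s, ?f) : cls X Y P pr g" using std_roof(2)[OF Y f b] unfolding e .
 then obtain p where r: "(?W, ?s, ?f) : roofs A X Y" and p: "p : cmaps A P ?W" "hty A P X (ccomp P ?s p) pr" "hty A P Y (ccomp P ?f p) g" unfolding cls_mem by blast
 note W = roofsD[OF r]
 have "hty A P Y (ccomp P ?f (tau P b)) (ccomp P ?f p)" by (rule lift_homotopic[OF W(2,3) tau_cmaps[OF PC] _ p(1,2) YC W(5)]) (simp add: t1(2) hty_refl[OF PC XC pr])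
 thus "hty A P Y f g" unfolding t2(2) by (rule hty_trans[OF PC YC f ccm[OF PC W(2) YC p(1) W(5)] g _ p(3)])
next
 note YC = bcD(1)[OF Y]
 assume h: "hty A P Y f g"
 have *: "cls X Y P pr f<=cls X Y P pr g" if f: "f : cmaps A P Y" and g: "g : cmaps A P Y" and h: "hty A P Y f g" for f g
 proof
  fix r assume r: "r : cls X Y P pr f"
  obtain Z s k where zs: "r = (Z, s, k)" by (cases r)
  obtain p where p: "(Z, s, k) : roofs A X Y" "p : cmaps A P Z" "hty A P X (ccomp P s p) pr" "hty A P Y (ccomp P k p) f" using r unfolding zs cls_mem by blast
  note Z = roofsD[OF p(1)]
  have "hty A P Y (ccomp P k p) g" by (rule hty_trans[OF PC YC ccm[OF PC Z(2) YC p(2) Z(5)] f g p(4) h])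
  thus "r : cls X Y P pr g" unfolding zs cls_mem using p by blast
 qed
 show "cls X Y P pr f = cls X Y P pr g" using *[OF f g h] *[OF g f hty_sym[OF PC YC f g h]] by blast
qed

lemma dmap_cls:
 assumes Y: "Y : bcx A" and f: "f : cmaps A X Y"
 shows "dmap A X Y f = cls X Y P pr (ccomp P f pr)" unfolding dmap_def
proof (rule roof_class_cls[OF Y _ pr])
 show "(X, cid X, f) : roofs A X Y" using X f qis_id[OF XC] by (simp add: roofs_def)
 show "hty A P X (ccomp P (cid X) pr) pr" using ccomp_cid(2)[OF PC XC pr] hty_refl[OF PC XC pr] by simp
qed

text \<open>\<open>dadd\<close> is a union of classes. They are all equal to the asserted one, and
  the family is not empty since the standard roofs of \<open>f\<close> and \<open>g\<close> have the
  same left leg.\<close>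

lemma dadd_cls:
 assumes Y: "Y : bcx A" and f: "f : cmaps A P Y" and g: "g : cmaps A P Y"
 shows "dadd A X Y (cls X Y P pr f) (cls X Y P pr g) = cls X Y P pr (cadd P Y f g)"
proof -
 note YC = bcD(1)[OF Y]
 have ca: "(%i. %z:cr Z$i. f0 i z +[Y$i] g0 i z) = cadd Z Y f0 g0" for Z f0 g0 by (simp add: cadd_def)
 have one: "roof_class A X Y (Z, s, cadd Z Y f0 g0) = cls X Y P pr (cadd P Y f g)"
  if r: "(Z, s, f0) : cls X Y P pr f" "(Z, s, g0) : cls X Y P pr g" for Z s f0 g0
 proof -
  obtain p where p: "(Z, s, f0) : roofs A X Y" "p : cmaps A P Z" "hty A P X (ccomp P s p) pr" "hty A P Y (ccomp P f0 p) f" using r(1) unfolding cls_mem by blast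
  obtain q where q: "(Z, s, g0) : roofs A X Y" "q : cmaps A P Z" "hty A P X (ccomp P s q) pr" "hty A P Y (ccomp P g0 q) g" using r(2) unfolding cls_mem by blast
  note Z = roofsD[OF p(1)] and g0 = roofsD(5)[OF q(1)]
  have sum: "cadd Z Y f0 g0 : cmaps A Z Y" by (rule cadd_cmaps[OF Z(2) YC Z(5) g0])
  have r': "(Z, s, cadd Z Y f0 g0) : roofs A X Y" using Z sum by (simp add: roofs_def)
  have e: "ccomp P (cadd Z Y f0 g0) p = cadd P Y (ccomp P f0 p) (ccomp P g0 p)"
   by (rule cmaps_eqI[OF ccm[OF PC Z(2) YC p(2) sum] cadd_cmaps[OF PC YC ccm[OF PC Z(2) YC p(2) Z(5)] ccm[OF PC Z(2) YC p(2) g0]]])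
    (use cmr(1)[OF p(2) PC Z(2)] in simp)
  have "hty A P Y (ccomp P g0 p) g"
   by (rule hty_trans[OF PC YC ccm[OF PC Z(2) YC p(2) g0] ccm[OF PC Z(2) YC q(2) g0] g lift_homotopic[OF Z(2,3) p(2,3) q(2,3) YC g0] q(4)])
  hence "hty A P Y (cadd P Y (ccomp P f0 p) (ccomp P g0 p)) (cadd P Y f g)" by (rule hty_cadd[OF PC YC ccm[OF PC Z(2) YC p(2) Z(5)] f ccm[OF PC Z(2) YC p(2) g0] g p(4)])
  hence "cls X Y P pr (ccomp P (cadd Z Y f0 g0) p) = cls X Y P pr (cadd P Y f g)"
   unfolding e[symmetric] using cls_eq_iff[OF Y ccm[OF PC Z(2) YC p(2) sum] cadd_cmaps[OF PC YC f g]] by blast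
  thus ?thesis using roof_class_cls[OF Y r' p(2,3)] by simp
 qed
 obtain b where b: "low b X" "low b Y" using ex_low2[OF X Y X X] by blast
 have "EX Z s f0 g0. (Z, s, f0) : cls X Y P pr f & (Z, s, g0) : cls X Y P pr g" using std_roof(2)[OF Y f b] std_roof(2)[OF Y g b] by blast
 hence ne: "{roof_class A X Y (Z, s, cadd Z Y f0 g0) | Z s f0 g0. (Z, s, f0) : cls X Y P pr f & (Z, s, g0) : cls X Y P pr g} = {cls X Y P pr (cadd P Y f g)}"
  using one by blast
 show ?thesis unfolding dadd_def ca ne by simp
qed

text \<open>Composition amounts to lifting \<open>f\<close> to the resolution of \<open>Y\<close>
  and composing chain maps. All classes in the union that defines \<open>dcomp\<close> are equal
  because lifts along quasi-isomorphisms are unique up to homotopy.\<close>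

lemma dcomp_cls:
 assumes Y: "Y : bcx A" and resY: "projres c' Y Q rh" and Z: "Z : bcx A"
  and f: "f : cmaps A P Y" and g: "g : cmaps A Q Z" and l: "l : cmaps A P Q" "hty A P Y (ccomp P rh l) f"
 shows "dcomp A X Y Z (cls Y Z Q rh g) (cls X Y P pr f) = cls X Z P pr (ccomp P g l)"
proof -
 note YC = bcD(1)[OF Y] and ZC = bcD(1)[OF Z]
 note Qr = prD[OF resY]
 have one: "roof_class A X Z (W, ccomp W s u, ccomp W k v) = cls X Z P pr (ccomp P g l)"
  if r: "(U, s, f0) : cls X Y P pr f" "(V, t, k) : cls Y Z Q rh g" "W : bcx A" "qis A W U u" "v : cmaps A W V"
   "hty A W Y (ccomp W f0 u) (ccomp W t v)" for U s f0 V t k W u v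
 proof -
  obtain p where p: "(U, s, f0) : roofs A X Y" "p : cmaps A P U" "hty A P X (ccomp P s p) pr" "hty A P Y (ccomp P f0 p) f" using r(1) unfolding cls_mem by blast
  obtain q where q: "(V, t, k) : roofs A Y Z" "q : cmaps A Q V" "hty A Q Y (ccomp Q t q) rh" "hty A Q Z (ccomp Q k q) g" using r(2) unfolding cls_mem by blast
  note U = roofsD[OF p(1)] and V = roofsD[OF q(1)] and WC = bcD(1)[OF r(3)]
  note u = qis_cmaps[OF r(4)] and v = r(5)
  have su: "qis A W X (ccomp W s u)" by (rule qis_comp[OF WC U(2) XC r(4) U(3)])
  have kv: "ccomp W k v : cmaps A W Z" by (rule ccm[OF WC V(2) ZC v V(5)])
  have rr: "(W, ccomp W s u, ccomp W k v) : roofs A X Z" using r(3) su kv by (simp add: roofs_def)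
  obtain w where w: "w : cmaps A P W" "hty A P X (ccomp P (ccomp W s u) w) pr" by (rule roof_lift[OF rr])
  note uw = ccm[OF PC WC U(2) w(1) u] and vw = ccm[OF PC WC V(2) w(1) v] and ql = ccm[OF PC Qr(2) V(2) l(1) q(2)]
  have a1: "ccomp P s (ccomp P u w) = ccomp P (ccomp W s u) w" by (rule ccomp_as[OF PC WC U(2) XC w(1) u U(4)])
  have a2: "ccomp P f0 (ccomp P u w) = ccomp P (ccomp W f0 u) w" by (rule ccomp_as[OF PC WC U(2) YC w(1) u U(5)])
  have a3: "ccomp P t (ccomp P v w) = ccomp P (ccomp W t v) w" by (rule ccomp_as[OF PC WC V(2) YC w(1) v V(4)])
  have a4: "ccomp P k (ccomp P v w) = ccomp P (ccomp W k v) w" by (rule ccomp_as[OF PC WC V(2) ZC w(1) v V(5)])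
  have a5: "ccomp P t (ccomp P q l) = ccomp P (ccomp Q t q) l" by (rule ccomp_as[OF PC Qr(2) V(2) YC l(1) q(2) V(4)])
  have a6: "ccomp P k (ccomp P q l) = ccomp P (ccomp Q k q) l" by (rule ccomp_as[OF PC Qr(2) V(2) ZC l(1) q(2) V(5)])
  note f0u = ccm[OF WC U(2) YC u U(5)] and tv = ccm[OF WC V(2) YC v V(4)]
  note tq = ccm[OF Qr(2) V(2) YC q(2) V(4)] and kq = ccm[OF Qr(2) V(2) ZC q(2) V(5)]
  note c_f0uw = ccm[OF PC U(2) YC uw U(5)] and c_tvw = ccm[OF PC V(2) YC vw V(4)] and c_tql = ccm[OF PC V(2) YC ql V(4)]
   and c_f0p = ccm[OF PC U(2) YC p(2) U(5)] and c_rl = ccm[OF PC Qr(2) YC l(1) Qr(5)]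
  have h1: "hty A P Y (ccomp P f0 (ccomp P u w)) (ccomp P f0 p)" by (rule lift_homotopic[OF U(2,3) uw _ p(2,3) YC U(5)]) (simp add: a1 w(2))
  have h2: "hty A P Y (ccomp P f0 (ccomp P u w)) f" by (rule hty_trans[OF PC YC c_f0uw c_f0p f h1 p(4)])
  have h3: "hty A P Y (ccomp P t (ccomp P v w)) (ccomp P f0 (ccomp P u w))" unfolding a2 a3 by (rule hty_comp2[OF PC WC YC w(1) tv f0u hty_sym[OF WC YC f0u tv r(6)]])
  have h4: "hty A P Y (ccomp P t (ccomp P v w)) f" by (rule hty_trans[OF PC YC c_tvw c_f0uw f h3 h2])
  have h5: "hty A P Y (ccomp P t (ccomp P q l)) (ccomp P rh l)" unfolding a5 by (rule hty_comp2[OF PC Qr(2) YC l(1) tq Qr(5) q(3)])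
  have h6: "hty A P Y (ccomp P t (ccomp P q l)) f" by (rule hty_trans[OF PC YC c_tql c_rl f h5 l(2)])
  have h7: "hty A P Y (ccomp P t (ccomp P v w)) (ccomp P t (ccomp P q l))" by (rule hty_trans[OF PC YC c_tvw f c_tql h4 hty_sym[OF PC YC c_tql f h6]])
  have h8: "hty A P V (ccomp P v w) (ccomp P q l)" by (rule lift_unique[OF bP V(2) YC V(3) vw ql h7])
  have h9: "hty A P Z (ccomp P k (ccomp P v w)) (ccomp P k (ccomp P q l))" by (rule hty_comp[OF PC V(2) ZC vw ql V(5) h8])
  have h10: "hty A P Z (ccomp P k (ccomp P q l)) (ccomp P g l)" unfolding a6 by (rule hty_comp2[OF PC Qr(2) ZC l(1) kq g q(4)])
  note c1 = ccm[OF PC V(2) ZC vw V(5)] and c2 = ccm[OF PC V(2) ZC ql V(5)] and c3 = ccm[OF PC Qr(2) ZC l(1) g]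
  have h11: "hty A P Z (ccomp P (ccomp W k v) w) (ccomp P g l)" using hty_trans[OF PC ZC c1 c2 c3 h9 h10] unfolding a4 .
  have "roof_class A X Z (W, ccomp W s u, ccomp W k v) = cls X Z P pr (ccomp P (ccomp W k v) w)" by (rule roof_class_cls[OF Z rr w])
  also have "... = cls X Z P pr (ccomp P g l)" using cls_eq_iff[OF Z c1[unfolded a4] c3] h11 by blast
  finally show ?thesis .
 qed
 obtain b1 where b1: "low b1 Y" "low b1 Z" using ex_low2[OF Y Z Y Y] by blast
 obtain b2 where b2: "!!b. b<=b2 ==> low b X" "!!b. b<=b2 ==> low b Y" using ex_low[OF X] ex_low[OF Y] by (metis min.boundedE)
 \<comment> \<open>The defining union still has to be nonempty. \<open>V\<close> is fixed first,
   because the truncation level \<open>b\<close> of \<open>P\<close> must be low with respect to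
   \<open>V\<close> too.\<close>
 let ?V = "trunc Q b1"
 have kV: "EX t k q. (?V, t, k) : cls Y Z Q rh g & q : cmaps A Q ?V & (?V, t, k) : roofs A Y Z & hty A Q Y (ccomp Q t q) rh"
 proof -
  have "EX t k. (?V, t, k) : cls Y Z Q rh g" using artin_alg.std_roof(2)[OF artin_alg_axioms Y resY Z g b1] by blast
  thus ?thesis unfolding cls_mem by blast
 qed
 then obtain t k q where V: "(?V, t, k) : cls Y Z Q rh g" "q : cmaps A Q ?V" "(?V, t, k) : roofs A Y Z" "hty A Q Y (ccomp Q t q) rh" by blast
 note Vr = roofsD[OF V(3)]
 obtain b3 where b3: "!!b. b<=b3 ==> low b ?V" using ex_low[OF Vr(1)] by blast
 define b where "b = min b2 b3"
 have b: "low b X" "low b Y" "low b ?V" using b2 b3 by (auto simp: b_def)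
 let ?U = "trunc P b"
 note ql = ccm[OF PC Qr(2) Vr(2) l(1) V(2)]
 note T = trunc_complex[OF PC, of b]
 let ?v = "tmap P b ?V (ccomp P q l)"
 note v = tmap_props[OF b(1,3) Vr(2) ql] and f0 = tmap_props[OF b(1,2) YC f]
 have U: "(?U, tmap P b X pr, tmap P b Y f) : cls X Y P pr f" by (rule std_roof(2)[OF Y f b(1,2)])
 have "hty A ?U Y (tmap P b Y f) (ccomp ?U t ?v)"
 proof (rule trunc_homotopic'[OF b(2) YC f0(1) ccm[OF T Vr(2) YC v(1) Vr(4)]])
  have a5: "ccomp P t (ccomp P q l) = ccomp P (ccomp Q t q) l" by (rule ccomp_as[OF PC Qr(2) Vr(2) YC l(1) V(2) Vr(4)])
  have h5: "hty A P Y (ccomp P t (ccomp P q l)) (ccomp P rh l)" unfolding a5 by (rule hty_comp2[OF PC Qr(2) YC l(1) ccm[OF Qr(2) Vr(2) YC V(2) Vr(4)] Qr(5) V(4)])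
  have c: "ccomp P t (ccomp P q l) : cmaps A P Y" by (rule ccm[OF PC Vr(2) YC ql Vr(4)])
  have "hty A P Y (ccomp P t (ccomp P q l)) f" by (rule hty_trans[OF PC YC c ccm[OF PC Qr(2) YC l(1) Qr(5)] f h5 l(2)])
  thus "hty A P Y (ccomp P (tmap P b Y f) (tau P b)) (ccomp P (ccomp ?U t ?v) (tau P b))"
   unfolding f0(2) ccomp_tmap[OF b(1,3) Vr(2) ql YC Vr(4)] by (rule hty_sym[OF PC YC c f])
 qed
 moreover have "ccomp ?U (tmap P b Y f) (cid ?U) = tmap P b Y f" by (rule ccomp_cid(1)[OF T YC f0(1)])
 ultimately have "EX U s f0 V t k W u v. (U, s, f0) : cls X Y P pr f & (V, t, k) : cls Y Z Q rh g & W : bcx A &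
  qis A W U u & v : cmaps A W V & hty A W Y (ccomp W f0 u) (ccomp W t v)" using U V(1) trunc_bc qis_id[OF T] v(1) by metis
 note ex = this
 have U_eq: "\<Union>S = x" if "x : S" "!!y. y : S ==> y = x" for S and x :: "'a roof set" using that by blast
 show ?thesis unfolding dcomp_def
 proof (rule U_eq)
  show "cls X Z P pr (ccomp P g l) : {roof_class A X Z (W, ccomp W s u, ccomp W k v) | U s f0 V t k W u v.
   (U, s, f0) : cls X Y P pr f & (V, t, k) : cls Y Z Q rh g & W : bcx A &
   qis A W U u & v : cmaps A W V & hty A W Y (ccomp W f0 u) (ccomp W t v)}" using ex by (elim exE conjE, intro CollectI exI conjI) (rule one[symmetric], assumption+)
 next
  fix y assume "y : {roof_class A X Z (W, ccomp W s u, ccomp W k v) | U s f0 V t k W u v.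
   (U, s, f0) : cls X Y P pr f & (V, t, k) : cls Y Z Q rh g & W : bcx A &
   qis A W U u & v : cmaps A W V & hty A W Y (ccomp W f0 u) (ccomp W t v)}"
  thus "y = cls X Z P pr (ccomp P g l)" by (elim CollectE exE conjE) (simp only:, rule one, assumption+)
 qed
qed

end
end

section \<open>Categories and equivalences\<close>

locale category =
 fixes C :: "('o, 'h) cat"
 assumes Id_closed [simp]: "X : Ob C ==> Id C X : Hom C X X"
  and Comp_closed [simp]: "X : Ob C ==> Y : Ob C ==> Z : Ob C ==> f : Hom C X Y ==> g : Hom C Y Z ==> Comp C X Y Z g f : Hom C X Z"
  and Comp_Id [simp]: "X : Ob C ==> Y : Ob C ==> f : Hom C X Y ==> Comp C X X Y f (Id C X) = f"
  and Id_Comp [simp]: "X : Ob C ==> Y : Ob C ==> f : Hom C X Y ==> Comp C X Y Y (Id C Y) f = f"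
  and assoc: "W : Ob C ==> X : Ob C ==> Y : Ob C ==> Z : Ob C ==> f : Hom C W X ==> g : Hom C X Y ==> h : Hom C Y Z ==>
   Comp C W Y Z h (Comp C W X Y g f) = Comp C W X Z (Comp C X Y Z h g) f"
begin

lemma isoE:
 assumes "iso_mor C X Y f"
 obtains g where "f : Hom C X Y" "g : Hom C Y X" "Comp C X Y X g f = Id C X" "Comp C Y X Y f g = Id C Y" using assms unfolding iso_mor_def by blast

lemma iso_sym:
 assumes "iso_mor C X Y f"
 obtains g where "iso_mor C Y X g" using assms unfolding iso_mor_def by blast

lemma iso_Id: "X : Ob C ==> iso_mor C X X (Id C X)" unfolding iso_mor_def using Id_closed Comp_Id by blast

lemma iso_monic:
 assumes O: "X : Ob C" "Y : Ob C" "Z : Ob C" and u: "iso_mor C Y Z u" and f: "f : Hom C X Y" "g : Hom C X Y"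
  and e: "Comp C X Y Z u f = Comp C X Y Z u g"
 shows "f=g"
proof -
 obtain v where v: "u : Hom C Y Z" "v : Hom C Z Y" "Comp C Y Z Y v u = Id C Y" using u by (rule isoE)
 have "k = Comp C X Z Y v (Comp C X Y Z u k)" if "k : Hom C X Y" for k using assoc[OF O(1,2,3,2) that v(1,2)] v(3) that O by simp
 thus ?thesis using f e by metis
qed

lemma iso_epic:
 assumes O: "X : Ob C" "Y : Ob C" "Z : Ob C" and u: "iso_mor C X Y u" and f: "f : Hom C Y Z" "g : Hom C Y Z"
  and e: "Comp C X Y Z f u = Comp C X Y Z g u"
 shows "f=g"
proof -
 obtain v where v: "u : Hom C X Y" "v : Hom C Y X" "Comp C Y X Y u v = Id C Y" using u by (rule isoE)
 have "k = Comp C Y X Z (Comp C X Y Z k u) v" if "k : Hom C Y Z" for k using assoc[OF O(2,1,2,3) v(2,1) that] v(3) that O by simp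
 thus ?thesis using f e by metis
qed

end

text \<open>\<open>Hom(X, Y) = 0\<close> without reference to addition: the hom sets in question
  contain a zero map, so having at most one element is the same. Every equivalence of categories
  preserves and reflects it.\<close>

definition hz :: "('o, 'h) cat => 'o => 'o => bool" where
 "hz C X Y <-> (ALL al:Hom C X Y. ALL be:Hom C X Y. al = be)"

lemma (in category) hz_iso:
 assumes O: "X : Ob C" "Y : Ob C" "X' : Ob C" "Y' : Ob C" and u: "iso_mor C X X' u" and v: "iso_mor C Y' Y v"
  and hz: "hz C X Y"
 shows "hz C X' Y'" unfolding hz_def
proof (intro ballI)
 fix al be assume ab: "al : Hom C X' Y'" "be : Hom C X' Y'"
 obtain u' where u': "u : Hom C X X'" using u by (rule isoE)
 obtain v' where v': "v : Hom C Y' Y" using v by (rule isoE)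
 have "Comp C X Y' Y v (Comp C X X' Y' al u) = Comp C X Y' Y v (Comp C X X' Y' be u)" using hz ab u' v' O unfolding hz_def by simp
 hence "Comp C X X' Y' al u = Comp C X X' Y' be u" by (rule iso_monic[OF O(1,4,2) v Comp_closed[OF O(1,3,4) u' ab(1)] Comp_closed[OF O(1,3,4) u' ab(2)]])
 thus "al = be" by (rule iso_epic[OF O(1,3,4) u ab])
qed

lemma nat_iso_faithful:
 assumes C: "category C" and F: "is_functor C D F" and G: "is_functor D C G" and s: "nat_iso C C (fcomp G F) fid s"
  and O: "X : Ob C" "Y : Ob C" and f: "f : Hom C X Y" "g : Hom C X Y" and e: "fmap F X Y f = fmap F X Y g"
 shows "f=g"
proof -
 interpret category C by (rule C)
 have Ob: "fob F X : Ob D" "fob G (fob F X) : Ob C" using F G O unfolding is_functor_def by auto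
 have i: "iso_mor C (fob G (fob F X)) X (s X)" using s O(1) unfolding nat_iso_def fcomp_def fid_def by simp
 have n: "Comp C (fob G (fob F X)) (fob G (fob F Y)) Y (s Y) (fmap G (fob F X) (fob F Y) (fmap F X Y k)) = Comp C (fob G (fob F X)) X Y k (s X)"
  if "k : Hom C X Y" for k using s O that unfolding nat_iso_def fcomp_def fid_def by simp
 show ?thesis by (rule iso_epic[OF Ob(2) O i f]) (use n[OF f(1)] n[OF f(2)] e in simp)
qed

locale equiv_cat = C: category C + D: category D
 for C :: "('o, 'h) cat" and D :: "('p, 'k) cat" and F :: "('o, 'h, 'p, 'k) funct" +
 assumes equiv: "cat_equivalence C D F"
begin

lemma fob_closed [simp]: "X : Ob C ==> fob F X : Ob D"
 and fmap_closed [simp]: "X : Ob C ==> Y : Ob C ==> f : Hom C X Y ==> fmap F X Y f : Hom D (fob F X) (fob F Y)"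
 and fmap_Id: "X : Ob C ==> fmap F X X (Id C X) = Id D (fob F X)"
 and fmap_Comp: "X : Ob C ==> Y : Ob C ==> Z : Ob C ==> f : Hom C X Y ==> g : Hom C Y Z ==>
  fmap F X Z (Comp C X Y Z g f) = Comp D (fob F X) (fob F Y) (fob F Z) (fmap F Y Z g) (fmap F X Y f)" using equiv unfolding cat_equivalence_def is_functor_def by auto

lemma adjE:
 obtains G s t where "is_functor C D F" "is_functor D C G" "nat_iso C C (fcomp G F) fid s" "nat_iso D D (fcomp F G) fid t"
 using equiv unfolding cat_equivalence_def by blast

lemma faithful:
 assumes "X : Ob C" "Y : Ob C" "f : Hom C X Y" "g : Hom C X Y" "fmap F X Y f = fmap F X Y g"
 shows "f=g" by (rule adjE) (rule nat_iso_faithful[OF C.category_axioms _ _ _ assms])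

lemma ess_surj:
 assumes W: "W : Ob D"
 obtains V v where "V : Ob C" "iso_mor D (fob F V) W v"
proof -
 obtain G s t where G: "is_functor D C G" "nat_iso D D (fcomp F G) fid t" by (rule adjE)
 have "fob G W : Ob C" using G(1) W unfolding is_functor_def by simp
 moreover have "iso_mor D (fob F (fob G W)) W (t W)" using G(2) W unfolding nat_iso_def fcomp_def fid_def by simp
 ultimately show ?thesis by (rule that)
qed

text \<open>The preimage of \<open>h\<close> is \<open>G h\<close> conjugated by the natural
  isomorphism from \<open>G F\<close> to the identity. Its image under \<open>F\<close> agrees with
  \<open>h\<close> after applying \<open>G\<close>, and \<open>G\<close> is faithful too.\<close>

lemma full:
 assumes O: "X : Ob C" "Y : Ob C" and h: "h : Hom D (fob F X) (fob F Y)"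
 obtains f where "f : Hom C X Y" "fmap F X Y f = h"
proof -
 obtain G s t where F: "is_functor C D F" and G: "is_functor D C G" and s: "nat_iso C C (fcomp G F) fid s" and t: "nat_iso D D (fcomp F G) fid t" by (rule adjE)
 let ?X = "fob G (fob F X)" and ?Y = "fob G (fob F Y)" and ?h = "fmap G (fob F X) (fob F Y) h"
 have Ob: "?X : Ob C" "?Y : Ob C" using G O unfolding is_functor_def by auto
 have i: "iso_mor C ?X X (s X)" "iso_mor C ?Y Y (s Y)" using s O unfolding nat_iso_def fcomp_def fid_def by auto
 obtain s' where s': "s X : Hom C ?X X" "s' : Hom C X ?X" "Comp C ?X X ?X s' (s X) = Id C ?X" using i(1) by (rule C.isoE)
 obtain r' where sY: "s Y : Hom C ?Y Y" using i(2) by (rule C.isoE)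
 have Gh: "?h : Hom C ?X ?Y" using G h O unfolding is_functor_def by simp
 let ?f = "Comp C X ?X Y (Comp C ?X ?Y Y (s Y) ?h) s'"
 have f: "?f : Hom C X Y" using Gh sY s' O Ob by simp
 have n: "Comp C ?X ?Y Y (s Y) (fmap G (fob F X) (fob F Y) (fmap F X Y ?f)) = Comp C ?X X Y ?f (s X)" using s O f unfolding nat_iso_def fcomp_def fid_def by simp
 have "Comp C ?X X Y ?f (s X) = Comp C ?X ?X Y (Comp C ?X ?Y Y (s Y) ?h) (Comp C ?X X ?X s' (s X))" by (rule C.assoc[symmetric]) (use O Ob s' sY Gh in auto)
 also have "... = Comp C ?X ?Y Y (s Y) ?h" unfolding s'(3) using Gh sY Ob O by simp
 finally have e: "Comp C ?X ?Y Y (s Y) (fmap G (fob F X) (fob F Y) (fmap F X Y ?f)) = Comp C ?X ?Y Y (s Y) ?h" using n by simp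
 have "fmap G (fob F X) (fob F Y) (fmap F X Y ?f) : Hom C ?X ?Y" using G f O unfolding is_functor_def by simp
 hence "fmap G (fob F X) (fob F Y) (fmap F X Y ?f) = ?h" by (rule C.iso_monic[OF Ob O(2) i(2) _ Gh e])
 hence "fmap F X Y ?f = h" by (intro nat_iso_faithful[OF D.category_axioms G F t _ _ _ h]) (use O f in auto)
 thus ?thesis by (rule that[OF f])
qed

lemma hz_fob:
 assumes O: "X : Ob C" "Y : Ob C"
 shows "hz D (fob F X) (fob F Y) <-> hz C X Y"
proof
 assume "hz D (fob F X) (fob F Y)"
 thus "hz C X Y" using faithful[OF O] fmap_closed[OF O] unfolding hz_def by blast
next
 assume h: "hz C X Y"
 show "hz D (fob F X) (fob F Y)" unfolding hz_def
 proof (intro ballI)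
  fix al be assume ab: "al : Hom D (fob F X) (fob F Y)" "be : Hom D (fob F X) (fob F Y)"
  obtain f where f: "f : Hom C X Y" "fmap F X Y f = al" by (rule full[OF O ab(1)])
  obtain g where g: "g : Hom C X Y" "fmap F X Y g = be" by (rule full[OF O ab(2)])
  have "f=g" using h f(1) g(1) unfolding hz_def by blast
  thus "al = be" using f(2) g(2) by simp
 qed
qed

end

section \<open>The derived category\<close>

lemma (in base_ring) zcm: "cpx A X ==> cpx A Y ==> (zmp X Y) : cmaps A X Y" by (rule cmapsI) (auto intro: hzmap)

lemma (in base_ring) conc_cmap:
 fixes X :: "('a, 'm) cplx" and Y :: "('a, 'n) cplx"
 assumes X: "cpx A X" and Y: "cpx A Y" and u: "u : lhom A X$j Y$j"
  and d: "PROP kz X j Y$j u" "!!x. x IN X$j ==> dif Y j (u x) = 0[Y$(j+1)]"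
 shows "conc X Y j u : cmaps A X Y" (is "?f : _")
proof (rule cmapsI)
 fix i
 show "?f i : lhom A X$i Y$i" using u hzmap[OF xlm[OF X] xlm[OF Y]] by simp
 fix x assume x: "x IN X$i"
 consider "i=j" | "i+1 = j" | "i~=j" "i+1~=j" by blast
 thus "?f (i+1) (dif X i x) = dif Y i (?f i x)"
 proof cases
  case 2
  hence "i = j-1" by simp
  thus ?thesis using d(1)[of x] x Y dif_rules(2)[OF Y, of "j-1"] by simp
 qed (use x d(2)[of x] X Y in auto)
qed

lemma (in base_ring) cmap_to_stalk:
 assumes "cpx A P" "lmod A M" "u : lhom A P$j M" "PROP kz P j M u"
 shows "(conc P (stalk M j) j u) : cmaps A P (stalk M j)"
 by (rule conc_cmap[OF assms(1) stalk_complex]) (use assms stalk_dif[of _ M j j] hcl[OF assms(3)] in auto)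

context artin_alg
begin

lemma ex_res:
 assumes X: "X : bcx A"
 obtains c P pr where "projres c X P pr"
proof -
 obtain m where m: "!!i. i>m ==> zm X$i" using bcomplexes_bounds[OF X] by blast
 show ?thesis by (rule ex_projres[OF X acyc_zero[OF bcD(1)[OF X] m]]) (blast, rule that)
qed

lemma Db_simps [simp]: "Ob (Db A) = bcx A" "Hom (Db A) = dhom A" "Comp (Db A) = dcomp A" "Id (Db A) X = dmap A X X (cid X)" by (simp_all add: Db_def)

lemma dmap_cid:
 assumes X: "X : bcx A" and P: "projres c X P pr"
 shows "dmap A X X (cid X) = cls X X P pr pr" using dmap_cls[OF X P X cid_cmaps[OF bcD(1)[OF X]]]
  ccomp_cid(2)[OF prD(2)[OF P] bcD(1)[OF X] prD(5)[OF P]] by simp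

lemma clift:
 assumes X: "projres c X P pr" and Y: "Y : bcx A" "projres c' Y Q rh" and f: "f : cmaps A P Y"
 obtains l where "l : cmaps A P Q" "hty A P Y (ccomp P rh l) f" by (rule lift_exists[OF prD(1)[OF X] prD(2)[OF Y(2)] bcD(1)[OF Y(1)] prD(4)[OF Y(2)] f])

lemma dcomp_Id:
 assumes X: "X : bcx A" and Y: "Y : bcx A" and f: "f : dhom A X Y"
 shows "dcomp A X X Y f (dmap A X X (cid X)) = f" "dcomp A X Y Y (dmap A Y Y (cid Y)) f = f"
proof -
 obtain c P pr where P: "projres c X P pr" by (rule ex_res[OF X])
 obtain c' Q rh where Q: "projres c' Y Q rh" by (rule ex_res[OF Y])
 obtain g where g: "g : cmaps A P Y" "f = cls X Y P pr g" by (rule dhom_cls[OF X P Y f])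
 note XC = bcD(1)[OF X] and YC = bcD(1)[OF Y] and Pr = prD[OF P] and Qr = prD[OF Q]
 have "hty A P X (ccomp P pr (cid P)) pr" unfolding ccomp_cid(1)[OF Pr(2) XC Pr(5)] by (rule hty_refl[OF Pr(2) XC Pr(5)])
 from dcomp_cls[OF X P X P Y Pr(5) g(1) cid_cmaps[OF Pr(2)] this]
 show "dcomp A X X Y f (dmap A X X (cid X)) = f" unfolding g(2) dmap_cid[OF X P] ccomp_cid(1)[OF Pr(2) YC g(1)] .
 obtain l where l: "l : cmaps A P Q" "hty A P Y (ccomp P rh l) g" by (rule clift[OF P Y Q g(1)])
 have "dcomp A X Y Y (cls Y Y Q rh rh) f = cls X Y P pr (ccomp P rh l)" unfolding g(2) by (rule dcomp_cls[OF X P Y Q Y g(1) Qr(5) l])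
 also have "... = f" unfolding g(2) using cls_eq_iff[OF X P Y ccm[OF Pr(2) Qr(2) YC l(1) Qr(5)] g(1)] l(2) by simp
 finally show "dcomp A X Y Y (dmap A Y Y (cid Y)) f = f" unfolding dmap_cid[OF Y Q] .
qed

lemma dcomp_closed:
 assumes X: "X : bcx A" and Y: "Y : bcx A" and Z: "Z : bcx A" and f: "f : dhom A X Y" and g: "g : dhom A Y Z"
 shows "dcomp A X Y Z g f : dhom A X Z"
proof -
 obtain c P pr where P: "projres c X P pr" by (rule ex_res[OF X])
 obtain c' Q rh where Q: "projres c' Y Q rh" by (rule ex_res[OF Y])
 obtain f' where f': "f' : cmaps A P Y" "f = cls X Y P pr f'" by (rule dhom_cls[OF X P Y f])
 obtain g' where g': "g' : cmaps A Q Z" "g = cls Y Z Q rh g'" by (rule dhom_cls[OF Y Q Z g])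
 obtain l where l: "l : cmaps A P Q" "hty A P Y (ccomp P rh l) f'" by (rule clift[OF P Y Q f'(1)])
 show ?thesis unfolding f'(2) g'(2) dcomp_cls[OF X P Y Q Z f'(1) g'(1) l] by (rule cls_dhom[OF X P Z ccm[OF prD(2)[OF P] prD(2)[OF Q] bcD(1)[OF Z] l(1) g'(1)]])
qed

lemma dcomp_assoc:
 assumes O: "W : bcx A" "X : bcx A" "Y : bcx A" "Z : bcx A"
  and f: "f : dhom A W X" and g: "g : dhom A X Y" and h: "h : dhom A Y Z"
 shows "dcomp A W Y Z h (dcomp A W X Y g f) = dcomp A W X Z (dcomp A X Y Z h g) f"
proof -
 obtain c P pr where P: "projres c W P pr" by (rule ex_res[OF O(1)])
 obtain c' Q rh where Q: "projres c' X Q rh" by (rule ex_res[OF O(2)])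
 obtain c'' S sg where S: "projres c'' Y S sg" by (rule ex_res[OF O(3)])
 obtain f' where f': "f' : cmaps A P X" "f = cls W X P pr f'" by (rule dhom_cls[OF O(1) P O(2) f])
 obtain g' where g': "g' : cmaps A Q Y" "g = cls X Y Q rh g'" by (rule dhom_cls[OF O(2) Q O(3) g])
 obtain h' where h': "h' : cmaps A S Z" "h = cls Y Z S sg h'" by (rule dhom_cls[OF O(3) S O(4) h])
 obtain l where l: "l : cmaps A P Q" "hty A P X (ccomp P rh l) f'" by (rule clift[OF P O(2) Q f'(1)])
 obtain k where k: "k : cmaps A Q S" "hty A Q Y (ccomp Q sg k) g'" by (rule clift[OF Q O(3) S g'(1)])
 note Pr = prD[OF P] and Qr = prD[OF Q] and Sr = prD[OF S]
 note YC = bcD(1)[OF O(3)] and ZC = bcD(1)[OF O(4)]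
 note kl = ccm[OF Pr(2) Qr(2) Sr(2) l(1) k(1)]
 have "hty A P Y (ccomp P sg (ccomp P k l)) (ccomp P g' l)" unfolding ccomp_as[OF Pr(2) Qr(2) Sr(2) YC l(1) k(1) Sr(5)]
  by (rule hty_comp2[OF Pr(2) Qr(2) YC l(1) ccm[OF Qr(2) Sr(2) YC k(1) Sr(5)] g'(1) k(2)])
 note L = dcomp_cls[OF O(1) P O(3) S O(4) ccm[OF Pr(2) Qr(2) YC l(1) g'(1)] h'(1) kl this]
 note R = dcomp_cls[OF O(1) P O(2) Q O(4) f'(1) ccm[OF Qr(2) Sr(2) ZC k(1) h'(1)] l]
 show ?thesis unfolding f'(2) g'(2) h'(2) dcomp_cls[OF O(1) P O(2) Q O(3) f'(1) g'(1) l] dcomp_cls[OF O(2) Q O(3) S O(4) g'(1) h'(1) k]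
  L R ccomp_as[OF Pr(2) Qr(2) Sr(2) ZC l(1) k(1) h'(1)] ..
qed

lemma dmap_dhom:
 assumes X: "X : bcx A" and Y: "Y : bcx A" and f: "f : cmaps A X Y"
 shows "dmap A X Y f : dhom A X Y"
proof -
 obtain c P pr where P: "projres c X P pr" by (rule ex_res[OF X])
 note Pr = prD[OF P]
 show ?thesis unfolding dmap_cls[OF X P Y f] by (rule cls_dhom[OF X P Y ccm[OF Pr(2) bcD(1)[OF X] bcD(1)[OF Y] Pr(5) f]])
qed

sublocale Db: category "Db A"
proof
 show "Id (Db A) X : Hom (Db A) X X" if "X : Ob (Db A)" for X using dmap_dhom[of X X] cid_cmaps bcD(1) that by auto
qed (use dcomp_Id dcomp_closed dcomp_assoc in simp_all)

lemma hz_iff: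
 assumes X: "X : bcx A" and P: "projres c X P pr" and Y: "Y : bcx A"
 shows "hz (Db A) X Y <-> (ALL f:cmaps A P Y. ALL g:cmaps A P Y. hty A P Y f g)"
proof
 assume h: "hz (Db A) X Y"
 show "ALL f:cmaps A P Y. ALL g:cmaps A P Y. hty A P Y f g"
 proof (intro ballI)
  fix f g assume fg: "f : cmaps A P Y" "g : cmaps A P Y"
  have "cls X Y P pr f = cls X Y P pr g" using h cls_dhom[OF X P Y fg(1)] cls_dhom[OF X P Y fg(2)] unfolding hz_def by simp
  thus "hty A P Y f g" using cls_eq_iff[OF X P Y fg] by simp
 qed
next
 assume h: "ALL f:cmaps A P Y. ALL g:cmaps A P Y. hty A P Y f g"
 show "hz (Db A) X Y" unfolding hz_def Db_simps
 proof (intro ballI)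
  fix al be assume ab: "al : dhom A X Y" "be : dhom A X Y"
  obtain f where f: "f : cmaps A P Y" "al = cls X Y P pr f" by (rule dhom_cls[OF X P Y ab(1)])
  obtain g where g: "g : cmaps A P Y" "be = cls X Y P pr g" by (rule dhom_cls[OF X P Y ab(2)])
  show "al = be" unfolding f(2) g(2) using cls_eq_iff[OF X P Y f(1) g(1)] h f(1) g(1) by blast
 qed
qed

lemma projres_self:
 assumes "X : bcx A" "!!i. fgproj X$i" "!!i. i>c ==> zm X$i"
 shows "projres c X X (cid X)" using assms bcD qis_id unfolding projres_def bproj_def by blast

lemma hz_proj:
 assumes X: "X : bcx A" and P: "!!i. fgproj X$i" and Y: "Y : bcx A"
 shows "hz (Db A) X Y <-> (ALL f:cmaps A X Y. ALL g:cmaps A X Y. hty A X Y f g)"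
proof -
 obtain m where m: "!!i. i>m ==> zm X$i" using bcomplexes_bounds[OF X] by blast
 show ?thesis by (rule hz_iff[OF X projres_self[OF X P m] Y])
qed

lemma fgproj_stalk: "fgproj M ==> fgproj (stalk M j)$i" using fgproj_zero[OF lm_zmod] by (cases "i=j") auto

text \<open>The regular module has elements of type \<open>'a\<close>; to be a term of a complex
  over \<open>'a univ\<close> it needs a copy, which is fixed here once.\<close>

definition unit_mod :: "('a, 'a univ) module" where
 "unit_mod = (SOME M. M : fgmod A & (EX f:lhom A (regular A) M. EX g:lhom A M (regular A).
   (ALL x:cr A. g (f x) = x) & (ALL y:cr M. f (g y) = y)))"

lemma unit_mod:
 shows "unit_mod : fgmod A" "EX f:lhom A (regular A) unit_mod. EX g:lhom A unit_mod (regular A).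
   (ALL x:cr A. g (f x) = x) & (ALL y:cr unit_mod. f (g y) = y)"
proof -
 obtain M f g where "M : fgmod A" "f : lhom A (regular A) M" "g : lhom A M (regular A)"
  "!!x. x IN regular A ==> g (f x) = x" "!!y. y IN M ==> f (g y) = y" by (rule ex_copy[OF lm_regular fin_gen_regular]) blast
 hence "EX M. M : fgmod A & (EX f:lhom A (regular A) M. EX g:lhom A M (regular A).
   (ALL x:cr A. g (f x) = x) & (ALL y:cr M. f (g y) = y))" by (metis regular_simps(1))
 from someI_ex[OF this]
 show "unit_mod : fgmod A" "EX f:lhom A (regular A) unit_mod. EX g:lhom A unit_mod (regular A).
   (ALL x:cr A. g (f x) = x) & (ALL y:cr unit_mod. f (g y) = y)" unfolding unit_mod_def by blast+
qed

lemma fgproj_iso_regular: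
 fixes M :: "('a, 'm) module"
 assumes M: "lmod A M" "liso A M (regular A)"
 shows "fgproj M"
proof -
 obtain f where f: "f : lhom A M (regular A)" "bij_betw f (cr M) (cr (regular A))" using M(2) unfolding liso_def by blast
 obtain g where g: "g : lhom A (regular A) M" "!!x. x IN M ==> g (f x) = x" by (rule lhom_inverse[OF M(1) lm_regular f]) blast
 show ?thesis by (rule fgproj_iso[OF fgproj_regular M(1) f(1) g])
qed

text \<open>\<open>Hom(A[-j], X) = H^j(X)\<close>: a cycle \<open>x\<close> is represented by
  \<open>s\<close> going to \<open>g s\<close> times \<open>x\<close>, and a null-homotopy evaluated
  at the generator \<open>r\<close> with \<open>g r = 1\<close> bounds \<open>x\<close>.\<close>

lemma hz_regular:
 assumes S: "S : bcx A" "liso A S$j (regular A)" "!!i. i~=j ==> zm S$i" and X: "X : bcx A"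
 shows "hz (Db A) S X <-> acyc X j"
proof -
 note XC = bcD(1)[OF X] and SC = bcD(1)[OF S(1)]
 have pS: "fgproj S$i" for i using fgproj_iso_regular[OF xlm[OF SC] S(2)] fgproj_zero[OF xlm[OF SC] S(3)] by (cases "i=j") auto
 have bS: "bproj j S" using SC pS S(3) unfolding bproj_def by auto
 obtain g where g: "g : lhom A S$j (regular A)" "bij_betw g (cr S$j) (cr (regular A))" using S(2) unfolding liso_def by blast
 obtain r where r: "r IN S$j" "g r = 1[A]" by (rule surjE[OF bij_betw_imp_surj_on[OF g(2)], of "1[A]"]) auto
 show ?thesis unfolding hz_proj[OF S(1) pS X]
 proof
  assume h: "ALL f:cmaps A S X. ALL g:cmaps A S X. hty A S X f g"
  show "acyc X j" unfolding acyc_def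
  proof (intro ballI impI)
   fix x assume x: "x IN X$j" "dif X j x = 0[X$(j+1)]"
   let ?u = "%s:cr S$j. g s *[X$j] x"
   have gc: "g s IN A" if "s IN S$j" for s using hcl[OF g(1) that] by simp
   have u: "?u : lhom A S$j X$j"
   proof (rule hresI)
    fix s t assume "s IN S$j" "t IN S$j"
    thus "g (s +[S$j] t) *[X$j] x = g s *[X$j] x +[X$j] g t *[X$j] x" using hadd[OF g(1)] gc x(1) lsm(2)[OF xlm[OF XC]] by simp
   next
    fix a s assume "a IN A" "s IN S$j"
    thus "g (a *[S$j] s) *[X$j] x = a *[X$j] (g s *[X$j] x)" using hsm[OF g(1)] gc x(1) lsm(3)[OF xlm[OF XC]] by simp
   qed (use SC XC x(1) gc in auto)
   let ?f = "conc S X j ?u"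
   let ?z = "zmp S X"
   have f: "?f : cmaps A S X"
   proof (rule conc_cmap[OF SC XC u])
    fix s assume s: "s IN S$(j-1)"
    have "dif S (j-1) s = 0[S$j]" using zmD[OF S(3)[of "j-1"] s] hzero[OF dhm'[OF SC, of j]] SC by simp
    thus "?u (dif S (j-1) s) = 0[X$j]" using hzero[OF u] SC XC by simp
   qed (use XC x gc in simp)
   have z: "?z : cmaps A S X" by (rule zcm[OF SC XC])
   obtain k where k: "hfam S X k" "!!i s. s IN S$i ==> ?f i s = ?z i s +[X$i] hm S X k i s"
    by (rule homotopicE[OF SC XC f z]) (use h f z in blast)+
   note rk = hfr[OF k(1) SC XC]
   have "dif S j r = 0[S$(j+1)]" using zmD[OF S(3)[of "j+1"]] r SC by simp
   hence "?f j r = dif X (j-1) (k j r)" unfolding k(2)[OF r(1)] using r(1) rk(5)[of j] rk(1)[OF r(1)] XC by simp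
   hence "dif X (j-1) (k j r) = x" using r x(1) lsm(4)[OF xlm[OF XC]] by simp
   thus "EX y:cr X$(j-1). dif X (j-1) y = x" using rk(1)[OF r(1)] by blast
  qed
 next
  assume "acyc X j"
  hence "zm S$i | acyc X i" for i using S(3) by (cases "i=j") auto
  thus "ALL f:cmaps A S X. ALL g:cmaps A S X. hty A S X f g" using hty_proj[OF bS XC] by blast
 qed
qed

text \<open>Cohomology is a Hom out of a shifted regular module, hence invariant under isomorphisms
  of the derived category without unfolding roofs.\<close>

lemma acyc_iso:
 assumes X: "X : bcx A" and Y: "Y : bcx A" and u: "iso_mor (Db A) X Y u"
 shows "acyc X j <-> acyc Y j"
proof -
 let ?S = "stalk unit_mod j"
 obtain f g where f: "f : lhom A (regular A) unit_mod" "g : lhom A unit_mod (regular A)"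
   "(ALL x:cr A. g (f x) = x) & (ALL y:cr unit_mod. f (g y) = y)" using unit_mod(2) by (elim bexE)
 have "bij_betw g (cr unit_mod) (cr (regular A))" by (rule bij_betwI[of _ _ _ f]) (use f hcl[OF f(1)] hcl[OF f(2)] in auto)
 hence l: "liso A ?S$j (regular A)" using f(2) unfolding liso_def by auto
 note S = stalk_bc[OF unit_mod(1)]
 have z: "zm ?S$i" if "i~=j" for i using that by simp
 obtain v where v: "iso_mor (Db A) Y X v" by (rule Db.iso_sym[OF u])
 note i = Db.iso_Id[of ?S]
 show ?thesis using hz_regular[OF S l z X] hz_regular[OF S l z Y]
  Db.hz_iso[of ?S X ?S Y, OF _ _ _ _ i v] Db.hz_iso[of ?S Y ?S X, OF _ _ _ _ i u] S X Y by auto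
qed

subsection \<open>Shifts\<close>

text \<open>Shifting a projective resolution gives one of the shifted complex; a homotopy between
  shifted maps shifts back after a change of sign. This direction suffices to raise the degrees of
  stalk complexes.\<close>

lemma hz_shift:
 assumes X: "X : bcx A" and Y: "Y : bcx A" and h: "hz (Db A) (shift X) (shift Y)"
 shows "hz (Db A) X Y"
proof -
 obtain c P pr where P: "projres c X P pr" by (rule ex_res[OF X])
 note XC = bcD(1)[OF X] and YC = bcD(1)[OF Y] and Pr = prD[OF P]
 note PS = shift_complex[OF Pr(2)] and YS = shift_complex[OF YC]
 have sc: "(%i. f (i+1)) : cmaps A (shift P) (shift Z)" if f: "f : cmaps A P Z" and Z: "cpx A Z" for f Z
 proof (rule cmapsI)
  note rf = cmr[OF f Pr(2) Z]
  show "f (i+1) : lhom A (shift P)$i (shift Z)$i" for i using cmh[OF f, of "i+1"] by simp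
  fix i x assume x: "x IN (shift P)$i"
  thus "f (i+1+1) (dif (shift P) i x) = dif (shift Z) i (f (i+1) x)"
   using rf(1)[of x "i+1"] rf(2)[of x "i+1"] rf(6)[of "dif P (i+1) x" "i+2"] dcl(1)[OF Pr(2), of x "i+1"] by (simp add: ips)
 qed
 have q: "qis A (shift P) (shift X) (%i. pr (i+1))" using Pr(4) sc[OF Pr(5) XC] unfolding quasi_iso_def cohomology_map_def[abs_def] cohomology_def
  by (simp add: shift_cycles[OF Pr(2)] shift_cycles[OF XC])
 have "bproj (c-1) (shift P)" using PS Pr(6) bprojD(3)[OF Pr(1)] unfolding bproj_def by auto
 hence SP: "projres (c-1) (shift X) (shift P) (%i. pr (i+1))" using q Pr(3) unfolding projres_def by simp
 show ?thesis unfolding hz_iff[OF X P Y]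
 proof (intro ballI)
  fix f g assume fg: "f : cmaps A P Y" "g : cmaps A P Y"
  have "hty A (shift P) (shift Y) (%i. f (i+1)) (%i. g (i+1))"
   using h sc[OF fg(1) YC] sc[OF fg(2) YC] unfolding hz_iff[OF shift_bcomplexes[OF X] SP shift_bcomplexes[OF Y]] by blast
  then obtain k where k: "hfam (shift P) (shift Y) k" "!!i x. x IN (shift P)$i ==> f (i+1) x = g (i+1) x +[(shift Y)$i]
    (hm (shift P) (shift Y) k i x)" using homotopicE[OF PS YS sc[OF fg(1) YC] sc[OF fg(2) YC]] by blast
  define m where "m = (%i. %x:cr P$i. -[Y$(i-1)] k (i-1) x)"
  have kh: "k (i-1) : lhom A P$i Y$(i-1)" for i using hfamD(1)[OF k(1), of "i-1"] by simp
  have mf: "hfam P Y m" unfolding hfam_def m_def using lhom_uminus[OF xlm[OF Pr(2)] xlm[OF YC] kh] by blast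
  show "hty A P Y f g"
  proof (rule homotopicI[OF Pr(2) YC fg mf])
   fix i x assume x: "x IN P$i"
   have kc: "k (i-1) x IN Y$(i-1)" by (rule hcl[OF kh x])
   have d: "dif P i x IN P$(i+1)" using x Pr(2) by simp
   have kh': "k i : lhom A P$(i+1) Y$i" using kh[of "i+1"] by simp
   have "f i x = g i x +[Y$i] (dif (shift Y) (i-2) (k (i-1) x) +[Y$i] k i (dif (shift P) (i-1) x))" using k(2)[of x "i-1"] x by simp
   also have "dif (shift Y) (i-2) (k (i-1) x) = -[Y$i] dif Y (i-1) (k (i-1) x)" using kc shift_simps(2)[of "k (i-1) x" Y "i-2"] by simp
   also have "... = dif Y (i-1) (-[Y$(i-1)] k (i-1) x)" using lhom_neg[OF dhm'[OF YC] _ _ kc] YC by simp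
   also have "dif (shift P) (i-1) x = -[P$(i+1)] dif P i x" using x shift_simps(2)[of x P "i-1"] by (simp add: ips)
   also have "k i (-[P$(i+1)] dif P i x) = -[Y$i] k i (dif P i x)" using lhom_neg[OF kh' _ _ d] Pr(2) YC by simp
   finally show "f i x = g i x +[Y$i] hm P Y m i x" using x d by (simp add: m_def)
  qed
 qed
qed

text \<open>Chain maps into a stalk complex are cocycles and homotopies are coboundaries, so the
  vanishing of an Ext group becomes a factorization statement about the terms of
  \<open>P\<close>.\<close>

lemma hz_stalk:
 assumes X: "X : bcx A" and P: "projres c X P pr" and M: "M : fgmod A"
 shows "hz (Db A) X (stalk M j) <-> (ALL u:lhom A P$j M. (ALL x:cr P$(j-1). u (dif P (j-1) x) = 0[M]) -->
  (fac A P j M u))" unfolding hz_iff[OF X P stalk_bc[OF M]]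
proof (intro iffI ballI impI)
 let ?L = "stalk M j"
 note PC = prD(2)[OF P] and lM = fgD(1)[OF M]
 fix u assume h: "ALL f:cmaps A P ?L. ALL g:cmaps A P ?L. hty A P ?L f g"
  and u: "u : lhom A P$j M" "ALL x:cr P$(j-1). u (dif P (j-1) x) = 0[M]"
 let ?f = "conc P ?L j u"
 let ?g = "zmp P ?L"
 have f: "?f : cmaps A P ?L" by (rule cmap_to_stalk[OF PC lM u(1)]) (use u(2) in blast)
 have g: "?g : cmaps A P ?L" by (rule zcm[OF PC stalk_complex[OF lM]])
 have "hty A P ?L ?f ?g" using h f g by blast
 then obtain k where k: "k : lhom A P$(j+1) M" "!!x. x IN P$j ==> ?f j x = ?g j x +[M] k (dif P j x)" by (rule stalk_homotopicE[OF PC lM f g]) blast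
 have "u x = k (dif P j x)" if "x IN P$j" for x using k(2)[OF that] that hcl[OF k(1)] PC lM by simp
 thus "fac A P j M u" using k(1) by blast
next
 let ?L = "stalk M j"
 note PC = prD(2)[OF P] and lM = fgD(1)[OF M]
 fix f g assume h: "ALL u:lhom A P$j M. (ALL x:cr P$(j-1). u (dif P (j-1) x) = 0[M]) -->
  (fac A P j M u)"
  and f: "f : cmaps A P ?L" and g: "g : cmaps A P ?L"
 note rf = stalk_map_hom[OF PC lM f] and rg = stalk_map_hom[OF PC lM g]
 let ?u = "%x:cr P$j. f j x -[M] g j x"
 have m1: "?u : lhom A P$j M" by (rule lhom_diff[OF xlm[OF PC] lM rf(1) rg(1)])
 have m2: "ALL x:cr P$(j-1). ?u (dif P (j-1) x) = 0[M]" using rf(2) rg(2) PC lM by simp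
 obtain k where k: "k : lhom A P$(j+1) M" "ALL x:cr P$j. ?u x = k (dif P j x)" by (rule bexE[OF mp[OF bspec[OF h m1] m2]])
 show "hty A P ?L f g"
 proof (rule stalk_homotopicI[OF PC lM f g k(1)])
  fix x assume x: "x IN P$j"
  have "f j x -[M] g j x = k (dif P j x)" using k(2) x by simp
  thus "f j x = g j x +[M] k (dif P j x)" using hcl[OF rf(1) x] hcl[OF rg(1) x] lM by (simp add: lm_ac flip: \<open>f j x -[M] g j x = _\<close>)
 qed
qed

end

section \<open>Derived equivalences\<close>

locale der_equiv = A: artin_alg R A + B: artin_alg R B
 for R :: "('r, 'e) ring_scheme" and A :: "('r, 'a) module" and B :: "('r, 'b) module" +
 fixes F :: "('a, 'b) dfunct"
 assumes der: "derived_equivalence R A B F"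
begin

sublocale E: equiv_cat "Db A" "Db B" F by unfold_locales (use der in "simp add: derived_equivalence_def")

lemma F_dadd:
 "X : bcx A ==> Y : bcx A ==> al : dhom A X Y ==> be : dhom A X Y ==>
  fmap F X Y (dadd A X Y al be) = dadd B (fob F X) (fob F Y) (fmap F X Y al) (fmap F X Y be)" using der unfolding derived_equivalence_def triangle_functor_def by blast

abbreviation (input) "FS Y j == fob F (A.stalk Y j)"

lemma Fb [simp]: "X : bcx A ==> fob F X : bcx B" using E.fob_closed by simp

lemma F_shift:
 assumes X: "X : bcx A"
 obtains u where "iso_mor (Db B) (fob F (shift X)) (shift (fob F X)) u"
proof -
 obtain \<eta> where "nat_iso (Db A) (Db B) (fcomp F (dshift A)) (fcomp (dshift B) F) \<eta>" using der unfolding derived_equivalence_def triangle_functor_def by blast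
 hence "iso_mor (Db B) (fob F (shift X)) (shift (fob F X)) (\<eta> X)" using X unfolding nat_iso_def fcomp_def dshift_def by simp
 thus ?thesis by (rule that)
qed

lemma acyc_F_stalk_shift:
 assumes Y: "Y : fgmod A"
 shows "B.acyc (FS Y k) j <-> B.acyc (FS Y (k+1)) (j+1)"
proof -
 note S = A.stalk_bc[OF Y, of "k+1"]
 have e: "shift (A.stalk Y (k+1)) = A.stalk Y k" using A.shift_stalk[OF A.fgD(1)[OF Y], of "k+1"] by simp
 obtain u where u: "iso_mor (Db B) (FS Y k) (shift (FS Y (k+1))) u" using F_shift[OF S] unfolding e by blast
 have "B.acyc (FS Y k) j <-> B.acyc (shift (FS Y (k+1))) j" by (rule B.acyc_iso[OF Fb[OF A.stalk_bc[OF Y]] B.shift_bcomplexes[OF Fb[OF S]] u])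
 thus ?thesis using B.shift_acyc[OF B.bcD(1)[OF Fb[OF S]]] by simp
qed

lemma acyc_F_stalk_0:
 assumes Y: "Y : fgmod A"
 shows "B.acyc (FS Y k) j <-> B.acyc (FS Y (k-j)) 0"
proof (induction j arbitrary: k rule: int_induct[where k=0])
 case (step1 i)
 thus ?case using acyc_F_stalk_shift[OF Y, of "k-1" i] by (simp add: algebra_simps)
next
 case (step2 i)
 thus ?case using acyc_F_stalk_shift[OF Y, of k "i-1"] by (simp add: algebra_simps)
qed simp

lemma hz_F_stalk_shift:
 assumes Y: "Y : fgmod A" and W: "W : fgmod B" and h: "hz (Db B) (FS Y k) (B.stalk W k)"
 shows "hz (Db B) (FS Y (k+1)) (B.stalk W (k+1))"
proof -
 note S = A.stalk_bc[OF Y, of "k+1"] and W' = B.stalk_bc[OF W]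
 have e: "shift (A.stalk Y (k+1)) = A.stalk Y k" "shift (B.stalk W (k+1)) = B.stalk W k"
  using A.shift_stalk[OF A.fgD(1)[OF Y], of "k+1"] B.shift_stalk[OF B.fgD(1)[OF W], of "k+1"] by simp_all
 obtain u where u: "iso_mor (Db B) (FS Y k) (shift (FS Y (k+1))) u" using F_shift[OF S] unfolding e by blast
 note SF = B.shift_bcomplexes[OF Fb[OF S]]
 have "hz (Db B) (shift (FS Y (k+1))) (B.stalk W k)" by (rule B.Db.hz_iso[OF _ _ _ _ u B.Db.iso_Id h]) (use SF W' Fb[OF A.stalk_bc[OF Y]] in simp_all)
 thus ?thesis unfolding e(2)[symmetric] by (rule B.hz_shift[OF Fb[OF S] W'])
qed

end

locale tilting = der_equiv R A B F
 for R :: "('r, 'e) ring_scheme" and A :: "('r, 'a) module" and B :: "('r, 'b) module" and F +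
 fixes T :: "'a ucplx" and n :: nat
 assumes tilt: "associated_tilting A B F T"
  and T_zero: "i < - int n | i>0 ==> zm T$i"
begin

lemma T: "T : bcx A" "cpx A T" "T$i : fgmod A" "A.fgproj T$i" using tilt A.bcD A.projective_fgproj unfolding associated_tilting_def by auto

lemma resT: "A.projres 0 T T (cid T)" by (rule A.projres_self[OF T(1) T(4) T_zero]) simp

lemma S_ex:
 obtains S u v where "S : bcx B" "liso B S$0 (regular B)" "!!i. i~=0 ==> zm S$i"
  "iso_mor (Db B) (fob F T) S u" "iso_mor (Db B) S (fob F T) v"
proof -
 obtain S phi where S: "regular_stalk B S" "iso_mor (Db B) (fob F T) S phi" using tilt unfolding associated_tilting_def by blast
 obtain v where v: "iso_mor (Db B) S (fob F T) v" by (rule B.Db.iso_sym[OF S(2)])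
 show ?thesis by (rule that[OF _ _ _ S(2) v]) (use S(1) in "auto simp: regular_stalk_def")
qed

text \<open>\<open>H^0(F X) = Hom(B, F X) = Hom(F T, F X) = Hom(T, X)\<close>, each read as a
  vanishing statement.\<close>

lemma acyc_F_0:
 assumes X: "X : bcx A"
 shows "B.acyc (fob F X) 0 <-> hz (Db A) T X"
proof -
 obtain S u v where S: "S : bcx B" "liso B S$0 (regular B)" "!!i. i~=0 ==> zm S$i"
  and u: "iso_mor (Db B) (fob F T) S u" and v: "iso_mor (Db B) S (fob F T) v" by (rule S_ex) blast
 note O = S(1) Fb[OF X] Fb[OF T(1)]
 note i = B.Db.iso_Id[of "fob F X"]
 have "B.acyc (fob F X) 0 <-> hz (Db B) S (fob F X)" using B.hz_regular[OF S O(2)] by simp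
 also have "... <-> hz (Db B) (fob F T) (fob F X)" using B.Db.hz_iso[OF _ _ _ _ u i] B.Db.hz_iso[OF _ _ _ _ v i] O by auto
 also have "... <-> hz (Db A) T X" using E.hz_fob T(1) X by simp
 finally show ?thesis .
qed

text \<open>\<open>F\<close> commutes with shifts, so degree \<open>j\<close> for the stalk in
  degree \<open>k\<close> becomes degree \<open>0\<close> for the stalk in degree
  \<open>k-j\<close>; only \<open>T$(k-j)\<close> and its two neighbours matter.\<close>

lemma acyc_F_stalk:
 assumes Y: "Y : fgmod A"
 shows "B.acyc (FS Y k) j <-> (ALL u:lhom A T$(k-j) Y. (ALL x:cr T$(k-j-1). u (dif T (k-j-1) x) = 0[Y]) -->
  (EX h:lhom A T$(k-j+1) Y. ALL x:cr T$(k-j). u x = h (dif T (k-j) x)))"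
 unfolding acyc_F_stalk_0[OF Y, of k j] acyc_F_0[OF A.stalk_bc[OF Y]] A.hz_stalk[OF T(1) resT Y] ..

lemma acyc_F_stalk_zero:
 assumes Y: "Y : fgmod A" and z: "!!u. u : lhom A T$(k-j) Y ==> u = (%x:cr T$(k-j). 0[Y])"
 shows "B.acyc (FS Y k) j" unfolding acyc_F_stalk[OF Y]
proof (intro ballI impI)
 fix u assume u: "u : lhom A T$(k-j) Y"
 have "u x = (%x:cr T$(k-j+1). 0[Y]) (dif T (k-j) x)" if "x IN T$(k-j)" for x using z[OF u] that T(2) by simp
 thus "EX h:lhom A T$(k-j+1) Y. ALL x:cr T$(k-j). u x = h (dif T (k-j) x)" using A.hzmap[OF A.xlm[OF T(2)] A.fgD(1)[OF Y]] by blast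
qed

text \<open>The image of a module placed in degree \<open>k\<close> lives in the degrees from
  \<open>k\<close> to \<open>k+n\<close>, the mirror image of the range of \<open>T\<close>.\<close>

lemma acyc_F_stalk_out:
 assumes Y: "Y : fgmod A" and j: "k-j>0 | k-j < - int n"
 shows "B.acyc (FS Y k) j"
proof (rule acyc_F_stalk_zero[OF Y])
 fix u assume u: "u : lhom A T$(k-j) Y"
 have z: "zm T$(k-j)" using T_zero j by auto
 show "u = (%x:cr T$(k-j). 0[Y])"
 proof (rule A.lhom_eqI[OF u A.hzmap[OF A.xlm[OF T(2)] A.fgD(1)[OF Y]]])
  fix x assume x: "x IN T$(k-j)"
  show "u x = (%x:cr T$(k-j). 0[Y]) x" using A.zmD[OF z x] A.hzero[OF u A.xlm[OF T(2)] A.fgD(1)[OF Y]] x by simp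
 qed
qed

text \<open>\<open>D\<^sup>\<le>\<^sup>c\<close> is the left orthogonal of the stalk complexes in degrees \<open>> c\<close>, whose images under \<open>F\<close> live in degrees \<open>> c\<close>.\<close>

lemma acyc_of_F:
 assumes V: "V : bcx A" and ac: "!!i. i>c ==> B.acyc (fob F V) i" and i: "i>c"
 shows "A.acyc V i"
proof -
 obtain c' P pr where P: "A.projres c' V P pr" by (rule A.ex_res[OF V])
 note PC = A.prD(2)[OF P]
 let ?U = "dif P (i-1) ` cr P$(i-1)"
 have U: "submod A P$i ?U" by (rule A.sm_range[OF A.xlm[OF PC] A.xlm[OF PC] A.dhm'[OF PC]])
 note Pf = A.prD(3)[OF P, of i]
 \<comment> \<open>The projection onto \<open>E\<close>, the term modulo boundaries, is the
   universal cocycle in degree \<open>i\<close>. Once it factors through the differential, every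
   cycle is killed by it and hence is a boundary.\<close>
 obtain E q where E: "E : fgmod A" "q : lhom A P$i E" "{x:cr P$i. q x = 0[E]} = ?U" by (rule A.ex_quotient[OF A.fgD[OF Pf] U])
 note Eb = A.stalk_bc[OF E(1), of i]
 obtain P' rh where P': "B.projres c (fob F V) P' rh" by (rule B.ex_projres[OF Fb[OF V] ac])
 have "zm P'$j | B.acyc (FS E i) j" for j using B.bprojD(3)[OF B.prD(1)[OF P']] acyc_F_stalk_out[OF E(1), of i j] i by (cases "j>c") auto
 hence "hz (Db B) (fob F V) (FS E i)" unfolding B.hz_iff[OF Fb[OF V] P' Fb[OF Eb]] using B.hty_proj[OF B.prD(1)[OF P'] B.bcD(1)[OF Fb[OF Eb]]] by blast
 hence "hz (Db A) V (A.stalk E i)" using E.hz_fob V Eb by simp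
 note hz = this[unfolded A.hz_stalk[OF V P E(1)]]
 have "ALL x:cr P$(i-1). q (dif P (i-1) x) = 0[E]" using imageI[of _ "cr P$(i-1)" "dif P (i-1)"] E(3) by blast
 then obtain h where h: "h : lhom A P$(i+1) E" "ALL x:cr P$i. q x = h (dif P i x)" by (rule bexE[OF mp[OF bspec[OF hz E(2)]]])
 have "A.acyc P i" unfolding A.acyc_def
 proof (intro ballI impI)
  fix x assume x: "x IN P$i" "dif P i x = 0[P$(i+1)]"
  have "q x = 0[E]" using h x A.hzero[OF h(1) A.xlm[OF PC] A.fgD(1)[OF E(1)]] by simp
  hence "x : ?U" using E(3) x(1) by blast
  thus "EX y:cr P$(i-1). dif P (i-1) y = x" by blast
 qed
 thus ?thesis using A.qis_acyc[OF PC A.bcD(1)[OF V] A.prD(4)[OF P]] by simp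
qed

end

section \<open>Duality and the Nakayama functor\<close>

context artin_ring
begin

lemma ideal_jacobson: "ideal (jacobson R) R"
proof (rule ideal_Collect)
 fix x y assume "x : jacobson R" "y : jacobson R"
 thus "x +[R] y : jacobson R" unfolding jacobson_def using idealD(4)[OF maximalideal.axioms(1)] by auto
next
 fix a x assume "a IN R" "x : jacobson R"
 thus "a **[R] x : jacobson R" unfolding jacobson_def using idealD(6)[OF maximalideal.axioms(1)] by auto
qed (auto simp: jacobson_def idealD(2)[OF maximalideal.axioms(1)])

text \<open>An ideal that is minimal among those not contained in \<open>m\<close> lies in all other maximal ideals.\<close>

lemma maximal_separating:
 assumes m: "maximalideal m R"
 obtains s where "s IN R" "s ~: m" "!!r. r : m ==> r **[R] s : jacobson R"
proof -
 have mi: "ideal m R" by (rule maximalideal.axioms(1)[OF m])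
 have "cr R : {K. ideal K R & ~ K<=m}" using oneideal maximalideal.I_notcarr[OF m] idealD(1)[OF mi] by auto
 then obtain K where K: "K : {K. ideal K R & ~ K<=m}" "!!Z. Z : {K. ideal K R & ~ K<=m} ==> Z<=K ==> Z = K" by (rule ideals_min) auto
 have Ki: "ideal K R" using K(1) by blast
 obtain s where s: "s : K" "s ~: m" using K(1) by blast
 have sm: "s : m'" if m': "maximalideal m' R" "m'~=m" for m'
 proof -
  have mi': "ideal m' R" by (rule maximalideal.axioms(1)[OF m'(1)])
  have "~ m'<=m" using maximalideal.I_maximal[OF m'(1) mi] idealD(1)[OF mi] maximalideal.I_notcarr[OF m] m'(2) by auto
  then obtain a where a: "a : m'" "a ~: m" by blast
  have sc: "s IN R" "a IN R" using s(1) a(1) idealD(3)[OF Ki] idealD(3)[OF mi'] by auto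
  have "a **[R] s : K" "s **[R] a : m'" using idealD(6)[OF Ki sc(2) s(1)] idealD(6)[OF mi' sc(1) a(1)] by auto
  hence "a **[R] s : K \<inter> m'" using m_comm sc by auto
  moreover have "a **[R] s ~: m" using primeideal.I_prime[OF maximalideal_prime[OF m] sc(2,1)] a s by blast
  ultimately have "K \<inter> m' = K" using K(2)[of "K \<inter> m'"] i_intersect[OF Ki mi'] by blast
  thus ?thesis using s(1) by blast
 qed
 have sc: "s IN R" by (rule idealD(3)[OF Ki s(1)])
 show ?thesis
 proof (rule that[OF sc s(2)])
  fix r assume r: "r : m"
  have rc: "r IN R" using idealD(3)[OF mi r] .
  have "r **[R] s : m'" if "maximalideal m' R" for m'
  proof (cases "m' = m")
   case True thus ?thesis using idealD(6)[OF mi sc r] m_comm[OF sc rc] by simp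
  next
   case False thus ?thesis using idealD(6)[OF maximalideal.axioms(1)[OF that] rc sm[OF that False]] by simp
  qed
  thus "r **[R] s : jacobson R" using rc sc unfolding jacobson_def by auto
 qed
qed

lemma ex_maximal:
 assumes "ideal I R" "1[R] ~: I"
 obtains m where "maximalideal m R" "I<=m"
proof -
 obtain U where U: "ideal U R" "I<=U" "1[R] ~: U" "!!W. ideal W R ==> U<=W ==> W<=cr R ==> 1[R] ~: W ==> W = U"
  by (rule ideal_maximal_avoiding[OF assms idealD(1)[OF assms(1)]]) blast
 have "maximalideal U R"
 proof (rule maximalidealI[OF U(1)])
  show "cr R~=U" using U(3) one_closed by blast
  show "W = U | W = cr R" if "ideal W R" "U<=W" "W<=cr R" for W using U(4)[OF that] ideal.one_imp_carrier[OF that(1)] by blast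
 qed
 thus ?thesis using U(2) by (rule that)
qed

lemma fin_gen_inj:
 fixes M :: "('r, 'm) module" and N :: "('r, 'n) module"
 assumes M: "lmod R M" and N: "lmod R N" "fin_gen R N" and f: "f : lhom R M N"
  and inj: "!!x. x IN M ==> f x = 0[N] ==> x = 0[M]"
 shows "fin_gen R M"
proof -
 note U = sm_range[OF M N(1) f]
 let ?U = "sub N (f ` cr M)"
 have "fin_gen R ?U" by (rule fin_gen_sub_stop[OF N(1) submods_stop[OF N] U])
 moreover have f': "f : lhom R M ?U" by (rule lhom_cosub[OF f order_refl])
 moreover have "bij_betw f (cr M) (cr ?U)" using lhom_inj_iff[OF M N(1) f] inj by (auto simp: bij_betw_def)
 ultimately obtain g where g: "g : lhom R ?U M" "!!x. x IN M ==> g (f x) = x" "fin_gen R ?U" using lhom_inverse[OF M lm_sub[OF N(1) U]] by metis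
 have "cr M<=g ` cr ?U"
 proof
  fix x assume x: "x IN M"
  thus "x : g ` cr ?U" using g(2)[OF x] by (intro image_eqI[where x="f x"]) auto
 qed
 hence "g ` cr ?U = cr M" using hcl[OF g(1)] by blast
 thus ?thesis by (rule fin_gen_image[OF lm_sub[OF N(1) U] M g(1) _ g(3)])
qed

end

locale dual_alg = artin_alg R A for R :: "('r, 'e) ring_scheme" and A :: "('r, 'a) module" +
 fixes J :: "('r, 'r univ) module"
 assumes J: "injective_envelope R (top_module R) J"
begin

lemma J_props: "injective R J" "lmod R J" "fin_gen R J" using J R.fgD unfolding injective_envelope_def by auto

text \<open>\<open>s\<close> spans a copy of the residue field at \<open>m\<close> inside
  \<open>R\<close> modulo its radical, and the envelope map embeds it into \<open>J\<close>.\<close>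

lemma J_element:
 assumes m: "maximalideal m R"
 obtains j where "j IN J" "j~=0[J]" "!!r. r : m ==> r *[J] j = 0[J]"
proof -
 let ?I = "jacobson R" and ?T = "top_module R"
 obtain s where s: "s IN R" "s ~: m" "!!r. r : m ==> r **[R] s : ?I" by (rule R.maximal_separating[OF m]) blast
 obtain e where e: "e : lhom R ?T J" "inj_on e (cr ?T)" using J unfolding injective_envelope_def by blast
 interpret I: ideal ?I R by (rule R.ideal_jacobson)
 have T: "cr ?T = a_rcosets\<^bsub>R\<^esub> ?I" "!!r x. r *[?T] x = rcoset_mult R ?I (?I +>\<^bsub>R\<^esub> r) x" by (auto simp: top_module_def Let_def FactRing_def)
 have mem: "?I +>\<^bsub>R\<^esub> r IN ?T" if "r IN R" for r using that unfolding T A_RCOSETS_def' by blast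
 let ?t = "?I +>\<^bsub>R\<^esub> s"
 have act: "r *[?T] ?t = ?I +>\<^bsub>R\<^esub> (r **[R] s)" if "r IN R" for r unfolding T using I.rcoset_mult_add[OF that s(1)] .
 have mc: "r IN R" if "r : m" for r using R.idealD(3)[OF maximalideal.axioms(1)[OF m] that] .
 have z: "0[R] : m" using R.idealD(2)[OF maximalideal.axioms(1)[OF m]] .
 have act0: "r *[?T] ?t = ?I" if "r : m" for r unfolding act[OF mc[OF that]] by (rule I.a_rcos_const[OF s(3)[OF that]])
 have e0: "e ?I = 0[J]" using R.hsm[OF e(1) R.zero_closed mem[OF s(1)]] act0[OF z] R.lm_smult_zero(1)[OF J_props(2) R.hcl[OF e(1) mem[OF s(1)]]] by simp
 show ?thesis
 proof (rule that[of "e ?t"])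
  show "e ?t IN J" by (rule R.hcl[OF e(1) mem[OF s(1)]])
  show "r *[J] e ?t = 0[J]" if "r : m" for r using R.hsm[OF e(1) mc[OF that] mem[OF s(1)]] act0[OF that] e0 by simp
  show "e ?t~=0[J]"
  proof
   assume "e ?t = 0[J]"
   moreover have "?I IN ?T" using mem[OF R.zero_closed] I.a_rcos_const[of "0[R]"] R.idealD(2)[OF R.ideal_jacobson] by simp
   ultimately have "?t = ?I" using inj_onD[OF e(2)] e0 mem[OF s(1)] by metis
   hence "s : ?I" using I.a_rcos_self[OF s(1)] by simp
   thus False using m s(2) unfolding jacobson_def by blast
  qed
 qed
qed

text \<open>\<open>J\<close> is a cogenerator: the annihilator of \<open>x\<close> lies in a maximal
  ideal \<open>m\<close>, so \<open>x\<close> can be sent to an element of \<open>J\<close> killed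
  by \<open>m\<close>, and injectivity extends the map from \<open>R x\<close> to
  \<open>X\<close>.\<close>

lemma J_separates:
 fixes X :: "('r, 'x) module"
 assumes X: "lmod R X" "fin_gen R X" and x: "x IN X" "x~=0[X]"
 obtains f where "f : lhom R X J" "f x~=0[J]"
proof -
 let ?I = "{r:cr R. r *[X] x = 0[X]}"
 have "ideal ?I R" by (rule R.ideal_Collect) (use X x in "auto simp: R.lsm")
 moreover have "1[R] ~: ?I" using x R.lsm(4)[OF X(1)] by simp
 ultimately obtain m where m: "maximalideal m R" "?I<=m" by (rule R.ex_maximal)
 obtain j where j: "j IN J" "j~=0[J]" "!!r. r : m ==> r *[J] j = 0[J]" by (rule J_element[OF m(1)]) blast
 let ?p = "%r:cr (regular R). r *[X] x" and ?q = "%r:cr (regular R). r *[J] j"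
 have p: "?p : lhom R (regular R) X" by (rule R.hresI) (use X x in "auto simp: R.lsm")
 have q: "?q : lhom R (regular R) J" by (rule R.hresI) (use J_props j in "auto simp: R.lsm")
 let ?U = "R.sub X (?p ` cr (regular R))"
 note U = R.sm_range[OF R.lm_regular X(1) p]
 have lU: "lmod R ?U" by (rule R.lm_sub[OF X(1) U])
 obtain k where k: "k : lhom R ?U J" "!!r. r IN regular R ==> k (?p r) = ?q r" by (rule R.lhom_factor[OF R.lm_regular lU J_props(2) q R.lhom_cosub[OF p order_refl]])
   (use m(2) j(3) in auto)
 have fU: "fin_gen R ?U" by (rule R.fin_gen_range[OF R.lm_regular X(1) p R.fin_gen_regular])
 obtain h where h: "h : lhom R X J" "!!u. u IN ?U ==> h ((%w:?p ` cr (regular R). w) u) = k u"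
  by (rule R.injective_extend[OF J_props(1) lU fU X R.lhom_incl[OF X(1) U] _ k(1)]) (auto simp: inj_on_def)
 have "x IN ?U" using x R.lsm(4)[OF X(1)] by (auto intro!: image_eqI[where x="1[R]"])
 hence "h x = k (?p 1[R])" using h(2)[of x] x R.lsm(4)[OF X(1)] by simp
 also have "... = j" using k(2)[of "1[R]"] j R.lsm(4)[OF J_props(2)] by simp
 finally show ?thesis using that[OF h(1)] j(2) by simp
qed

lemma unit_central:
 "r IN R ==> a IN A ==> (r *[A] 1[A]) **[A] a = a **[A] (r *[A] 1[A])" using alg_assoc[of r "1[A]" a] alg_assoc[of r a "1[A]"] by simp

definition hmod :: "('a, 'p) module => ('a, 'x) module => ('r, 'p => 'x) module" where
 "hmod P X = \<lparr>carrier = lhom A P X, mult = undefined, one = undefined, zero = (%p:cr P. 0[X]),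
   add = (%f g. %p:cr P. f p +[X] g p), smult = (%r f. %p:cr P. (r *[A] 1[A]) *[X] f p)\<rparr>"

lemma hmod_simps [simp]:
 "cr (hmod P X) = lhom A P X" "0[hmod P X] = (%p:cr P. 0[X])"
 "f +[hmod P X] g = (%p:cr P. f p +[X] g p)" "r *[hmod P X] f = (%p:cr P. (r *[A] 1[A]) *[X] f p)" by (auto simp: hmod_def)

lemma lhom_scale:
 assumes P: "lmod A P" and X: "lmod A X" and f: "f : lhom A P X" and r: "r IN R"
 shows "(%p:cr P. (r *[A] 1[A]) *[X] f p) : lhom A P X"
proof (rule hresI)
 fix a p assume "a IN A" "p IN P"
 thus "(r *[A] 1[A]) *[X] f (a *[P] p) = a *[X] ((r *[A] 1[A]) *[X] f p)" using unit_central[OF r] r X hsm[OF f] hcl[OF f] by (simp flip: lsm(3)[OF X])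
qed (use P X r hcl[OF f] hadd[OF f] in "auto simp: lsm")

lemma fun_eqI: "f : extensional S ==> g : extensional S ==> (!!x. x : S ==> f x = g x) ==> f = g" by (rule extensionalityI)

lemma lm_hmod:
 assumes P: "lmod A P" and X: "lmod A X"
 shows "lmod R (hmod P X)"
proof (rule R.left_moduleI)
 note cl = hcl[of _ P X]
 note scal = lm_restrict[OF X]
 note rs = R.lsm[OF scal, simplified] 
 fix f assume f: "f IN hmod P X"
 have f': "f : lhom A P X" using f by simp
 note ext = lhom_extensional[OF f']
 show "0[hmod P X] +[hmod P X] f = f" by (rule fun_eqI[OF _ ext]) (use cl[OF f'] X in auto)
 show "1[R] *[hmod P X] f = f" by (rule fun_eqI[OF _ ext]) (use cl[OF f'] rs(4) in auto)
 show "EX g:cr (hmod P X). g +[hmod P X] f = 0[hmod P X]" using lhom_uminus[OF P X f'] cl[OF f'] X by (intro bexI[of _ "%p:cr P. -[X] f p"]) (auto intro!: restrict_ext)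
 fix g assume g: "g IN hmod P X"
 have g': "g : lhom A P X" using g by simp
 show "f +[hmod P X] g IN hmod P X" using lhom_plus[OF P X f' g'] by simp
 show "f +[hmod P X] g = g +[hmod P X] f" using cl[OF f'] cl[OF g'] X by (auto simp: lgr(2)[OF X] intro!: restrict_ext)
 show "(f +[hmod P X] g) +[hmod P X] h = f +[hmod P X] (g +[hmod P X] h)" if "h IN hmod P X" for h
  using cl[OF f'] cl[OF g'] cl[of h] that X by (auto simp: lgr(1)[OF X] intro!: restrict_ext)
 fix a assume a: "a IN R"
 show "a *[hmod P X] (f +[hmod P X] g) = a *[hmod P X] f +[hmod P X] a *[hmod P X] g" using cl[OF f'] cl[OF g'] a by (auto simp: rs(1) intro!: restrict_ext)
 show "a *[hmod P X] f IN hmod P X" using lhom_scale[OF P X f' a] by simp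
 fix b assume b: "b IN R"
 show "(a +[R] b) *[hmod P X] f = a *[hmod P X] f +[hmod P X] b *[hmod P X] f" using cl[OF f'] a b by (auto simp: rs(2) intro!: restrict_ext)
 show "(a **[R] b) *[hmod P X] f = a *[hmod P X] (b *[hmod P X] f)" using cl[OF f'] a b by (auto simp: rs(3) intro!: restrict_ext)
qed (use hzmap[OF P X] in simp)

lemma fgproj_eqI:
 assumes P: "fgproj P" and X: "lmod A X" and f: "f : lhom A P X"
  and q: "!!j. j<k ==> phi j : lhom A P (regular A)" "!!j. j<(k::nat) ==> q j IN P"
   "!!x. x IN P ==> x = finsum P (%j. phi j x *[P] q j) {..<k}"
  and x: "x IN P"
 shows "f x = finsum X (%j. phi j x *[X] f (q j)) {..<k}"
proof -
 note lP = fgproj_lm[OF P]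
 have c: "phi j x IN A" if "j<k" for j using hcl[OF q(1)[OF that] x] by simp
 have "f x = f (finsum P (%j. phi j x *[P] q j) {..<k})" using q(3)[OF x] by simp
 also have "... = finsum X (%j. f (phi j x *[P] q j)) {..<k}" by (rule lhom_finsum[OF lP X f]) (use c q(2) lP in auto)
 also have "... = finsum X (%j. phi j x *[X] f (q j)) {..<k}" by (rule finsum_cong'[OF X]) (use c q(2) hsm[OF f] hcl[OF f] X in auto)
 finally show ?thesis .
qed

lemma fin_gen_hmod:
 fixes P :: "('a, 'p) module" and X :: "('a, 'x) module"
 assumes P: "fgproj P" and X: "lmod A X" "fin_gen A X"
 shows "fin_gen R (hmod P X)"
proof -
 note lP = fgproj_lm[OF P]
 obtain k phi q where q: "!!j. j<k ==> phi j : lhom A P (regular A)" "!!j. j<(k::nat) ==> q j IN P"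
   "!!x. x IN P ==> x = finsum P (%j. phi j x *[P] q j) {..<k}" by (rule fgproj_dual_basis[OF P]) blast
 let ?X = "restrict_scalars A X"
 note lX = lm_restrict[OF X(1)]
 let ?D = "dsum {..<k} (%_. ?X)"
 let ?e = "%f:cr (hmod P X). %j:{..<k}. (%f:cr (hmod P X). f (q j)) f"
 have D: "lmod R ?D" "fin_gen R ?D" using R.lm_dsum[of "{..<k}" "%_. ?X"] R.fin_gen_dsum[of "{..<k}" "%_. ?X"] lX fin_gen_restrict[OF X] by auto
 have ev: "(%f:cr (hmod P X). f (q j)) : lhom R (hmod P X) ?X" if "j<k" for j by (rule R.hresI[OF lm_hmod[OF lP X(1)]]) (use hcl q(2)[OF that] in auto)
 have e: "?e : lhom R (hmod P X) ?D" by (rule R.lhom_dpair[OF lm_hmod[OF lP X(1)]]) (rule ev, simp)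
 show ?thesis
 proof (rule R.fin_gen_inj[OF lm_hmod[OF lP X(1)] D e])
  fix f assume f: "f IN hmod P X" "?e f = 0[?D]"
  have f': "f : lhom A P X" using f by simp
  have z: "f (q j) = 0[X]" if "j<k" for j using fun_cong[OF f(2), of j] f(1) that by simp
  show "f = 0[hmod P X]"
  proof (rule fun_eqI[OF lhom_extensional[OF f']])
   fix p assume p: "p IN P"
   have "f p = finsum X (%j. phi j p *[X] f (q j)) {..<k}" by (rule fgproj_eqI[OF P X(1) f' q p])
   also have "... = finsum X (%j. 0[X]) {..<k}" by (rule finsum_cong'[OF X(1)]) (use z X hcl[OF q(1) p] in auto)
   also have "... = 0[X]" using abelian_monoid.finsum_zero[OF lm_am[OF X(1)]] .
   finally show "f p = 0[hmod P X] p" using p by simp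
  qed simp
 qed
qed

abbreviation ract :: "('a, 'p) module => 'a => ('p => 'a) => 'p => 'a" where
 "ract P a f == %p:cr P. f p **[A] a"

lemma ract_hom:
 assumes P: "lmod A P" and f: "f : lhom A P (regular A)" and a: "a IN A"
 shows "ract P a f : lhom A P (regular A)" by (rule hresI[OF P])
  (use hcl[OF f] hadd[OF f] hsm[OF f] a in "auto simp: A.l_distr A.m_assoc")

abbreviation hr :: "('a, 'p) module => ('r, 'p => 'a) module" where
 "hr P == hmod P (regular A)"

lemma hr_smult:
 assumes f: "f : lhom A P (regular A)" and r: "r IN R"
 shows "ract P (r *[A] 1[A]) f = r *[hr P] f" using hcl[OF f] unit_central[OF r] by (auto intro!: restrict_ext)

text \<open>\<open>hom_ring A P\<close> with restricted scalars and \<open>hr P\<close> are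
  different records, but they have the same \<open>R\<close>-linear functionals on the same maps.
  After this, elements of \<open>nu P\<close> are functionals on \<open>hr P\<close>.\<close>

lemma nakayama_carrier: "cr (nakayama R J A P) = lhom R (hr P) J"
proof -
 have "!!r f. r IN R ==> f : lhom A P (regular A) ==> ract P (r *[A] 1[A]) f = r *[hr P] f" by (rule hr_smult)
 thus ?thesis unfolding nakayama_def dual_def lhom_def[where A=R] by (simp add: hom_ring_def)
qed

lemma nakayama_simps [simp]:
 "0[nakayama R J A P] = (%m:lhom A P (regular A). 0[J])"
 "f +[nakayama R J A P] g = (%m:lhom A P (regular A). f m +[J] g m)"
 "a *[nakayama R J A P] f = (%m:lhom A P (regular A). f (ract P a m))" by (auto simp: nakayama_def dual_def hom_ring_def)

lemma lm_nakayama: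
 assumes P: "lmod A P"
 shows "lmod A (nakayama R J A P)"
proof (rule left_moduleI, unfold nakayama_carrier nakayama_simps)
 let ?H = "lhom A P (regular A)"
 note lH = lm_hmod[OF P lm_regular] and lJ = J_props(2)
 note cl = R.hcl[of _ "hr P" J, simplified]
 fix f assume f: "f : lhom R (hr P) J"
 have ext: "f : extensional ?H" using R.lhom_extensional[OF f] by simp
 note cf = cl[OF f]
 show "(%m:?H. (%m:?H. 0[J]) m +[J] f m) = f" by (rule fun_eqI[OF _ ext]) (use cf lJ in auto)
 show "(%m:?H. f (ract P 1[A] m)) = f"
 proof (rule fun_eqI[OF _ ext])
  fix m assume m: "m : ?H"
  have "ract P 1[A] m = m" by (rule fun_eqI[OF _ lhom_extensional[OF m]]) (use hcl[OF m] in auto)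
  thus "(%m:?H. f (ract P 1[A] m)) m = f m" using m by simp
 qed simp
 show "EX g:lhom R (hr P) J. (%m:?H. g m +[J] f m) = (%m:?H. 0[J])"
  using R.lhom_uminus[OF lH lJ f] cf lJ by (intro bexI[of _ "%m:cr (hr P). -[J] f m"]) (auto intro!: restrict_ext)
 fix g assume g: "g : lhom R (hr P) J"
 note cg = cl[OF g]
 show "(%m:?H. f m +[J] g m) : lhom R (hr P) J" using R.lhom_plus[OF lH lJ f g] by simp
 show "(%m:?H. f m +[J] g m) = (%m:?H. g m +[J] f m)" using cf cg by (auto simp: R.lgr(2)[OF lJ] intro!: restrict_ext)
 show "(%m:?H. (%m:?H. f m +[J] g m) m +[J] h m) = (%m:?H. f m +[J] (%m:?H. g m +[J] h m) m)" if "h : lhom R (hr P) J" for h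
  using cf cg cl[OF that] by (auto simp: R.lgr(1)[OF lJ] intro!: restrict_ext)
 fix a assume a: "a IN A"
 have ra: "ract P a m : ?H" if "m : ?H" for m by (rule ract_hom[OF P that a])
 show "(%m:?H. (%m:?H. f m +[J] g m) (ract P a m)) = (%m:?H. (%m:?H. f (ract P a m)) m +[J] (%m:?H. g (ract P a m)) m)" using ra by (auto intro!: restrict_ext)
 have "(%m:cr (hr P). f (ract P a m)) : lhom R (hr P) J"
 proof (rule R.hresI[OF lH])
  fix m assume m: "m IN hr P"
  show "f (ract P a m) IN J" using cf ra m by simp
  note cm = hcl[of m P "regular A", simplified]
  show "f (ract P a (m +[hr P] m')) = f (ract P a m) +[J] f (ract P a m')" if m': "m' IN hr P" for m'
  proof -
   have "ract P a (m +[hr P] m') = ract P a m +[hr P] ract P a m'" using cm m hcl[of m' P "regular A"] m' a by (auto simp: A.l_distr intro!: restrict_ext)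
   thus ?thesis using R.hadd[OF f, of "ract P a m" "ract P a m'"] ra m m' by simp
  qed
  show "f (ract P a (r *[hr P] m)) = r *[J] f (ract P a m)" if r: "r IN R" for r
  proof -
   have "ract P a (r *[hr P] m) = r *[hr P] ract P a m" using cm m a r by (auto simp: A.m_assoc intro!: restrict_ext)
   thus ?thesis using R.hsm[OF f r, of "ract P a m"] ra m by simp
  qed
 qed
 thus "(%m:?H. f (ract P a m)) : lhom R (hr P) J" by simp
 fix b assume b: "b IN A"
 have rb: "ract P b m : ?H" if "m : ?H" for m by (rule ract_hom[OF P that b])
 show "(%m:?H. f (ract P (a +[A] b) m)) = (%m:?H. (%m:?H. f (ract P a m)) m +[J] (%m:?H. f (ract P b m)) m)"
 proof (rule restrict_ext)
  fix m assume m: "m : ?H"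
  have "ract P (a +[A] b) m = ract P a m +[hr P] ract P b m" using hcl[OF m] a b by (auto simp: A.r_distr intro!: restrict_ext)
  thus "f (ract P (a +[A] b) m) = (%m:?H. f (ract P a m)) m +[J] (%m:?H. f (ract P b m)) m" using R.hadd[OF f, of "ract P a m" "ract P b m"] ra rb m by simp
 qed
 show "(%m:?H. f (ract P (a **[A] b) m)) = (%m:?H. (%m:?H. f (ract P b m)) (ract P a m))"
 proof (rule restrict_ext)
  fix m assume m: "m : ?H"
  have "ract P (a **[A] b) m = ract P b (ract P a m)" using hcl[OF m] a b by (auto simp: A.m_assoc intro!: restrict_ext)
  thus "f (ract P (a **[A] b) m) = (%m:?H. f (ract P b m)) (ract P a m)" using ra m by simp
 qed
qed (use R.hzmap[OF lm_hmod[OF P lm_regular] J_props(2)] in simp)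

text \<open>A functional on \<open>Hom(P, A)\<close> is determined by its values on finitely many
  \<open>R\<close>-generators. So \<open>nu P\<close> embeds \<open>R\<close>-linearly into a power
  of \<open>J\<close>, and submodules of finitely generated \<open>R\<close>-modules are finitely
  generated.\<close>

lemma fin_gen_nakayama:
 fixes P :: "('a, 'p) module"
 assumes P: "fgproj P"
 shows "fin_gen A (nakayama R J A P)"
proof -
 let ?N = "nakayama R J A P" and ?H = "lhom A P (regular A)"
 note lP = fgproj_lm[OF P]
 note lH = lm_hmod[OF lP lm_regular] and lN = lm_nakayama[OF lP]
 note lNR = lm_restrict[OF lN]
 obtain k c where c: "c : lhom R (R.free k) (hr P)" "c ` cr (R.free k) = cr (hr P)" by (rule R.fin_gen_cover[OF lH fin_gen_hmod[OF P lm_regular fin_gen_regular]])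
 have cb: "c (R.basis k j) : ?H" for j using R.hcl[OF c(1) R.basis_closed] by simp
 let ?D = "dsum {..<k} (%_. J)"
 have D: "lmod R ?D" "fin_gen R ?D" using R.lm_dsum[of "{..<k}" "%_. J"] R.fin_gen_dsum[of "{..<k}" "%_. J"] J_props by auto
 let ?e = "%f:cr (restrict_scalars A ?N). %j:{..<k}. (%f:cr (restrict_scalars A ?N). f (c (R.basis k j))) f"
 have ev: "(%f:cr (restrict_scalars A ?N). f (c (R.basis k j))) : lhom R (restrict_scalars A ?N) J" for j
 proof (rule R.hresI[OF lNR])
  fix f assume f: "f IN restrict_scalars A ?N"
  have f': "f : lhom R (hr P) J" using f nakayama_carrier by auto
  show "f (c (R.basis k j)) IN J" using R.hcl[OF f'] cb by simp
  show "(f +[restrict_scalars A ?N] g) (c (R.basis k j)) = f (c (R.basis k j)) +[J] g (c (R.basis k j))" for g using cb by simp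
  show "(r *[restrict_scalars A ?N] f) (c (R.basis k j)) = r *[J] f (c (R.basis k j))" if r: "r IN R" for r
   unfolding restrict_simps nakayama_simps using cb[of j] hr_smult[OF cb r, of j] R.hsm[OF f' r, of "c (R.basis k j)"] by simp
 qed
 have e: "?e : lhom R (restrict_scalars A ?N) ?D" by (rule R.lhom_dpair[OF lNR]) (rule ev)
 have "fin_gen R (restrict_scalars A ?N)"
 proof (rule R.fin_gen_inj[OF lNR D e])
  fix f assume f: "f IN restrict_scalars A ?N" "?e f = 0[?D]"
  have f': "f : lhom R (hr P) J" using f nakayama_carrier by auto
  have z: "f (c (R.basis k j)) = 0[J]" if "j<k" for j using fun_cong[OF f(2), of j] f(1) that by simp
  have "f m = 0[J]" if m: "m IN hr P" for m
  proof -
   obtain w where w: "w IN R.free k" "c w = m" by (rule surjE[OF c(2) m])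
   have "(%w:cr (R.free k). f (c w)) w = (%w:cr (R.free k). 0[J]) w"
    by (rule R.free_hom_eq[OF J_props(2) R.hcomp[OF R.lm_free c(1) f'] R.hzmap[OF R.lm_free J_props(2)] _ w(1)])
     (use z in simp)
   thus ?thesis using w by simp
  qed
  thus "f = 0[restrict_scalars A ?N]" using R.lhom_extensional[OF f'] by (intro fun_eqI[of _ ?H]) auto
 qed
 then obtain S where S: "finite S" "R.generates (restrict_scalars A ?N) S" using R.fin_gen_generates[OF lNR] by blast
 have "generates ?N S" unfolding generates_def
 proof (intro conjI allI impI)
  show "S<=cr ?N" using S(2) unfolding R.generates_def by simp
  fix U assume U: "submod A ?N U & S<=U"
  hence "submod R (restrict_scalars A ?N) U" unfolding submod_def by (simp del: nakayama_simps)
  thus "U = cr ?N" using S(2) U unfolding R.generates_def by simp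
 qed
 thus ?thesis by (rule generates_fin_gen[OF lN S(1)])
qed

text \<open>The adjunction \<open>D Hom(P, X) \<cong> Hom(X, \<nu>P)\<close>.\<close>

lemma to_nakayama:
 fixes P :: "('a, 'p) module" and X :: "('a, 'x) module"
 assumes P: "lmod A P" and X: "lmod A X" and mu: "mu : lhom R (hmod P X) J"
 shows "(%x:cr X. %phi:lhom A P (regular A). mu (%p:cr P. phi p *[X] x)) : lhom A X (nakayama R J A P)"
proof -
 let ?H = "lhom A P (regular A)"
 let ?s = "%phi x. %p:cr P. phi p *[X] x"
 note lH = lm_hmod[OF P lm_regular]
 have cl: "phi p IN A" if "phi : ?H" "p IN P" for phi p using hcl[OF that] by simp
 have s: "?s phi x : lhom A P X" if "phi : ?H" "x IN X" for phi x by (rule hresI[OF P]) (use X cl hadd[OF that(1)] hsm[OF that(1)] that in "auto simp: lsm")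
 have mua: "mu (%p:cr P. f p +[X] g p) = mu f +[J] mu g" if "f : lhom A P X" "g : lhom A P X" for f g using R.hadd[OF mu] that by simp
 have mus: "mu (%p:cr P. (r *[A] 1[A]) *[X] f p) = r *[J] mu f" if "f : lhom A P X" "r IN R" for f r using R.hsm[OF mu] that by simp
 show ?thesis
 proof (rule hresI[OF X], unfold nakayama_carrier)
  fix x assume x: "x IN X"
  have "(%phi:cr (hr P). mu (?s phi x)) : lhom R (hr P) J"
  proof (rule R.hresI[OF lH])
   fix phi assume f: "phi IN hr P"
   thus "mu (?s phi x) IN J" using R.hcl[OF mu] s x by simp
   show "mu (?s (phi +[hr P] phi') x) = mu (?s phi x) +[J] mu (?s phi' x)" if f': "phi' IN hr P" for phi'
   proof -
    have e: "?s (phi +[hr P] phi') x = (%p:cr P. ?s phi x p +[X] ?s phi' x p)" using cl f f' x X by (auto simp: lsm intro!: restrict_ext)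
    show ?thesis unfolding e by (rule mua[of "?s phi x" "?s phi' x"]) (use s f f' x in simp_all)
   qed
   show "mu (?s (r *[hr P] phi) x) = r *[J] mu (?s phi x)" if r: "r IN R" for r
   proof -
    have "?s (r *[hr P] phi) x = (%p:cr P. (r *[A] 1[A]) *[X] ?s phi x p)" using cl f r x X by (auto simp: lsm intro!: restrict_ext)
    thus ?thesis using mus[OF s r] f x by simp
   qed
  qed
  thus "(%phi:?H. mu (?s phi x)) : lhom R (hr P) J" by simp
  show "(%phi:?H. mu (?s phi (x +[X] y))) = (%phi:?H. mu (?s phi x)) +[nakayama R J A P] (%phi:?H. mu (?s phi y))" if y: "y IN X" for y unfolding nakayama_simps
  proof (rule restrict_ext)
   fix phi assume f: "phi : ?H"
   have e: "?s phi (x +[X] y) = (%p:cr P. ?s phi x p +[X] ?s phi y p)" using cl f x y X by (auto simp: lsm intro!: restrict_ext)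
   have "mu (?s phi (x +[X] y)) = mu (?s phi x) +[J] mu (?s phi y)" unfolding e by (rule mua[OF s[OF f x] s[OF f y]])
   thus "mu (?s phi (x +[X] y)) = (%phi:?H. mu (?s phi x)) phi +[J] (%phi:?H. mu (?s phi y)) phi" using f by simp
  qed
  show "(%phi:?H. mu (?s phi (a *[X] x))) = a *[nakayama R J A P] (%phi:?H. mu (?s phi x))" if a: "a IN A" for a unfolding nakayama_simps
  proof (rule restrict_ext)
   fix phi assume f: "phi : ?H"
   have "?s phi (a *[X] x) = ?s (ract P a phi) x" using cl f x a X by (auto simp: lsm intro!: restrict_ext)
   thus "mu (?s phi (a *[X] x)) = (%phi:?H. mu (?s phi x)) (ract P a phi)" using ract_hom[OF P f a] by simp
  qed
 qed
qed

text \<open>Separate \<open>u p\<close> from zero by a functional \<open>f\<close> with values in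
  \<open>J\<close>. Then \<open>v\<close> going to \<open>f (v p)\<close> is a functional on
  \<open>Hom(P, X)\<close>, and its adjoint is a map from \<open>X\<close> to \<open>nu P\<close>;
  if that were zero, the dual basis formula would give \<open>f (u p) = 0\<close>.\<close>

lemma nakayama_nonzero:
 fixes P :: "('a, 'p) module" and X :: "('a, 'x) module"
 assumes P: "fgproj P" and X: "lmod A X" "fin_gen A X" and u: "u : lhom A P X" and p: "p IN P" "u p~=0[X]"
 obtains h x where "h : lhom A X (nakayama R J A P)" "x IN X" "h x~=0[nakayama R J A P]"
proof -
 let ?H = "lhom A P (regular A)"
 note lP = fgproj_lm[OF P]
 note lXR = lm_restrict[OF X(1)]
 obtain f where f: "f : lhom R (restrict_scalars A X) J" "f (u p)~=0[J]"
  by (rule J_separates[OF lXR fin_gen_restrict[OF X], of "u p"]) (use hcl[OF u p(1)] p(2) in auto)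
 let ?m = "%v:cr (hmod P X). f (v p)"
 have vp: "v p IN X" if "v : lhom A P X" for v by (rule hcl[OF that p(1)])
 have m: "?m : lhom R (hmod P X) J" by (rule R.hresI[OF lm_hmod[OF lP X(1)]])
   (use p vp R.hcl[OF f(1)] R.hadd[OF f(1)] R.hsm[OF f(1)] in auto)
 let ?h = "%x:cr X. %phi:?H. ?m (%p:cr P. phi p *[X] x)"
 have h: "?h : lhom A X (nakayama R J A P)" by (rule to_nakayama[OF lP X(1) m])
 note tt = that[OF h]
 show ?thesis
 proof (rule ccontr)
  assume "~ thesis"
  hence z: "?h x = 0[nakayama R J A P]" if xx: "x IN X" for x using tt[OF xx] by blast
  obtain k phi q where q: "!!j. j<k ==> phi j : ?H" "!!j. j<(k::nat) ==> q j IN P"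
   "!!x. x IN P ==> x = finsum P (%j. phi j x *[P] q j) {..<k}" by (rule fgproj_dual_basis[OF P]) blast
  have fz: "f (phi j p *[X] u (q j)) = 0[J]" if "j<k" for j
  proof -
   have c: "u (q j) IN X" by (rule hcl[OF u q(2)[OF that]])
   have cl: "phi j p IN A" if "p IN P" for p using hcl[OF q(1)[OF \<open>j < k\<close>] that] by simp
   have "(%p:cr P. phi j p *[X] u (q j)) : lhom A P X" by (rule hresI[OF lP]) (use X c cl hadd[OF q(1)[OF that]] hsm[OF q(1)[OF that]] in "auto simp: lsm")
   thus ?thesis using fun_cong[OF z[OF c], of "phi j"] c q(1)[OF that] p(1) by simp
  qed
  have c: "phi j p *[X] u (q j) IN X" if "j<k" for j using hcl[OF q(1)[OF that] p(1)] hcl[OF u q(2)[OF that]] X by simp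
  have fx: "finsum X g {..<k} = finsum (restrict_scalars A X) g {..<k}" for g unfolding finsum_def restrict_scalars_def by (simp add: finprod_def)
  have "f (u p) = f (finsum (restrict_scalars A X) (%j. phi j p *[X] u (q j)) {..<k})" using fgproj_eqI[OF P X(1) u q p(1)] fx by simp
  also have "... = finsum J (%j. f (phi j p *[X] u (q j))) {..<k}" by (rule R.lhom_finsum[OF lXR J_props(2) f(1)]) (use c in auto)
  also have "... = finsum J (%j. 0[J]) {..<k}" by (rule R.finsum_cong'[OF J_props(2)]) (use fz J_props in auto)
  also have "... = 0[J]" using abelian_monoid.finsum_zero[OF R.lm_am[OF J_props(2)]] .
  finally show False using f(2) by simp
 qed
qed

text \<open>Under the adjunction, extending a map along \<open>X -> Y\<close> becomes extending a
  functional along \<open>Hom(P, X) -> Hom(P, Y)\<close>. This map stays injective, and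
  \<open>J\<close> is injective over \<open>R\<close>.\<close>

lemma injective_nakayama:
 fixes P :: "('a, 'p) module"
 assumes P: "fgproj P"
 shows "injective A (nakayama R J A P)" unfolding injective_def
proof (intro conjI ballI impI)
 let ?N = "nakayama R J A P" and ?H = "lhom A P (regular A)"
 note lP = fgproj_lm[OF P]
 show lN: "lmod A ?N" by (rule lm_nakayama[OF lP])
 fix X Y g f assume X: "X : fgmod A" and Y: "Y : fgmod A" and g: "g : lhom A X Y" "inj_on g (cr X)" and f: "f : lhom A X ?N"
 note lX = fgD[OF X] and lY = fgD[OF Y]
 obtain k phi q where q: "!!j. j<k ==> phi j : ?H" "!!j. j<(k::nat) ==> q j IN P"
  "!!x. x IN P ==> x = finsum P (%j. phi j x *[P] q j) {..<k}" by (rule fgproj_dual_basis[OF P]) blast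
 have fc: "f x : lhom R (hr P) J" if "x IN X" for x using hcl[OF f that] nakayama_carrier by auto
 note hX = lm_hmod[OF lP lX(1)] and hY = lm_hmod[OF lP lY(1)] and lH = lm_hmod[OF lP lm_regular]
 \<comment> \<open>The functional adjoint to \<open>f\<close>, written with the dual basis:
   \<open>h\<close> is the sum of the maps \<open>phi j\<close> followed by multiples of
   \<open>h (q j)\<close>.\<close>
 let ?l = "%h:cr (hmod P X). finsum J (%j. (%h:cr (hmod P X). f (h (q j)) (phi j)) h) {..<k}"
 have fadd: "f (x +[X] y) m = f x m +[J] f y m" if "x IN X" "y IN X" "m : ?H" for x y m using hadd[OF f that(1,2)] that(3) by simp
 have fact: "f (a *[X] x) m = f x (ract P a m)" if "a IN A" "x IN X" "m : ?H" for a x m using hsm[OF f that(1,2)] that(3) by simp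
 have l1: "(%h:cr (hmod P X). f (h (q j)) (phi j)) : lhom R (hmod P X) J" if j: "j<k" for j
 proof (rule R.hresI[OF hX])
  fix h assume h: "h IN hmod P X"
  have hc: "h (q j) IN X" using hcl[of h P X, OF _ q(2)[OF j]] h by simp
  show "f (h (q j)) (phi j) IN J" using R.hcl[OF fc[OF hc]] q(1)[OF j] by simp
  show "f ((h +[hmod P X] h') (q j)) (phi j) = f (h (q j)) (phi j) +[J] f (h' (q j)) (phi j)" if "h' IN hmod P X" for h'
   using fadd[OF hc _ q(1)[OF j]] hcl[of h' P X, OF _ q(2)[OF j]] that q(2)[OF j] by simp
  show "f ((r *[hmod P X] h) (q j)) (phi j) = r *[J] f (h (q j)) (phi j)" if r: "r IN R" for r
   using fact[OF unit_closed[OF r] hc q(1)[OF j]] hr_smult[OF q(1)[OF j] r] R.hsm[OF fc[OF hc] r, of "phi j"] q(1,2)[OF j] by simp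
 qed
 have l: "?l : lhom R (hmod P X) J" by (rule R.lhom_sum[OF hX J_props(2) finite_lessThan]) (rule l1, simp)
 have gc: "(%p:cr P. g (h p)) : lhom A P Y" if "h : lhom A P X" for h by (rule hcomp[OF lP that g(1)])
 let ?g = "%h:cr (hmod P X). (%p:cr P. g (h p))"
 have gh: "?g : lhom R (hmod P X) (hmod P Y)"
 proof (rule R.hresI[OF hX])
  fix h assume h: "h IN hmod P X"
  hence c: "h p IN X" if "p IN P" for p using hcl[of h P X, OF _ that] by simp
  show "(%p:cr P. g (h p)) IN hmod P Y" using gc h by simp
  show "(%p:cr P. g ((h +[hmod P X] h') p)) = (%p:cr P. g (h p)) +[hmod P Y] (%p:cr P. g (h' p))" if "h' IN hmod P X" for h'
   using c hcl[of h' P X] that hadd[OF g(1)] by (auto intro!: restrict_ext)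
  show "(%p:cr P. g ((r *[hmod P X] h) p)) = r *[hmod P Y] (%p:cr P. g (h p))" if "r IN R" for r using c that hsm[OF g(1)] by (auto intro!: restrict_ext)
 qed
 have gi: "inj_on ?g (cr (hmod P X))"
 proof (rule inj_onI)
  fix h h' assume h: "h IN hmod P X" "h' IN hmod P X" "?g h = ?g h'"
  have h': "h : lhom A P X" "h' : lhom A P X" using h by auto
  show "h = h'"
  proof (rule lhom_eqI[OF h'])
   fix p assume p: "p IN P"
   have "g (h p) = g (h' p)" using fun_cong[OF h(3), of p] h(1,2) p by simp
   thus "h p = h' p" using inj_onD[OF g(2)] hcl[OF h'(1) p] hcl[OF h'(2) p] by blast
  qed
 qed
 obtain mu where mu: "mu : lhom R (hmod P Y) J" "!!h. h IN hmod P X ==> mu (?g h) = ?l h"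
  by (rule R.injective_extend[OF J_props(1) hX fin_gen_hmod[OF P lX] hY fin_gen_hmod[OF P lY] gh gi l]) blast
 let ?h = "%y:cr Y. %phi:?H. mu (%p:cr P. phi p *[Y] y)"
 have h: "?h : lhom A Y ?N" by (rule to_nakayama[OF lP lY(1) mu(1)])
 have "?h (g x) = f x" if x: "x IN X" for x
 proof (rule fun_eqI[of _ ?H])
  show "f x : extensional ?H" using R.lhom_extensional[OF fc[OF x]] by simp
  show "?h (g x) : extensional ?H" using hcl[OF g(1) x] by simp
  fix m assume m: "m : ?H"
  have mc: "m p IN A" if "p IN P" for p using hcl[OF m that] by simp
  let ?s = "%p:cr P. m p *[X] x"
  have s: "?s : lhom A P X" by (rule hresI[OF lP]) (use lX(1) x mc hadd[OF m] hsm[OF m] in "auto simp: lsm")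
  have "(%p:cr P. m p *[Y] g x) = ?g ?s" using s hsm[OF g(1)] mc x by (auto intro!: restrict_ext)
  hence "?h (g x) m = ?l ?s" using mu(2)[of ?s] s m hcl[OF g(1) x] by simp
  also have "... = finsum J (%j. f x (ract P (m (q j)) (phi j))) {..<k}"
  proof -
   have e: "(%h:cr (hmod P X). f (h (q j)) (phi j)) ?s = f x (ract P (m (q j)) (phi j))" if j: "j<k" for j
    using s q(2)[OF j] fact[OF mc[OF q(2)[OF j]] x q(1)[OF j]] by simp
   have c: "f x (ract P (m (q j)) (phi j)) IN J" if j: "j<k" for j using R.hcl[OF fc[OF x]] ract_hom[OF lP q(1)[OF j] mc[OF q(2)[OF j]]] by simp
   have "?l ?s = finsum J (%j. (%h:cr (hmod P X). f (h (q j)) (phi j)) ?s) {..<k}" using s by simp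
   also have "... = finsum J (%j. f x (ract P (m (q j)) (phi j))) {..<k}" by (rule R.finsum_cong'[OF J_props(2)]) (use e c in auto)
   finally show ?thesis .
  qed
  also have "... = f x (finsum (hr P) (%j. ract P (m (q j)) (phi j)) {..<k})"
   by (rule R.lhom_finsum[OF lH J_props(2) fc[OF x], symmetric]) (use ract_hom[OF lP q(1)] mc q(2) in auto)
  \<comment> \<open>The dual basis formula for \<open>m\<close> itself, now as an identity in the
    right module \<open>Hom(P, A)\<close>.\<close>
  also have "finsum (hr P) (%j. ract P (m (q j)) (phi j)) {..<k} = m"
  proof -
   have rh: "ract P (m (q j)) (phi j) IN hr P" if "j<k" for j using ract_hom[OF lP q(1)[OF that] mc[OF q(2)[OF that]]] by simp
   have fin: "finsum (hr P) (%j. ract P (m (q j)) (phi j)) {..<k} : ?H" using R.finsum_closed'[OF lH, of "{..<k}"] rh by simp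
   show ?thesis
   proof (rule lhom_eqI[OF fin m])
    fix p assume p: "p IN P"
    let ?ev = "%f:cr (hr P). f p"
    have ev: "?ev : lhom R (hr P) (restrict_scalars A (regular A))" by (rule R.hresI[OF lH]) (use hcl[OF _ p, of _ "regular A"] p in auto)
    have fr: "finsum (restrict_scalars A (regular A)) g {..<k} = finsum (regular A) g {..<k}" for g unfolding finsum_def restrict_scalars_def by (simp add: finprod_def)
    have cj: "phi j p IN A" if "j<k" for j using hcl[OF q(1)[OF that] p] by simp
    have "finsum (hr P) (%j. ract P (m (q j)) (phi j)) {..<k} p = ?ev (finsum (hr P) (%j. ract P (m (q j)) (phi j)) {..<k})" using fin by simp
    also have "... = finsum (regular A) (%j. ?ev (ract P (m (q j)) (phi j))) {..<k}"
     unfolding fr[symmetric] by (rule R.lhom_finsum[OF lH lm_restrict[OF lm_regular] ev]) (use rh in auto)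
    also have "... = finsum (regular A) (%j. phi j p *[regular A] m (q j)) {..<k}" by (rule finsum_cong'[OF lm_regular]) (use rh p cj mc[OF q(2)] in auto)
    also have "... = m p" using fgproj_eqI[OF P lm_regular m q p] by simp
    finally show "finsum (hr P) (%j. ract P (m (q j)) (phi j)) {..<k} p = m p" .
   qed
  qed
  finally show "?h (g x) m = f x m" .
 qed
 thus "EX h:lhom A Y ?N. ALL x:cr X. h (g x) = f x" using h by blast
qed

end

section \<open>Injective modules over Artin algebras\<close>

context base_ring
begin

text \<open>\<open>biprod\<close> produces pairs and so leaves \<open>fgmod A\<close>;
  \<open>bip\<close> names the copies of the sum that stay inside, which lets classes of modules in
  \<open>fgmod A\<close> be closed under sums.\<close>

definition bip :: "('a, 'a univ) module => ('a, 'a univ) module => ('a, 'a univ) module => bool" where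
 "bip M N L <-> L : fgmod A & (EX f:lhom A (biprod M N) L. EX g:lhom A L (biprod M N).
   (ALL x:cr (biprod M N). g (f x) = x) & (ALL y:cr L. f (g y) = y))"

lemma ex_bip:
 assumes "M : fgmod A" "N : fgmod A"
 obtains L where "bip M N L"
proof -
 obtain L f g where "L : fgmod A" "f : lhom A (biprod M N) L" "g : lhom A L (biprod M N)"
  "!!x. x IN biprod M N ==> g (f x) = x" "!!y. y IN L ==> f (g y) = y"
  by (rule ex_copy[OF lm_biprod[OF assms[THEN fgD(1)]] fin_gen_biprod[OF assms[THEN fgD(1)] assms[THEN fgD(2)]]]) blast
 hence "bip M N L" unfolding bip_def by blast
 thus ?thesis by (rule that)
qed

lemma bipE:
 assumes "bip M N L"
 obtains f g where "L : fgmod A" "lmod A L" "f : lhom A (biprod M N) L" "g : lhom A L (biprod M N)"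
  "!!x. x IN biprod M N ==> g (f x) = x" "!!y. y IN L ==> f (g y) = y"
 using assms unfolding bip_def by (elim conjE bexE) (rule that[OF _ fgD(1)], assumption+, (erule (1) bspec)+)

lemma bip_fgproj: "bip M N L ==> fgproj M ==> fgproj N ==> fgproj L" by (rule bipE) (auto intro: fgproj_iso[OF fgproj_biprod])

lemma bip_injective: "bip M N L ==> injective A M ==> injective A N ==> injective A L" by (rule bipE) (auto intro: injective_retract[OF injective_biprod])

lemma bip_fgmod: "bip M N L ==> L : fgmod A" by (simp add: bip_def)

lemma bip_pair:
 assumes L: "bip M N L" and X: "lmod A X" "lmod A M" "lmod A N" and f: "f : lhom A X M" "g : lhom A X N"
 obtains h where "h : lhom A X L" "!!x. x IN X ==> h x = 0[L] <-> f x = 0[M] & g x = 0[N]"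
proof -
 obtain i r where L: "L : fgmod A" "lmod A L" "i : lhom A (biprod M N) L" "r : lhom A L (biprod M N)"
  and ri: "!!x. x IN biprod M N ==> r (i x) = x" by (rule bipE[OF L]) blast
 note h = hcomp[OF X(1) lhom_pair[OF X(1) f] L(3)]
 have "i (f x, g x) = 0[L] <-> f x = 0[M] & g x = 0[N]" if x: "x IN X" for x
 proof -
  have c: "(f x, g x) IN biprod M N" using hcl[OF f(1) x] hcl[OF f(2) x] by simp
  have z: "i 0[biprod M N] = 0[L]" "r 0[L] = 0[biprod M N]" using hzero[OF L(3)] hzero[OF L(4)] L(2) X by auto
  have "i (f x, g x) = 0[L] <-> (f x, g x) = 0[biprod M N]" using ri[OF c] z by metis
  thus ?thesis by simp
 qed
 thus ?thesis by (intro that[OF h]) simp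
qed

lemma bip_copair:
 assumes L: "bip M N L" and X: "lmod A X" "lmod A M" "lmod A N" and f: "f : lhom A M X" "g : lhom A N X"
 obtains h where "h : lhom A L X" "f ` cr M<=h ` cr L" "g ` cr N<=h ` cr L"
proof -
 obtain i r where L: "L : fgmod A" "lmod A L" "i : lhom A (biprod M N) L" "r : lhom A L (biprod M N)"
  and ri: "!!x. x IN biprod M N ==> r (i x) = x" by (rule bipE[OF L]) blast
 let ?c = "%z:cr (biprod M N). f (fst z) +[X] g (snd z)"
 note h = hcomp[OF L(2,4) lhom_copair[OF X(2,3,1) f]]
 have hi: "(%x:cr L. ?c (r x)) (i (x, y)) = f x +[X] g y" if "x IN M" "y IN N" for x y using that ri[of "(x, y)"] hcl[OF L(3), of "(x, y)"] by simp
 have ic: "i (x, y) IN L" if "x IN M" "y IN N" for x y using that hcl[OF L(3), of "(x, y)"] by simp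
 show ?thesis
 proof (rule that[OF h]; rule image_subsetI)
  fix x assume x: "x IN M"
  have "f x = (%x:cr L. ?c (r x)) (i (x, 0[N]))" using hi[OF x, of "0[N]"] X hzero[OF f(2) X(3,1)] hcl[OF f(1) x] by simp
  thus "f x : (%x:cr L. ?c (r x)) ` cr L" by (rule image_eqI) (use ic[OF x, of "0[N]"] X in simp)
 next
  fix x assume x: "x IN N"
  have "g x = (%x:cr L. ?c (r x)) (i (0[M], x))" using hi[OF _ x, of "0[M]"] X hzero[OF f(1) X(2,1)] hcl[OF f(2) x] by simp
  thus "g x : (%x:cr L. ?c (r x)) ` cr L" by (rule image_eqI) (use ic[OF _ x, of "0[M]"] X in simp)
 qed
qed

lemma injective_zero: "lmod A M ==> zm M ==> injective A M" unfolding injective_def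
proof (intro conjI ballI impI)
 fix X Y g f assume M: "lmod A M" "zm M" and X: "X : fgmod A" "Y : fgmod A" "f : lhom A X M"
 have "f x = 0[M]" if "x IN X" for x using zmD[OF M(2) hcl[OF X(3) that]] .
 moreover assume "g : lhom A X Y"
 ultimately show "EX h:lhom A Y M. ALL x:cr X. h (g x) = f x" using hzmap[OF fgD(1)[OF X(2)] M(1)] hcl[of g X Y] by (intro bexI[of _ "%y:cr Y. 0[M]"]) auto
qed

end

context artin_alg
begin

lemma funpow_hom:
 assumes "f : lhom A M M" "lmod A M"
 shows "(%x:cr M. (f ^^ k) x) : lhom A M M"
proof (induction k)
 case (Suc k)
 have "(%x:cr M. (f ^^ Suc k) x) = (%x:cr M. f ((%x:cr M. (f ^^ k) x) x))" by (rule restrict_ext) simp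
 thus ?case using hcomp[OF assms(2) Suc assms(1)] by (simp only:)
next
 case 0
 have "(%x:cr M. (f ^^ 0) x) = (%x:cr M. x)" by (rule restrict_ext) simp
 thus ?case using lhom_id[OF assms(2)] by (simp only:)
qed

lemma kernels_stop:
 fixes M :: "('a, 'm) module"
 assumes M: "lmod A M" "fin_gen A M" and f: "f : lhom A M M"
 obtains m where "!!x. x IN M ==> (f ^^ Suc m) x = 0[M] ==> (f ^^ m) x = 0[M]"
proof -
 define U where "U k = {x:cr M. (%x:cr M. (f ^^ k) x) x = 0[M]}" for k
 have Us: "submod A M (U k)" for k unfolding U_def by (rule submod_kernel[OF M(1) M(1) funpow_hom[OF f M(1)]])
 have Ui: "x : U k <-> x IN M & (f ^^ k) x = 0[M]" for x k unfolding U_def by simp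
 have "U k<=U (Suc k)" for k using hzero[OF f M(1) M(1)] Ui by auto
 then obtain m where m: "ALL n>=m. U n = U m" using submods_stop[OF M, unfolded chains_stop_def, rule_format, of U] Us by blast
 have "U (Suc m) = U m" by (rule mp[OF spec[OF m]]) simp
 thus ?thesis by (intro that[of m]) (metis Ui)
qed

text \<open>The kernels of the powers of \<open>f\<close> stabilise at some \<open>m\<close>.
  Writing \<open>x\<close> as the \<open>m\<close>-th power of \<open>f\<close> applied to some
  \<open>y\<close>, one more application kills \<open>y\<close>, so already the \<open>m\<close>-th
  power does.\<close>

lemma surj_endo_inj:
 fixes M :: "('a, 'm) module"
 assumes M: "lmod A M" "fin_gen A M" and f: "f : lhom A M M" "f ` cr M = cr M" and x: "x IN M" "f x = 0[M]"
 shows "x = 0[M]"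
proof -
 obtain m where m: "!!x. x IN M ==> (f ^^ Suc m) x = 0[M] ==> (f ^^ m) x = 0[M]" by (rule kernels_stop[OF M f(1)]) blast
 have "EX y:cr M. (f ^^ k) y = x" for k
 proof (induction k)
  case (Suc k)
  then obtain y where y: "y IN M" "(f ^^ k) y = x" by blast
  obtain z where "z IN M" "f z = y" by (rule surjE[OF f(2) y(1)])
  thus ?case using y(2) by (intro bexI[of _ z]) (auto simp: funpow_swap1)
 qed (use x in simp)
 then obtain y where "y IN M" "(f ^^ m) y = x" by blast
 thus ?thesis using m[of y] x(2) by simp
qed

text \<open>The trace of the class in \<open>X\<close> is reached by a single map: choose a largest
  image, and enlarge by a sum to see that it absorbs all others. It is used for projective-injective
  modules and for \<open>ext0\<close>.\<close>

lemma max_image: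
 assumes X: "X : fgmod A" and z: "\<C> zmod" and C: "!!M. \<C> M ==> M : fgmod A" "!!M N L. \<C> M ==> \<C> N ==> bip M N L ==> \<C> L"
 obtains V f where "\<C> V" "f : lhom A V X" "!!M g. \<C> M ==> g : lhom A M X ==> g ` cr M<=f ` cr V"
proof -
 note lX = fgD[OF X]
 define S where "S = {f ` cr V | f V. \<C> V & f : lhom A V X}"
 have sub: "submod A X U" if "U : S" for U using that unfolding S_def using sm_range[OF _ lX(1)] C(1) fgD(1) by auto
 have mem: "(%x:cr zmod. 0[X]) ` cr zmod : S" unfolding S_def using z hzmap[OF lm_zmod lX(1)] by blast
 obtain U where U: "U : S" "!!Z. Z : S ==> U<=Z ==> Z = U" by (rule chains_stop_max[OF submods_stop[OF lX] mem sub]) auto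
 obtain f V where f: "U = f ` cr V" "\<C> V" "f : lhom A V X" using U(1) unfolding S_def by blast
 show ?thesis
 proof (rule that[OF f(2,3)])
  fix M g assume M: "\<C> M" "g : lhom A M X"
  obtain L where L: "bip V M L" by (rule ex_bip[OF C(1)[OF f(2)] C(1)[OF M(1)]])
  obtain h where h: "h : lhom A L X" "f ` cr V<=h ` cr L" "g ` cr M<=h ` cr L"
   by (rule bip_copair[OF L lX(1) fgD(1)[OF C(1)[OF f(2)]] fgD(1)[OF C(1)[OF M(1)]] f(3) M(2)])
  have "h ` cr L : S" unfolding S_def using h(1) C(2)[OF f(2) M(1) L] by blast
  from U(2)[OF this] show "g ` cr M<=f ` cr V" using h f(1) by simp
 qed
qed

text \<open>The dual of \<open>max_image\<close>: the common kernel of all maps from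
  \<open>X\<close> into the class is the kernel of a single one.\<close>

lemma min_kernel:
 assumes X: "X : fgmod A" and z: "\<C> zmod" and C: "!!M. \<C> M ==> M : fgmod A" "!!M N L. \<C> M ==> \<C> N ==> bip M N L ==> \<C> L"
 obtains W f where "\<C> W" "f : lhom A X W" "!!M g x. \<C> M ==> g : lhom A X M ==> x IN X ==> f x = 0[W] ==> g x = 0[M]"
proof -
 note lX = fgD[OF X]
 define S where "S = {{x:cr X. f x = 0[W]} | f W. \<C> W & f : lhom A X W}"
 have sub: "submod A X U" if "U : S" for U using that unfolding S_def using submod_kernel[OF lX(1)] C(1) fgD(1) by auto
 have mem: "{x:cr X. (%x:cr X. 0[zmod]) x = 0[zmod]} : S" unfolding S_def using z hzmap[OF lX(1) lm_zmod] by blast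
 obtain U where U: "U : S" "!!Z. Z : S ==> Z<=U ==> Z = U" by (rule chains_stop_min[OF submods_stop[OF lX] mem sub]) auto
 obtain f W where f: "U = {x:cr X. f x = 0[W]}" "\<C> W" "f : lhom A X W" using U(1) unfolding S_def by blast
 show ?thesis
 proof (rule that[OF f(2,3)])
  fix M g x assume M: "\<C> M" "g : lhom A X M" and x: "x IN X" "f x = 0[W]"
  obtain L where L: "bip W M L" by (rule ex_bip[OF C(1)[OF f(2)] C(1)[OF M(1)]])
  obtain h where h: "h : lhom A X L" "!!x. x IN X ==> h x = 0[L] <-> f x = 0[W] & g x = 0[M]"
   by (rule bip_pair[OF L lX(1) fgD(1)[OF C(1)[OF f(2)]] fgD(1)[OF C(1)[OF M(1)]] f(3) M(2)]) blast
  have "{x:cr X. h x = 0[L]} : S" unfolding S_def using h(1) C(2)[OF f(2) M(1) L] by blast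
  hence "{x:cr X. h x = 0[L]} = U" by (rule U(2)) (use h(2) f(1) in auto)
  hence "x : {x:cr X. h x = 0[L]}" using f(1) x by simp
  thus "g x = 0[M]" using h(2)[OF x(1)] by simp
 qed
qed

end

context dual_alg
begin

text \<open>Take a map to an injective module with smallest kernel. A nonzero \<open>x\<close> in
  that kernel gives a nonzero map from \<open>A\<close> into it, hence a nonzero map from the kernel
  to the injective module \<open>nu A\<close>; extended to \<open>X\<close>, it contradicts
  minimality.\<close>

lemma ex_injective_embedding:
 assumes X: "X : fgmod A"
 obtains E e where "E : fgmod A" "injective A E" "e : lhom A X E" "!!x. x IN X ==> e x = 0[E] ==> x = 0[X]"
proof -
 note lX = fgD[OF X]
 define C where "C M <-> M : fgmod A & injective A M" for M
 have C: "C zmod" "!!M. C M ==> M : fgmod A" "!!M N L. C M ==> C N ==> bip M N L ==> C L" using injective_zero[OF lm_zmod] bip_injective bip_fgmod unfolding C_def by auto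
 obtain E e where E: "C E" "e : lhom A X E"
  and m: "!!M g x. C M ==> g : lhom A X M ==> x IN X ==> e x = 0[E] ==> g x = 0[M]" by (rule min_kernel[of X C, OF X C(1,2)]) (assumption, erule (2) C(3), blast)
 have EC: "E : fgmod A" "injective A E" using E(1) C_def by auto
 let ?N = "nakayama R J A (regular A)"
 note lN = lm_nakayama[OF lm_regular]
 obtain N i r where N: "N : fgmod A" "i : lhom A ?N N" "r : lhom A N ?N" "!!x. x IN ?N ==> r (i x) = x" "!!y. y IN N ==> i (r y) = y"
  by (rule ex_copy[OF lN fin_gen_nakayama[OF fgproj_regular]]) blast
 have iN: "C N" unfolding C_def using N(1) by (rule conjI, intro injective_retract[OF injective_nakayama[OF fgproj_regular] fgD(1)[OF N(1)] N(3,2)]) (rule N(5))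
 show ?thesis
 proof (rule that[OF EC E(2)], rule ccontr)
  fix x assume x: "x IN X" "e x = 0[E]" "x~=0[X]"
  let ?K = "sub X {x:cr X. e x = 0[E]}"
  note K = submod_kernel[OF lX(1) fgD(1)[OF EC(1)] E(2)]
  have lK: "lmod A ?K" "fin_gen A ?K" using lX K fin_gen_sub by auto
  let ?u = "%a:cr (regular A). a *[X] x"
  have u: "?u : lhom A (regular A) ?K" by (rule lhom_cosub) (rule hresI, use lX x smD(4)[OF K] in "auto simp: lsm")
  have "?u 1[A]~=0[?K]" using x lX by (simp add: lsm)
  then obtain h y where h: "h : lhom A ?K ?N" "y IN ?K" "h y~=0[?N]" by (rule nakayama_nonzero[OF fgproj_regular lK u, of "1[A]", rotated]) auto
  obtain g where g: "g : lhom A X ?N" "!!y. y IN ?K ==> g ((%u:{x:cr X. e x = 0[E]}. u) y) = h y"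
   by (rule injective_extend[OF injective_nakayama[OF fgproj_regular] lK lX lhom_incl[OF lX(1) K] _ h(1)]) (auto simp: inj_on_def)
  have y: "y IN X" "e y = 0[E]" "g y = h y" using h(2) g(2)[OF h(2)] by auto
  have "i (g y) = 0[N]" using m[OF iN hcomp[OF lX(1) g(1) N(2)] y(1,2)] y(1) by simp
  hence "g y = r 0[N]" using N(4)[OF hcl[OF g(1) y(1)]] by simp
  thus False using h(3) y(3) hzero[OF N(3) fgD(1)[OF N(1)] lN] by simp
 qed
qed

text \<open>The envelope is cut out of an injective module \<open>E\<close> containing
  \<open>X\<close> as a smallest image of an endomorphism that is the identity on \<open>X\<close>.
  Such an image is a direct summand of \<open>E\<close>.\<close>

lemma ex_injective_envelope:
 assumes X: "X : fgmod A"
 obtains E e where "E : fgmod A" "injective A E" "e : lhom A X E" "!!x. x IN X ==> e x = 0[E] ==> x = 0[X]" "essential A E (e ` cr X)"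
proof -
 note lX = fgD[OF X]
 obtain E e where E: "E : fgmod A" "injective A E" "e : lhom A X E" "!!x. x IN X ==> e x = 0[E] ==> x = 0[X]" by (rule ex_injective_embedding[OF X]) blast
 note lE = fgD[OF E(1)]
 define S where "S = {phi ` cr E | phi. phi : lhom A E E & (ALL x:cr X. phi (e x) = e x)}"
 have sub: "submod A E U" if "U : S" for U using that unfolding S_def using sm_range[OF lE(1) lE(1)] by auto
 have mem: "(%x:cr E. x) ` cr E : S" unfolding S_def using lhom_id[OF lE(1)] hcl[OF E(3)] by (intro CollectI exI[of _ "%x:cr E. x"]) auto
 obtain I where I: "I : S" "!!Z. Z : S ==> Z<=I ==> Z = I" by (rule chains_stop_min[OF submods_stop[OF lE] mem sub]) auto
 obtain phi where p: "I = phi ` cr E" "phi : lhom A E E" "!!x. x IN X ==> phi (e x) = e x" using I(1) unfolding S_def by blast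
 note Is = sub[OF I(1)] and pc = hcl[OF p(2)] and ec = hcl[OF E(3)]
 let ?I = "sub E I"
 have lI: "lmod A ?I" "fin_gen A ?I" "?I : fgmod A" using lE Is fin_gen_sub fgmod_sub[OF E(1)] by auto
 have eI: "e x : I" if "x IN X" for x unfolding p(1) by (rule image_eqI[where x="e x"]) (use p(3) ec that in auto)
 text \<open>By minimality of the image, every \<open>psi\<close> fixing \<open>X\<close> restricts via \<open>phi\<close> to an automorphism of \<open>I\<close>.\<close>
 have inj: "y = 0[E]" if s: "psi : lhom A E E" "!!x. x IN X ==> psi (e x) = e x" and y: "y : I" "phi (psi y) = 0[E]" for psi y
 proof -
  let ?c = "%x:cr E. phi (psi x)"
  note c = hcomp[OF lE(1) s(1) p(2)]
  note c2 = hcomp[OF lE(1) p(2) c]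
  have "(%x:cr E. ?c (phi x)) ` cr E : S" unfolding S_def using c2 p(3) s(2) ec by (intro CollectI exI[of _ "%x:cr E. ?c (phi x)"]) auto
  moreover have "(%x:cr E. ?c (phi x)) ` cr E<=I" unfolding p(1) using pc hcl[OF s(1)] by auto
  ultimately have "(%x:cr E. ?c (phi x)) ` cr E = I" by (rule I(2))
  moreover have "(%x:cr E. ?c (phi x)) ` cr E = (%x:I. ?c x) ` cr ?I" unfolding p(1) using pc by auto
  ultimately have im: "(%x:I. ?c x) ` cr ?I = cr ?I" by simp
  have "y = 0[?I]" by (rule surj_endo_inj[OF lI(1,2) lhom_cosub[OF lhom_sub[OF c Is]] im])
    (use im y smD(5)[OF Is] in auto)
  thus ?thesis by simp
 qed
 have pI: "(%x:I. phi x) : lhom A ?I ?I" by (rule lhom_cosub[OF lhom_sub[OF p(2) Is]]) (use p(1) smD(5)[OF Is] in auto)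
 have pin: "x = 0[E]" if "x : I" "phi x = 0[E]" for x by (rule inj[of "%x:cr E. x"]) (use that lhom_id[OF lE(1)] ec smD(5)[OF Is] in auto)
 have "(%x:cr E. phi (phi x)) ` cr E : S" unfolding S_def using hcomp[OF lE(1) p(2,2)] p(3) ec by (intro CollectI exI[of _ "%x:cr E. phi (phi x)"]) auto
 hence im2: "(%x:cr E. phi (phi x)) ` cr E = I" by (rule I(2)) (use pc p(1) in auto)
 have bij: "bij_betw (%x:I. phi x) (cr ?I) (cr ?I)"
 proof (rule bij_betw_imageI)
  show "inj_on (%x:I. phi x) (cr ?I)" using lhom_inj_iff[OF lI(1) lI(1) pI] pin by auto
  show "(%x:I. phi x) ` cr ?I = cr ?I" using im2 unfolding p(1) by (auto simp: image_image)
 qed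
 obtain k where k: "k : lhom A ?I ?I" "!!x. x IN ?I ==> k ((%x:I. phi x) x) = x" by (rule lhom_inverse[OF lI(1) lI(1) pI bij]) blast
 have p': "phi : lhom A E ?I" by (rule lhom_cosub[OF p(2)]) (use p(1) in simp)
 have injI: "injective A ?I" by (rule injective_retract[OF E(2) lI(1) lhom_incl[OF lE(1) Is] hcomp[OF lE(1) p' k(1)]]) (use k(2) smD(5)[OF Is] in auto)
 have e': "e : lhom A X ?I" by (rule lhom_cosub[OF E(3)]) (use eI in auto)
 \<comment> \<open>If \<open>V\<close> misses \<open>X\<close>, then \<open>X\<close> embeds into
   \<open>E / V\<close> and the embedding into \<open>E\<close> extends along it. The resulting
   endomorphism of \<open>E\<close> fixes \<open>X\<close> and kills \<open>V\<close>, so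
   \<open>inj\<close> forces \<open>V\<close> to vanish.\<close>
 have "V = {0[?I]}" if V: "submod A ?I V" "e ` cr X \<inter> V = {0[?I]}" for V
 proof -
  have VI: "V<=I" using smD(1)[OF V(1)] by simp
  have VE: "submod A E V" using V(1) smD(5)[OF Is] unfolding submod_def by auto
  obtain M q where M: "M : fgmod A" "q : lhom A E M" "q ` cr E = cr M" "{x:cr E. q x = 0[M]} = V" by (rule ex_quotient[OF lE VE])
  note qe = hcomp[OF lX(1) E(3) M(2)]
  have "inj_on (%x:cr X. q (e x)) (cr X)" unfolding lhom_inj_iff[OF lX(1) fgD(1)[OF M(1)] qe]
  proof (intro ballI impI)
   fix x assume x: "x IN X" "(%x:cr X. q (e x)) x = 0[M]"
   hence "e x : V" using M(4) ec by auto
   hence "e x = 0[E]" using V(2) x(1) by auto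
   thus "x = 0[X]" by (rule E(4)[OF x(1)])
  qed
  then obtain h where h: "h : lhom A M E" "!!x. x IN X ==> h ((%x:cr X. q (e x)) x) = e x" by (rule injective_extend[OF E(2) lX fgD[OF M(1)] qe _ E(3)]) blast
  have "y = 0[E]" if y: "y : V" for y
  proof (rule inj[OF hcomp[OF lE(1) M(2) h(1)]])
   have "y IN E" "q y = 0[M]" using M(4) y by auto
   thus "phi ((%x:cr E. h (q x)) y) = 0[E]" using hzero[OF h(1) fgD(1)[OF M(1)] lE(1)] hzero[OF p(2) lE(1) lE(1)] by simp
  qed (use h(2) ec y VI in auto)
  hence "V <= {0[?I]}" by (intro subsetI) simp
  thus ?thesis using smD(2)[OF V(1)] by blast
 qed
 hence "essential A ?I (e ` cr X)" unfolding essential_def using sm_range[OF lX(1) lI(1) e'] by blast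
 thus ?thesis using E(4) by (intro that[OF lI(3) injI e']) simp_all
qed

text \<open>A state consists of a cosyzygy, its injective envelope and the embedding. The recursion
  starts from \<open>unit_mod\<close>, as the states live in \<open>fgmod A\<close>; the regular
  module enters at the end by composing with the isomorphism.\<close>

lemma ex_min_inj_resolution:
 obtains I where "min_inj_resolution A (regular A) I"
proof -
 let ?L = "regular A"
 let ?I = "%(k::nat) (C, I, e). C : fgmod A & I : fgmod A & injective A I & e : lhom A C I & (ALL x:cr C. e x = 0[I] --> x = 0[C]) &
  essential A I (e ` cr C) & (k = 0 --> C = unit_mod)"
 let ?S = "%(k::nat) (C, I, e) (C', I', e'). EX q:lhom A I C'. q ` cr I = cr C' & {x:cr I. q x = 0[C']} = e ` cr C"
 have env: "EX I e. ?I k (C, I, e)" if "C : fgmod A" "k = 0 --> C = unit_mod" for C k by (rule ex_injective_envelope[OF that(1)]) (use that in auto)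
 have "EX s. ALL k. ?I k (s k) & ?S k (s k) (s (Suc k))"
 proof (rule dependent_nat_choice)
  obtain I e where "?I 0 (unit_mod, I, e)" using env[OF unit_mod(1), of 0] by blast
  thus "EX s. ?I 0 s" by (rule exI[where x="(unit_mod, I, e)"])
 next
  fix s k assume I: "?I k s"
  obtain C I e where s: "s = (C, I, e)" by (cases s)
  have II: "C : fgmod A" "I : fgmod A" "e : lhom A C I" using I s by auto
  obtain C' q where C': "C' : fgmod A" "q : lhom A I C'" "q ` cr I = cr C'" "{x:cr I. q x = 0[C']} = e ` cr C"
   by (rule ex_quotient[OF fgD[OF II(2)] sm_range[OF fgD(1)[OF II(1)] fgD(1)[OF II(2)] II(3)]])
  obtain I' e' where "?I (Suc k) (C', I', e')" using env[OF C'(1), of "Suc k"] by blast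
  hence "?I (Suc k) (C', I', e') & ?S k s (C', I', e')" using C' unfolding s by auto
  thus "EX s'. ?I (Suc k) s' & ?S k s s'" by (rule exI[where x="(C', I', e')"])
 qed
 then obtain s where s0: "ALL k. ?I k (s k) & ?S k (s k) (s (Suc k))" ..
 define C where "C k = fst (s k)" for k
 define I where "I k = fst (snd (s k))" for k
 define e where "e k = snd (snd (s k))" for k
 have se: "s k = (C k, I k, e k)" for k by (simp add: C_def I_def e_def)
 have s: "C k : fgmod A" "I k : fgmod A" "injective A (I k)" "e k : lhom A (C k) (I k)" "x IN C k ==> e k x = 0[I k] ==> x = 0[C k]"
  "essential A (I k) (e k ` cr (C k))" "C 0 = unit_mod" for k x using spec[OF s0, of k] spec[OF s0, of 0] unfolding se by auto
 have "ALL k. EX q. q : lhom A (I k) (C (Suc k)) & q ` cr (I k) = cr (C (Suc k)) & {x:cr (I k). q x = 0[C (Suc k)]} = e k ` cr (C k)" using s0 unfolding se by auto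
 from choice[OF this] obtain q where
  q0: "ALL k. q k : lhom A (I k) (C (Suc k)) & q k ` cr (I k) = cr (C (Suc k)) & {x:cr (I k). q k x = 0[C (Suc k)]} = e k ` cr (C k)" ..
 note q = conjunct1[OF spec[OF q0]] conjunct1[OF conjunct2[OF spec[OF q0]]] conjunct2[OF conjunct2[OF spec[OF q0]]]
 define d where "d k = (%x:cr (I k). e (Suc k) (q k x))" for k
 note lC = fgD(1)[OF s(1)] and lI = fgD(1)[OF s(2)]
 have d: "d k : lhom A (I k) (I (Suc k))" for k unfolding d_def by (rule hcomp[OF lI q(1) s(4)])
 have dk: "{x:cr (I k). d k x = 0[I (Suc k)]} = e k ` cr (C k)" for k
 proof -
  have "d k x = 0[I (Suc k)] <-> q k x = 0[C (Suc k)]" if x: "x IN I k" for x using s(5)[OF hcl[OF q(1) x]] hzero[OF s(4)[of "Suc k"] lC lI] x by (auto simp: d_def)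
  thus ?thesis unfolding q(3)[symmetric] by blast
 qed
 have di: "d k ` cr (I k) = e (Suc k) ` cr (C (Suc k))" for k unfolding q(2)[symmetric] d_def by (auto simp: image_image)
 obtain f g where f: "f : lhom A ?L unit_mod" "g : lhom A unit_mod ?L"
   "(ALL x:cr A. g (f x) = x) & (ALL y:cr unit_mod. f (g y) = y)" using unit_mod(2) by (elim bexE)
 have e0: "e 0 : lhom A unit_mod (I 0)" "!!x. x IN unit_mod ==> e 0 x = 0[I 0] ==> x = 0[unit_mod]" using s(4)[of 0] s(5)[of _ 0] s(7) by auto
 let ?e = "%x:cr ?L. e 0 (f x)"
 have e: "?e : lhom A ?L (I 0)" by (rule hcomp[OF lm_regular f(1) e0(1)])
 have fc: "f x IN unit_mod" if "x IN A" for x using hcl[OF f(1)] that by simp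
 have gc: "g x IN A" if "x IN unit_mod" for x using hcl[OF f(2)] that by simp
 have ei: "?e ` cr ?L = e 0 ` cr (C 0)" unfolding s(7)
 proof (intro equalityI subsetI; elim imageE; hypsubst)
  fix x assume "x IN regular A" thus "?e x : e 0 ` cr unit_mod" using fc by auto
 next
  fix y assume "y IN unit_mod" thus "e 0 y : ?e ` cr ?L" using gc f(3) by (intro image_eqI[where x="g y"]) auto
 qed
 have g0: "g 0[unit_mod] = 0[A]" using hzero[OF f(2) fgD(1)[OF unit_mod(1)] lm_regular] by simp
 have einj: "inj_on ?e (cr ?L)" unfolding lhom_inj_iff[OF lm_regular lI e]
 proof (intro ballI impI)
  fix x assume x: "x IN regular A" "?e x = 0[I 0]"
  hence "f x = 0[unit_mod]" using e0(2)[OF fc] by simp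
  thus "x = 0[regular A]" using g0 f(3) x(1) by (metis regular_simps(1,2))
 qed
 have r: "{x:cr (I 0). d 0 x = 0[I 1]} = ?e ` cr ?L" "essential A (I 0) (?e ` cr ?L)"
  "{x:cr (I (Suc k)). d (Suc k) x = 0[I (Suc (Suc k))]} = d k ` cr (I k)" "essential A (I (Suc k)) (d k ` cr (I k))" for k
  using dk[of 0] s(6)[of 0] dk[of "Suc k"] s(6)[of "Suc k"] unfolding ei di One_nat_def .
 have "min_inj_resolution A ?L I" unfolding min_inj_resolution_def
  by (rule exI[where x="?e"], rule exI[where x=d], intro conjI allI) (rule s(2) s(3) d e einj r)+
 thus ?thesis by (rule that)
qed

end

section \<open>Projective dimension\<close>

context base_ring
begin

text \<open>Passes to submodules of the terms and breaks the differential at \<open>b\<close>. It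
  yields subcomplexes when that differential vanishes on \<open>U\<close> anyway, and brutal
  truncations otherwise.\<close>

definition cutc :: "('a, 'm) cplx => (int => 'm set) => int => ('a, 'm) cplx" where
 "cutc P U b = \<lparr>obj = (%i. sub P$i (U i)), dif = (%i. %x:U i. if i=b then 0[P$(i+1)] else dif P i x)\<rparr>"

lemma cutc_simps [simp]:
 "(cutc P U b)$i = sub P$i (U i)" "x : U i ==> dif (cutc P U b) i x = (if i=b then 0[P$(i+1)] else dif P i x)" by (simp_all add: cutc_def)

lemma cutc_complex:
 assumes P: "cpx A P" and U: "!!i. submod A P$i (U i)" "!!i x. i~=b ==> x : U i ==> dif P i x : U (i+1)"
 shows "cpx A (cutc P U b)" unfolding is_complex_def
proof (intro allI conjI ballI)
 let ?L = "cutc P U b"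
 fix i
 note lU = lm_sub[OF xlm[OF P] U(1)]
 show "lmod A ?L$i" using lU by simp
 show "dif ?L i : lhom A ?L$i ?L$(i+1)"
 proof (cases "i=b")
  case True
  thus ?thesis using hzmap[OF lU[of b] lU[of "b+1"]] by (simp add: cutc_def)
 next
  case False
  have "(%x:U i. dif P i x) : lhom A (sub P$i (U i)) (sub P$(i+1) (U (i+1)))" by (rule lhom_cosub[OF lhom_sub[OF dhm[OF P] U(1)]]) (use U(2)[OF False] in auto)
  thus ?thesis using False by (simp add: cutc_def)
 qed
 fix x assume "x IN ?L$i"
 hence x: "x : U i" "x IN P$i" using smD(5)[OF U(1)] by auto
 have z: "0[P$(i+1)] : U (i+1)" by (rule smD(2)[OF U(1)])
 show "dif ?L (i+1) (dif ?L i x) = 0[?L$(i+2)]"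
  using x z U(2)[of i x] P dif_rules(2)[OF P, of "i+1"] dif_dif(1)[OF P x(2)] by (cases "i=b") (auto simp: ips)
qed

end

context artin_alg
begin

text \<open>If all Ext groups in the next degree vanish, then the boundaries in degree
  \<open>p\<close> split off from \<open>P$p\<close>. The complement can serve as the last term, and
  nothing is needed below.\<close>

lemma short_res:
 assumes X: "X : bcx A" and P: "projres c X P pr" and ac: "!!i. i<p ==> acyc X i" and hz: "!!N. N : fgmod A ==> hz (Db A) X (stalk N (p-1))"
 obtains P' pr' where "projres c X P' pr'" "!!i. i<p ==> zm P'$i"
proof -
 note XC = bcD(1)[OF X] and Pr = prD[OF P]
 note PC = Pr(2)
 let ?d = "dif P (p-1)"
 \<comment> \<open>The vanishing is applied to the module of boundaries and to the differential onto
   it, which is itself a cocycle. So it factors as \<open>h\<close> after itself, and a lift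
   \<open>r\<close> of \<open>h\<close> satisfies \<open>d r d = d\<close>.\<close>
 let ?N = "sub P$p (?d ` cr P$(p-1))"
 have d: "?d : lhom A P$(p-1) P$p" by (rule dhm'[OF PC])
 note B = sm_range[OF xlm[OF PC] xlm[OF PC] d]
 have N: "?N : fgmod A" by (rule fgmod_sub[OF Pr(3) B])
 have dN: "?d : lhom A P$(p-1) ?N" by (rule lhom_cosub[OF d order_refl])
 have k: "ALL x:cr P$(p-1-1). ?d (dif P (p-1-1) x) = 0[?N]" using dif_dif(2)[OF PC, of _ "p-1"] by simp
 obtain h where h: "h : lhom A P$(p-1+1) ?N" "ALL x:cr P$(p-1). ?d x = h (?d x)" by (rule bexE[OF mp[OF bspec[OF hz[OF N, unfolded hz_stalk[OF X P N]] dN] k]])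
 have h': "h : lhom A P$p ?N" using h(1) by simp
 obtain r where r: "r : lhom A P$p P$(p-1)" "!!x. x IN P$p ==> ?d (r x) = h x"
  by (rule fgproj_lift[OF Pr(6) xlm[OF PC] xlm[OF PC] d lhom_unsub[OF h' B]]) (use hcl[OF h'] in auto)
 have drd: "?d (r (?d x)) = ?d x" if "x IN P$(p-1)" for x using h(2) r(2)[of "?d x"] that PC by simp
 note rc = hcl[OF r(1)] and dc = hcl[OF d]
 let ?e = "%x:cr P$p. ?d (r x)"
 have e: "?e : lhom A P$p P$p" by (rule hcomp[OF xlm[OF PC] r(1) d])
 let ?C = "{x:cr P$p. ?e x = 0[P$p]}"
 \<comment> \<open>\<open>?e = d r\<close> is an idempotent whose image consists of the boundaries,
   so its kernel \<open>?C\<close> is the projective complement to keep in degree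
   \<open>p\<close>.\<close>
 define U where "U i = (if i>p then cr P$i else if i=p then ?C else {0[P$i]})" for i
 have Us: "submod A P$i (U i)" for i using submod_kernel[OF xlm[OF PC] xlm[OF PC] e] PC unfolding U_def by auto
 have Ud: "dif P i x : U (i+1)" if "i~=p-1" "x : U i" for i x using that PC unfolding U_def by (auto split: if_splits)
 note U0 = smD(2)[OF Us]
 let ?P = "cutc P U (p-1)" and ?i = "%i. %x:U i. x"
 have PC': "cpx A ?P" by (rule cutc_complex[OF PC Us Ud])
 have dz: "dif P (p-1) x = 0[P$p]" if "x : U (p-1)" for x using that dif_rules(2)[OF PC, of "p-1"] by (simp add: U_def)
 have d': "dif ?P i x = dif P i x" if "x : U i" for i x using that dz[of x] by auto
 have ic: "?i : cmaps A ?P P"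
 proof (rule cmapsI)
  show "(%x:U i. x) : lhom A ?P$i P$i" for i using lhom_incl[OF xlm[OF PC] Us] by simp
  fix i x assume "x IN ?P$i"
  hence x: "x : U i" by simp
  have "dif ?P i x : U (i+1)" using dcl(1)[OF PC', of x i] x by simp
  thus "(%x:U (i+1). x) (dif ?P i x) = dif P i ((%x:U i. x) x)" using x d'[OF x] by simp
 qed
 have sC: "y -[P$p] ?d (r y) : ?C" "y = (y -[P$p] ?d (r y)) +[P$p] ?d (r y)" if y: "y IN P$p" for y
  using y rc[OF y] dc[OF rc[OF y]] drd[OF rc[OF y]] hminus[OF e] PC by (auto simp: lm_ac)
 have q: "qis A ?P P ?i"
 proof (rule quasi_isoI[OF PC' PC ic])
  fix i x w assume "x IN ?P$i" and w: "w IN P$(i-1)" and "(%x:U i. x) x = dif P (i-1) w"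
  hence x: "x : U i" "x = dif P (i-1) w" by auto
  have "EX v:U (i-1). dif P (i-1) v = x"
  proof (cases "i<=p")
   case True
   have "x = 0[P$i]" using x w drd[of w] dc[of w] True unfolding U_def by (cases "i=p") auto
   thus ?thesis using U0[of "i-1"] dif_rules(2)[OF PC, of "i-1"] by (intro bexI[of _ "0[P$(i-1)]"]) auto
  next
   case False
   show ?thesis
   proof (cases "i = p+1")
    case True
    have w': "w IN P$p" using w True by simp
    have "dif P p (w -[P$p] ?d (r w)) = dif P p w -[P$(p+1)] dif P p (?d (r w))" by (rule hminus[OF dhm[OF PC]]) (use PC w' dc[OF rc[OF w']] in auto)
    also have "... = dif P p w" using dif_dif(2)[OF PC rc[OF w']] PC w' by simp
    finally show ?thesis using x(2) sC(1)[OF w'] True by (intro bexI[of _ "w -[P$p] ?d (r w)"]) (auto simp: U_def)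
   next
    case i: False
    thus ?thesis using False w x(2) by (intro bexI[of _ w]) (auto simp: U_def)
   qed
  qed
  then obtain v where v: "v : U (i-1)" "dif P (i-1) v = x" by blast
  show "EX v:cr ?P$(i-1). dif ?P (i-1) v = x" by (rule bexI[of _ v], rule trans[OF d'[OF v(1)] v(2)]) (use v in simp)
 next
  fix i y assume y: "y IN P$i" "dif P i y = 0[P$(i+1)]"
  have "EX x:U i. EX w:cr P$(i-1). dif P i x = 0[P$(i+1)] & y = x +[P$i] dif P (i-1) w"
  proof (cases i p rule: linorder_cases)
   case less
   have "acyc P i" using qis_acyc[OF PC XC Pr(4)] ac[OF less] by simp
   then obtain w where "w IN P$(i-1)" "dif P (i-1) w = y" using y by (rule acycE)
   thus ?thesis using U0[of i] PC y(1) by (intro bexI[of _ "0[P$i]"] bexI[of _ w]) auto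
  next
   case equal
   have y': "y IN P$p" using y(1) equal by simp
   have "dif P p (y -[P$p] ?d (r y)) = dif P p y -[P$(p+1)] dif P p (?d (r y))" by (rule hminus[OF dhm[OF PC]]) (use PC y' dc[OF rc[OF y']] in auto)
   also have "... = 0[P$(p+1)]" using dif_dif(2)[OF PC rc[OF y']] PC y equal by simp
   finally show ?thesis using sC[OF y'] rc[OF y'] equal by (intro bexI[of _ "y -[P$p] ?d (r y)"] bexI[of _ "r y"]) (auto simp: U_def)
  next
   case greater
   thus ?thesis using y PC dif_rules(2)[OF PC, of "i-1"] by (intro bexI[of _ y] bexI[of _ "0[P$(i-1)]"]) (auto simp: U_def)
  qed
  then obtain x w where "x : U i" "w IN P$(i-1)" "dif P i x = 0[P$(i+1)]" "y = x +[P$i] dif P (i-1) w" by blast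
  thus "EX x:cr ?P$i. EX w:cr P$(i-1). dif ?P i x = 0[?P$(i+1)] & y = (%x:U i. x) x +[P$i] dif P (i-1) w" using d' by (intro bexI[of _ x] bexI[of _ w]) auto
 qed
 have "fgproj (sub P$i (U i))" for i
 proof (cases i p rule: linorder_cases)
  case less
  show ?thesis by (rule fgproj_zero[OF lm_sub[OF xlm[OF PC] Us]]) (use less in "auto simp: U_def zero_module_def")
 next
  case equal
  have s: "(%x:cr P$p. (%x:cr P$p. x) x -[P$p] ?e x) : lhom A P$p (sub P$p ?C)"
   by (rule lhom_cosub[OF lhom_diff[OF xlm[OF PC] xlm[OF PC] lhom_id[OF xlm[OF PC]] e]], rule image_subsetI)
    (use sC(1) in "simp only: restrict_apply' simp_thms")
  have "U p = ?C" by (simp add: U_def)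
  thus ?thesis unfolding equal using lm_sub[OF xlm[OF PC] Us[of p]] lhom_incl[OF xlm[OF PC] Us[of p]] s PC
   by (intro fgproj_retract[OF Pr(6)[of p], of _ "%x:U p. x" "%x:cr P$p. (%x:cr P$p. x) x -[P$p] ?e x"]) auto
 next
  case greater
  hence "sub P$i (U i) = P$i" by (simp add: U_def sub_def)
  thus ?thesis using Pr(6) by simp
 qed
 moreover have "zm ?P$i" if "i>c" for i using bprojD(3)[OF Pr(1) that] smD(1,2)[OF Us[of i]] unfolding zero_module_def by auto
 ultimately have "projres c X ?P (ccomp ?P pr ?i)" using PC' fgmod_sub[OF Pr(3) Us] qis_comp[OF PC' PC XC q Pr(4)] unfolding projres_def bproj_def by simp
 moreover have "zm ?P$i" if "i<p" for i using that by (simp add: U_def zero_module_def)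
 ultimately show ?thesis by (rule that)
qed

text \<open>The shortened resolution has no terms below \<open>p\<close> and the target no
  cohomology from \<open>p\<close> on, so \<open>hty_proj\<close> applies.\<close>

lemma hz_short:
 assumes X: "X : bcx A" "!!i. i<p ==> acyc X i" "!!N. N : fgmod A ==> hz (Db A) X (stalk N (p-1))"
  and W: "W : bcx A" "!!i. i>=p ==> acyc W i"
 shows "hz (Db A) X W"
proof -
 obtain c P pr where P: "projres c X P pr" by (rule ex_res[OF X(1)])
 obtain P' pr' where P': "projres c X P' pr'" "!!i. i<p ==> zm P'$i" by (rule short_res[OF X(1) P]) (erule X(2), erule X(3), blast)
 have "zm P'$i | acyc W i" for i using P'(2)[of i] W(2)[of i] by (cases "i<p") auto
 thus ?thesis unfolding hz_iff[OF X(1) P'(1) W(1)] using hty_proj[OF prD(1)[OF P'(1)] bcD(1)[OF W(1)]] by blast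
qed

lemma stalk_acyc: "lmod A M ==> i~=j ==> acyc (stalk M j) i" by (rule acyc_zero[OF stalk_complex]) auto

lemma stalk_res:
 assumes M: "M : fgmod A" and P: "bproj 0 P" "!!i. P$i : fgmod A" "!!i. i<0 ==> acyc P i"
  and e: "e : lhom A P$0 M" "e ` cr P$0 = cr M" "{x:cr P$0. e x = 0[M]} = dif P (- 1) ` cr P$(- 1)"
 obtains pr where "projres 0 (stalk M 0) P pr"
proof -
 let ?L = "stalk M 0"
 note PC = bprojD(1)[OF P(1)] and lM = fgD(1)[OF M]
 note SC = stalk_complex[OF lM, of 0]
 let ?f = "conc P ?L 0 e"
 have f: "?f : cmaps A P ?L" by (rule cmap_to_stalk[OF PC lM e(1)]) (use e(3) in auto)
 have z: "x = 0[P$i]" if "x IN P$i" "i>0" for x i using zmD[OF bprojD(3)[OF P(1) that(2)] that(1)] .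
 have "qis A P ?L ?f"
 proof (rule quasi_isoI[OF PC SC f])
  fix i x w assume x: "x IN P$i" "w IN ?L$(i-1)" "dif P i x = 0[P$(i+1)]" "?f i x = dif ?L (i-1) w"
  show "EX v:cr P$(i-1). dif P (i-1) v = x"
  proof (cases i "0::int" rule: linorder_cases)
   case less thus ?thesis using acycE[OF P(3) x(1,3)] by blast
  next
   case equal
   hence "e x = 0[M]" using x(4) stalk_dif[OF x(2)] by simp
   hence "x : dif P (- 1) ` cr P$(- 1)" using e(3) x(1) equal by blast
   thus ?thesis using equal by auto
  next
   case greater
   thus ?thesis using z[OF x(1)] PC dif_rules(2)[OF PC, of "i-1"] by (intro bexI[of _ "0[P$(i-1)]"]) auto
  qed
 next
  fix i y assume y: "y IN ?L$i"
  have "EX x:cr P$i. dif P i x = 0[P$(i+1)] & y = ?f i x"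
  proof (cases "i=0")
   case True
   then obtain x where "x IN P$0" "e x = y" using surjE[OF e(2), of y] y by auto
   thus ?thesis using True z[of "dif P 0 x" 1] PC dcl(1)[OF PC, of x 0] by (intro bexI[of _ x]) auto
  next
   case False thus ?thesis using y PC by (intro bexI[of _ "0[P$i]"]) auto
  qed
  then obtain x where "x IN P$i" "dif P i x = 0[P$(i+1)]" "y = ?f i x" by blast
  thus "EX x:cr P$i. EX w:cr ?L$(i-1). dif P i x = 0[P$(i+1)] & y = ?f i x +[?L$i] dif ?L (i-1) w"
   using y stalk_lm[OF lM] stalk_dif[of "0[?L$(i-1)]" M 0 "i-1"] by (intro bexI[of _ x] bexI[of _ "0[?L$(i-1)]"]) auto
 qed
 thus ?thesis using P(1,2) by (intro that) (auto simp: projres_def)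
qed

lemma res_stalkD:
 assumes M: "M : fgmod A" and P: "projres j (stalk M j) P pr"
 shows "pr j : lhom A P$j M" "pr j ` cr P$j = cr M"
  "{x:cr P$j. pr j x = 0[M]} = dif P (j-1) ` cr P$(j-1)" "i~=j ==> acyc P i"
proof -
 let ?L = "stalk M j"
 note Pr = prD[OF P] and lM = fgD(1)[OF M]
 note PC = Pr(2) and SC = stalk_complex[OF lM, of j]
 note e = stalk_map_hom[OF PC lM Pr(5)]
 show "pr j : lhom A P$j M" by (rule e(1))
 show "acyc P i" if "i~=j" using qis_acyc[OF PC SC Pr(4)] stalk_acyc[OF lM] that by simp
 show "pr j ` cr P$j = cr M"
 proof (intro equalityI subsetI)
  fix y assume y: "y IN M"
  hence "y IN ?L$j" "dif ?L j y = 0[?L$(j+1)]" using stalk_dif[of y M j j] by auto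
  then obtain x w where x: "x IN P$j" "w IN ?L$(j-1)" "y = pr j x +[?L$j] dif ?L (j-1) w" by (rule quasi_isoD2[OF PC SC Pr(4)])
  have "y = pr j x" using x stalk_dif[OF x(2)] hcl[OF e(1) x(1)] lM by simp
  thus "y : pr j ` cr P$j" using x(1) by blast
 qed (use hcl[OF e(1)] in auto)
 show "{x:cr P$j. pr j x = 0[M]} = dif P (j-1) ` cr P$(j-1)"
 proof (intro equalityI subsetI)
  fix x assume x: "x : {x:cr P$j. pr j x = 0[M]}"
  have "dif P j x = 0[P$(j+1)]" using zmD[OF bprojD(3)[OF Pr(1), of "j+1"]] x PC by simp
  moreover have "pr j x = dif ?L (j-1) {}" using x stalk_dif[of "{}" M j "j-1"] by simp
  ultimately obtain v where "v IN P$(j-1)" "dif P (j-1) v = x" using quasi_isoD1[OF PC SC Pr(4), of x j "{}"] x by auto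
  thus "x : dif P (j-1) ` cr P$(j-1)" by auto
 next
  fix x assume "x : dif P (j-1) ` cr P$(j-1)"
  thus "x : {x:cr P$j. pr j x = 0[M]}" using e(2) PC by auto
 qed
qed

text \<open>Term \<open>k\<close> of a module resolution sits in degree \<open>- k\<close>; the
  augmentation becomes a quasi-isomorphism to the stalk complex, and the length bound
  \<open>p\<close> becomes vanishing below \<open>- p\<close>.\<close>

lemma proj_resolution_iff:
 assumes M: "M : fgmod A"
 shows "proj_resolution A M p <-> (EX P pr. projres 0 (stalk M 0) P pr & (ALL i. i < - int p --> zm P$i))"
proof
 assume "proj_resolution A M p"
 then obtain P d e where R: "(ALL i::nat. P i : fgmod A & projective A (P i) & d i : lhom A (P (Suc i)) (P i)) & (ALL i>p. zm (P i)) &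
   e : lhom A (P 0) M & e ` cr (P 0) = cr M & {x:cr (P 0). e x = 0[M]} = d 0 ` cr (P 1) &
   (ALL i. {x:cr (P (Suc i)). d i x = 0[P i]} = d (Suc i) ` cr (P (Suc (Suc i))))" unfolding proj_resolution_def by (elim exE)
 note R1 = spec[OF conjunct1[OF R]] and R2 = conjunct2[OF R]
 note P = conjunct1[OF R1] conjunct1[OF conjunct2[OF R1]] conjunct2[OF conjunct2[OF R1]]
 note z = mp[OF spec[OF conjunct1[OF R2]]] and R3 = conjunct2[OF R2]
 note e = conjunct1[OF R3] conjunct1[OF conjunct2[OF R3]] conjunct1[OF conjunct2[OF conjunct2[OF R3]]]
 note ex = spec[OF conjunct2[OF conjunct2[OF conjunct2[OF R3]]]]
 note lP = fgD(1)[OF P(1)]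
 let ?Q = "\<lparr>obj = (%i. if i<=0 then P (nat (- i)) else zmod),
  dif = (%i. if i<0 then d (nat (- i-1)) else (%x:cr (if i<=0 then P (nat (- i)) else zmod). {}))\<rparr>"
 have neg: "EX k. nat (- i) = Suc k & nat (- i-1) = k & nat (- (i+1)) = k" if "i<0" for i :: int by (rule exI[of _ "nat (- i-1)"]) (use that in auto)
 have QC: "cpx A ?Q" unfolding is_complex_def
 proof (intro allI conjI ballI)
  fix i
  show "lmod A ?Q$i" using lP by simp
  show "dif ?Q i : lhom A ?Q$i ?Q$(i+1)"
  proof (cases "i<0")
   case True
   then obtain k where "nat (- i) = Suc k" "nat (- i-1) = k" "nat (- (i+1)) = k" using neg by blast
   thus ?thesis using P(3)[of k] True by simp
  next
   case False
   have "lmod A ?Q$i" using lP by simp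
   from hzmap[OF this lm_zmod] show ?thesis using False by simp
  qed
  fix x assume x: "x IN ?Q$i"
  show "dif ?Q (i+1) (dif ?Q i x) = 0[?Q$(i+2)]"
  proof (cases "i+1<0")
   case True
   then obtain k where "nat (- (i+1)) = Suc k" "nat (- (i+1) - 1) = k" "nat (- (i+1+1)) = k" using neg[of "i+1"] by blast
   hence k: "nat (- i) = Suc (Suc k)" "nat (- i-1) = Suc k" "nat (- i-2) = k" "nat (- (i+2)) = k" by auto
   have "d (Suc k) x : d (Suc k) ` cr (P (Suc (Suc k)))" using x True k by simp
   hence "d k (d (Suc k) x) = 0[P k]" unfolding ex[symmetric] by blast
   thus ?thesis using True k by (simp add: algebra_simps)
  next
   case False
   have "dif ?Q i x IN ?Q$(i+1)" if i0: "i<0"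
   proof -
    obtain k where "nat (- i) = Suc k" "nat (- i-1) = k" "nat (- (i+1)) = k" using neg[OF i0] by blast
    thus ?thesis using hcl[OF P(3)[of k], of x] x i0 by simp
   qed
   thus ?thesis using False x by (cases "i<0") auto
  qed
 qed
 have bp: "bproj 0 ?Q" using QC projective_fgproj[OF P(2,1)] fgproj_zero[OF lm_zmod] unfolding bproj_def by simp
 have fg: "?Q$i : fgmod A" for i using P(1) by simp
 have ac: "acyc ?Q i" if i: "i<0" for i unfolding acyc_def
 proof (intro ballI impI)
  fix x assume x: "x IN ?Q$i" "dif ?Q i x = 0[?Q$(i+1)]"
  obtain k where k: "nat (- i) = Suc k" "nat (- i-1) = k" "nat (- (i+1)) = k" using neg[OF i] by blast
  have k2: "nat (- (i-1)) = Suc (Suc k)" "nat (- (i-1) - 1) = Suc k" using k by auto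
  have "x IN P (Suc k)" "d k x = 0[P k]" using x i k by auto
  then obtain y where "y IN P (Suc (Suc k))" "x = d (Suc k) y" using ex[of k] by blast
  thus "EX y:cr ?Q$(i-1). dif ?Q (i-1) y = x" using i k2 by (intro bexI[of _ y]) auto
 qed
 obtain pr where "projres 0 (stalk M 0) ?Q pr" by (rule stalk_res[OF M bp fg ac, of e]) (use e in auto)
 moreover have "zm ?Q$i" if "i < - int p" for i using z[of "nat (- i)"] that by auto
 ultimately show "EX P pr. projres 0 (stalk M 0) P pr & (ALL i. i < - int p --> zm P$i)" by blast
next
 assume "EX P pr. projres 0 (stalk M 0) P pr & (ALL i. i < - int p --> zm P$i)"
 then obtain P pr where P: "projres 0 (stalk M 0) P pr" and z: "!!i. i < - int p ==> zm P$i" by blast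
 note Pr = prD[OF P] and lM = fgD(1)[OF M]
 note PC = Pr(2)
 note e = res_stalkD[OF M P] and k = res_stalkD(3)[OF M P, simplified]
 have ac: "acyc P i" if "i<0" for i using res_stalkD(4)[OF M P, of i] that by simp
 let ?P = "%k. P$(- int k)" and ?d = "%k. dif P (- int k-1)"
 have "proj_resolution A M p" unfolding proj_resolution_def
 proof (rule exI[where x="?P"], rule exI[where x="?d"], rule exI[where x="pr 0"], intro conjI allI impI)
  fix k
  have i: "- int (Suc k) = - int k-1" "- int (Suc (Suc k)) = - int k-1 - 1" by simp_all
  show "?P k : fgmod A" "projective A (?P k)" using Pr(3,6) fgproj_projective by blast+
  show "?d k : lhom A (?P (Suc k)) (?P k)" unfolding i by (rule dhm'[OF PC])
  show "{x:cr (?P (Suc k)). ?d k x = 0[?P k]} = ?d (Suc k) ` cr (?P (Suc (Suc k)))" unfolding i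
  proof (intro equalityI subsetI)
   fix x assume "x : {x:cr P$(- int k-1). dif P (- int k-1) x = 0[P$(- int k)]}"
   hence "x IN P$(- int k-1)" "dif P (- int k-1) x = 0[P$(- int k-1+1)]" by auto
   from acycE[OF ac this] show "x : dif P (- int k-1 - 1) ` cr P$(- int k-1-1)" by auto
  qed (use dcl(2)[OF PC, of _ "- int k-1"] dif_dif(2)[OF PC, of _ "- int k-1"] in auto)
 next
  fix k assume "k>p" thus "zm (?P k)" using z by simp
 qed (use e(1,2) k in auto)
 thus "proj_resolution A M p" .
qed

text \<open>The stalk complex in degree \<open>- p - 1\<close> is \<open>N[p+1]\<close>. Hence the
  existence of a resolution of length \<open>p\<close> depends on vanishing in the derived category
  alone.\<close>

lemma proj_resolution_hz:
 assumes M: "M : fgmod A"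
 shows "proj_resolution A M p <-> (ALL N:fgmod A. hz (Db A) (stalk M 0) (stalk N (- int p-1)))" unfolding proj_resolution_iff[OF M]
proof
 let ?L = "stalk M 0"
 note S = stalk_bc[OF M, of 0] and lM = fgD(1)[OF M]
 assume "EX P pr. projres 0 ?L P pr & (ALL i. i < - int p --> zm P$i)"
 then obtain P pr where P: "projres 0 ?L P pr" "ALL i. i < - int p --> zm P$i" by blast
 have "zm P$i | acyc (stalk N (- int p-1)) i" if N: "N : fgmod A" for N i using P(2) stalk_acyc[OF fgD(1)[OF N], of i "- int p-1"] by (cases "i = - int p-1") auto
 thus "ALL N:fgmod A. hz (Db A) ?L (stalk N (- int p-1))" using hz_iff[OF S P(1) stalk_bc] hty_proj[OF prD(1)[OF P(1)] stalk_complex[OF fgD(1)]] by blast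
next
 let ?L = "stalk M 0"
 note S = stalk_bc[OF M, of 0] and lM = fgD(1)[OF M]
 assume h: "ALL N:fgmod A. hz (Db A) ?L (stalk N (- int p-1))"
 obtain P pr where P: "projres 0 ?L P pr" by (rule ex_projres[OF S stalk_acyc[OF lM], of 0]) auto
 obtain P' pr' where "projres 0 ?L P' pr'" "!!i. i < - int p ==> zm P'$i" by (rule short_res[OF S P, of "- int p"]) (use h stalk_acyc[OF lM] in auto)
 thus "EX P pr. projres 0 ?L P pr & (ALL i. i < - int p --> zm P$i)" by blast
qed

end

section \<open>Transfer of the projective dimension\<close>

definition (in base_ring) pinj :: "('a, 'a univ) module => bool" where
 "pinj M <-> M : fgmod A & fgproj M & injective A M"

lemma (in base_ring) pinj_class:
 "pinj zmod" "pinj M ==> M : fgmod A" "pinj M ==> pinj N ==> bip M N L ==> pinj L"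
 using fgproj_zero[OF lm_zmod] injective_zero[OF lm_zmod] bip_fgmod bip_fgproj bip_injective unfolding pinj_def by auto

locale tilting_pinj = tilting R A B F T n
 for R :: "('r, 'e) ring_scheme" and A :: "('r, 'a) module" and B :: "('r, 'b) module" and F T n +
 assumes T_inj: "i<0 ==> injective A T$i"
begin

lemma T_pinj: "i<0 ==> A.pinj T$i" using T T_inj unfolding A.pinj_def by simp

context
 fixes X assumes X: "X : fgmod A"
begin

lemma SX: "A.stalk X 0 : bcx A" "i<0 ==> A.acyc (A.stalk X 0) i" "FS X 0 : bcx B"
 "i<0 | i>int n ==> B.acyc (FS X 0) i" using A.stalk_bc[OF X] A.stalk_acyc[OF A.fgD(1)[OF X]] acyc_F_stalk_out[OF X, of 0 i] by auto

text \<open>By essential surjectivity \<open>N[p+1]\<close> is \<open>F V\<close>. As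
  \<open>F V\<close> has no cohomology above degree \<open>- p - 1\<close>, neither has
  \<open>V\<close>, and the short resolution of \<open>X\<close> sees nothing of it.\<close>

lemma ext_vanish_F:
 assumes ev: "!!N. N : fgmod A ==> hz (Db A) (A.stalk X 0) (A.stalk N (- int p-1))" and N: "N : fgmod B"
 shows "hz (Db B) (FS X 0) (B.stalk N (- int p-1))"
proof -
 note S = B.stalk_bc[OF N, of "- int p-1"]
 obtain V v where V: "V : bcx A" "iso_mor (Db B) (fob F V) (B.stalk N (- int p-1)) v" using E.ess_surj[of "B.stalk N (- int p-1)"] S by auto
 have "B.acyc (fob F V) i" if "i > - int p-1" for i using B.acyc_iso[OF Fb[OF V(1)] S V(2)] B.stalk_acyc[OF B.fgD(1)[OF N]] that by simp
 from acyc_of_F[OF V(1) this] have "A.acyc V i" if "i >= - int p" for i using that by simp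
 hence "hz (Db A) (A.stalk X 0) V" by (intro A.hz_short[OF SX(1,2) ev V(1)]) auto
 hence "hz (Db B) (FS X 0) (fob F V)" using E.hz_fob SX(1) V(1) by simp
 moreover obtain w where "iso_mor (Db B) (B.stalk N (- int p-1)) (fob F V) w" by (rule B.Db.iso_sym[OF V(2)])
 ultimately show ?thesis using B.Db.hz_iso[OF _ _ _ _ B.Db.iso_Id, of "FS X 0" "fob F V" "B.stalk N (- int p-1)"] SX(3) S Fb[OF V(1)] by simp
qed

text \<open>In the induction step the last term \<open>\<Omega>\<close> of a resolution is shown to split off: modulo the image of a
 projective-injective module it does so because the images of the stalk complexes of \<open>\<Omega> / f(V)\<close> are concentrated in one degree.\<close>

lemma ext_vanish_of_F:
 assumes ev: "!!N. N : fgmod B ==> hz (Db B) (FS X 0) (B.stalk N (- int p-1))" and N: "N : fgmod A"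
 shows "hz (Db A) (A.stalk X 0) (A.stalk N (- int p-1))"
proof -
 have ev': "hz (Db A) (A.stalk X 0) (A.stalk Y (- int q))" if Y: "Y : fgmod A" and ac: "!!i. i >= - int p ==> B.acyc (FS Y (- int q)) i" for Y q
 proof -
  note SY = A.stalk_bc[OF Y, of "- int q"]
  have "hz (Db B) (FS X 0) (FS Y (- int q))" by (rule B.hz_short[OF SX(3), of "- int p"]) (use SX(4) ev ac Fb[OF SY] in auto)
  thus ?thesis using E.hz_fob SX(1) SY by simp
 qed
 \<comment> \<open>Descending induction on \<open>k\<close> from \<open>n\<close>. For
   \<open>k = n\<close> the image of \<open>Y[p+n+1]\<close> ends in degree \<open>- p - 1\<close>,
   just low enough for the hypothesis on \<open>B\<close>.\<close>
 have "hz (Db A) (A.stalk X 0) (A.stalk Y (- int (p+k+1)))" if "Y : fgmod A" "k<=n" for Y k using that(2,1)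
 proof (induction arbitrary: Y rule: inc_induct)
  case base
  show ?case by (rule ev'[OF base acyc_F_stalk_out[OF base]]) auto
 next
  case (step k)
  let ?q = "- int (p+k+1)"
  obtain P0 pi0 where "A.projres 0 (A.stalk X 0) P0 pi0" by (rule A.ex_projres[OF SX(1) A.stalk_acyc[OF A.fgD(1)[OF X]], of 0]) auto
  then obtain P pr where P: "A.projres 0 (A.stalk X 0) P pr" "!!i. i<?q ==> zm P$i"
   by (rule A.short_res[OF SX(1), of _ _ _ ?q]) (use SX(2) step.IH in "auto simp: algebra_simps")
  note Pr = A.prD[OF P(1)]
  note PC = Pr(2)
  let ?O = "P$?q" and ?d = "dif P ?q"
  note O = Pr(3)[of ?q]
  note lO = A.fgD[OF O]
  have d: "?d : lhom A ?O P$(?q+1)" by (rule A.dhm[OF PC])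
  have "A.acyc P ?q" using A.qis_acyc[OF PC A.bcD(1)[OF SX(1)] Pr(4)] SX(2) by simp
  note acq = this
  have dz: "dif P (?q-1) y = 0[?O]" if "y IN P$(?q-1)" for y using A.zmD[OF P(2)[of "?q-1"] that] A.hzero[OF A.dhm'[OF PC, of ?q] A.xlm[OF PC] lO(1)] by simp
  have d0: "x = 0[?O]" if "x IN ?O" "?d x = 0[P$(?q+1)]" for x by (rule A.acycE[OF acq that]) (use dz in simp)
  \<comment> \<open>\<open>f\<close> collects everything that projective-injective modules
    contribute to the last term \<open>?O\<close> of the resolution; the quotient \<open>W\<close>
    receives no nonzero map from a term of \<open>T\<close> in negative degree.\<close>
  obtain V f where V: "A.pinj V" "f : lhom A V ?O" and max: "!!M g. A.pinj M ==> g : lhom A M ?O ==> g ` cr M<=f ` cr V"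
   by (rule A.max_image[of ?O A.pinj, OF O A.pinj_class(1,2)]) (assumption, erule (2) A.pinj_class(3), blast)
  have Vp: "V : fgmod A" "A.fgproj V" "injective A V" using V(1) unfolding A.pinj_def by auto
  note lV = A.fgD[OF Vp(1)]
  obtain W c where W: "W : fgmod A" "c : lhom A ?O W" "c ` cr ?O = cr W" "{x:cr ?O. c x = 0[W]} = f ` cr V" by (rule A.ex_quotient[OF lO A.sm_range[OF lV(1) lO(1) V(2)]])
  note lW = A.fgD[OF W(1)]
  \<comment> \<open>For \<open>i >= - p\<close> the relevant term of \<open>T\<close> has degree
    \<open>?q - i < 0\<close>. A map from it to \<open>W\<close> lifts to \<open>?O\<close> by
    projectivity and then lands in the image of \<open>f\<close>.\<close>
  have "B.acyc (fob F (A.stalk W ?q)) i" if i: "i >= - int p" for i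
  proof (rule acyc_F_stalk_zero[OF W(1)])
   fix u assume u: "u : lhom A T$(?q-i) W"
   let ?T = "T$(?q-i)"
   have pT: "A.pinj ?T" by (rule T_pinj) (use i in simp)
   obtain g where g: "g : lhom A ?T ?O" "!!x. x IN ?T ==> c (g x) = u x" by (rule A.fgproj_lift[OF T(4) lO(1) lW(1) W(2) u]) (use W(3) A.hcl[OF u] in auto)
   have "u x = 0[W]" if x: "x IN ?T" for x
   proof -
    have "g x : f ` cr V" using max[OF pT g(1)] x by blast
    hence "c (g x) = 0[W]" unfolding W(4)[symmetric] by blast
    thus ?thesis using g(2)[OF x] by simp
   qed
   thus "u = (%x:cr ?T. 0[W])" by (intro A.lhom_eqI[OF u A.hzmap[OF A.xlm[OF T(2)] lW(1)]]) simp
  qed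
  hence hzW: "hz (Db A) (A.stalk X 0) (A.stalk W ?q)" by (rule ev'[OF W(1)])
  have "ALL x:cr P$(?q-1). c (dif P (?q-1) x) = 0[W]" using dz A.hzero[OF W(2) lO(1) lW(1)] by simp
  then obtain k where k: "k : lhom A P$(?q+1) W" "ALL x:cr ?O. c x = k (?d x)" by (rule bexE[OF mp[OF bspec[OF hzW[unfolded A.hz_stalk[OF SX(1) P(1) W(1)]] W(2)]]])
  obtain k' where k': "k' : lhom A P$(?q+1) ?O" "!!x. x IN P$(?q+1) ==> c (k' x) = k x"
   by (rule A.fgproj_lift[OF Pr(6) lO(1) lW(1) W(2) k(1)]) (use W(3) A.hcl[OF k(1)] in auto)
  note lQ = A.xlm[OF PC, of "?q+1"]
  note kd = A.hcomp[OF lO(1) d k'(1)]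
  \<comment> \<open>\<open>k' d\<close> agrees with the identity modulo \<open>f(V)\<close>, so the
    defect \<open>?m\<close> lifts through \<open>f\<close> to \<open>V\<close>. Since
    \<open>V\<close> is injective, the lift extends along \<open>?d\<close>; added to
    \<open>k'\<close>, it gives a retraction \<open>?r\<close> of \<open>?d\<close>.\<close>
  let ?m = "%x:cr ?O. (%x:cr ?O. x) x -[?O] (%x:cr ?O. k' (?d x)) x"
  have m: "?m : lhom A ?O ?O" by (rule A.lhom_diff[OF lO(1) lO(1) A.lhom_id[OF lO(1)] kd])
  note dc = A.hcl[OF d] and kc = A.hcl[OF k'(1)]
  have mf: "?m x : f ` cr V" if x: "x IN ?O" for x
  proof -
   have "c (?m x) = c x -[W] c (k' (?d x))" using x A.hminus[OF W(2) lO(1) lW(1) x kc[OF dc[OF x]]] by simp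
   also have "... = 0[W]" using k(2) k'(2)[OF dc[OF x]] x lW A.hcl[OF W(2) x] by simp
   finally show ?thesis using A.hcl[OF m x] W(4) by blast
  qed
  obtain s where s: "s : lhom A ?O V" "!!x. x IN ?O ==> f (s x) = ?m x" by (rule A.fgproj_lift[OF Pr(6) lV(1) lO(1) V(2) m]) (rule image_subsetI, erule mf, blast)
  have dinj: "inj_on ?d (cr ?O)" unfolding A.lhom_inj_iff[OF lO(1) lQ d] using d0 by blast
  obtain s' where s': "s' : lhom A P$(?q+1) V" "!!x. x IN ?O ==> s' (?d x) = s x" by (rule A.injective_extend[OF Vp(3) lO lQ A.fgD(2)[OF Pr(3)] d dinj s(1)]) blast
  let ?r = "%x:cr P$(?q+1). k' x +[?O] (%x:cr P$(?q+1). f (s' x)) x"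
  have r: "?r : lhom A P$(?q+1) ?O" by (rule A.lhom_plus[OF lQ lO(1) k'(1) A.hcomp[OF lQ s'(1) V(2)]])
  have rd: "?r (?d x) = x" if x: "x IN ?O" for x using x dc[OF x] s'(2)[OF x] s(2)[OF x] kc[OF dc[OF x]] lO by (simp add: A.lm_ac)
  show ?case unfolding A.hz_stalk[OF SX(1) P(1) step.prems]
  proof (intro ballI impI)
   fix u assume u: "u : lhom A ?O Y"
   show "EX h:lhom A P$(?q+1) Y. ALL x:cr ?O. u x = h (?d x)" by (rule bexI[OF _ A.hcomp[OF lQ r u]]) (use rd dc in simp)
  qed
 qed
 moreover have "- int (p+0+1) = - int p-1" by simp
 ultimately show ?thesis using N by (metis zero_le)
qed

text \<open>\<open>F X\<close> has cohomology in degrees \<open>0\<close> to \<open>n\<close> only,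
  so the part of its resolution in degrees up to \<open>0\<close> resolves the cokernel
  \<open>M\<close> in degree \<open>0\<close>.\<close>

lemma proj_resolution_transfer:
 obtains M where "M : fgmod B" "!!p. proj_resolution A X p <-> proj_resolution B M p"
proof -
 obtain P pr where P: "B.projres (int n) (FS X 0) P pr" by (rule B.ex_projres[OF SX(3) SX(4)]) auto
 note Pr = B.prD[OF P]
 note PC = Pr(2)
 note P0 = B.fgD[OF Pr(3)[of 0]]
 let ?d = "dif P (- 1)"
 have d: "?d : lhom B P$(- 1) P$0" using B.dhm[OF PC, of "- 1"] by simp
 obtain M e where M: "M : fgmod B" "e : lhom B P$0 M" "e ` cr P$0 = cr M" "{x:cr P$0. e x = 0[M]} = ?d ` cr P$(- 1)"
  by (rule B.ex_quotient[OF P0 B.sm_range[OF B.xlm[OF PC] P0(1) d]])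
 define U where "U i = (if i<=0 then cr P$i else {0[P$i]})" for i
 have Us: "submod B P$i (U i)" for i using PC unfolding U_def by simp
 let ?Q = "B.cutc P U 0"
 have QC: "cpx B ?Q" by (rule B.cutc_complex[OF PC Us]) (use PC in "auto simp: U_def split: if_splits")
 have sc: "B.sub N (cr N) = N" for N :: "('b, 'b univ) module" by (simp add: B.sub_def)
 have Qo: "?Q$i = P$i" if "i<=0" for i using that sc by (simp add: U_def)
 have Qd: "dif ?Q i x = dif P i x" if "i<0" "x IN P$i" for i x using that by (simp add: U_def)
 have z: "zm ?Q$i" if "i>0" for i using that by (simp add: U_def zero_module_def)
 have fp: "B.fgproj ?Q$i" for i using Pr(6) Qo B.fgproj_zero[OF B.xlm[OF QC] z] by (cases "i<=0") auto
 have fg: "?Q$i : fgmod B" for i using B.fgmod_sub[OF Pr(3) Us] by simp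
 have ac: "B.acyc ?Q i" if i: "i<0" for i
 proof -
  have "B.acyc P i" using B.qis_acyc[OF PC B.bcD(1)[OF SX(3)] Pr(4)] SX(4) i by simp
  thus ?thesis unfolding B.acyc_def using i Qo[of i] Qo[of "i-1"] Qo[of "i+1"] Qd[of i] Qd[of "i-1"] by auto
 qed
 have b: "B.bproj 0 ?Q" using QC fp z unfolding B.bproj_def by blast
 have im: "dif ?Q (- 1) ` cr ?Q$(- 1) = ?d ` cr P$(- 1)" by (rule image_cong) (use Qo[of "- 1"] Qd[of "- 1"] in auto)
 obtain rh where Q: "B.projres 0 (B.stalk M 0) ?Q rh" by (rule B.stalk_res[OF M(1) b fg ac, of e]) (use M Qo[of 0] im in auto)
 \<comment> \<open>Only the terms in degrees \<open>- p - 2\<close> to \<open>- p\<close> enter, and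
   they are common to both resolutions.\<close>
 have "hz (Db B) (B.stalk M 0) (B.stalk N (- int p-1)) <-> hz (Db B) (FS X 0) (B.stalk N (- int p-1))" if N: "N : fgmod B" for N p
  unfolding B.hz_stalk[OF SX(3) P N] B.hz_stalk[OF B.stalk_bc[OF M(1)] Q N]
  using Qo[of "- int p-1"] Qo[of "- int p-1 - 1"] Qo[of "- int p-1 + 1"] Qd[of "- int p-1"] Qd[of "- int p-1 - 1"] by simp
 hence "proj_resolution A X p <-> proj_resolution B M p" for p
  unfolding A.proj_resolution_hz[OF X] B.proj_resolution_hz[OF M(1)] using ext_vanish_F ext_vanish_of_F by blast
 thus ?thesis by (rule that[OF M(1)])
qed

lemma proj_dim_transfer: "EX M:fgmod B. proj_dim A X = proj_dim B M" by (rule proj_resolution_transfer) (auto simp: proj_dim_def)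

end

lemma gl_dim_le: "gl_dim A<=gl_dim B" unfolding gl_dim_def by (rule Sup_subset_mono) (use proj_dim_transfer in blast)

lemma fin_dim_le: "fin_dim A<=fin_dim B" unfolding fin_dim_def by (rule Sup_subset_mono) (use proj_dim_transfer in force)

end

section \<open>Null-homotopies concentrated in one degree\<close>

context base_ring
begin

text \<open>Where \<open>R\<close> is acyclic, a cocycle is a map defined on the boundaries in the
  next degree, and an injective target lets it extend to the whole term.\<close>

lemma ext_inj:
 fixes R :: "('a, 'm) cplx" and M :: "('a, 'n) module"
 assumes R: "cpx A R" "!!i. fin_gen A R$i" and M: "injective A M" and ac: "acyc R j"
  and u: "u : lhom A R$j M" "PROP kz R j M u"
 obtains h where "h : lhom A R$(j+1) M" "!!x. x IN R$j ==> u x = h (dif R j x)"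
proof -
 note lR = xlm[OF R(1)] and d = dhm[OF R(1), of j]
 note B = sm_range[OF lR lR d]
 let ?B = "sub R$(j+1) (dif R j ` cr R$j)"
 obtain k where k: "k : lhom A ?B M" "!!x. x IN R$j ==> k (dif R j x) = u x"
 proof (rule lhom_factor[OF lR lm_sub[OF lR B] injective_lm[OF M] u(1) lhom_cosub[OF d order_refl]])
  fix x assume x: "x IN R$j" "dif R j x = 0[?B]"
  have "dif R j x = 0[R$(j+1)]" using x(2) by simp
  with ac x(1) obtain y where "y IN R$(j-1)" "dif R (j-1) y = x" by (rule acycE)
  thus "u x = 0[M]" using u(2) by blast
 qed auto
 obtain h where h: "h : lhom A R$(j+1) M" "!!x. x IN ?B ==> h ((%x:dif R j ` cr R$j. x) x) = k x"
  by (rule injective_extend[OF M lm_sub[OF lR B] fin_gen_range[OF lR lR d R(2)] lR R(2) lhom_incl[OF lR B] _ k(1)]) (auto simp: inj_on_def)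
 have "u x = h (dif R j x)" if "x IN R$j" for x using h(2)[of "dif R j x"] k(2)[OF that] that by simp
 thus ?thesis by (rule that[OF h(1)])
qed

context
 fixes R :: "('a, 'm) cplx" and K :: "('a, 'n) cplx" and b c :: int
 assumes R: "cpx A R" and K: "cpx A K" and low: "!!i. i<b ==> zm K$i"
begin

text \<open>\<open>ascending_null\<close> gives a homotopy that trivialises \<open>U\<close> below
  \<open>c\<close>; subtracting its full boundary, also in degrees from \<open>c\<close> on, keeps a
  chain map.\<close>

lemma partial_null:
 assumes U: "U : cmaps A R K"
  and ext: "!!j f. j<c ==> f : lhom A R$j K$j ==> PROP kz R j K$j f ==>
   fac A R j K$j f"
 obtains U' where "U' : cmaps A R K" "hty A R K U U'" "!!j x. j<c ==> x IN R$j ==> U' j x = 0[K$j]"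
proof -
 note lR = xlm[OF R] and lK = xlm[OF K] and rU = cmr[OF U R K]
 obtain h where h: "!!i. h i : lhom A R$i K$(i-1)" "!!i x. i<=c-1 ==> x IN R$i ==> U i x = hm R K h i x"
 proof (rule ascending_null[where N="obj K" and d="dif K" and b=b and c="c-1" and u=U, OF R lK dhm[OF K]])
  show "dif K (i+1) (dif K i x) = 0[K$(i+1+1)]" if "x IN K$i" for i x using dif_dif(1)[OF K that] by (simp add: ips)
  show "fac A R j K$j f" if "j<=c-1" "f : lhom A R$j K$j" "PROP kz R j K$j f" for j f using ext[OF _ that(2,3)] that(1) by simp
 qed (blast intro: low cmh[OF U] rU(2) that)+
 have hf: "hfam R K h" using h(1) unfolding hfam_def by blast
 note rh = hfr[OF hf R K]
 let ?D = "%i x. hm R K h i x"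
 let ?U = "%i. %x:cr R$i. U i x -[K$i] ?D i x"
 have Dc: "?D i x IN K$i" if "x IN R$i" for i x using that rh(1)[OF that] rh(2)[of "dif R i x"] R K by simp
 have Dh: "(%x:cr R$i. (%x:cr R$i. dif K (i-1) (h i x)) x +[K$i] (%x:cr R$i. h (i+1) (dif R i x)) x) : lhom A R$i K$i" for i
  by (rule lhom_plus[OF lR lK hcomp[OF lR h(1) dhm'[OF K]] hcomp[OF lR dhm[OF R] hfamD(2)[OF hf]]])
 have U': "?U : cmaps A R K"
 proof (rule cmapsI)
  fix i
  have e: "?U i = (%x:cr R$i. U i x -[K$i] (%x:cr R$i. (%x:cr R$i. dif K (i-1) (h i x)) x +[K$i] (%x:cr R$i. h (i+1) (dif R i x)) x) x)" by (rule restrict_ext) simp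
  show "?U i : lhom A R$i K$i" unfolding e by (rule lhom_diff[OF lR lK cmh[OF U] Dh])
  fix x assume x: "x IN R$i"
  have d: "dif R i x IN R$(i+1)" using x R by simp
  have hd: "h (i+1) (dif R i x) IN K$i" by (rule rh(2)[OF d])
  have "?D (i+1) (dif R i x) = dif K i (?D i x)" using x d hd rh(1)[OF x] rh(5)[of "i+1"] R K by (simp add: ips)
  hence "?U (i+1) (dif R i x) = dif K i (U i x) -[K$(i+1)] dif K i (?D i x)" using d rU(2)[OF x] by simp
  also have "... = dif K i (U i x -[K$i] ?D i x)" by (rule hminus[OF dhm[OF K] lK lK rU(1)[OF x] Dc[OF x], symmetric])
  finally show "?U (i+1) (dif R i x) = dif K i (?U i x)" using x by simp
 qed
 show ?thesis
 proof (rule that[OF U'])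
  show "hty A R K U ?U" by (rule homotopicI[OF R K U U' hf]) (use rU(1) Dc K in "simp add: lm_ac")
  show "?U j x = 0[K$j]" if "j<c" "x IN R$j" for j x using h(2)[of j x] that Dc[OF that(2)] K by simp
 qed
qed

text \<open>Below \<open>c\<close> the two maps agree, so the homotopy itself is a chain map of
  degree \<open>- 1\<close> there up to sign. Being null-homotopic by \<open>ascending_null\<close>,
  it can be modified until in degree \<open>c\<close> only the part through \<open>dif R c\<close>
  is left.\<close>

lemma null_homotopic_top:
 assumes U: "U : cmaps A R K" "U' : cmaps A R K" "!!j x. j<c ==> x IN R$j ==> U j x = U' j x" and UU: "hty A R K U U'"
  and ext: "!!j f. j<=c ==> f : lhom A R$j K$(j-1) ==> PROP kz R j K$(j-1) f ==>
   fac A R j K$(j-1) f"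
 obtains g where "g : lhom A R$(c+1) K$c" "!!x. x IN R$c ==> U c x = U' c x +[K$c] g (dif R c x)"
proof -
 note lR = xlm[OF R] and lK = xlm[OF K]
 obtain h where h: "hfam R K h" "!!i x. x IN R$i ==> U i x = U' i x +[K$i] hm R K h i x" by (rule homotopicE[OF R K U(1,2) UU]) blast
 note rh = hfr[OF h(1) R K] and hh = hfamD(1)[OF h(1)]
 have hd: "h (i+1) (dif R i x) IN K$i" if "x IN R$i" for i x using rh(2) that R by simp
 \<comment> \<open>The target complex is shifted by one degree and its differential negated, which
   is exactly what makes \<open>h\<close> commute with the differentials below
   \<open>c\<close>.\<close>
 let ?d = "%i. %x:cr K$(i-1). -[K$i] dif K (i-1) x"
 have d: "?d i : lhom A K$(i-1) K$(i+1-1)" for i using lhom_uminus[OF lK lK dhm'[OF K]] by simp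
 have dd: "?d (i+1) (?d i x) = 0[K$(i+1+1-1)]" if x: "x IN K$(i-1)" for i x using x dcl(2)[OF K x] dif_dif(2)[OF K x] dif_rules(3)[OF K dcl(2)[OF K x]] K by (simp add: ips)
 have hr: "h (i+1) (dif R i x) = ?d i (h i x)" if i: "i<c" and x: "x IN R$i" for i x
 proof -
  have "hm R K h i x = 0[K$i]"
   using h(2)[OF x] U(3)[OF i x] cmr(1)[OF U(2) R K x] lm_add_cancel[OF lK _ _ , of "U' i x" i "0[K$i]"] hd[OF x] dcl(2)[OF K rh(1)[OF x]] K by simp
  thus ?thesis using lm_neg_unique[OF lK dcl(2)[OF K rh(1)[OF x]] hd[OF x]] rh(1)[OF x] by simp
 qed
 have lo: "zm K$(i-1)" if "i<b+1" for i using low that by simp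
 obtain m where m: "!!i. m i : lhom A R$i K$(i-1-1)" "!!i x. i<=c ==> x IN R$i ==> h i x = ?d (i-1) (m i x) +[K$(i-1)] m (i+1) (dif R i x)"
  by (rule ascending_null[where N="%i. K$(i-1)" and d="?d" and b="b+1" and c=c and u=h, OF R lK d dd lo hh hr]) (blast intro: ext)+
 have m1: "m (c+1) : lhom A R$(c+1) K$(c-1)" using m(1)[of "c+1"] by simp
 let ?p = "%x:cr R$(c+1). (%x:cr R$(c+1). dif K (c-1) (m (c+1) x)) x +[K$c] h (c+1) x"
 have p: "?p : lhom A R$(c+1) K$c" by (rule lhom_plus[OF lR lK hcomp[OF lR m1 dhm'[OF K]] hfamD(2)[OF h(1)]])
 have "U c x = U' c x +[K$c] ?p (dif R c x)" if x: "x IN R$c" for x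
 proof -
  have d: "dif R c x IN R$(c+1)" using x R by simp
  have mc: "m c x IN K$(c-1-1)" "m (c+1) (dif R c x) IN K$(c-1)" using hcl[OF m(1) x] hcl[OF m1 d] by auto
  have dm: "dif K (c-1-1) (m c x) IN K$(c-1)" using mc(1) dcl(2)[OF K, of "m c x" "c-1"] by simp
  have "h c x = -[K$(c-1)] dif K (c-1-1) (m c x) +[K$(c-1)] m (c+1) (dif R c x)" using m(2)[OF _ x] mc(1) by simp
  hence "dif K (c-1) (h c x) = dif K (c-1) (m (c+1) (dif R c x))"
   using hadd[OF dhm'[OF K]] lhom_neg[OF dhm'[OF K] lK lK dm] dif_dif(2)[OF K, of "m c x" "c-1"] mc dm K by simp
  thus ?thesis using h(2)[OF x] d by simp
 qed
 thus ?thesis by (rule that[OF p])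
qed

end

section \<open>Finite sums of chain maps and powers of a complex\<close>

definition csm :: "('a, 'm) cplx => ('a, 'n) cplx => (nat => ('m, 'n) gmap) => nat => ('m, 'n) gmap" where
 "csm X Y g k = (%i. %x:cr X$i. finsum Y$i (%j. g j i x) {..<k})"

lemma csm_apply [simp]: "x IN X$i ==> csm X Y g k i x = finsum Y$i (%j. g j i x) {..<k}" by (simp add: csm_def)

lemma csm_0: "cpx A Y ==> csm X Y g 0 = zmp X Y" by (simp add: csm_def)

lemma csm_Suc:
 assumes X: "cpx A X" "cpx A Y" and g: "!!j. j<=k ==> g j : cmaps A X Y"
 shows "csm X Y g (Suc k) = cadd X Y (g k) (csm X Y g k)" unfolding csm_def cadd_def
proof (rule ext, rule restrict_ext)
 fix i x assume x: "x IN X$i"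
 have "finsum Y$i (%j. g j i x) (insert k {..<k}) = g k i x +[Y$i] finsum Y$i (%j. g j i x) {..<k}"
  by (rule finsum_insert'[OF xlm[OF X(2)]]) (use cmr(1)[OF g X x] in auto)
 thus "finsum Y$i (%j. g j i x) {..<Suc k} = g k i x +[Y$i] (%x:cr X$i. finsum Y$i (%j. g j i x) {..<k}) x" using x by (simp add: lessThan_Suc)
qed

lemma csm_cmaps:
 assumes X: "cpx A X" "cpx A Y" and g: "!!j. j<k ==> g j : cmaps A X Y"
 shows "csm X Y g k : cmaps A X Y" using g
proof (induction k)
 case 0 show ?case unfolding csm_0[OF X(2)] by (rule zcm[OF X])
next
 case (Suc k)
 show ?case by (subst csm_Suc[OF X]) (use Suc in "auto intro!: cadd_cmaps[OF X]")
qed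

definition cpow :: "nat => ('a, 'm) cplx => ('a, nat => 'm) cplx" where
 "cpow k T = \<lparr>obj = (%i. dsum {..<k} (%_. T$i)), dif = (%i. %x:cr (dsum {..<k} (%_. T$i)). %l:{..<k}. dif T i (x l))\<rparr>"

lemma cpow_simps [simp]:
 "(cpow k T)$i = dsum {..<k} (%_. T$i)" "x IN dsum {..<k} (%_. T$i) ==> dif (cpow k T) i x = (%l:{..<k}. dif T i (x l))" by (simp_all add: cpow_def)

context
 fixes T :: "('a, 'm) cplx" and k :: nat
 assumes T: "cpx A T"
begin

lemma cpow_proj: "l<k ==> (%x:cr (cpow k T)$i. x l) : lhom A (cpow k T)$i T$i" unfolding cpow_simps by (rule lhom_dproj) (use T in auto)

lemma cpow_lm: "lmod A (cpow k T)$i" unfolding cpow_simps by (rule lm_dsum) (use T in auto)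

lemma cpow_comp: "l<k ==> f : lhom A T$i N ==> (%x:cr (cpow k T)$i. f (x l)) : lhom A (cpow k T)$i N"
proof -
 assume l: "l<k" and f: "f : lhom A T$i N"
 have "(%x:cr (cpow k T)$i. f (x l)) = (%x:cr (cpow k T)$i. f ((%x:cr (cpow k T)$i. x l) x))" by (rule restrict_ext) simp
 thus ?thesis using hcomp[OF cpow_lm cpow_proj[OF l] f] by (simp only:)
qed

lemma cpow_complex: "cpx A (cpow k T)" unfolding is_complex_def
proof (intro allI conjI ballI)
 let ?L = "cpow k T"
 fix i
 show "lmod A ?L$i" by (rule cpow_lm)
 have "(%x:cr ?L$i. %l:{..<k}. (%x:cr ?L$i. dif T i (x l)) x) : lhom A ?L$i (dsum {..<k} (%_. T$(i+1)))"
  by (rule lhom_dpair[OF cpow_lm]) (rule cpow_comp, simp, rule dhm[OF T])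
 moreover have "(%x:cr ?L$i. %l:{..<k}. (%x:cr ?L$i. dif T i (x l)) x) = dif ?L i"
  unfolding cpow_def cplx.select_convs by (rule restrict_ext, rule restrict_ext) simp
 ultimately show "dif ?L i : lhom A ?L$i ?L$(i+1)" by simp
 fix x assume x: "x IN ?L$i"
 have xl: "x l IN T$i" if "l<k" for l using x that by (auto simp: PiE_iff)
 have "(%l:{..<k}. dif T i (x l)) IN dsum {..<k} (%_. T$(i+1))" using xl T by simp
 thus "dif ?L (i+1) (dif ?L i x) = 0[?L$(i+2)]" using x xl dif_dif(1)[OF T] by (auto intro!: restrict_ext)
qed

lemma cpow_pair:
 assumes P: "cpx A P" and p: "!!l. l<k ==> p l : cmaps A P T"
 shows "(%i. %x:cr P$i. %l:{..<k}. p l i x) : cmaps A P (cpow k T)"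
proof (rule cmapsI)
 fix i
 show "(%x:cr P$i. %l:{..<k}. p l i x) : lhom A P$i (cpow k T)$i" unfolding cpow_simps by (rule lhom_dpair[OF xlm[OF P]]) (rule cmh[OF p], simp)
 fix x assume x: "x IN P$i"
 have c: "(%l:{..<k}. p l i x) IN dsum {..<k} (%_. T$i)" using cmr(1)[OF p P T x] by simp
 show "(%x:cr P$(i+1). %l:{..<k}. p l (i+1) x) (dif P i x) = dif (cpow k T) i ((%x:cr P$i. %l:{..<k}. p l i x) x)"
  using x c P cmr(2)[OF p P T x] by (auto intro!: restrict_ext)
qed

lemma cpow_copair:
 assumes V: "cpx A V" and s: "!!l. l<k ==> s l : cmaps A T V"
 shows "(%i. %x:cr (cpow k T)$i. finsum V$i (%l. s l i (x l)) {..<k}) : cmaps A (cpow k T) V"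
proof (rule cmapsI)
 let ?L = "cpow k T"
 fix i
 have "(%x:cr ?L$i. finsum V$i (%l. (%x:cr ?L$i. s l i (x l)) x) {..<k}) : lhom A ?L$i V$i"
  by (rule lhom_sum[OF cpow_lm xlm[OF V] finite_lessThan]) (rule cpow_comp, simp, rule cmh[OF s], simp)
 moreover have "(%x:cr ?L$i. finsum V$i (%l. (%x:cr ?L$i. s l i (x l)) x) {..<k})
   = (%x:cr ?L$i. finsum V$i (%l. s l i (x l)) {..<k})" by (rule restrict_ext) simp
 ultimately show "(%x:cr ?L$i. finsum V$i (%l. s l i (x l)) {..<k}) : lhom A ?L$i V$i" by (simp only:)
 fix x assume x: "x IN ?L$i"
 have xl: "x l IN T$i" if "l<k" for l using x that by (auto simp: PiE_iff)
 have dx: "(%l:{..<k}. dif T i (x l)) IN ?L$(i+1)" using xl T by simp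
 have "finsum V$(i+1) (%l. s l (i+1) ((%l:{..<k}. dif T i (x l)) l)) {..<k} = finsum V$(i+1) (%l. dif V i (s l i (x l))) {..<k}"
  by (rule finsum_cong'[OF xlm[OF V]]) (use cmr(1,2)[OF s T V xl] V in auto)
 also have "... = dif V i (finsum V$i (%l. s l i (x l)) {..<k})"
  by (rule lhom_finsum[OF xlm[OF V] xlm[OF V] dhm[OF V] finite_lessThan, symmetric]) (use cmr(1)[OF s T V xl] in auto)
 finally show "(%x:cr ?L$(i+1). finsum V$(i+1) (%l. s l (i+1) (x l)) {..<k}) (dif ?L i x) =
  dif V i ((%x:cr ?L$i. finsum V$i (%l. s l i (x l)) {..<k}) x)" using x dx by simp
qed

end

end

context artin_alg
begin

text \<open>The zero morphism is the only one with \<open>al + al = al\<close>. This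
  characterisation is preserved by an additive functor, which shows that \<open>F\<close> maps zero
  to zero, the empty case of \<open>F_csm\<close>.\<close>

lemma dadd_idem_zero:
 assumes X: "X : bcx A" "projres c X P pr" and Y: "Y : bcx A" and a: "al : dhom A X Y" "dadd A X Y al al = al"
 shows "al = cls X Y P pr (zmp P Y)"
proof -
 note PC = prD(2)[OF X(2)] and YC = bcD(1)[OF Y]
 obtain f where f: "f : cmaps A P Y" "al = cls X Y P pr f" by (rule dhom_cls[OF X Y a(1)])
 note z = zcm[OF PC YC] and ff = cadd_cmaps[OF PC YC f(1,1)]
 have "hty A P Y (cadd P Y f f) f" using a(2) unfolding f(2) dadd_cls[OF X Y f(1,1)] cls_eq_iff[OF X Y ff f(1)] .
 then obtain h where h: "hfam P Y h" "!!i x. x IN P$i ==> cadd P Y f f i x = f i x +[Y$i] hm P Y h i x"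
  by (rule homotopicE[OF PC YC ff f(1)]) blast
 note rh = hfr[OF h(1) PC YC]
 have "hty A P Y f (zmp P Y)"
 proof (rule homotopicI[OF PC YC f(1) z h(1)])
  fix i x assume x: "x IN P$i"
  have c: "hm P Y h i x IN Y$i" using rh(1)[OF x] rh(2)[of "dif P i x"] x PC YC by simp
  have "f i x = hm P Y h i x" using h(2)[OF x] x c cmr(1)[OF f(1) PC YC x] lm_add_cancel[OF xlm[OF YC] _ _ c] by simp
  thus "f i x = (%x:cr P$i. 0[Y$i]) x +[Y$i] hm P Y h i x" using x c YC by simp
 qed
 thus ?thesis unfolding f(2) cls_eq_iff[OF X Y f(1) z] .
qed

end

context tilting
begin

lemma F_csm:
 assumes X: "X : bcx A" "A.projres c X P pr" and Y: "Y : bcx A" and P': "B.projres c' (fob F X) P' rh"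
  and g: "!!j. j<k ==> g j : cmaps A P Y" "!!j. j<k ==> g' j : cmaps B P' (fob F Y)"
   "!!j. j<k ==> fmap F X Y (A.cls X Y P pr (g j)) = B.cls (fob F X) (fob F Y) P' rh (g' j)"
 shows "fmap F X Y (A.cls X Y P pr (A.csm P Y g k)) = B.cls (fob F X) (fob F Y) P' rh (B.csm P' (fob F Y) g' k)" using g
proof (induction k)
 note PC = A.prD(2)[OF X(2)] and YC = A.bcD(1)[OF Y] and PC' = B.prD(2)[OF P'] and YC' = B.bcD(1)[OF Fb[OF Y]]
 case 0
 let ?z = "A.cls X Y P pr (A.csm P Y g 0)"
 have z: "A.csm P Y g 0 : cmaps A P Y" by (rule A.csm_cmaps[OF PC YC]) simp
 have zd: "?z : dhom A X Y" by (rule A.cls_dhom[OF X Y z])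
 have "A.cadd P Y (A.csm P Y g 0) (A.csm P Y g 0) = A.csm P Y g 0" by (rule A.cmaps_eqI[OF A.cadd_cmaps[OF PC YC z z] z]) (use YC in simp)
 hence "dadd A X Y ?z ?z = ?z" using A.dadd_cls[OF X Y z z] by simp
 hence "dadd B (fob F X) (fob F Y) (fmap F X Y ?z) (fmap F X Y ?z) = fmap F X Y ?z" using F_dadd[OF X(1) Y zd zd] by simp
 moreover have "fmap F X Y ?z : dhom B (fob F X) (fob F Y)" using E.fmap_closed[of X Y ?z] X(1) Y zd by simp
 ultimately show ?case unfolding B.csm_0[OF YC'] by (intro B.dadd_idem_zero[OF Fb[OF X(1)] P' Fb[OF Y]])
next
 note PC = A.prD(2)[OF X(2)] and YC = A.bcD(1)[OF Y] and PC' = B.prD(2)[OF P'] and YC' = B.bcD(1)[OF Fb[OF Y]]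
 case (Suc k)
 have c: "A.csm P Y g k : cmaps A P Y" "B.csm P' (fob F Y) g' k : cmaps B P' (fob F Y)"
  using A.csm_cmaps[OF PC YC, of k g] B.csm_cmaps[OF PC' YC', of k g'] Suc.prems by auto
 have gk: "g k : cmaps A P Y" "g' k : cmaps B P' (fob F Y)" using Suc.prems by auto
 have e: "A.csm P Y g (Suc k) = A.cadd P Y (g k) (A.csm P Y g k)" "B.csm P' (fob F Y) g' (Suc k) = B.cadd P' (fob F Y) (g' k) (B.csm P' (fob F Y) g' k)"
  by (rule A.csm_Suc[OF PC YC], use Suc.prems in simp) (rule B.csm_Suc[OF PC' YC'], use Suc.prems in simp)
 show ?case unfolding e A.dadd_cls[OF X Y gk(1) c(1), symmetric] B.dadd_cls[OF Fb[OF X(1)] P' Fb[OF Y] gk(2) c(2), symmetric]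
  using F_dadd[OF X(1) Y A.cls_dhom[OF X Y gk(1)] A.cls_dhom[OF X Y c(1)]] Suc by simp
qed

text \<open>A finitely generated projective \<open>W\<close> is a retract of \<open>B\<^sup>k\<close>, so a preimage of \<open>W\<close> under \<open>F\<close> is a retract of \<open>T\<^sup>k\<close>.\<close>

lemma retract_of_T:
 assumes V: "V : bcx A" and W: "W : fgmod B" "B.fgproj W" and phi: "iso_mor (Db B) (fob F V) (B.stalk W 0) phi" and P: "A.projres c V P pr"
 obtains k p s where "!!j. j<(k::nat) ==> p j : cmaps A P T" "!!j. j<k ==> s j : cmaps A T V"
  "hty A P V (A.csm P V (%j. ccomp P (s j) (p j)) k) pr"
proof -
 let ?V = "fob F V" and ?T = "fob F T" and ?W = "B.stalk W 0" and ?d = "A.cls V V P pr"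
 note FV = Fb[OF V] and FT = Fb[OF T(1)] and VC = A.bcD(1)[OF V] and Pr = A.prD[OF P] and lW = B.fgD(1)[OF W(1)]
 note FVC = B.bcD(1)[OF FV] and SW = B.stalk_bc[OF W(1), of 0]
 note SWC = B.bcD(1)[OF SW]
 obtain c' P' rh where P': "B.projres c' ?V P' rh" by (rule B.ex_res[OF FV])
 note Pr' = B.prD[OF P']
 let ?c = "B.cls ?V ?V P' rh"
 obtain S u where S: "S : bcx B" "liso B S$0 (regular B)" "!!i. i~=0 ==> zm S$i" "iso_mor (Db B) ?T S u" by (rule S_ex) blast
 obtain v where u: "u : dhom B ?T S" and v: "v : dhom B S ?T" and uv: "dcomp B S ?T S u v = dmap B S S (cid S)" by (rule B.Db.isoE[OF S(4)]) simp
 note SC = B.bcD(1)[OF S(1)]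
 have Sp: "B.fgproj S$i" for i using B.fgproj_iso_regular[OF B.xlm[OF SC] S(2)] B.fgproj_zero[OF B.xlm[OF SC] S(3)] by (cases "i=0") auto
 have resS: "B.projres 0 S S (cid S)" by (rule B.projres_self[OF S(1) Sp S(3)]) simp
 have resW: "B.projres 0 ?W ?W (cid ?W)" by (rule B.projres_self[OF SW B.fgproj_stalk[OF W(2)]]) simp
 have cidl: "hty C P1 Y (ccomp P1 (cid Y) f) f" if "ring C" "cpx C P1" "cpx C Y" "f : cmaps C P1 Y" for C :: "('r, 'c) module" and P1 :: "'c ucplx" and Y :: "'c ucplx" and f
  using base_ring.ccomp_cid(2)[OF base_ring.intro[OF that(1)] that(2-4)] base_ring.hty_refl[OF base_ring.intro[OF that(1)] that(2-4)] by simp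
 obtain psi where ps: "phi : dhom B ?V ?W" "psi : dhom B ?W ?V"
  "dcomp B ?V ?W ?V psi phi = dmap B ?V ?V (cid ?V)" using phi by (rule B.Db.isoE) simp
 obtain a where a: "a : cmaps B P' ?W" "phi = B.cls ?V ?W P' rh a" by (rule B.dhom_cls[OF FV P' SW ps(1)])
 obtain b where b: "b : cmaps B ?W ?V" "psi = B.cls ?W ?V ?W (cid ?W) b"
  by (rule B.dhom_cls[OF SW resW FV ps(2)])
 have ba: "ccomp P' b a : cmaps B P' ?V" by (rule B.ccm[OF Pr'(2) SWC FVC a(1) b(1)])
 have "?c (ccomp P' b a) = dmap B ?V ?V (cid ?V)"
  using ps(3) B.dcomp_cls[OF FV P' SW resW FV a(1) b(1) a(1) cidl[OF B.ring_A Pr'(2) SWC a(1)]] unfolding a(2) b(2) by simp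
 obtain k xi q where q: "!!j. j<k ==> xi j : lhom B W (regular B)" "!!j. j<(k::nat) ==> q j IN W"
  "!!x. x IN W ==> x = finsum W (%j. xi j x *[W] q j) {..<k}" by (rule B.fgproj_dual_basis[OF W(2)]) blast
 obtain g where g: "g : lhom B S$0 (regular B)" "bij_betw g (cr S$0) (cr (regular B))" using S(2) unfolding liso_def by blast
 obtain f where f: "f : lhom B (regular B) S$0" "!!y. y IN regular B ==> g (f y) = y" by (rule B.lhom_inverse[OF B.xlm[OF SC] B.lm_regular g]) blast
 \<comment> \<open>The dual basis of \<open>W\<close> yields maps from \<open>W\<close> to the
   regular module and back, carried over to \<open>S\<close> by the isomorphism \<open>g\<close>.
   Their composites add up to the identity of \<open>W\<close>.\<close>
 define pj where "pj j = (%i. if i=0 then (%x:cr W. f (xi j x)) else (%x:cr ?W$i. 0[S$i]))" for j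
 define sj where "sj j = (conc S ?W 0 (%x:cr S$0. g x *[W] q j))" for j
 have pj: "pj j : cmaps B ?W S" if j: "j<k" for j unfolding pj_def
 proof (rule B.conc_cmap[OF SWC SC])
  fix x assume "x IN ?W$0"
  hence x: "x IN W" by simp
  have "dif S 0 ((%x:cr W. f (xi j x)) x) IN S$(0+1)" using B.hcl[OF B.hcomp[OF lW q(1)[OF j] f(1)] x] by (rule B.dcl(1)[OF SC])
  thus "dif S 0 ((%x:cr W. f (xi j x)) x) = 0[S$(0+1)]" using B.zmD[OF S(3)[of "0+1"]] by simp
 qed (use B.hcomp[OF lW q(1)[OF j] f(1)] B.stalk_dif[of _ W 0 "- 1"] B.hzero[OF B.hcomp[OF lW q(1)[OF j] f(1)] lW B.xlm[OF SC]] lW in auto)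
 have gc: "g x IN B" if "x IN S$0" for x using B.hcl[OF g(1) that] by simp
 have sj: "sj j : cmaps B S ?W" if j: "j<k" for j unfolding sj_def
 proof (rule B.cmap_to_stalk[OF SC lW])
  show l: "(%x:cr S$0. g x *[W] q j) : lhom B S$0 W" by (rule B.hresI[OF B.xlm[OF SC]]) (use gc q(2)[OF j] lW B.hadd[OF g(1)] B.hsm[OF g(1)] in "auto simp: B.lsm")
  fix x assume x: "x IN S$(0-1)"
  have "dif S (0-1) x = 0[S$0]" using B.zmD[OF S(3)[of "0-1"] x] B.hzero[OF B.dhm'[OF SC, of 0]] SC by simp
  thus "(%x:cr S$0. g x *[W] q j) (dif S (0-1) x) = 0[W]" using B.hzero[OF l B.xlm[OF SC] lW] by simp
 qed
 define al where "al j = ccomp P' (pj j) a" for j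
 define be where "be j = ccomp S b (sj j)" for j
 have al: "al j : cmaps B P' S" and be: "be j : cmaps B S ?V" if "j<k" for j
  unfolding al_def be_def using B.ccm[OF Pr'(2) SWC SC a(1) pj[OF that]] B.ccm[OF SC SWC FVC sj[OF that] b(1)] by auto
 let ?g' = "%j. ccomp P' (be j) (al j)"
 have g': "?g' j : cmaps B P' ?V" if "j<k" for j by (rule B.ccm[OF Pr'(2) SC FVC al[OF that] be[OF that]])
 have sum: "B.csm P' ?V ?g' k = ccomp P' b a"
 proof (rule B.cmaps_eqI[OF B.csm_cmaps[OF Pr'(2) FVC g'] ba])
  fix i x assume x: "x IN P'$i"
  let ?M = "?W$i" and ?y = "a i x"
  note lM = B.xlm[OF SWC, of i]
  have y: "?y IN ?M" by (rule B.cmr(1)[OF a(1) Pr'(2) SWC x])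
  have pc: "pj j i ?y IN S$i" if "j<k" for j by (rule B.cmr(1)[OF pj[OF that] SWC SC y])
  have sc: "sj j i (pj j i ?y) IN ?M" if "j<k" for j by (rule B.cmr(1)[OF sj[OF that] SC SWC pc[OF that]])
  have m: "finsum ?M (%j. sj j i (pj j i ?y)) {..<k} = ?y"
  proof (cases "i=0")
   case True
   have "sj j 0 (pj j 0 ?y) = xi j ?y *[W] q j" if "j<k" for j using y True f(2) B.hcl[OF f(1)] B.hcl[OF q(1)[OF that]] unfolding sj_def pj_def by simp
   hence "finsum W (%j. sj j 0 (pj j 0 ?y)) {..<k} = finsum W (%j. xi j ?y *[W] q j) {..<k}" by (intro B.finsum_cong'[OF lW]) (use sc True in auto)
   thus ?thesis using q(3)[of ?y] y True by simp
  next
   case False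
   have "finsum ?M (%j. sj j i (pj j i ?y)) {..<k} IN ?M" by (rule B.finsum_closed'[OF lM]) (use sc in auto)
   thus ?thesis using y False by simp
  qed
  have "finsum ?V$i (%j. ?g' j i x) {..<k} = finsum ?V$i (%j. b i (sj j i (pj j i ?y))) {..<k}" by (rule B.finsum_cong'[OF B.xlm[OF FVC]])
    (use x pc sc B.cmr(1)[OF b(1) SWC FVC] in "auto simp: al_def be_def")
  also have "... = b i (finsum ?M (%j. sj j i (pj j i ?y)) {..<k})"
   by (rule B.lhom_finsum[OF lM B.xlm[OF FVC] B.cmh[OF b(1)] finite_lessThan, symmetric]) (use sc in auto)
  finally show "B.csm P' ?V ?g' k i x = ccomp P' b a i x" using x m by simp
 qed
 \<comment> \<open>Each summand of the identity of \<open>F V\<close> factors through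
   \<open>S\<close>, hence through \<open>F T\<close>. Fullness lifts both factors to
   \<open>A\<close>, and later faithfulness transports the equation for the sum.\<close>
 have ex: "EX p s. p : cmaps A P T & s : cmaps A T V &
  fmap F V V (?d (ccomp P s p)) = ?c (?g' j)" if j: "j<k" for j
 proof -
  let ?al = "B.cls ?V S P' rh (al j)" and ?be = "B.cls S ?V S (cid S) (be j)"
  have ald: "?al : dhom B ?V S" by (rule B.cls_dhom[OF FV P' S(1) al[OF j]])
  have bed: "?be : dhom B S ?V" by (rule B.cls_dhom[OF S(1) resS FV be[OF j]])
  have vd: "dcomp B ?V S ?T v ?al : dhom B ?V ?T" by (rule B.dcomp_closed[OF FV S(1) FT ald v])
  have ud: "dcomp B ?T S ?V ?be u : dhom B ?T ?V" by (rule B.dcomp_closed[OF FT S(1) FV u bed])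
  obtain p0 where p0: "p0 : dhom A V T" "fmap F V T p0 = dcomp B ?V S ?T v ?al" using E.full[of V T] V T(1) vd by auto
  obtain s0 where s0: "s0 : dhom A T V" "fmap F T V s0 = dcomp B ?T S ?V ?be u" using E.full[of T V] V T(1) ud by auto
  obtain p where p: "p : cmaps A P T" "p0 = A.cls V T P pr p" by (rule A.dhom_cls[OF V P T(1) p0(1)])
  obtain s where s: "s : cmaps A T V" "s0 = A.cls T V T (cid T) s" by (rule A.dhom_cls[OF T(1) resT V s0(1)])
  have "?d (ccomp P s p) = dcomp A V T V s0 p0"
   unfolding p(2) s(2) by (rule A.dcomp_cls[OF V P T(1) resT V p(1) s(1) p(1) cidl[OF A.ring_A Pr(2) T(2) p(1)], symmetric])
  hence "fmap F V V (?d (ccomp P s p)) = dcomp B ?V ?T ?V (dcomp B ?T S ?V ?be u) (dcomp B ?V S ?T v ?al)"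
   using E.fmap_Comp[of V T V p0 s0] V T(1) p0 s0 by simp
  also have "... = dcomp B ?V S ?V ?be (dcomp B ?V ?T S u (dcomp B ?V S ?T v ?al))"
   by (rule B.dcomp_assoc[OF FV FT S(1) FV vd u bed, symmetric])
  also have "dcomp B ?V ?T S u (dcomp B ?V S ?T v ?al) = ?al"
   unfolding B.dcomp_assoc[OF FV S(1) FT S(1) ald v u] uv by (rule B.dcomp_Id(2)[OF FV S(1) ald])
  also have "dcomp B ?V S ?V ?be ?al = ?c (?g' j)"
   by (rule B.dcomp_cls[OF FV P' S(1) resS FV al[OF j] be[OF j] al[OF j] cidl[OF B.ring_A Pr'(2) SC al[OF j]]])
  finally show ?thesis using p(1) s(1) by blast
 qed
 define pp where "pp j = (SOME p. EX s. p : cmaps A P T & s : cmaps A T V &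
  fmap F V V (?d (ccomp P s p)) = ?c (?g' j))" for j
 have "EX s. pp j : cmaps A P T & s : cmaps A T V &
  fmap F V V (?d (ccomp P s (pp j))) = ?c (?g' j)" if "j<k" for j unfolding pp_def by (rule someI_ex[OF ex[OF that]])
 then obtain ss where ps: "!!j. j<k ==> pp j : cmaps A P T & ss j : cmaps A T V &
  fmap F V V (?d (ccomp P (ss j) (pp j))) = ?c (?g' j)" by metis
 let ?g = "%j. ccomp P (ss j) (pp j)"
 have gA: "?g j : cmaps A P V" if "j<k" for j by (rule A.ccm[OF Pr(2) T(2) VC]) (use ps[OF that] in auto)
 have cA: "A.csm P V ?g k : cmaps A P V" by (rule A.csm_cmaps[OF Pr(2) VC gA])
 have "fmap F V V (?d (A.csm P V ?g k)) = ?c (ccomp P' b a)"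
  unfolding sum[symmetric] by (rule F_csm[OF V P V P']) (use gA g' ps in auto)
 also have "... = fmap F V V (?d pr)" using \<open>?c (ccomp P' b a) = _\<close> E.fmap_Id[of V] V A.dmap_cid[OF V P] by simp
 finally have "?d (A.csm P V ?g k) = ?d pr" by (intro E.faithful[of V V]) (use V A.cls_dhom[OF V P V cA] A.cls_dhom[OF V P V Pr(5)] in auto)
 hence "hty A P V (A.csm P V ?g k) pr" unfolding A.cls_eq_iff[OF V P V cA Pr(5)] .
 thus ?thesis using ps by (intro that[of k pp ss]) auto
qed

end

section \<open>Dominant dimension\<close>

text \<open>Modules with no nonzero map to a projective-injective one. These are the test modules: a
  module without nonzero submodule of this kind embeds into a projective-injective module.\<close>

definition (in base_ring) pnull :: "('a, 'a univ) module => bool" where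
 "pnull Y <-> Y : fgmod A & (ALL M u y. pinj M --> u : lhom A Y M --> y IN Y --> u y = 0[M])"

lemma (in base_ring) pnullD: "pnull Y ==> Y : fgmod A" "pnull Y ==> pinj M ==> u : lhom A Y M ==> y IN Y ==> u y = 0[M]" unfolding pnull_def by auto

context artin_alg
begin

text \<open>In the top degree of a resolution of \<open>Y\<close>, a cocycle with values in
  \<open>M\<close> is a map from \<open>Y\<close> to \<open>M\<close>.\<close>

lemma null_res:
 assumes Y: "pnull Y" and Q: "projres j (stalk Y j) Q rh" and M: "pinj M"
  and u: "u : lhom A Q$j M" "PROP kz Q j M u" and x: "x IN Q$j"
 shows "u x = 0[M]"
proof -
 note r = res_stalkD[OF pnullD(1)[OF Y] Q]
 have lM: "lmod A M" using M fgD unfolding pinj_def by blast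
 obtain k where k: "k : lhom A Y M" "!!x. x IN Q$j ==> k (rh j x) = u x"
 proof (rule lhom_factor[OF xlm[OF prD(2)[OF Q]] fgD(1)[OF pnullD(1)[OF Y]] lM u(1) r(1,2)])
  fix x assume "x IN Q$j" "rh j x = 0[Y]"
  hence "x : dif Q (j-1) ` cr Q$(j-1)" using r(3) by blast
  thus "u x = 0[M]" using u(2) by blast
 qed auto
 show ?thesis using k(2)[OF x] pnullD(2)[OF Y M k(1) hcl[OF r(1) x]] by simp
qed

text \<open>A projective-injective \<open>M\<close> is invisible to \<open>Y\<close> in all degrees:
  there are no maps by \<open>pnull\<close> and no extensions by injectivity.\<close>

lemma null_ext:
 assumes Y: "pnull Y" and Q: "projres j (stalk Y j) Q rh" and M: "pinj M"
  and u: "u : lhom A Q$i M" "PROP kz Q i M u"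
 shows "fac A Q i M u"
proof (cases "i=j")
 case True
 have lM: "lmod A M" using M fgD unfolding pinj_def by blast
 have "u x = 0[M]" if "x IN Q$i" for x using null_res[OF Y Q M] u that unfolding True by blast
 thus ?thesis using hzmap[OF xlm[OF prD(2)[OF Q]] lM] prD(2)[OF Q] by (intro bexI[of _ "%x:cr Q$(i+1). 0[M]"]) auto
next
 case False
 have "injective A M" using M unfolding pinj_def by blast
 then obtain h where "h : lhom A Q$(i+1) M" "!!x. x IN Q$i ==> u x = h (dif Q i x)"
  using ext_inj[OF prD(2)[OF Q] fgD(2)[OF prD(3)[OF Q]] _ res_stalkD(4)[OF pnullD(1)[OF Y] Q False] u] by blast
 thus ?thesis by blast
qed

text \<open>Fitting's lemma for \<open>\<iota>\<epsilon>\<close>: its stable image is a summand of \<open>J\<close> and of \<open>P\<close>.\<close>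

lemma fitting_summand:
 fixes P :: "('a, 'p) module"
 assumes J: "J : fgmod A" "injective A J" and P: "fgproj P" and f: "\<iota> : lhom A P J" "\<epsilon> : lhom A J P"
 obtains I where "submod A J I" "pinj (sub J I)" "!!y. y IN J ==> \<iota> (\<epsilon> y) = y ==> y : I"
proof -
 note lJ = fgD[OF J(1)] and lP = fgproj_lm[OF P]
 define phi where "phi = (%x:cr J. \<iota> (\<epsilon> x))"
 have p: "phi : lhom A J J" unfolding phi_def by (rule hcomp[OF lJ(1) f(2,1)])
 have pk: "(%x:cr J. (phi ^^ k) x) : lhom A J J" for k by (rule funpow_hom[OF p lJ(1)])
 have pc: "(phi ^^ k) x IN J" if "x IN J" for k x using hcl[OF pk that, of k] that by simp
 define S where "S = {(%x:cr J. (phi ^^ Suc k) x) ` cr J | k. True}"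
 have sub: "submod A J U" if U: "U : S" for U
 proof -
  obtain k where k: "U = (%x:cr J. (phi ^^ Suc k) x) ` cr J" using U unfolding S_def by blast
  show ?thesis unfolding k by (rule sm_range[OF lJ(1) lJ(1) pk])
 qed
 have mem: "(%x:cr J. (phi ^^ Suc k) x) ` cr J : S" for k unfolding S_def by blast
 obtain I where I: "I : S" "!!Z. Z : S ==> Z<=I ==> Z = I" by (rule chains_stop_min[OF submods_stop[OF lJ] mem sub]) auto
 then obtain m where m: "I = (%x:cr J. (phi ^^ Suc m) x) ` cr J" unfolding S_def by blast
 define N where "N = (%x:cr J. (phi ^^ Suc m) x)"
 have N: "N : lhom A J J" unfolding N_def by (rule pk)
 note Is = sub[OF I(1)] and IN' = m[folded N_def]
 let ?I = "sub J I"
 have lI: "lmod A ?I" "fin_gen A ?I" "?I : fgmod A" using lJ Is fin_gen_sub fgmod_sub[OF J(1)] by auto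
 have NJ: "N x : I" if "x IN J" for x unfolding IN' using that by blast
 have Ic: "x IN J" if "x : I" for x using smD(5)[OF Is that] .
 have i2: "(%x:cr J. (phi ^^ Suc (m + Suc m)) x) ` cr J = (%x:I. N x) ` I"
 proof -
  have "(%x:cr J. (phi ^^ Suc (m + Suc m)) x) x = N (N x)" if "x IN J" for x using that pc[OF that, of "Suc m"] unfolding N_def by (simp add: funpow_add funpow_swap1)
  thus ?thesis using NJ unfolding IN' by (auto simp: image_image intro!: image_cong)
 qed
 have im: "(%x:I. N x) ` I = I" by (rule I(2)[OF mem[of "m + Suc m", unfolded i2]]) (use NJ Ic in auto)
 have NI: "(%x:I. N x) : lhom A ?I ?I" by (rule lhom_cosub[OF lhom_sub[OF N Is]]) (use NJ Ic in auto)
 have im': "(%x:I. N x) ` cr ?I = cr ?I" using im by simp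
 have "bij_betw (%x:I. N x) (cr ?I) (cr ?I)" using surj_endo_inj[OF lI(1,2) NI im'] lhom_inj_iff[OF lI(1) lI(1) NI] im' unfolding bij_betw_def by blast
 then obtain k where k: "k : lhom A ?I ?I" "!!x. x IN ?I ==> k ((%x:I. N x) x) = x" by (rule lhom_inverse[OF lI(1) lI(1) NI]) blast
 have kN: "k (N x) = x" if "x : I" for x using k(2)[of x] that by simp
 have NJI: "N : lhom A J ?I" by (rule lhom_cosub[OF N]) (use NJ in blast)
 have "injective A ?I" by (rule injective_retract[OF J(2) lI(1) lhom_incl[OF lJ(1) Is] hcomp[OF lJ(1) NJI k(1)]]) (use kN Ic in auto)
 moreover have "fgproj ?I"
 proof (rule fgproj_retract[OF P lI(1)])
  let ?e = "%x:cr J. \<epsilon> ((%x:cr J. (phi ^^ m) x) x)"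
  have e: "?e : lhom A J P" by (rule hcomp[OF lJ(1) pk f(2)])
  show "(%x:I. ?e x) : lhom A ?I P" by (rule lhom_sub[OF e Is])
  \<comment> \<open>On \<open>I\<close> the map \<open>?e\<close> followed by \<open>\<iota>\<close>
    is \<open>N\<close>, and \<open>?r\<close> applies \<open>N\<close> once more; the two copies of
    \<open>k\<close> undo both.\<close>
  let ?r = "%t:cr P. k ((%t:cr P. k ((%t:cr P. N (\<iota> t)) t)) t)"
  show "?r : lhom A P ?I" by (rule hcomp[OF lP hcomp[OF lP hcomp[OF lP f(1) NJI] k(1)] k(1)])
  fix x assume x: "x IN ?I"
  have "\<iota> (?e x) = N x" using x Ic[of x] pc[of x m] unfolding N_def phi_def[symmetric] by (simp add: phi_def)
  thus "?r ((%x:I. ?e x) x) = x" using x Ic[of x] hcl[OF e, of x] kN NJ[of x] by simp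
 qed
 moreover have "y : I" if y: "y IN J" "\<iota> (\<epsilon> y) = y" for y
 proof -
  have "(phi ^^ j) y = y" for j by (induction j) (use y in \<open>auto simp: phi_def\<close>)
  from this[of "Suc m"] have "N y = y" using y(1) unfolding N_def by (simp only: restrict_apply' if_True)
  thus ?thesis using NJ[OF y(1)] by simp
 qed
 ultimately show ?thesis using lI(3) by (intro that[OF Is]) (auto simp: pinj_def)
qed

end

locale nakayama_tilting = tilting_pinj R A B F T n + D: dual_alg R A J
 for R :: "('r, 'e) ring_scheme" and A :: "('r, 'a) module" and B :: "('r, 'b) module" and F T n and J :: "('r, 'r univ) module" +
 assumes null_T: "A.pnull Y ==> i<0 ==> u : lhom A T$i Y ==> x IN T$i ==> u x = 0[Y]"
begin

text \<open>\<open>F\<close> sends a module in degree \<open>1\<close> into the degrees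
  \<open>1\<close> to \<open>n+1\<close>. Maps into an injective module in degree \<open>0\<close>
  are governed by the cohomology in degree \<open>0\<close>, which is missing.\<close>

lemma hz_injective:
 assumes C: "C : fgmod A" and V: "V : bcx A" and W: "W : fgmod B" "injective B W" and phi: "iso_mor (Db B) (fob F V) (B.stalk W 0) phi"
 shows "hz (Db A) (A.stalk C 1) V"
proof -
 note SC = A.stalk_bc[OF C, of 1] and SW = B.stalk_bc[OF W(1), of 0]
 note FS = Fb[OF SC]
 obtain c U sg where U: "B.projres c (FS C 1) U sg" by (rule B.ex_res[OF FS])
 note Ur = B.prD[OF U]
 have ac: "B.acyc U 0" using B.qis_acyc[OF Ur(2) B.bcD(1)[OF FS] Ur(4)] acyc_F_stalk_out[OF C, of 1 0] by simp
 have "hz (Db B) (FS C 1) (B.stalk W 0)" unfolding B.hz_stalk[OF FS U W(1)]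
 proof (intro ballI impI)
  fix u assume u: "u : lhom B U$0 W" "ALL x:cr U$(0-1). u (dif U (0-1) x) = 0[W]"
  obtain h where "h : lhom B U$(0+1) W" "!!x. x IN U$0 ==> u x = h (dif U 0 x)" by (rule B.ext_inj[OF Ur(2) B.fgD(2)[OF Ur(3)] W(2) ac u(1)]) (use u(2) in blast)+
  thus "EX h:lhom B U$(0+1) W. ALL x:cr U$0. u x = h (dif U 0 x)" by blast
 qed
 hence "hz (Db B) (FS C 1) (fob F V)" using B.Db.hz_iso[OF _ _ _ _ B.Db.iso_Id phi, of "FS C 1"] FS SW Fb[OF V] by simp
 thus ?thesis using E.hz_fob SC V by simp
qed

text \<open>A map from \<open>Y\<close> to \<open>V\<close> becomes a map \<open>y\<close> to a
  power \<open>?K\<close> of \<open>T\<close> that the idempotent \<open>e\<close> fixes up to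
  homotopy. Injectivity of the negative terms moves \<open>y\<close> into degree \<open>0\<close>;
  there it is fixed by \<open>e\<close> exactly and takes its values in a projective-injective
  summand of an injective module, so it is zero by \<open>pnull\<close>.\<close>

lemma hz_null:
 assumes Y: "A.pnull Y" and V: "V : bcx A" and W: "B.pinj W" and phi: "iso_mor (Db B) (fob F V) (B.stalk W 0) phi"
 shows "hz (Db A) (A.stalk Y 0) V"
proof -
 have Wf: "W : fgmod B" "B.fgproj W" "injective B W" using W unfolding B.pinj_def by auto
 note VC = A.bcD(1)[OF V] and Yf = A.pnullD(1)[OF Y]
 note SY = A.stalk_bc[OF Yf, of 0]
 obtain c P pr where P: "A.projres c V P pr" by (rule A.ex_res[OF V])
 note Pr = A.prD[OF P]
 note PC = Pr(2)
 obtain k p0 s0 where p0: "!!j. j<(k::nat) ==> p0 j : cmaps A P T" and s0: "!!j. j<k ==> s0 j : cmaps A T V"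
  and sp0: "hty A P V (A.csm P V (%j. ccomp P (s0 j) (p0 j)) k) pr" by (rule retract_of_T[OF V Wf(1,2) phi P]) blast
 let ?K = "A.cpow k T"
 note KC = A.cpow_complex[OF T(2), of k]
 note lK = A.xlm[OF KC]
 have Kp: "A.fgproj ?K$i" for i using A.fgproj_dsum[of "{..<k}" "%_. T$i"] T(4) by simp
 have Kz: "zm ?K$i" if i: "i < - int n | i>0" for i
 proof -
  have "x = 0[?K$i]" if x: "x IN ?K$i" for x by (rule extensionalityI[of _ "{..<k}"]) (use x A.zmD[OF T_zero[OF i]] in "auto simp: PiE_iff")
  thus ?thesis unfolding zero_module_def using A.lcl(1)[OF lK] by blast
 qed
 have bK: "A.bproj 0 ?K" using KC Kp Kz unfolding A.bproj_def by blast
 have Ki: "injective A ?K$i" if "i<0" for i using A.injective_dsum[of "{..<k}" "%_. T$i"] T_inj[OF that] by simp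
 define p where "p = (%i. %x:cr P$i. %l:{..<k}. p0 l i x)"
 define s where "s = (%i. %x:cr ?K$i. finsum V$i (%l. s0 l i (x l)) {..<k})"
 have p: "p : cmaps A P ?K" unfolding p_def by (rule A.cpow_pair[OF T(2) PC p0])
 have s: "s : cmaps A ?K V" unfolding s_def by (rule A.cpow_copair[OF T(2) VC s0])
 note sp = A.ccm[OF PC KC VC p s]
 have "ccomp P s p = A.csm P V (%j. ccomp P (s0 j) (p0 j)) k"
 proof (rule A.cmaps_eqI[OF sp A.csm_cmaps[OF PC VC A.ccm[OF PC T(2) VC p0 s0]]])
  fix i x assume x: "x IN P$i"
  have "p i x IN ?K$i" by (rule A.cmr(1)[OF p PC KC x])
  hence "s i (p i x) = finsum V$i (%l. s0 l i (p i x l)) {..<k}" unfolding s_def by simp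
  also have "... = finsum V$i (%l. ccomp P (s0 l) (p0 l) i x) {..<k}"
   by (rule A.finsum_cong'[OF A.xlm[OF VC]]) (use x A.cmr(1)[OF s0 T(2) VC A.cmr(1)[OF p0 PC T(2) x]] in "auto simp: p_def")
  finally show "ccomp P s p i x = A.csm P V (%j. ccomp P (s0 j) (p0 j)) k i x" using x by simp
 qed
 hence sp1: "hty A P V (ccomp P s p) pr" using sp0 by simp
 obtain t where t: "t : cmaps A ?K P" "hty A ?K V (ccomp ?K pr t) s" by (rule A.lift_exists[OF bK PC VC Pr(4) s])
 note tp = A.ccm[OF PC KC PC p t(1)]
 have tp1: "hty A P P (ccomp P t p) (cid P)"
 proof (rule A.lift_unique[OF Pr(1) PC VC Pr(4) tp A.cid_cmaps[OF PC]])
  have "hty A P V (ccomp P (ccomp ?K pr t) p) (ccomp P s p)" by (rule A.hty_comp2[OF PC KC VC p A.ccm[OF KC PC VC t(1) Pr(5)] s t(2)])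
  hence "hty A P V (ccomp P pr (ccomp P t p)) (ccomp P s p)" unfolding A.ccomp_as[OF PC KC PC VC p t(1) Pr(5)] .
  thus "hty A P V (ccomp P pr (ccomp P t p)) (ccomp P pr (cid P))"
   unfolding A.ccomp_cid(1)[OF PC VC Pr(5)] by (rule A.hty_trans[OF PC VC A.ccm[OF PC PC VC tp Pr(5)] sp Pr(5) _ sp1])
 qed
 \<comment> \<open>\<open>t p\<close> is homotopic to the identity of \<open>P\<close>, so
   \<open>e\<close> is an idempotent of \<open>?K\<close> up to homotopy whose image stands for
   \<open>V\<close>.\<close>
 define e where "e = ccomp ?K p t"
 have e: "e : cmaps A ?K ?K" unfolding e_def by (rule A.ccm[OF KC PC KC t(1) p])
 let ?P0 = "?K$0"
 note l0 = lK[of 0] and e0 = A.cmh[OF e, of 0]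
 have f0: "lmod A ?P0" "fin_gen A ?P0" using l0 A.fgproj_fin_gen[OF Kp[of 0]] by auto
 obtain P1 i1 r1 where P1: "P1 : fgmod A" "i1 : lhom A ?P0 P1" "r1 : lhom A P1 ?P0" "!!x. x IN ?P0 ==> r1 (i1 x) = x" by (rule A.ex_copy[OF f0]) blast
 obtain H i2 where H: "H : fgmod A" "injective A H" "i2 : lhom A P1 H" "!!x. x IN P1 ==> i2 x = 0[H] ==> x = 0[P1]" by (rule D.ex_injective_embedding[OF P1(1)]) blast
 note lH = A.fgD[OF H(1)] and lP1 = A.fgD[OF P1(1)]
 define io where "io = (%x:cr ?P0. i2 (i1 x))"
 have io: "io : lhom A ?P0 H" unfolding io_def by (rule A.hcomp[OF l0 P1(2) H(3)])
 have io0: "x = 0[?P0]" if "x IN ?P0" "io x = 0[H]" for x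
  using that H(4)[OF A.hcl[OF P1(2) that(1)]] P1(4)[OF that(1)] A.hzero[OF P1(3) lP1(1) l0] unfolding io_def by simp
 text \<open>The obstruction to extending \<open>\<epsilon>\<close> from \<open>P0\<close> to the injective module \<open>H\<close> lies in \<open>Hom(H/P0[-1], V) = 0\<close>.\<close>
 obtain C c where C: "C : fgmod A" "c : lhom A H C" "c ` cr H = cr C" "{x:cr H. c x = 0[C]} = io ` cr ?P0" by (rule A.ex_quotient[OF lH A.sm_range[OF l0 lH(1) io]])
 note lC = A.fgD(1)[OF C(1)] and SC = A.stalk_bc[OF C(1), of 1]
 obtain Q sg where Q: "A.projres 1 (A.stalk C 1) Q sg" by (rule A.ex_projres[OF SC A.stalk_acyc[OF lC], of 1]) auto
 note Qr = A.prD[OF Q] and q = A.res_stalkD[OF C(1) Q]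
 note QC = Qr(2)
 have dQ: "dif Q 0 : lhom A Q$0 Q$1" using A.dhm[OF QC, of 0] by simp
 have q3: "{x:cr Q$1. sg 1 x = 0[C]} = dif Q 0 ` cr Q$0" using q(3) by simp
 obtain a where a: "a : lhom A Q$1 H" "!!x. x IN Q$1 ==> c (a x) = sg 1 x" by (rule A.fgproj_lift[OF Qr(6) lH(1) lC C(2) q(1)]) (use C(3) A.hcl[OF q(1)] in auto)
 note ad = A.hcomp[OF A.xlm[OF QC] dQ a(1)]
 have adP: "a (dif Q 0 x) : io ` cr ?P0" if x: "x IN Q$0" for x
 proof -
  have d: "dif Q 0 x IN Q$1" by (rule A.hcl[OF dQ x])
  have "sg 1 (dif Q 0 x) = 0[C]" using imageI[OF x, of "dif Q 0"] unfolding q3[symmetric] by blast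
  hence "c (a (dif Q 0 x)) = 0[C]" using a(2)[OF d] by simp
  thus ?thesis using C(4) A.hcl[OF a(1) d] by blast
 qed
 obtain b where b: "b : lhom A Q$0 ?P0" "!!x. x IN Q$0 ==> io (b x) = (%x:cr Q$0. a (dif Q 0 x)) x" by (rule A.fgproj_lift[OF Qr(6) l0 lH(1) io ad]) (use adP in auto)
 have bd: "b (dif Q (0-1) x) = 0[?P0]" if x: "x IN Q$(0-1)" for x
 proof (rule io0)
  have d: "dif Q (0-1) x IN Q$0" using x A.dcl(2)[OF QC, of x 0] by simp
  show "b (dif Q (0-1) x) IN ?P0" by (rule A.hcl[OF b(1) d])
  have "dif Q 0 (dif Q (0-1) x) = 0[Q$1]" using A.dif_dif(2)[OF QC x] by simp
  thus "io (b (dif Q (0-1) x)) = 0[H]" using b(2)[OF d] d A.hzero[OF a(1) A.xlm[OF QC] lH(1)] by simp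
 qed
 \<comment> \<open>\<open>b\<close> measures how \<open>Q$0\<close> is glued to \<open>?P0\<close>
   inside \<open>H\<close>. As a map in degree \<open>0\<close> it represents a morphism from
   \<open>C[-1]\<close> to \<open>?K\<close>; composed with \<open>t\<close> it becomes a morphism
   to \<open>V\<close> and vanishes, so \<open>e\<close> after \<open>U\<close> is null-homotopic
   and \<open>e 0\<close> after \<open>b\<close> factors through \<open>dif Q 0\<close>.\<close>
 define U where "U = conc Q ?K 0 b"
 have dK1: "dif ?K 0 z = 0[?K$(0+1)]" if "z IN ?P0" for z using A.zmD[OF Kz[of "0+1"] A.dcl(1)[OF KC that]] by simp
 have U: "U : cmaps A Q ?K" unfolding U_def by (rule A.conc_cmap[OF QC KC b(1) bd dK1]) (use A.hcl[OF b(1)] in auto)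
 note tU = A.ccm[OF QC KC PC U t(1)] and zP = A.zcm[OF QC PC]
 let ?zP = "zmp Q P"
 have "hty A Q V (ccomp Q pr (ccomp Q t U)) (ccomp Q pr ?zP)" using hz_injective[OF C(1) V Wf(1,3) phi] unfolding A.hz_iff[OF SC Q V]
  using A.ccm[OF QC PC VC tU Pr(5)] A.ccm[OF QC PC VC zP Pr(5)] by blast
 hence "hty A Q P (ccomp Q t U) ?zP" by (rule A.lift_unique[OF Qr(1) PC VC Pr(4) tU zP])
 hence h1: "hty A Q ?K (ccomp Q p (ccomp Q t U)) (ccomp Q p ?zP)" by (rule A.hty_comp[OF QC PC KC tU zP p])
 have extQ: "fac A Q j ?K$(j-1) xi"
  if j: "j<=0" and x: "xi : lhom A Q$j ?K$(j-1)" "PROP kz Q j ?K$(j-1) xi" for j xi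
 proof -
  have i: "injective A ?K$(j-1)" and a: "A.acyc Q j" using Ki[of "j-1"] q(4)[of j] j by auto
  obtain h where "h : lhom A Q$(j+1) ?K$(j-1)" "!!x. x IN Q$j ==> xi x = h (dif Q j x)" by (rule A.ext_inj[OF QC A.fgD(2)[OF Qr(3)] i a x]) auto
  thus ?thesis by blast
 qed
 have pt0: "p i 0[P$i] = 0[?K$i]" "t i 0[?K$i] = 0[P$i]" for i using A.cmr(5)[OF p PC KC] A.cmr(5)[OF t(1) KC PC] by auto
 obtain psi where psi: "psi : lhom A Q$(0+1) ?P0" "!!x. x IN Q$0 ==> ccomp Q p (ccomp Q t U) 0 x = ccomp Q p ?zP 0 x +[?P0] psi (dif Q 0 x)"
 proof (rule A.null_homotopic_top[OF QC KC, of "- int n" "ccomp Q p (ccomp Q t U)" "ccomp Q p ?zP" 0])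
  show "ccomp Q p (ccomp Q t U) j x = ccomp Q p ?zP j x" if "j<0" "x IN Q$j" for j x using that pt0 by (simp add: U_def)
 qed (use A.ccm[OF QC PC KC tU p] A.ccm[OF QC PC KC zP p] h1 Kz extQ in auto)
 have eb: "e 0 (b x) = psi (dif Q 0 x)" if x: "x IN Q$0" for x
  using psi(2)[OF x] x pt0 A.hcl[OF b(1) x] A.hcl[OF psi(1), of "dif Q 0 x"] A.dcl(1)[OF QC x] l0 by (simp add: U_def e_def del: A.cpow_simps A.dsum_simps)
 have psi1: "psi : lhom A Q$1 ?P0" using psi(1) by simp
 let ?B = "biprod Q$1 ?P0"
 note lQ1 = A.xlm[OF QC, of 1]
 note lB = A.lm_biprod[OF lQ1 l0]
 let ?m = "%z:cr ?B. a (fst z) +[H] io (snd z)" and ?l = "%z:cr ?B. psi (fst z) +[?P0] e 0 (snd z)"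
 have m: "?m : lhom A ?B H" by (rule A.lhom_copair[OF lQ1 l0 lH(1) a(1) io])
 have l: "?l : lhom A ?B ?P0" by (rule A.lhom_copair[OF lQ1 l0 l0 psi1 e0])
 have ms: "?m ` cr ?B = cr H"
 proof (intro equalityI subsetI)
  fix y assume y: "y IN H"
  obtain x where x: "x IN Q$1" "sg 1 x = c y" by (rule surjE[OF q(2) A.hcl[OF C(2) y]])
  note ax = A.hcl[OF a(1) x(1)]
  have "c (y -[H] a x) = c y -[C] c (a x)" by (rule A.hminus[OF C(2) lH(1) lC y ax])
  also have "... = 0[C]" using a(2)[OF x(1)] x(2) A.hcl[OF C(2) y] lC by simp
  finally have "y -[H] a x : io ` cr ?P0" using A.lcl(4)[OF lH(1) y ax] unfolding C(4)[symmetric] by blast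
  then obtain w where w: "w IN ?P0" "y -[H] a x = io w" by blast
  have "?m (x, w) = y" using x(1) w ax y lH(1) by (simp add: A.lm_ac flip: w(2))
  thus "y : ?m ` cr ?B" using x(1) w(1) by (intro image_eqI[where x="(x, w)"]) auto
 qed (use A.hcl[OF m] in auto)
 obtain e' where e': "e' : lhom A H ?P0" "!!z. z IN ?B ==> e' (?m z) = ?l z"
 proof (rule A.lhom_factor[OF lB lH(1) l0 l m ms])
  fix z assume z: "z IN ?B" "?m z = 0[H]"
  obtain x w where xw: "z = (x, w)" "x IN Q$1" "w IN ?P0" using z(1) by auto
  have zz: "a x +[H] io w = 0[H]" using z xw by simp
  note ax = A.hcl[OF a(1) xw(2)] and iw = A.hcl[OF io xw(3)]
  have "c (a x +[H] io w) = c (a x) +[C] c (io w)" by (rule A.hadd[OF C(2) ax iw])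
  moreover have "c (io w) = 0[C]" using C(4) xw(3) by blast
  ultimately have "sg 1 x = 0[C]" using zz a(2)[OF xw(2)] A.hzero[OF C(2) lH(1) lC] A.hcl[OF C(2) ax] lC by simp
  hence "x : dif Q 0 ` cr Q$0" using q3 xw(2) by blast
  then obtain v where v: "v IN Q$0" "x = dif Q 0 v" by blast
  note bv = A.hcl[OF b(1) v(1)]
  have "io (b v +[?P0] w) = 0[H]" using A.hadd[OF io bv xw(3)] b(2)[OF v(1)] v zz by simp
  hence "b v +[?P0] w = 0[?P0]" by (rule io0[OF A.lcl(2)[OF l0 bv xw(3)]])
  hence "e 0 (b v) +[?P0] e 0 w = 0[?P0]" using A.hadd[OF e0 bv xw(3)] A.hzero[OF e0 l0 l0] by simp
  thus "?l z = 0[?P0]" using xw v eb[OF v(1)] by simp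
 qed (use that in auto)
 have ee: "e' (io x) = e 0 x" if x: "x IN ?P0" for x
  using e'(2)[of "(0[Q$1], x)"] x lQ1 l0 lH(1) A.hzero[OF a(1) lQ1 lH(1)] A.hzero[OF psi1 lQ1 l0] A.hcl[OF io x] A.hcl[OF e0 x] by (simp del: A.cpow_simps A.dsum_simps)
 obtain I where I: "submod A H I" "A.pinj (A.sub H I)" "!!y. y IN H ==> io (e' y) = y ==> y : I" by (rule A.fitting_summand[OF H(1,2) Kp[of 0] io e'(1)]) blast
 obtain S rh where S: "A.projres 0 (A.stalk Y 0) S rh" by (rule A.ex_projres[OF SY A.stalk_acyc[OF A.fgD(1)[OF Yf]], of 0]) auto
 note Sr = A.prD[OF S]
 note C1 = Sr(2)
 have main: "hty A S V v (zmp S V)" if v: "v : cmaps A S V" for v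
 proof -
  obtain w where w: "w : cmaps A S P" "hty A S V (ccomp S pr w) v" by (rule A.lift_exists[OF Sr(1) PC VC Pr(4) v])
  define y where "y = ccomp S p w"
  have y: "y : cmaps A S ?K" unfolding y_def by (rule A.ccm[OF C1 PC KC w(1) p])
  note ty = A.ccm[OF C1 KC PC y t(1)]
  have tyw: "hty A S P (ccomp S t y) w" using A.hty_comp2[OF C1 PC PC w(1) tp A.cid_cmaps[OF PC] tp1]
   unfolding y_def A.ccomp_as[OF C1 PC KC PC w(1) p t(1)] A.ccomp_cid(2)[OF C1 PC w(1)] .
  have ey: "hty A S ?K (ccomp S e y) y" using A.hty_comp[OF C1 PC KC ty w(1) p tyw] unfolding y_def[symmetric] e_def A.ccomp_as[OF C1 KC PC KC y t(1) p] .
  \<comment> \<open>Below degree \<open>0\<close> the terms of \<open>?K\<close> are injective and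
    \<open>S\<close> is acyclic, so \<open>y\<close> can be made zero there.\<close>
  obtain y' where y': "y' : cmaps A S ?K" "hty A S ?K y y'" "!!j x. j<0 ==> x IN S$j ==> y' j x = 0[?K$j]"
  proof (rule A.partial_null[OF C1 KC, of "- int n" y 0])
   fix j xi assume j: "j<0" and x: "xi : lhom A S$j ?K$j" "PROP kz S j ?K$j xi"
   obtain h where "h : lhom A S$(j+1) ?K$j" "!!x. x IN S$j ==> xi x = h (dif S j x)"
    by (rule A.ext_inj[OF C1 A.fgD(2)[OF Sr(3)] Ki[OF j] A.res_stalkD(4)[OF Yf S] x]) (use j in auto)
   thus "fac A S j ?K$j xi" by blast
  qed (use Kz y that in auto)
  note ey' = A.ccm[OF C1 KC KC y'(1) e]
  have "hty A S ?K (ccomp S e y') (ccomp S e y)" by (rule A.hty_comp[OF C1 KC KC y'(1) y e A.hty_sym[OF C1 KC y y'(1,2)]])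
  hence h2: "hty A S ?K (ccomp S e y') y'" using A.hty_trans[OF C1 KC ey' A.ccm[OF C1 KC KC y e] y] A.hty_trans[OF C1 KC ey' y y'(1)] ey y'(2) by blast
  have e00: "e i 0[?K$i] = 0[?K$i]" for i by (rule A.cmr(5)[OF e KC KC])
  \<comment> \<open>Both \<open>e y'\<close> and \<open>y'\<close> vanish in negative degrees, so
    their difference in degree \<open>0\<close> factors through \<open>S$1\<close>, which is zero.
    Thus \<open>e 0\<close> fixes the values of \<open>y' 0\<close> exactly and not only up to
    homotopy.\<close>
  obtain psi where psi: "psi : lhom A S$(0+1) ?P0" "!!x. x IN S$0 ==> ccomp S e y' 0 x = y' 0 x +[?P0] psi (dif S 0 x)"
  proof (rule A.null_homotopic_top[OF C1 KC, of "- int n" "ccomp S e y'" y' 0])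
   fix j xi assume j: "j<=0" and x: "xi : lhom A S$j ?K$(j-1)" "PROP kz S j ?K$(j-1) xi"
   have "EX psi:lhom A S$(j+1) T$(j-1). ALL x:cr S$j. xi x l = psi (dif S j x)" if l: "l<k" for l
   proof -
    note pr = A.hcomp[OF A.xlm[OF C1] x(1) A.cpow_proj[OF T(2) l]]
    have "EX psi:lhom A S$(j+1) T$(j-1). ALL x:cr S$j. (%x:cr S$j. (%x:cr ?K$(j-1). x l) (xi x)) x = psi (dif S j x)"
     by (rule A.null_ext[OF Y S T_pinj pr]) (use x(2) l j C1 T(2) A.hcl[OF x(1)] in auto)
    thus ?thesis using A.hcl[OF x(1)] by simp
   qed
   then obtain psi where ps: "!!l. l<k ==> psi l : lhom A S$(j+1) T$(j-1)" "!!l x. l<k ==> x IN S$j ==> xi x l = psi l (dif S j x)" by metis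
   have "(%x:cr S$(j+1). %l:{..<k}. psi l x) : lhom A S$(j+1) ?K$(j-1)" unfolding A.cpow_simps by (rule A.lhom_dpair[OF A.xlm[OF C1]]) (use ps(1) in auto)
   moreover have "xi x = (%x:cr S$(j+1). %l:{..<k}. psi l x) (dif S j x)" if x1: "x IN S$j" for x
    by (rule extensionalityI[of _ "{..<k}"]) (use x1 ps(2) A.hcl[OF x(1) x1] C1 in "auto simp: PiE_iff")
   ultimately show "fac A S j ?K$(j-1) xi" by blast
  qed (use Kz y'(1,3) ey' h2 e00 that in auto)
  have S1: "dif S 0 x = 0[S$(0+1)]" if "x IN S$0" for x using A.zmD[OF A.bprojD(3)[OF Sr(1), of "0+1"] A.dcl(1)[OF C1 that]] by simp
  have yc: "y' 0 x IN ?P0" if "x IN S$0" for x by (rule A.cmr(1)[OF y'(1) C1 KC that])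
  have fix0: "e 0 (y' 0 x) = y' 0 x" if x: "x IN S$0" for x
   using psi(2)[OF x] x S1[OF x] A.hzero[OF psi(1) A.xlm[OF C1] l0] yc[OF x] l0 by (simp del: A.cpow_simps A.dsum_simps)
  let ?z = "%x:cr S$0. io (y' 0 x)"
  \<comment> \<open>\<open>e'\<close> extends \<open>e 0\<close>, so \<open>io\<close> of a fixed
    element is fixed by \<open>io e'\<close>, and the summand \<open>I\<close> contains all elements
    fixed by that endomorphism.\<close>
  have zI: "?z x : I" if x: "x IN S$0" for x using I(3)[OF A.hcl[OF io yc[OF x]]] ee[OF yc[OF x]] fix0[OF x] x by simp
  have zh: "?z : lhom A S$0 (A.sub H I)" by (rule A.lhom_cosub[OF A.hcomp[OF A.xlm[OF C1] A.cmh[OF y'(1)] io]]) (use zI in blast)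
  have zd: "?z (dif S (0-1) x) = 0[A.sub H I]" if x: "x IN S$(0-1)" for x
  proof -
   have "y' 0 (dif S (0-1) x) = 0[?P0]" using A.cmr(3)[OF y'(1) C1 KC x] y'(3)[of "0-1" x] x A.dif_rules(2)[OF KC, of "0-1"] by simp
   thus ?thesis using A.dcl(2)[OF C1 x] A.hzero[OF io l0 lH(1)] by simp
  qed
  have y0: "y' j x = 0[?K$j]" if x: "x IN S$j" for j x
  proof (cases j "0::int" rule: linorder_cases)
   case less thus ?thesis by (rule y'(3)[OF _ x])
  next
   case equal
   hence x0: "x IN S$0" using x by simp
   have "?z x = 0[A.sub H I]" by (rule A.null_res[OF Y S I(2) zh zd x0])
   hence "y' 0 x = 0[?P0]" using io0[OF yc[OF x0]] x0 by simp
   thus ?thesis unfolding equal .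
  next
   case greater
   thus ?thesis using A.zmD[OF A.bprojD(3)[OF Sr(1) greater] x] A.cmr(5)[OF y'(1) C1 KC] by simp
  qed
  let ?zS = "%Z i. %x:cr S$i. 0[Z$i]"
  note zSV = A.zcm[OF C1 VC]
  have "y' = ?zS ?K" by (rule A.cmaps_eqI[OF y'(1) A.zcm[OF C1 KC]]) (use y0 in simp)
  moreover have "ccomp S t (?zS ?K) = ?zS P" by (rule A.cmaps_eqI[OF A.ccm[OF C1 KC PC A.zcm[OF C1 KC] t(1)] A.zcm[OF C1 PC]]) (use pt0 in simp)
  ultimately have "hty A S P (ccomp S t y) (?zS P)" using A.hty_comp[OF C1 KC PC y y'(1) t(1) y'(2)] by simp
  hence "hty A S P w (?zS P)" by (rule A.hty_trans[OF C1 PC w(1) ty A.zcm[OF C1 PC] A.hty_sym[OF C1 PC ty w(1) tyw]])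
  from A.hty_comp[OF C1 PC VC w(1) A.zcm[OF C1 PC] Pr(5) this]
  have "hty A S V (ccomp S pr w) (ccomp S pr (?zS P))" .
  moreover have "ccomp S pr (?zS P) = ?zS V" by (rule A.cmaps_eqI[OF A.ccm[OF C1 PC VC A.zcm[OF C1 PC] Pr(5)] zSV]) (use A.cmr(5)[OF Pr(5) PC VC] in simp)
  ultimately show ?thesis using A.hty_trans[OF C1 VC v A.ccm[OF C1 PC VC w(1) Pr(5)] zSV A.hty_sym[OF C1 VC A.ccm[OF C1 PC VC w(1) Pr(5)] v w(2)]] by simp
 qed
 show ?thesis unfolding A.hz_iff[OF SY S V]
 proof (intro ballI)
  fix f g assume fg: "f : cmaps A S V" "g : cmaps A S V"
  note z = A.zcm[OF C1 VC]
  show "hty A S V f g" by (rule A.hty_trans[OF C1 VC fg(1) z fg(2) main[OF fg(1)] A.hty_sym[OF C1 VC fg(2) z main[OF fg(2)]]])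
 qed
qed

end

section \<open>Injective resolutions as complexes and the comparison of dominant dimensions\<close>

context artin_alg
begin

lemma min_inj_complex:
 fixes S :: "'a ucplx"
 assumes I: "min_inj_resolution A (regular A) I" and S: "S : bcx A" "liso A S$0 (regular A)" "!!i. i~=0 ==> zm S$i"
 obtains K e where "cpx A K" "!!l. K$(int l) = I l" "!!i. i<0 ==> zm K$i"
  "!!i. K$i : fgmod A" "!!i. injective A K$i" "qis A S K e"
  "!!i. i>=0 ==> essential A K$i (kd K i)"
proof -
 let ?L = "regular A"
 obtain e d where Id: "!!i. I i : fgmod A" "!!i. injective A (I i)" "!!i. d i : lhom A (I i) (I (Suc i))"
  and e: "e : lhom A ?L (I 0)" "inj_on e (cr ?L)" "{x:cr (I 0). d 0 x = 0[I 1]} = e ` cr ?L"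
  and ex: "!!i. {x:cr (I (Suc i)). d (Suc i) x = 0[I (Suc (Suc i))]} = d i ` cr (I i)"
  and es: "essential A (I 0) (e ` cr ?L)" "!!i. essential A (I (Suc i)) (d i ` cr (I i))"
  using I unfolding min_inj_resolution_def by (elim exE conjE) (rule that, (assumption | (erule allE, (elim conjE)?, assumption))+)
 note SC = bcD(1)[OF S(1)]
 obtain f where f: "f : lhom A S$0 ?L" "bij_betw f (cr S$0) (cr ?L)" using S(2) unfolding liso_def by blast
 have lI: "lmod A (I i)" for i using fgD(1)[OF Id(1)] .
 have Iz: "zm zmod" by (simp add: zero_module_def zmod_def)
 define K where "K = \<lparr>obj = (%i. if i<0 then zmod else I (nat i)),
  dif = (%i. if i<0 then (%x:cr zmod. 0[if i+1<0 then zmod else I (nat (i+1))]) else d (nat i))\<rparr>"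
 have K: "K$i = (if i<0 then zmod else I (nat i))" for i unfolding K_def by simp
 have dK: "i>=0 ==> dif K i x = d (nat i) x" "i<0 ==> x IN zmod ==> dif K i x = 0[K$(i+1)]" for i x unfolding K_def by auto
 have Kl: "lmod A K$i" for i using lI lm_zmod unfolding K by simp
 have nS: "i>=0 ==> nat (i+1) = Suc (nat i)" for i by simp
 have Kd: "dif K i : lhom A K$i K$(i+1)" for i
 proof (cases "i<0")
  case True
  have "dif K i = (%x:cr zmod. 0[K$(i+1)])" using True unfolding K_def by simp
  thus ?thesis using hzmap[OF lm_zmod Kl[of "i+1"]] True K[of i] by simp
 next
  case False
  thus ?thesis using Id(3)[of "nat i"] nS[of i] unfolding K_def by simp
 qed
 have KC: "cpx A K" unfolding is_complex_def
 proof (intro allI conjI ballI Kl Kd)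
  fix i x assume x: "x IN K$i"
  have "dif K (i+1) (dif K i x) = 0[K$(i+1+1)]"
  proof (cases "i<0")
   case True
   hence 1: "dif K i x = 0[K$(i+1)]" using dK(2)[OF True] x K[of i] by simp
   show ?thesis unfolding 1 by (rule hzero[OF Kd Kl Kl])
  next
   case False
   hence x: "x IN I (nat i)" using x K[of i] by simp
   show ?thesis using imageI[OF x, of "d (nat i)"] False dK(1)[of i x] dK(1)[of "i+1" "dif K i x"] nS[of i] nS[of "i+1"] K[of "i+1 + 1"] unfolding ex[symmetric] by simp
  qed
  thus "dif K (i+1) (dif K i x) = 0[K$(i+2)]" by (simp add: ips)
 qed
 have Z: "kd K i = (if i=0 then e ` cr ?L else d (nat i-1) ` cr (I (nat i-1)))" if i: "i>=0" for i
 proof -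
  have "kd K i = {x:cr (I (nat i)). d (nat i) x = 0[I (Suc (nat i))]}" using i dK(1)[OF i] nS[OF i] K[of i] K[of "i+1"] by simp
  also have "... = (if i=0 then e ` cr ?L else d (nat i-1) ` cr (I (nat i-1)))"
  proof (cases "nat i")
   case (Suc k)
   thus ?thesis using ex[of k] by auto
  qed (use e(3) i in auto)
  finally show ?thesis .
 qed
 have ess: "essential A K$i (kd K i)" if i: "i>=0" for i
  unfolding Z[OF i] using i es(1) es(2)[of "nat i-1"] K[of i] by (cases "i=0") (auto simp: Suc_nat_eq_nat_zadd1)
 define g where "g = (%x:cr S$0. e (f x))"
 have g: "g : lhom A S$0 K$0" unfolding g_def K using hcomp[OF xlm[OF SC] f(1) e(1)] by simp
 have gz: "x = 0[S$0]" if x: "x IN S$0" "g x = 0[K$0]" for x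
 proof -
  have "e (f x) = e (f 0[S$0])" using x hzero[OF f(1) xlm[OF SC] lm_regular] hzero[OF e(1) lm_regular lI] unfolding g_def K by simp
  hence "f x = f 0[S$0]" by (rule inj_onD[OF e(2) _ hcl[OF f(1) x(1)] hcl[OF f(1) lcl(1)[OF xlm[OF SC]]]])
  thus ?thesis by (rule inj_onD[OF bij_betw_imp_inj_on[OF f(2)] _ x(1) lcl(1)[OF xlm[OF SC]]])
 qed
 have gim: "EX x:cr S$0. y = g x" if y: "y IN K$0" "dif K 0 y = 0[K$(0+1)]" for y
 proof -
  have "y : e ` cr ?L" using y Z[of 0] by auto
  then obtain a where a: "a IN regular A" "y = e a" by blast
  obtain x where x: "x IN S$0" "a = f x" using a(1) f(2) unfolding bij_betw_def by blast
  show ?thesis using a(2) x unfolding g_def by (intro bexI[of _ x]) auto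
 qed
 have gd: "dif K 0 (g x) = 0[K$(0+1)]" if x: "x IN S$0" for x
 proof -
  have "g x : e ` cr ?L" using x hcl[OF f(1) x] unfolding g_def by auto
  thus ?thesis using Z[of 0] by auto
 qed
 let ?e = "conc S K 0 g"
 have dS: "dif S (0-1) x = 0[S$0]" if "x IN S$(0-1)" for x using zmD[OF S(3)[of "0-1"] that] dif_rules(2)[OF SC, of "0-1"] by simp
 have c: "?e : cmaps A S K" by (rule conc_cmap[OF SC KC g]) (use dS gd hzero[OF g xlm[OF SC] Kl] in auto)
 have "qis A S K ?e"
 proof (rule quasi_isoI[OF SC KC c])
  fix i x w assume x: "x IN S$i" "w IN K$(i-1)" "dif S i x = 0[S$(i+1)]" "?e i x = dif K (i-1) w"
  have "x = 0[S$i]"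
  proof (cases "i=0")
   case True
   have w: "w IN zmod" using x(2) True K[of "- 1"] by simp
   have "dif K (- 1) w = 0[K$0]" using dK(2)[OF _ w, of "- 1"] by simp
   thus ?thesis using gz[of x] x True by simp
  qed (use zmD[OF S(3) x(1)] in auto)
  thus "EX v:cr S$(i-1). dif S (i-1) v = x" using dif_rules(2)[OF SC, of "i-1"] lcl(1)[OF xlm[OF SC], of "i-1"] by (intro bexI[of _ "0[S$(i-1)]"]) auto
 next
  fix i y assume y: "y IN K$i" "dif K i y = 0[K$(i+1)]"
  have "EX x:cr S$i. EX w:cr K$(i-1). y = ?e i x +[K$i] dif K (i-1) w"
  proof (cases "i=0")
   case True
   obtain x where x: "x IN S$0" "y = g x" using gim[of y] y unfolding True by auto
   have "y = g x +[K$0] dif K (0-1) 0[K$(0-1)]" using x y(1) Kl[of 0] True dif_rules(2)[OF KC, of "0-1"] by simp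
   thus ?thesis using x(1) lcl(1)[OF Kl] True by (intro bexI[of _ x] bexI[of _ "0[K$(i-1)]"]) auto
  next
   case False
   have "EX w:cr K$(i-1). y = dif K (i-1) w"
   proof (cases "i<0")
    case True
    hence "y = 0[K$i]" using y(1) K[of i] Iz zmD by auto
    thus ?thesis using dif_rules(2)[OF KC, of "i-1"] lcl(1)[OF Kl, of "i-1"] by (intro bexI[of _ "0[K$(i-1)]"]) auto
   next
    case F: False
    have "y : d (nat i-1) ` cr (I (nat i-1))" using Z[of i] y F False by auto
    thus ?thesis using False F K[of "i-1"] dK(1)[of "i-1"] by (auto simp: nat_diff_distrib)
   qed
   then obtain w where w: "w IN K$(i-1)" "y = dif K (i-1) w" by blast
   have "y = ?e i 0[S$i] +[K$i] dif K (i-1) w" using False w y(1) Kl[of i] lcl(1)[OF xlm[OF SC], of i] by simp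
   thus ?thesis using w(1) lcl(1)[OF xlm[OF SC], of i] by blast
  qed
  then obtain x w where xw: "x IN S$i" "w IN K$(i-1)" "y = ?e i x +[K$i] dif K (i-1) w" by blast
  have "dif S i x = 0[S$(i+1)]"
  proof (cases "i+1 = 0")
   case True
   hence "x = 0[S$i]" using zmD[OF S(3) xw(1)] by simp
   thus ?thesis using dif_rules(2)[OF SC] by simp
  qed (use zmD[OF S(3) dcl(1)[OF SC xw(1)]] in auto)
  thus "EX x:cr S$i. EX w:cr K$(i-1). dif S i x = 0[S$(i+1)] & y = ?e i x +[K$i] dif K (i-1) w" using xw by blast
 qed
 moreover have "K$i : fgmod A" "injective A K$i" for i using Id(1,2) zmod_fgmod injective_zero[OF lm_zmod Iz] unfolding K by auto
 ultimately show ?thesis using ess Iz by (intro that[of K ?e] KC) (auto simp: K)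
qed

end

context nakayama_tilting
begin

text \<open>The injective resolution \<open>K\<close> of \<open>B\<close> replaces
  \<open>F T\<close>. The image of \<open>Y[-i]\<close> has cohomology in degree \<open>i\<close> at
  most, so the only term of \<open>K\<close> that could receive something is \<open>I i\<close>; it
  is projective-injective and excluded by \<open>hz_null\<close>.\<close>

lemma hz_stalk_T:
 assumes I: "min_inj_resolution B (regular B) I" "!!l. l<m ==> projective B (I l)" and i: "i<m" and Y: "A.pnull Y"
 shows "hz (Db A) (A.stalk Y (int i)) T"
proof -
 note Yf = A.pnullD(1)[OF Y]
 obtain S a b where S: "S : bcx B" "liso B S$0 (regular B)" "!!i. i~=0 ==> zm S$i"
  "iso_mor (Db B) (fob F T) S a" "iso_mor (Db B) S (fob F T) b" by (rule S_ex) blast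
 note SC = B.bcD(1)[OF S(1)] and SY = A.stalk_bc[OF Yf]
 note FY = Fb[OF SY]
 obtain K e where K: "cpx B K" "!!l. K$(int l) = I l" "!!i. i<0 ==> zm K$i"
  "!!i. K$i : fgmod B" "!!i. injective B K$i" "qis B S K e" by (rule B.min_inj_complex[OF I(1) S(1-3)]) auto
 obtain c U sg where U: "B.projres c (FS Y (int i)) U sg" by (rule B.ex_res[OF FY])
 note Ur = B.prD[OF U]
 \<comment> \<open>For \<open>l\<close> above \<open>i\<close> negative terms of \<open>T\<close>
   would have to map to \<open>Y\<close>, contrary to \<open>null_T\<close>; for \<open>l\<close>
   below \<open>i\<close> positive terms would, and there are none.\<close>
 have ac: "B.acyc U l" if l: "l~=int i" for l unfolding B.qis_acyc[OF Ur(2) B.bcD(1)[OF FY] Ur(4)]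
 proof (cases "int i-l<0")
  case True
  show "B.acyc (FS Y (int i)) l"
  proof (rule acyc_F_stalk_zero[OF Yf])
   fix u assume u: "u : lhom A T$(int i-l) Y"
   show "u = (%x:cr T$(int i-l). 0[Y])" by (rule extensionalityI[of _ "cr T$(int i-l)"]) (use null_T[OF Y True u] u in "auto simp: lhom_def PiE_def")
  qed
 qed (use l acyc_F_stalk_out[OF Yf] in auto)
 have W: "B.pinj (I i)" using K(4,5)[of "int i"] I(2)[OF i] B.projective_fgproj[of "I i"] unfolding B.pinj_def K(2) by simp
 have Wf: "I i : fgmod B" using W unfolding B.pinj_def by blast
 have "hz (Db B) (FS Y (int k)) (B.stalk (I i) (int k))" for k
 proof (induction k)
  case 0
  note SW = B.stalk_bc[OF Wf, of 0]
  obtain V v where V: "V : bcx A" "iso_mor (Db B) (fob F V) (B.stalk (I i) 0) v" using E.ess_surj[of "B.stalk (I i) 0"] SW by auto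
  have "hz (Db B) (FS Y 0) (fob F V)" using hz_null[OF Y V(1) W V(2)] E.hz_fob SY V(1) by simp
  obtain v' where v: "iso_mor (Db B) (B.stalk (I i) 0) (fob F V) v'" by (rule B.Db.iso_sym[OF V(2)])
  thus ?case using \<open>hz _ _ _\<close> B.Db.hz_iso[OF _ _ _ _ B.Db.iso_Id v, of "FS Y 0"] FY SW Fb[OF V(1)] by simp
 next
  case (Suc k)
  show ?case using hz_F_stalk_shift[OF Yf Wf Suc] by (simp add: add.commute)
 qed
 hence hzi: "hz (Db B) (FS Y (int i)) (B.stalk (I i) (int i))" .
 have "hz (Db B) (FS Y (int i)) S" unfolding B.hz_iff[OF FY U S(1)]
 proof (intro ballI)
  fix f g assume fg: "f : cmaps B U S" "g : cmaps B U S"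
  note ec = B.qis_cmaps[OF K(6)]
  note ef = B.ccm[OF Ur(2) SC K(1) fg(1) ec] and eg = B.ccm[OF Ur(2) SC K(1) fg(2) ec]
  have hz: "hty B U K y (zmp U K)" if y: "y : cmaps B U K" for y
  proof -
   \<comment> \<open>The bound \<open>c+1\<close> lies above all terms of \<open>U\<close>, so
     making \<open>y\<close> zero below it makes it zero altogether.\<close>
   obtain y' where y': "y' : cmaps B U K" "hty B U K y y'" "!!j x. j<c+1 ==> x IN U$j ==> y' j x = 0[K$j]"
   proof (rule B.partial_null[where b=0 and c="c+1" and U=y, OF Ur(2) K(1,3) y])
    fix l phi assume p: "phi : lhom B U$l K$l" "PROP kz U l K$l phi"
    show "EX psi:lhom B U$(l+1) K$l. ALL x:cr U$l. phi x = psi (dif U l x)"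
    proof (cases "l = int i")
     case True
     show ?thesis using hzi p unfolding B.hz_stalk[OF FY U Wf] True K(2) by blast
    next
     case False
     obtain h where "h : lhom B U$(l+1) K$l" "!!x. x IN U$l ==> phi x = h (dif U l x)" by (rule B.ext_inj[OF Ur(2) B.fgD(2)[OF Ur(3)] K(5) ac[OF False] p]) auto
     thus ?thesis by blast
    qed
   qed (blast intro: that)+
   have "y' i x = 0[K$i]" if x: "x IN U$i" for i x using y'(3)[OF _ x] B.zmD[OF B.bprojD(3)[OF Ur(1)] x] B.cmr(5)[OF y'(1) Ur(2) K(1)] by (cases "i>c") auto
   hence "y' = zmp U K" using B.lhom_extensional[OF B.cmh[OF y'(1)]] by (intro ext extensionalityI) auto
   thus ?thesis using y'(2) by simp
  qed
  note z = B.zcm[OF Ur(2) K(1)]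
  have "hty B U K (ccomp U e f) (ccomp U e g)" by (rule B.hty_trans[OF Ur(2) K(1) ef z eg hz[OF ef] B.hty_sym[OF Ur(2) K(1) eg z hz[OF eg]]])
  thus "hty B U S f g" by (rule B.lift_unique[OF Ur(1) SC K(1,6) fg])
 qed
 hence "hz (Db B) (FS Y (int i)) (fob F T)" using B.Db.hz_iso[OF _ _ _ _ B.Db.iso_Id S(4), of "FS Y (int i)"] FY S(1) Fb[OF T(1)] by simp
 thus ?thesis using E.hz_fob SY T(1) by simp
qed

text \<open>For a resolution \<open>Q\<close> of \<open>Y[-i]\<close> this is the vanishing of
  \<open>Ext^i(Y, V)\<close>.\<close>

definition ext0 :: "'a ucplx => ('a, 'a univ) module => bool" where
 "ext0 Q V <-> V : fgmod A & (ALL u:lhom A Q$0 V. (ALL x:cr Q$(- 1). u (dif Q (- 1) x) = 0[V]) -->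
  (EX psi:lhom A Q$1 V. ALL x:cr Q$0. u x = psi (dif Q 0 x)))"

lemma ext0_retract:
 assumes Q: "cpx A Q" and V: "ext0 Q V" and L: "L : fgmod A" and s: "s : lhom A L V" "f : lhom A V L" "!!x. x IN L ==> f (s x) = x"
 shows "ext0 Q L" unfolding ext0_def
proof (intro conjI L ballI impI)
 note lL = A.fgD(1)[OF L] and lQ = A.xlm[OF Q]
 have lV: "lmod A V" using V A.fgD unfolding ext0_def by blast
 fix u assume u: "u : lhom A Q$0 L" "ALL x:cr Q$(- 1). u (dif Q (- 1) x) = 0[L]"
 note su = A.hcomp[OF lQ u(1) s(1)]
 have d: "dif Q (- 1) x IN Q$0" if "x IN Q$(- 1)" for x using A.dcl(1)[OF Q that] by simp
 have "ALL x:cr Q$(- 1). (%x:cr Q$0. s (u x)) (dif Q (- 1) x) = 0[V]" using d u(2) A.hzero[OF s(1) lL lV] by simp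
 then obtain psi where p: "psi : lhom A Q$1 V" "ALL x:cr Q$0. (%x:cr Q$0. s (u x)) x = psi (dif Q 0 x)" using V su unfolding ext0_def by blast
 show "EX psi:lhom A Q$1 L. ALL x:cr Q$0. u x = psi (dif Q 0 x)"
 proof (intro bexI ballI)
  fix x assume x: "x IN Q$0"
  have d: "dif Q 0 x IN Q$1" using A.dcl(1)[OF Q x] by simp
  have "u x = f (s (u x))" using s(3)[OF A.hcl[OF u(1) x]] by simp
  also have "... = f (psi (dif Q 0 x))" using p(2) x by simp
  finally show "u x = (%z:cr Q$1. f (psi z)) (dif Q 0 x)" using d by simp
 qed (rule A.hcomp[OF lQ p(1) s(2)])
qed

lemma ext0_bip:
 assumes Q: "cpx A Q" and V: "ext0 Q M" "ext0 Q N" and L: "A.bip M N L"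
 shows "ext0 Q L" unfolding ext0_def
proof (intro conjI ballI impI)
 show Lf: "L : fgmod A" by (rule A.bip_fgmod[OF L])
 note lQ = A.xlm[OF Q]
 have lM: "lmod A M" "lmod A N" using V A.fgD unfolding ext0_def by auto
 obtain f g where f: "lmod A L" "f : lhom A (biprod M N) L" "g : lhom A L (biprod M N)" "!!y. y IN L ==> f (g y) = y" by (rule A.bipE[OF L]) auto
 fix u assume u: "u : lhom A Q$0 L" "ALL x:cr Q$(- 1). u (dif Q (- 1) x) = 0[L]"
 have gz: "g 0[L] = (0[M], 0[N])" using A.hzero[OF f(3,1) A.lm_biprod[OF lM]] by simp
 have d: "dif Q (- 1) x IN Q$0" if "x IN Q$(- 1)" for x using A.dcl(1)[OF Q that] by simp
 note gu = A.hcomp[OF lQ u(1) f(3)]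
 have h: "EX p:lhom A Q$1 N'. ALL x:cr Q$0. t (g (u x)) = p (dif Q 0 x)" if t: "ext0 Q N'" "(%x:cr (biprod M N). t x) : lhom A (biprod M N) N'" "t (0[M], 0[N]) = 0[N']" for N' and t :: "'a univ * 'a univ => 'a univ"
 proof -
  have "(%x:cr Q$0. t (g (u x))) : lhom A Q$0 N'" using A.hcomp[OF lQ gu t(2)] A.hcl[OF u(1)] A.hcl[OF f(3)] by (simp cong: restrict_cong)
  moreover have "ALL x:cr Q$(- 1). (%x:cr Q$0. t (g (u x))) (dif Q (- 1) x) = 0[N']" using d u(2) gz t(3) by simp
  ultimately have "EX p:lhom A Q$1 N'. ALL x:cr Q$0. (%x:cr Q$0. t (g (u x))) x = p (dif Q 0 x)" using t(1) unfolding ext0_def by blast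
  thus ?thesis by simp
 qed
 obtain p where p: "p : lhom A Q$1 M" "ALL x:cr Q$0. fst (g (u x)) = p (dif Q 0 x)" using h[OF V(1) A.lhom_fst[OF lM]] by auto
 obtain q where q: "q : lhom A Q$1 N" "ALL x:cr Q$0. snd (g (u x)) = q (dif Q 0 x)" using h[OF V(2) A.lhom_snd[OF lM]] by auto
 note pq = A.lhom_pair[OF lQ p(1) q(1)]
 show "EX psi:lhom A Q$1 L. ALL x:cr Q$0. u x = psi (dif Q 0 x)"
 proof (intro bexI ballI)
  fix x assume x: "x IN Q$0"
  have d: "dif Q 0 x IN Q$1" using A.dcl(1)[OF Q x] by simp
  have "u x = f (g (u x))" using f(4)[OF A.hcl[OF u(1) x]] by simp
  also have "g (u x) = (p (dif Q 0 x), q (dif Q 0 x))" using p(2) q(2) x by (simp add: prod_eq_iff)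
  finally show "u x = (%z:cr Q$1. f ((%z:cr Q$1. (p z, q z)) z)) (dif Q 0 x)" using d by simp
 qed (rule A.hcomp[OF lQ pq f(2)])
qed

text \<open>Negative terms are projective-injective, so \<open>null_ext\<close> applies. For the
  term in degree \<open>0\<close> a cocycle is a chain map to \<open>T\<close>, null-homotopic by
  assumption, and the negative terms drop out of the homotopy by
  \<open>null_homotopic_top\<close>.\<close>

lemma ext0_T:
 assumes Y: "A.pnull Y" and Q: "A.projres i (A.stalk Y i) Q rh" and hz: "hz (Db A) (A.stalk Y i) T"
 shows "ext0 Q T$j" unfolding ext0_def
proof (intro conjI T(3) ballI impI)
 note Qr = A.prD[OF Q] and SY = A.stalk_bc[OF A.pnullD(1)[OF Y], of i]
 note QC = Qr(2)
 note TC = T(2)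
 fix u assume u: "u : lhom A Q$0 T$j" "ALL x:cr Q$(- 1). u (dif Q (- 1) x) = 0[T$j]"
 have u': "PROP kz Q 0 T$j u" using u(2) by simp
 consider "j<0" | "j=0" | "j>0" by linarith
 thus "EX psi:lhom A Q$1 T$j. ALL x:cr Q$0. u x = psi (dif Q 0 x)"
 proof cases
  case 1
  show ?thesis using A.null_ext[OF Y Q T_pinj[OF 1] u(1) u'] by simp
 next
  case 3
  hence "zm T$j" using T_zero by blast
  hence "u x = 0[T$j]" if "x IN Q$0" for x using A.zmD[OF _ A.hcl[OF u(1) that]] by simp
  thus ?thesis using A.hzmap[OF A.xlm[OF QC] A.xlm[OF TC], of j 1] A.dcl(1)[OF QC, of _ 0] by (intro bexI[of _ "%x:cr Q$1. 0[T$j]"]) auto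
 next
  case 2
  have T1: "dif T 0 x = 0[T$(0+1)]" if "x IN T$0" for x by (rule A.zmD[OF T_zero A.dcl(1)[OF TC that]]) simp
  let ?U = "conc Q T 0 u"
  note z = A.zcm[OF QC TC]
  have u0: "u : lhom A Q$0 T$0" using u(1) 2 by simp
  have U: "?U : cmaps A Q T" by (rule A.conc_cmap[OF QC TC u0]) (use u' 2 T1 A.hcl[OF u0] in auto)
  have h: "hty A Q T ?U (zmp Q T)" using hz U z unfolding A.hz_iff[OF SY Q T(1)] by blast
  obtain psi where p: "psi : lhom A Q$(0+1) T$0" "!!x. x IN Q$0 ==> ?U 0 x = zmp Q T 0 x +[T$0] psi (dif Q 0 x)"
  proof (rule A.null_homotopic_top[OF QC TC, of "- int n" ?U "zmp Q T" 0])
   fix k phi assume k: "k<=(0::int)" and f: "phi : lhom A Q$k T$(k-1)" "PROP kz Q k T$(k-1) phi"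
   show "fac A Q k T$(k-1) phi" by (rule A.null_ext[OF Y Q T_pinj f]) (use k in auto)
  qed (use T_zero U z h in auto)
  have "u x = psi (dif Q 0 x)" if x: "x IN Q$0" for x using p(2)[OF x] x A.hcl[OF p(1) A.dcl(1)[OF QC x]] TC by simp
  thus ?thesis using p(1) unfolding 2 by auto
 qed
qed

text \<open>Let \<open>V\<close> be a module with \<open>ext0\<close> whose image in
  \<open>A\<close> is largest and \<open>Z\<close> the quotient. Maps from the terms of
  \<open>T\<close> to \<open>Z\<close> lift to \<open>A\<close> and land in that image, hence
  vanish; so \<open>F Z\<close> is acyclic and \<open>Z\<close> is zero. Thus \<open>V\<close>
  covers the projective module \<open>A\<close>, which is then a summand of it.\<close>

lemma ext0_unit:
 assumes Y: "A.pnull Y" and Q: "A.projres i (A.stalk Y i) Q rh" and hz: "hz (Db A) (A.stalk Y i) T"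
 shows "ext0 Q A.unit_mod"
proof -
 note QC = A.prD(2)[OF Q]
 note uf = A.unit_mod(1)
 note lu = A.fgD[OF uf]
 have up: "A.fgproj A.unit_mod"
 proof -
  obtain f g where "f : lhom A (regular A) A.unit_mod" "g : lhom A A.unit_mod (regular A)" "ALL y:cr A.unit_mod. f (g y) = y" using A.unit_mod(2) by blast
  thus ?thesis using A.fgproj_retract[OF A.fgproj_regular lu(1), of g f] by blast
 qed
 have C: "ext0 Q A.zmod" "!!M. ext0 Q M ==> M : fgmod A" "!!M N L. ext0 Q M ==> ext0 Q N ==> A.bip M N L ==> ext0 Q L"
 proof -
  show "ext0 Q A.zmod" unfolding ext0_def
  proof (intro conjI A.zmod_fgmod ballI impI)
   fix u assume u: "u : lhom A Q$0 A.zmod"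
   show "EX psi:lhom A Q$1 A.zmod. ALL x:cr Q$0. u x = psi (dif Q 0 x)" using A.hzmap[OF A.xlm[OF QC] A.lm_zmod, of 1] A.hcl[OF u] A.dcl(1)[OF QC, of _ 0]
    by (intro bexI[of _ "%x:cr Q$1. 0[A.zmod]"]) (auto simp: A.zmod_def)
  qed
  show "!!M. ext0 Q M ==> M : fgmod A" unfolding ext0_def by blast
  show "!!M N L. ext0 Q M ==> ext0 Q N ==> A.bip M N L ==> ext0 Q L" by (rule ext0_bip[OF QC])
 qed
 obtain V f where V: "ext0 Q V" "f : lhom A V A.unit_mod" "!!M g. ext0 Q M ==> g : lhom A M A.unit_mod ==> g ` cr M<=f ` cr V"
  by (rule A.max_image[of A.unit_mod "ext0 Q", OF uf C(1)]) (erule C(2), erule (2) C(3), blast)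
 note Vf = C(2)[OF V(1)]
 note lV = A.fgD(1)[OF Vf]
 obtain Z q where Z: "Z : fgmod A" "q : lhom A A.unit_mod Z" "q ` cr A.unit_mod = cr Z" "{x:cr A.unit_mod. q x = 0[Z]} = f ` cr V"
  by (rule A.ex_quotient[OF lu A.sm_range[OF lV lu(1) V(2)]])
 note lZ = A.fgD(1)[OF Z(1)]
 have u0: "u = (%x:cr T$j. 0[Z])" if u: "u : lhom A T$j Z" for j u
 proof -
  obtain h where h: "h : lhom A T$j A.unit_mod" "!!x. x IN T$j ==> q (h x) = u x" by (rule A.fgproj_lift[OF T(4) lu(1) lZ Z(2) u]) (use Z(3) A.hcl[OF u] in auto)
  have "u x = 0[Z]" if x: "x IN T$j" for x
  proof -
   have "h x : f ` cr V" using V(3)[OF ext0_T[OF Y Q hz] h(1)] x by blast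
   thus ?thesis using h(2)[OF x] unfolding Z(4)[symmetric] by simp
  qed
  thus ?thesis using u by (intro extensionalityI[of _ "cr T$j"]) (auto simp: lhom_def PiE_def)
 qed
 have "A.acyc (A.stalk Z 0) 0" by (rule acyc_of_F[OF A.stalk_bc[OF Z(1)], of "- 1"]) (use acyc_F_stalk_zero[OF Z(1) u0] in auto)
 hence Z0: "z = 0[Z]" if z0: "z IN Z" for z
 proof -
  have "dif (A.stalk Z 0) 0 z = 0[(A.stalk Z 0)$(0+1)]" using A.stalk_dif[of z Z 0 0] z0 by simp
  then obtain w where "w IN (A.stalk Z 0)$(0-1)" "dif (A.stalk Z 0) (0-1) w = z" by (rule A.acycE[OF \<open>A.acyc _ 0\<close>, rotated]) (use z0 in auto)
  thus ?thesis using A.stalk_dif[of w Z 0 "0-1"] by simp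
 qed
 have "f ` cr V = cr A.unit_mod" unfolding Z(4)[symmetric] using Z0 A.hcl[OF Z(2)] by blast
 note im = this
 obtain s where s: "s : lhom A A.unit_mod V" "!!x. x IN A.unit_mod ==> f (s x) = (%x:cr A.unit_mod. x) x"
  by (rule A.fgproj_lift[OF up lV lu(1) V(2) A.lhom_id[OF lu(1)]]) (use im in auto)
 show ?thesis by (rule ext0_retract[OF QC V(1) uf s(1) V(2)]) (use s(2) in simp)
qed

text \<open>Strong induction: the terms of the resolution before \<open>i\<close> must already be
  projective, because homotopies into them have to be removed.\<close>

lemma projective_transfer:
 assumes I: "min_inj_resolution B (regular B) I" "!!l. l<m ==> projective B (I l)" and I': "min_inj_resolution A (regular A) I'" and i: "i<m"
 shows "projective A (I' i)" using i
proof (induction i rule: less_induct)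
 case (less i)
 note i = less.prems
 let ?U = A.unit_mod and ?S = "A.stalk A.unit_mod 0"
 note uf = A.unit_mod(1)
 note lu = A.fgD[OF uf] and SU = A.stalk_bc[OF uf, of 0]
 note SC = A.bcD(1)[OF SU]
 have lr: "liso A ?U (regular A)"
 proof -
  obtain f g where fg: "f : lhom A (regular A) ?U" "g : lhom A ?U (regular A)" "ALL x:cr A. g (f x) = x" "ALL y:cr ?U. f (g y) = y" using A.unit_mod(2) by blast
  have "bij_betw g (cr ?U) (cr (regular A))" by (rule bij_betw_byWitness[where f'=f]) (use fg A.hcl[OF fg(1)] A.hcl[OF fg(2)] in auto)
  thus ?thesis using fg(2) unfolding liso_def by blast
 qed
 obtain K e where K: "cpx A K" "!!l. K$(int l) = I' l" "!!i. i<0 ==> zm K$i"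
  "!!i. K$i : fgmod A" "!!i. injective A K$i" "qis A ?S K e"
  "!!i. i>=0 ==> essential A K$i (kd K i)" by (rule A.min_inj_complex[OF I' SU]) (use lr A.stalk_obj A.zero_module_zmod in auto)
 define Z where "Z = {x:cr K$(int i). dif K (int i) x = 0[K$(int i+1)]}"
 note KC = K(1) and lK = A.fgD[OF K(4)]
 have Zs: "submod A K$(int i) Z" unfolding Z_def by (rule A.submod_kernel[OF lK(1) lK(1) A.dhm[OF KC]])
 let ?X = "A.sub K$(int i) Z"
 have Xf: "?X : fgmod A" by (rule A.fgmod_sub[OF K(4) Zs])
 note lX = A.fgD[OF Xf]
 obtain W f where W: "A.pinj W" "f : lhom A ?X W" "!!M g x. A.pinj M ==> g : lhom A ?X M ==> x IN ?X ==> f x = 0[W] ==> g x = 0[M]"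
  by (rule A.min_kernel[of ?X A.pinj, OF Xf A.pinj_class(1)]) (erule A.pinj_class(2), erule (2) A.pinj_class(3), blast)
 have Wf: "W : fgmod A" "A.fgproj W" "injective A W" using W(1) unfolding A.pinj_def by auto
 note lW = A.fgD[OF Wf(1)]
 \<comment> \<open>\<open>N\<close> is the common kernel of all maps from the cosyzygy to
   projective-injective modules. A map from \<open>N\<close> to such a module would extend to the
   cosyzygy, so \<open>N\<close> is a test module; the aim is to show that it is zero.\<close>
 define N where "N = {x:cr ?X. f x = 0[W]}"
 have Ns: "submod A ?X N" unfolding N_def by (rule A.submod_kernel[OF lX(1) lW(1) W(2)])
 let ?Y = "A.sub ?X N"
 have Yf: "?Y : fgmod A" by (rule A.fgmod_sub[OF Xf Ns])
 note lY = A.fgD[OF Yf]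
 note incl = A.lhom_incl[OF lX(1) Ns]
 have Y: "A.pnull ?Y" unfolding A.pnull_def
 proof (intro conjI Yf allI impI)
  fix M u y assume M: "A.pinj M" and u: "u : lhom A ?Y M" and y: "y IN ?Y"
  have Mi: "injective A M" using M unfolding A.pinj_def by blast
  have inj: "inj_on (%x:N. x) (cr ?Y)" by (auto simp: inj_on_def)
  obtain g where g: "g : lhom A ?X M" "!!x. x IN ?Y ==> g ((%x:N. x) x) = u x" by (rule A.injective_extend[OF Mi lY lX incl inj u]) auto
  have "g y = 0[M]" by (rule W(3)[OF M g(1)]) (use y in "auto simp: N_def")
  thus "u y = 0[M]" using g(2)[OF y] y by simp
 qed
 note SY = A.stalk_bc[OF Yf, of "int i"]
 obtain Q rh where Q: "A.projres (int i) (A.stalk ?Y (int i)) Q rh" by (rule A.ex_projres[OF SY A.stalk_acyc[OF lY(1)], of "int i"]) auto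
 note Qr = A.prD[OF Q] and r = A.res_stalkD[OF Yf Q]
 note QC = Qr(2)
 have ext: "ext0 Q ?U" by (rule ext0_unit[OF Y Q hz_stalk_T[OF I i Y]])
 have incK: "(%x:cr ?Y. (%x:Z. x) ((%x:N. x) x)) : lhom A ?Y K$(int i)" by (rule A.hcomp[OF lY(1) incl A.lhom_incl[OF lK(1) Zs]])
 have NZ: "x : Z" if "x : N" for x using that unfolding N_def by simp
 define w0 where "w0 = (%x:cr Q$(int i). (%x:cr ?Y. (%x:Z. x) ((%x:N. x) x)) (rh (int i) x))"
 have w0: "w0 : lhom A Q$(int i) K$(int i)" unfolding w0_def by (rule A.hcomp[OF A.xlm[OF QC] r(1) incK])
 have rN: "rh (int i) x : N" if "x IN Q$(int i)" for x using A.hcl[OF r(1) that] by simp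
 have w0a: "w0 x = rh (int i) x" if x: "x IN Q$(int i)" for x using rN[OF x] NZ[OF rN[OF x]] x unfolding w0_def by simp
 let ?w = "%k. if k = int i then w0 else (%x:cr Q$k. 0[K$k])"
 let ?z = "zmp Q K"
 have w: "?w : cmaps A Q K"
 proof (rule A.conc_cmap[OF QC KC w0])
  fix x assume x: "x IN Q$(int i-1)"
  have d: "dif Q (int i-1) x IN Q$(int i)" by (rule A.dcl(2)[OF QC x])
  have "dif Q (int i-1) x : {x:cr Q$(int i). rh (int i) x = 0[?Y]}" unfolding r(3) using x by blast
  thus "w0 (dif Q (int i-1) x) = 0[K$(int i)]" using w0a[OF d] by simp
 next
  fix x assume x: "x IN Q$(int i)"
  show "dif K (int i) (w0 x) = 0[K$(int i+1)]" using NZ[OF rN[OF x]] unfolding w0a[OF x] Z_def by blast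
 qed
 note ec = A.qis_cmaps[OF K(6)] and z = A.zcm[OF QC KC] and zS = A.zcm[OF QC SC]
 \<comment> \<open>The inclusion of \<open>N\<close> into \<open>K$(int i)\<close> is a morphism
   from \<open>N[-i]\<close> to \<open>K\<close>, that is to \<open>A\<close>; \<open>ext0\<close>
   makes it vanish.\<close>
 obtain v where v: "v : cmaps A Q ?S" "hty A Q K (ccomp Q e v) ?w" by (rule A.lift_exists[OF Qr(1) SC KC K(6) w])
 note vh = A.stalk_map_hom[OF QC lu(1) v(1)]
 have "EX psi:lhom A Q$1 ?U. ALL x:cr Q$0. v 0 x = psi (dif Q 0 x)" using ext vh unfolding ext0_def by simp
 then obtain psi where psi: "psi : lhom A Q$1 ?U" "!!x. x IN Q$0 ==> v 0 x = psi (dif Q 0 x)" by blast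
 have v0: "hty A Q ?S v (zmp Q ?S)"
 proof (rule A.stalk_homotopicI[OF QC lu(1) v(1) zS, of psi])
  show "psi : lhom A Q$(0+1) ?U" using psi(1) by simp
  fix x assume x: "x IN Q$0"
  have "psi (dif Q 0 x) IN ?U" using A.hcl[OF psi(1), of "dif Q 0 x"] A.dcl(1)[OF QC x] by simp
  thus "v 0 x = zmp Q ?S 0 x +[?U] psi (dif Q 0 x)" using psi(2)[OF x] x lu(1) by simp
 qed
 have "ccomp Q e (zmp Q ?S) = ?z" by (rule A.cmaps_eqI[OF A.ccm[OF QC SC KC zS ec] z]) (use A.cmr(5)[OF ec SC KC] in simp)
 hence ev: "hty A Q K (ccomp Q e v) ?z" using A.hty_comp[OF QC SC KC v(1) zS ec v0] by simp
 note ecv = A.ccm[OF QC SC KC v(1) ec]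
 have wz: "hty A Q K ?w ?z" by (rule A.hty_trans[OF QC KC w ecv z A.hty_sym[OF QC KC ecv w v(2)] ev])
 obtain th where th: "th : lhom A Q$(int i+1) K$(int i)" "!!x. x IN Q$(int i) ==> ?w (int i) x = ?z (int i) x +[K$(int i)] th (dif Q (int i) x)"
 proof (rule A.null_homotopic_top[OF QC KC, of 0 ?w ?z "int i"])
  fix j phi assume j: "j<=int i" and p: "phi : lhom A Q$j K$(j-1)" "PROP kz Q j K$(j-1) phi"
  show "fac A Q j K$(j-1) phi"
  proof (rule A.null_ext[OF Y Q _ p])
   show "A.pinj K$(j-1)"
   proof (cases "j-1<0")
    case True
    show ?thesis using K(4,5)[of "j-1"] A.fgproj_zero[OF lK(1) K(3)[OF True]] unfolding A.pinj_def by blast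
   next
    case False
    hence "K$(j-1) = I' (nat (j-1))" using K(2)[of "nat (j-1)"] by simp
    moreover have "projective A (I' (nat (j-1)))" by (rule less.IH) (use False j i in auto)
    ultimately show ?thesis using K(4,5)[of "j-1"] A.projective_fgproj[of "I' (nat (j-1))"] unfolding A.pinj_def by simp
   qed
  qed
 qed (use w z wz K(3) in auto)
 have rz: "rh (int i) x = 0[?Y]" if x: "x IN Q$(int i)" for x
 proof -
  \<comment> \<open>\<open>Q\<close> has no term above degree \<open>i\<close>, so the factorization
    through \<open>dif Q (int i)\<close> shows that the inclusion of \<open>N\<close> is
    zero.\<close>
  have "dif Q (int i) x = 0[Q$(int i+1)]" by (rule A.zmD[OF A.bprojD(3)[OF Qr(1)] A.dcl(1)[OF QC x]]) simp
  thus ?thesis using th(2)[OF x] x w0a[OF x] A.hzero[OF th(1) A.xlm[OF QC] lK(1)] lK(1) by simp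
 qed
 have N0: "x = 0[K$(int i)]" if x: "x : N" for x
 proof -
  have "x : rh (int i) ` cr Q$(int i)" unfolding r(2) using x by simp
  then obtain t where "t IN Q$(int i)" "x = rh (int i) t" by blast
  thus ?thesis using rz by simp
 qed
 have injZ: "inj_on (%x:Z. x) (cr ?X)" by (auto simp: inj_on_def)
 obtain g where g: "g : lhom A K$(int i) W" "!!x. x IN ?X ==> g ((%x:Z. x) x) = f x" by (rule A.injective_extend[OF Wf(3) lX lK A.lhom_incl[OF lK(1) Zs] injZ W(2)]) auto
 have gs: "submod A K$(int i) {x:cr K$(int i). g x = 0[W]}" (is "submod _ _ ?G") by (rule A.submod_kernel[OF lK(1) lW(1) g(1)])
 have "Z \<inter> ?G = {0[K$(int i)]}"
 proof (intro equalityI subsetI)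
  fix x assume x: "x : Z \<inter> ?G"
  hence "x : N" using g(2)[of x] unfolding N_def by simp
  thus "x : {0[K$(int i)]}" using N0 by simp
 qed (use A.smD(2)[OF Zs] A.smD(2)[OF gs] in auto)
 \<comment> \<open>The cosyzygy now embeds into \<open>W\<close>. By essentiality the extension
   \<open>g\<close> of this embedding is injective on the envelope, which therefore is a summand of
   the projective module \<open>W\<close>.\<close>
 moreover have "essential A K$(int i) Z" unfolding Z_def by (rule K(7)) simp
 ultimately have "?G = {0[K$(int i)]}" using gs unfolding essential_def by blast
 hence gi: "inj_on g (cr K$(int i))" unfolding A.lhom_inj_iff[OF lK(1) lW(1) g(1)] by blast
 obtain h where h: "h : lhom A W K$(int i)" "!!x. x IN K$(int i) ==> h (g x) = (%x:cr K$(int i). x) x"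
  by (rule A.injective_extend[OF K(5) lK lW g(1) gi A.lhom_id[OF lK(1)]]) auto
 have "A.fgproj K$(int i)" by (rule A.fgproj_retract[OF Wf(2) lK(1) g(1) h(1)]) (use h(2) in simp)
 thus ?case using A.fgproj_projective unfolding K(2) by blast
qed

lemma dom_dim_ge: "dom_dim B<=dom_dim A" unfolding dom_dim_def dom_dim_module_def
proof (rule Sup_subset_mono, rule subsetI)
 fix d assume "d : {enat m |m. EX I. min_inj_resolution B (regular B) I & (ALL i<m. projective B (I i))}"
 then obtain m I where m: "d = enat m" "min_inj_resolution B (regular B) I" "!!i. i<m ==> projective B (I i)" by blast
 obtain I' where I': "min_inj_resolution A (regular A) I'" by (rule D.ex_min_inj_resolution)
 show "d : {enat m |m. EX I. min_inj_resolution A (regular A) I & (ALL i<m. projective A (I i))}" using projective_transfer[OF m(2,3) I'] I' m(1) by blast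
qed

end

section \<open>Retracts, the categories \<open>add\<close> and the conclusion\<close>

context artin_alg
begin

text \<open>One copy of \<open>X\<close> is enough: the complement of \<open>M\<close> is the kernel
  of the retraction, copied into \<open>fgmod A\<close>.\<close>

lemma addcat_retract:
 fixes X :: "('a, 'x) module"
 assumes M: "M : fgmod A" and X: "lmod A X" "fin_gen A X" and i: "i : lhom A M X" and r: "r : lhom A X M" "!!x. x IN M ==> r (i x) = x"
 shows "M : addcat A X"
proof -
 note lM = fgD(1)[OF M] and ic = hcl[OF i] and rc = hcl[OF r(1)]
 define U where "U = {x:cr X. r x = 0[M]}"
 have U: "submod A X U" unfolding U_def by (rule submod_kernel[OF X(1) lM r(1)])
 let ?U = "sub X U"
 have lU: "lmod A ?U" "fin_gen A ?U" using U X fin_gen_sub by auto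
 obtain N a b where N: "N : fgmod A" "a : lhom A ?U N" "b : lhom A N ?U" "!!x. x IN ?U ==> b (a x) = x" "!!y. y IN N ==> a (b y) = y" by (rule ex_copy[OF lU]) blast
 note lN = fgD(1)[OF N(1)]
 have b: "b : lhom A N X" by (rule lhom_unsub[OF N(3) U])
 have bU: "b y IN X" "r (b y) = 0[M]" if "y IN N" for y using hcl[OF N(3) that] unfolding U_def by auto
 let ?B = "biprod M N" and ?e = "%v. v -[X] i (r v)"
 let ?k = "%x. (r (x 0), a (?e (x 0)))"
 let ?g = "%z:cr ?B. i (fst z) +[X] b (snd z)"
 note g = lhom_copair[OF lM lN X(1) i b]
 let ?D = "dsum {..<1::nat} (%_. X)"
 let ?h = "%z:cr ?B. %_:{..<1::nat}. ?g z"
 have lB: "lmod A ?B" by (rule lm_biprod[OF lM lN])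
 have h: "?h : lhom A ?B ?D" by (rule lhom_dpair[OF lB g])
 have bij: "bij_betw ?h (cr ?B) (cr ?D)"
 proof (rule bij_betw_byWitness[where f'="?k"])
  have rg: "r (i x +[X] b y) = x" if "x IN M" "y IN N" for x y using hadd[OF r(1) ic[OF that(1)] bU(1)[OF that(2)]] r(2)[OF that(1)] bU(2)[OF that(2)] that lM by simp
  show "ALL z:cr ?B. ?k (?h z) = z"
  proof
   fix z assume "z IN biprod M N"
   then obtain x y where z: "z = (x, y)" "x IN M" "y IN N" by auto
   have "i x +[X] b y -[X] i x = b y" using ic[OF z(2)] bU(1)[OF z(3)] X(1) by (simp add: lm_ac)
   thus "?k (?h z) = z" using z rg N(5) by simp
  qed
  have wU: "x -[X] i (r x) : U" if x: "x IN X" for x using hminus[OF r(1) X(1) lM x ic[OF rc[OF x]]] r(2)[OF rc[OF x]] rc[OF x] x ic X(1) lM unfolding U_def by simp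
  show "ALL x:cr ?D. ?h (?k x) = x"
  proof
   fix x assume x: "x IN ?D"
   have x0: "x 0 IN X" using x by auto
   have w: "a (?e (x 0)) IN N" using hcl[OF N(2), of "?e (x 0)"] wU[OF x0] by simp
   have "i (r (x 0)) +[X] b (a (?e (x 0))) = x 0" using N(4)[of "?e (x 0)"] wU[OF x0] x0 ic[OF rc[OF x0]] X(1) by (simp add: lm_ac)
   hence "(%_:{..<1::nat}. ?g (r (x 0), a (?e (x 0)))) = x" by (intro extensionalityI[of _ "{..<1}"]) (use x w rc[OF x0] in "auto simp: PiE_iff")
   thus "?h (?k x) = x" using w rc[OF x0] by simp
  qed
  show "?h ` cr ?B<=cr ?D" using hcl[OF h] by blast
  show "?k ` cr ?D<=cr ?B" using hcl[OF N(2)] wU rc by auto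
 qed
 hence "liso A ?B ?D" using h unfolding liso_def by blast
 thus ?thesis using M N(1) unfolding addcat_def by blast
qed

lemma addcatE:
 fixes X :: "('a, 'x) module"
 assumes M: "M : addcat A X" and X: "lmod A X"
 obtains k i r where "i : lhom A M (dsum {..<k::nat} (%_. X))" "r : lhom A (dsum {..<k} (%_. X)) M" "!!x. x IN M ==> r (i x) = x"
proof -
 obtain N k f where N: "M : fgmod A" "N : fgmod A" "f : lhom A (biprod M N) (dsum {..<k::nat} (%_. X))"
  "bij_betw f (cr (biprod M N)) (cr (dsum {..<k} (%_. X)))" using M unfolding addcat_def liso_def by blast
 let ?D = "dsum {..<k} (%_. X)" and ?B = "biprod M N"
 note lM = fgD(1)[OF N(1)] and lN = fgD(1)[OF N(2)]
 have lD: "lmod A ?D" by (rule lm_dsum[OF X])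
 obtain g where g: "g : lhom A ?D ?B" "!!x. x IN biprod M N ==> g (f x) = x" by (rule lhom_inverse[OF lm_biprod[OF lM lN] lD N(3,4)]) blast
 show ?thesis
 proof (rule that[OF hcomp[OF lM lhom_inl[OF lM lN] N(3)] hcomp[OF lD g(1) lhom_fst[OF lM lN]]])
  fix x assume x: "x IN M"
  hence p: "(x, 0[N]) IN biprod M N" using lN by simp
  show "(%y:cr ?D. restrict fst (cr ?B) (g y))
    ((%x:cr M. f ((%x:cr M. (x, 0[N])) x)) x) = x" using hcl[OF N(3) p] g(2)[OF p] p x by (simp del: dsum_simps biprod_simps)
 qed
qed

end

locale nakayama_add = tilting R A B F T n + D: dual_alg R A J
 for R :: "('r, 'e) ring_scheme" and A :: "('r, 'a) module" and B :: "('r, 'b) module" and F T n and J :: "('r, 'r univ) module" +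
 fixes Q :: "('a, nat => 'a univ) module"
 assumes Q: "Q = dsum {1..n} (%i. T$(- int i))" and add: "addcat A Q = addcat A (nakayama R J A Q)"
begin

abbreviation "N == nakayama R J A Q"

lemma Q_fgproj: "A.fgproj Q" unfolding Q by (rule A.fgproj_dsum) (use T in auto)

lemmas Q_lm = A.fgproj_lm[OF Q_fgproj] A.fgproj_fin_gen[OF Q_fgproj]

lemmas N_lm = D.lm_nakayama[OF Q_lm(1)] D.fin_gen_nakayama[OF Q_fgproj]

text \<open>A retract of a power of \<open>Q\<close> is projective, a retract of a power of
  \<open>nu Q\<close> is injective, and the two categories coincide.\<close>

lemma addcat_pinj:
 assumes M: "M : addcat A Q"
 shows "A.pinj M"
proof -
 have Mf: "M : fgmod A" using M unfolding addcat_def by blast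
 note lM = A.fgD(1)[OF Mf]
 have "A.fgproj M"
 proof -
  obtain k i r where k: "i : lhom A M (dsum {..<k::nat} (%_. Q))" "r : lhom A (dsum {..<k} (%_. Q)) M" "!!x. x IN M ==> r (i x) = x"
   by (rule A.addcatE[OF M Q_lm(1)]) blast
  show ?thesis by (rule A.fgproj_retract[OF A.fgproj_dsum lM k(1,2)]) (use Q_fgproj k(3) in auto)
 qed
 moreover have "injective A M"
 proof -
  obtain k i r where k: "i : lhom A M (dsum {..<k::nat} (%_. N))" "r : lhom A (dsum {..<k} (%_. N)) M" "!!x. x IN M ==> r (i x) = x"
   by (rule A.addcatE[OF M[unfolded add] N_lm(1)]) blast
  show ?thesis by (rule A.injective_retract[OF A.injective_dsum lM k(1,2)]) (use D.injective_nakayama[OF Q_fgproj] k(3) in auto)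
 qed
 ultimately show ?thesis using Mf unfolding A.pinj_def by blast
qed

lemma T_addcat:
 assumes l: "l : {1..n}"
 shows "T$(- int l) : addcat A Q"
proof -
 have lT: "lmod A T$(- int j)" for j using A.xlm[OF T(2)] .
 note p = A.lhom_dproj[of "{1..n}" "%i. T$(- int i)", OF lT l, folded Q]
 note i = A.lhom_dinj[of "{1..n}" "%i. T$(- int i)", OF lT l, folded Q]
 show ?thesis
 proof (rule A.addcat_retract[OF T(3) Q_lm i p])
  fix x assume x: "x IN T$(- int l)"
  show "(%x:cr Q. x l) (A.dinj {1..n} (%i. T$(- int i)) l x) = x" using A.hcl[OF i x] x l unfolding A.dinj_def by simp
 qed
qed

lemma T_cases: "i<0 ==> zm T$i | (EX l:{1..n}. i = - int l)" using T_zero[of i] by (cases "i < - int n") (auto intro!: bexI[of _ "nat (- i)"])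

text \<open>For \<open>null_T\<close>: a nonzero map from a negative term of \<open>T\<close> to
  \<open>Y\<close> is nonzero on \<open>Q\<close>, and by the adjunction it yields a nonzero map
  from \<open>Y\<close> to \<open>nu Q\<close>. A copy of \<open>nu Q\<close> in
  \<open>fgmod A\<close> belongs to \<open>add Q\<close> and so is projective-injective, which
  contradicts \<open>pnull\<close>.\<close>

sublocale nakayama_tilting R A B F T n J
proof unfold_locales
 fix i :: int assume i: "i<0"
 show "injective A T$i" using T_cases[OF i] addcat_pinj[OF T_addcat] A.injective_zero[OF A.xlm[OF T(2)]] unfolding A.pinj_def by blast
next
 fix Y and i :: int and u x assume Y: "A.pnull Y" and i: "i<0" and u: "u : lhom A T$i Y" and x: "x IN T$i"
 note Yf = A.pnullD(1)[OF Y]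
 note lY = A.fgD[OF Yf] and lT = A.xlm[OF T(2)]
 show "u x = 0[Y]"
 proof (rule ccontr)
  assume ne: "u x~=0[Y]"
  hence "~ zm T$i" using A.zmD[OF _ x] A.hzero[OF u lT lY(1)] by auto
  then obtain l where l: "l : {1..n}" "i = - int l" using T_cases[OF i] by blast
  note p = A.lhom_dproj[of "{1..n}" "%i. T$(- int i)", OF lT l(1), folded Q l(2)]
   and i = A.lhom_dinj[of "{1..n}" "%i. T$(- int i)", OF lT l(1), folded Q l(2)]
  let ?q = "A.dinj {1..n} (%i. T$(- int i)) l x"
  have q: "?q IN Q" by (rule A.hcl[OF i x])
  note up = A.hcomp[OF Q_lm(1) p u]
  have "?q l = x" using x l unfolding A.dinj_def by simp
  hence "(%z:cr Q. u ((%z:cr Q. z l) z)) ?q~=0[Y]" using q ne by simp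
  then obtain h y where h: "h : lhom A Y N" "y IN Y" "h y~=0[N]" by (rule D.nakayama_nonzero[OF Q_fgproj lY up q])
  obtain M a b where M: "M : fgmod A" "a : lhom A N M" "b : lhom A M N" "!!z. z IN N ==> b (a z) = z" "!!z. z IN M ==> a (b z) = z" by (rule A.ex_copy[OF N_lm]) blast
  have "M : addcat A Q" unfolding add by (rule A.addcat_retract[OF M(1) N_lm M(3,2)]) (rule M(5))
  hence Mp: "A.pinj M" by (rule addcat_pinj)
  have "(%z:cr Y. a (h z)) y = 0[M]" by (rule A.pnullD(2)[OF Y Mp A.hcomp[OF lY(1) h(1) M(2)] h(2)])
  hence "b (a (h y)) = 0[N]" using h(2) A.hzero[OF M(3) A.fgD(1)[OF M(1)] N_lm(1)] by simp
  thus False using M(4)[OF A.hcl[OF h(1,2)]] h(3) by simp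
 qed
qed

end

theorem corollary1p2:
  fixes R :: "'r ring" and J :: "('r, 'r univ) module"
    and A :: "('r, 'a) module" and B :: "('r, 'b) module"
    and F :: "('a, 'b) dfunct" and T :: "'a ucplx" and n :: nat
    and Q :: "('a, nat \<Rightarrow> 'a univ) module"
  assumes "artin_algebra R A" and "artin_algebra R B"
    and "derived_equivalence R A B F"
    and "associated_tilting A B F T" and "radical_complex A T"
    and "\<And>i. i < - int n \<or> i > 0 \<Longrightarrow> zero_module (obj T i)"
    and "Q = dsum {1..n} (\<lambda>i. obj T (- int i))"
    and "injective_envelope R (top_module R) J"
    and "addcat A Q = addcat A (nakayama R J A Q)"
  shows "gl_dim A \<le> gl_dim B \<and> fin_dim A \<le> fin_dim B \<and> dom_dim A \<ge> dom_dim B"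
proof -
 interpret nakayama_add R A B F T n J Q by unfold_locales (use assms in auto)
 show ?thesis using gl_dim_le fin_dim_le dom_dim_ge by blast
qed

end
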